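(* Let $(X_n)_{n\in\mathbb{Z}_+}$ be an absorbed Markov process in $E\cup\{\partial\}$ with the partition $\{D_1,D_2,D_3\}$ of $E$ described in the context, and assume that (H1) and (H2) of the context hold. Then the process $X$ satisfies Assumption (E) with $K=K^Y$, $$\varphi_1(x)=\mathbb{E}_x\left(\gamma^{-T_K\wedge\tau_\partial}\right)\qquad\text{and}\qquad\varphi_2(x)\ge c\,\mathbf{1}_{x\in K},\qquad\forall x\in E,$$ for some constant $c>0$. In particular, it admits a unique quasi-stationary distribution $\nu_{QSD}$ such that $\nu_{QSD}(\varphi_1)<\infty$ and $\nu_{QSD}(\varphi_2)>0$. Moreover, there exist two constants $C>0$ and $\alpha\in(0,1)$ such that, for all probability measures $\mu$ on $E$ such that $\mu(\varphi_1)<\infty$ and $\mu(\varphi_2)>0$, $$\left\|\mathbb{P}_\mu(X_n\in\cdot\mid n<\tau_\partial)-\nu_{QSD}\right\|_{TV(\varphi_1)}\le C\alpha^n\,\frac{\mu(\varphi_1)}{\mu(\varphi_2)},\qquad\forall n\ge 0.$$ Finally, $\theta_0=\theta_0^Y$, $\nu_{QSD}(D_1)=0$ and the function $\eta$ vanishes on $D_3$, where $\theta_0\in(0,1]$ is defined by $\mathbb{P}_{\nu_{QSD}}(n<\tau_\partial)=\theta_0^n$ for all $n$ and $\eta(x)=\lim_{n\to+\infty}\theta_0^{-n}\,\mathbb{P}_x(n<\tau_\partial)$.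
   Context: Assumption (E) for a discrete-time Markov process $X$ in $E\cup\{\partial\}$, absorbed at $\partial\notin E$ at time $\tau_\partial=\inf\{n:X_n=\partial\}$, with $P_1f(x)=\mathbb{E}_x(f(X_1)\mathbf{1}_{1<\tau_\partial})$: there exist a positive integer $n_1$, positive constants $\theta_1,\theta_2,c_1,c_2,c_3$, measurable functions $\varphi_1,\varphi_2:E\to\mathbb{R}_+$ and a probability measure $\nu$ on a measurable subset $K\subset E$ such that: - (E1) for all $x\in K$, $\mathbb{P}_x(X_{n_1}\in\cdot)\ge c_1\nu(\cdot\cap K)$. - (E2) $\theta_1<\theta_2$, $\inf_E\varphi_1\ge1$, $\sup_K\varphi_1<\infty$, $\inf_K\varphi_2>0$, $\sup_E\varphi_2\le1$, and on $E$: $P_1\varphi_1\le\theta_1\varphi_1+c_2\mathbf{1}_K$, $P_1\varphi_2\ge\theta_2\varphi_2$. - (E3) $\sup_{n\in\mathbb{Z}_+}\frac{\sup_{y\in K}\mathbb{P}_y(n<\tau_\partial)}{\inf_{y\in K}\mathbb{P}_y(n<\tau_\partial)}\le c_3$. - (E4) for all $x\in K$ there exists $n_4(x)$ such that $\mathbb{P}_x(X_n\in K)>0$ for all $n\ge n_4(x)$. Under (E), there is a unique quasi-stationary distribution $\nu_{QSD}$ (probability measure with $\mathbb{P}_{\nu_{QSD}}(X_n\in\cdot\mid n<\tau_\partial)=\nu_{QSD}$ for all $n$) with $\nu_{QSD}(\varphi_1)<\infty$, $\nu_{QSD}(\varphi_2)>0$; its decay parameter $\theta_0$ is given by $\mathbb{P}_{\nu_{QSD}}(n<\tau_\partial)=\theta_0^n$,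 and $\lim_n\theta_0^{-n}\mathbb{P}_x(n<\tau_\partial)$ exists for all $x\in E$. Setting. $(X_n)_{n\in\mathbb{Z}_+}$ is a time-homogeneous Markov process in the measurable set $E\cup\{\partial\}$, absorbed at $\partial$; for measurable $A$, $T_A=\inf\{n\in\mathbb{Z}_+:X_n\in A\}$. $\{D_1,D_2,D_3\}$ is a measurable partition of $E$ such that the process started from $D_1$ can access $D_1\cup D_2\cup D_3\cup\{\partial\}$, from $D_2$ only $D_2\cup D_3\cup\{\partial\}$, and from $D_3$ only $D_3\cup\{\partial\}$; formally $\mathbb{P}_x(T_{D_3}\wedge\tau_\partial<T_{D_1})=1$ for all $x\in D_2$ and $\mathbb{P}_x(\tau_\partial<T_{D_1\cup D_2})=1$ for all $x\in D_3$. (H1) The absorbed Markov process $Y$ in $D_2\cup\{\partial\}$ defined by $Y_n=X_n$ if $n<T_{D_1\cup D_3\cup\{\partial\}}$ and $Y_n=\partial$ if $n\ge T_{D_1\cup D_3\cup\{\partial\}}$ satisfies Assumption (E). Objects related to $Y$ carry a superscript $Y$ ($K^Y$, $\varphi_1^Y$, $\theta_1^Y$, $\theta_2^Y$, and $\theta_0^Y$ the decay parameter of the associated quasi-stationary distribution of $Y$). (H2) (Exponential moments of the exit times of $X$ from $D_1$ and $D_3$; these exit times are in particular almost surely finite.) There exists a positive constant $\gamma<\theta_0^Y$ such that, for all $x\in D_1$, $$\mathbb{E}_x\left(\gamma^{-T_{D_2}}\varphi_1^Y(X_{T_{D_2}})\mathbf{1}_{T_{D_2}<T_{D_3}\wedge\tau_\partial}\right)<+\infty,\qquad\mathbb{E}_x\left(\gamma^{-T_{D_3}\wedge\tau_\partial}\mathbf{1}_{T_{D_3}\wedge\tau_\partial<T_{D_2}}\right)<+\infty,$$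 and $\sup_{x\in D_3}\mathbb{E}_x(\gamma^{-\tau_\partial})<+\infty$. Here $-T\wedge\tau$ means $-(T\wedge\tau)$. $\|\mu_1-\mu_2\|_{TV(\varphi_1)}=\sup\{|\mu_1(f)-\mu_2(f)|:f:E\to\mathbb{R}\text{ measurable},|f|\le\varphi_1\}$, $\mu(f)=\int f\,\mathrm d\mu$.
   Formalization: In φ1 the constant γ is replaced by any g with γ ≤ g < θ_0^Y and g > θ_1^Y (g = γ allowed when γ > θ_1^Y), since for smaller γ the function φ1 can be infinite on D_2; such g exist because θ_1^Y < θ_2^Y ≤ θ_0^Y. *)

theory Defs
  imports "HOL-Probability.Probability"
begin

text \<open>
  Throughout, \<open>S\<close> is the measurable space carried by \<open>E \<union> {\<partial>}\<close>, \<open>cem\<close> is the cemetery point \<open>\<partial>\<close>,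
  \<open>X :: nat \<Rightarrow> 'w \<Rightarrow> 'a\<close> is the process, defined on a measurable space \<open>\<Omega>\<close>, and \<open>P x\<close> is the law
  on \<open>\<Omega>\<close> under which the process starts from \<open>x\<close>. For a probability measure \<open>\<mu>\<close> on \<open>E\<close>, the law
  with initial distribution \<open>\<mu>\<close> is \<open>\<mu> \<bind> P\<close>, i.e. the mixture of the \<open>P x\<close>.
\<close>

abbreviation live_space :: "'a measure \<Rightarrow> 'a \<Rightarrow> 'a measure" where
  "live_space S cem \<equiv> restrict_space S (space S - {cem})"

definition hitting_time :: "(nat \<Rightarrow> 'w \<Rightarrow> 'a) \<Rightarrow> 'a set \<Rightarrow> 'w \<Rightarrow> enat" where
  "hitting_time X A \<omega> = Inf {enat n | n. X n \<omega> \<in> A}"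

abbreviation absorption_time :: "(nat \<Rightarrow> 'w \<Rightarrow> 'a) \<Rightarrow> 'a \<Rightarrow> 'w \<Rightarrow> enat" where
  "absorption_time X cem \<equiv> hitting_time X {cem}"

definition natural_filtration ::
  "'a measure \<Rightarrow> 'w measure \<Rightarrow> (nat \<Rightarrow> 'w \<Rightarrow> 'a) \<Rightarrow> nat \<Rightarrow> 'w measure" where
  "natural_filtration S \<Omega> X n =
     sigma (space \<Omega>) (\<Union>i\<le>n. {X i -` B \<inter> space \<Omega> | B. B \<in> sets S})"

text \<open>
  The condition \<open>X\<^sub>0 = x\<close> is stated through the law of \<open>X\<^sub>0\<close> because, apart from \<open>{cem}\<close>, singletons
  need not be measurable.
\<close>

locale absorbed_markov_process =
  fixes S :: "'a measure" and cem :: 'a and \<Omega> :: "'w measure"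
    and P :: "'a \<Rightarrow> 'w measure" and X :: "nat \<Rightarrow> 'w \<Rightarrow> 'a"
  assumes cem_measurable: "{cem} \<in> sets S"
    and P_kernel: "P \<in> S \<rightarrow>\<^sub>M prob_algebra \<Omega>"
    and X_measurable: "\<And>n. X n \<in> \<Omega> \<rightarrow>\<^sub>M S"
    and starts_at: "\<And>x. x \<in> space S \<Longrightarrow> distr (P x) S (X 0) = return S x"
    and markov: "\<And>x n B. x \<in> space S \<Longrightarrow> B \<in> sets S \<Longrightarrow>
      AE \<omega> in P x.
        real_cond_exp (P x) (natural_filtration S \<Omega> X n) (\<lambda>\<omega>. indicator B (X (Suc n) \<omega>)) \<omega>
          = \<P>(\<omega>' in P (X n \<omega>). X 1 \<omega>' \<in> B)"
    and absorbed: "\<And>x. x \<in> space S \<Longrightarrow>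
      AE \<omega> in P x. \<forall>n. absorption_time X cem \<omega> \<le> enat n \<longrightarrow> X n \<omega> = cem"

text \<open>The operator \<open>P\<^sub>1\<close>, applied to nonnegative functions and hence valued in \<open>[0, \<infinity>]\<close>.\<close>

definition one_step ::
  "'a \<Rightarrow> ('a \<Rightarrow> 'w measure) \<Rightarrow> (nat \<Rightarrow> 'w \<Rightarrow> 'a) \<Rightarrow> ('a \<Rightarrow> real) \<Rightarrow> 'a \<Rightarrow> ennreal" where
  "one_step cem P X f x =
     (\<integral>\<^sup>+\<omega>. ennreal (f (X 1 \<omega>)) * indicator {\<omega>. 1 < absorption_time X cem \<omega>} \<omega> \<partial>P x)"

text \<open>
  Assumption (E), in its data \<open>K\<close>, \<open>\<phi>\<^sub>1\<close>, \<open>\<phi>\<^sub>2\<close>, \<open>\<theta>\<^sub>1\<close>, \<open>\<theta>\<^sub>2\<close>; the remaining constants and \<open>\<nu>\<close> are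
  existentially quantified. The ratio in (E3) is taken in \<open>[0, \<infinity>]\<close>, where \<open>a / 0 = \<infinity>\<close> for \<open>a > 0\<close>;
  the case \<open>0 / 0\<close> is excluded by (E2), which gives
  \<open>P\<^sub>y(n < \<tau>) \<ge> \<theta>\<^sub>2 ^ n * inf\<^sub>K \<phi>\<^sub>2 > 0\<close> on the nonempty set \<open>K\<close>.
\<close>

definition assumption_E ::
  "'a measure \<Rightarrow> 'a \<Rightarrow> ('a \<Rightarrow> 'w measure) \<Rightarrow> (nat \<Rightarrow> 'w \<Rightarrow> 'a) \<Rightarrow>
   'a set \<Rightarrow> ('a \<Rightarrow> real) \<Rightarrow> ('a \<Rightarrow> real) \<Rightarrow> real \<Rightarrow> real \<Rightarrow> bool" where
  "assumption_E S cem P X K \<phi>1 \<phi>2 \<theta>1 \<theta>2 \<longleftrightarrow>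
     K \<in> sets S \<and> K \<subseteq> space S - {cem} \<and>
     \<phi>1 \<in> borel_measurable (live_space S cem) \<and>
     \<phi>2 \<in> borel_measurable (live_space S cem) \<and>
     0 < \<theta>1 \<and> 0 < \<theta>2 \<and>
     (\<exists>(n1::nat) (c1::real) (c2::real) (c3::real) \<nu>.
        0 < n1 \<and> 0 < c1 \<and> 0 < c2 \<and> 0 < c3 \<and>
        \<nu> \<in> space (prob_algebra (restrict_space S K)) \<and>
        \<comment> \<open>(E1)\<close>
        (\<forall>x\<in>K. \<forall>A\<in>sets (live_space S cem).
           c1 * measure \<nu> (A \<inter> K) \<le> \<P>(\<omega> in P x. X n1 \<omega> \<in> A)) \<and>
        \<comment> \<open>(E2)\<close>
        \<theta>1 < \<theta>2 \<and>
        (\<forall>x\<in>space S - {cem}. 1 \<le> \<phi>1 x) \<and> bdd_above (\<phi>1 ` K) \<and>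
        0 < (INF x\<in>K. \<phi>2 x) \<and> (\<forall>x\<in>space S - {cem}. 0 \<le> \<phi>2 x \<and> \<phi>2 x \<le> 1) \<and>
        (\<forall>x\<in>space S - {cem}.
           one_step cem P X \<phi>1 x \<le> ennreal (\<theta>1 * \<phi>1 x + c2 * indicator K x) \<and>
           ennreal (\<theta>2 * \<phi>2 x) \<le> one_step cem P X \<phi>2 x) \<and>
        \<comment> \<open>(E3)\<close>
        (SUP n.
           (SUP y\<in>K. emeasure (P y) {\<omega> \<in> space (P y). enat n < absorption_time X cem \<omega>}) /
           (INF y\<in>K. emeasure (P y) {\<omega> \<in> space (P y). enat n < absorption_time X cem \<omega>}))
          \<le> ennreal c3 \<and>
        \<comment> \<open>(E4)\<close>
        (\<forall>x\<in>K. \<exists>n4. \<forall>n\<ge>n4. 0 < \<P>(\<omega> in P x. X n \<omega> \<in> K)))"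

text \<open>
  \<open>P\<^sub>\<mu>(X\<^sub>n \<in> \<cdot> | n < \<tau>)\<close> as a measure on \<open>E\<close>. It is the null measure if \<open>P\<^sub>\<mu>(n < \<tau>) = 0\<close>.
\<close>

definition cond_law ::
  "'a measure \<Rightarrow> 'a \<Rightarrow> ('a \<Rightarrow> 'w measure) \<Rightarrow> (nat \<Rightarrow> 'w \<Rightarrow> 'a) \<Rightarrow> 'a measure \<Rightarrow> nat \<Rightarrow> 'a measure"
where
  "cond_law S cem P X \<mu> n =
     restrict_space
       (distr
          (uniform_measure (\<mu> \<bind> P)
             {\<omega> \<in> space (\<mu> \<bind> P). enat n < absorption_time X cem \<omega>})
          S (X n))
       (space S - {cem})"

definition is_qsd ::
  "'a measure \<Rightarrow> 'a \<Rightarrow> ('a \<Rightarrow> 'w measure) \<Rightarrow> (nat \<Rightarrow> 'w \<Rightarrow> 'a) \<Rightarrow> 'a measure \<Rightarrow> bool" where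
  "is_qsd S cem P X \<nu> \<longleftrightarrow>
     \<nu> \<in> space (prob_algebra (live_space S cem)) \<and> (\<forall>n. cond_law S cem P X \<nu> n = \<nu>)"

definition is_qsd_for ::
  "'a measure \<Rightarrow> 'a \<Rightarrow> ('a \<Rightarrow> 'w measure) \<Rightarrow> (nat \<Rightarrow> 'w \<Rightarrow> 'a) \<Rightarrow>
   ('a \<Rightarrow> real) \<Rightarrow> ('a \<Rightarrow> real) \<Rightarrow> 'a measure \<Rightarrow> bool" where
  "is_qsd_for S cem P X \<phi>1 \<phi>2 \<nu> \<longleftrightarrow>
     is_qsd S cem P X \<nu> \<and> (\<integral>\<^sup>+x. ennreal (\<phi>1 x) \<partial>\<nu>) < \<infinity> \<and> 0 < (\<integral>\<^sup>+x. ennreal (\<phi>2 x) \<partial>\<nu>)"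

definition is_decay_parameter ::
  "'a \<Rightarrow> ('a \<Rightarrow> 'w measure) \<Rightarrow> (nat \<Rightarrow> 'w \<Rightarrow> 'a) \<Rightarrow> 'a measure \<Rightarrow> real \<Rightarrow> bool" where
  "is_decay_parameter cem P X \<nu> \<theta>0 \<longleftrightarrow>
     0 < \<theta>0 \<and> \<theta>0 \<le> 1 \<and> (\<forall>n. \<P>(\<omega> in \<nu> \<bind> P. enat n < absorption_time X cem \<omega>) = \<theta>0 ^ n)"

text \<open>
  The weighted total variation distance, for measures integrating the weight \<open>\<phi>\<close>; otherwise
  \<open>\<mu>\<^sub>1(f)\<close> or \<open>\<mu>\<^sub>2(f)\<close> may be undefined (the Bochner integral would silently be \<open>0\<close>), and the
  distance is set to \<open>\<infinity>\<close>.
\<close>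

definition weighted_tv :: "('a \<Rightarrow> real) \<Rightarrow> 'a measure \<Rightarrow> 'a measure \<Rightarrow> ennreal" where
  "weighted_tv \<phi> \<mu>1 \<mu>2 =
     (if integrable \<mu>1 \<phi> \<and> integrable \<mu>2 \<phi>
      then SUP f\<in>{f \<in> borel_measurable \<mu>1. \<forall>x\<in>space \<mu>1. \<bar>f x\<bar> \<le> \<phi> x}.
             ennreal \<bar>(\<integral>x. f x \<partial>\<mu>1) - (\<integral>x. f x \<partial>\<mu>2)\<bar>
      else \<infinity>)"

text \<open>The process killed when it enters \<open>A\<close>.\<close>

definition killed_process ::
  "(nat \<Rightarrow> 'w \<Rightarrow> 'a) \<Rightarrow> 'a \<Rightarrow> 'a set \<Rightarrow> nat \<Rightarrow> 'w \<Rightarrow> 'a" where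
  "killed_process X cem A n \<omega> = (if enat n < hitting_time X A \<omega> then X n \<omega> else cem)"

text \<open>\<open>\<gamma> ^ (-t)\<close> for a possibly infinite time \<open>t\<close> and \<open>0 < \<gamma> < 1\<close>, so that \<open>\<gamma> ^ (-\<infinity>) = \<infinity>\<close>.\<close>

definition inv_pow :: "real \<Rightarrow> enat \<Rightarrow> ennreal" where
  "inv_pow \<gamma> t = (case t of enat n \<Rightarrow> ennreal (\<gamma> powi (- int n)) | \<infinity> \<Rightarrow> \<infinity>)"

definition reducible_partition ::
  "'a measure \<Rightarrow> 'a \<Rightarrow> ('a \<Rightarrow> 'w measure) \<Rightarrow> (nat \<Rightarrow> 'w \<Rightarrow> 'a) \<Rightarrow>
   'a set \<Rightarrow> 'a set \<Rightarrow> 'a set \<Rightarrow> bool" where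
  "reducible_partition S cem P X D1 D2 D3 \<longleftrightarrow>
     D1 \<in> sets S \<and> D2 \<in> sets S \<and> D3 \<in> sets S \<and>
     D1 \<inter> D2 = {} \<and> D1 \<inter> D3 = {} \<and> D2 \<inter> D3 = {} \<and> D1 \<union> D2 \<union> D3 = space S - {cem} \<and>
     (\<forall>x\<in>D2. AE \<omega> in P x.
        min (hitting_time X D3 \<omega>) (absorption_time X cem \<omega>) < hitting_time X D1 \<omega>) \<and>
     (\<forall>x\<in>D3. AE \<omega> in P x. absorption_time X cem \<omega> < hitting_time X (D1 \<union> D2) \<omega>)"

text \<open>
  (H2) for a given \<open>\<gamma>\<close>. Almost sure finiteness of the exit time from \<open>D\<^sub>1\<close> is a separate clause: the
  two moments on \<open>D\<^sub>1\<close> carry indicators which vanish when the process never leaves \<open>D\<^sub>1\<close>.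
\<close>

definition hypothesis_H2 ::
  "'a measure \<Rightarrow> 'a \<Rightarrow> ('a \<Rightarrow> 'w measure) \<Rightarrow> (nat \<Rightarrow> 'w \<Rightarrow> 'a) \<Rightarrow>
   'a set \<Rightarrow> 'a set \<Rightarrow> 'a set \<Rightarrow> ('a \<Rightarrow> real) \<Rightarrow> real \<Rightarrow> real \<Rightarrow> bool" where
  "hypothesis_H2 S cem P X D1 D2 D3 \<phi>1Y \<theta>0Y \<gamma> \<longleftrightarrow>
     0 < \<gamma> \<and> \<gamma> < \<theta>0Y \<and>
     (\<forall>D\<in>{D1, D3}. \<forall>x\<in>D. AE \<omega> in P x. hitting_time X (space S - D) \<omega> < \<infinity>) \<and>
     (\<forall>x\<in>D1.
        (\<integral>\<^sup>+\<omega>. inv_pow \<gamma> (hitting_time X D2 \<omega>)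
              * ennreal (\<phi>1Y (X (the_enat (hitting_time X D2 \<omega>)) \<omega>))
              * indicator {\<omega>. hitting_time X D2 \<omega>
                               < min (hitting_time X D3 \<omega>) (absorption_time X cem \<omega>)} \<omega> \<partial>P x) < \<infinity> \<and>
        (\<integral>\<^sup>+\<omega>. inv_pow \<gamma> (min (hitting_time X D3 \<omega>) (absorption_time X cem \<omega>))
              * indicator {\<omega>. min (hitting_time X D3 \<omega>) (absorption_time X cem \<omega>)
                               < hitting_time X D2 \<omega>} \<omega> \<partial>P x) < \<infinity>) \<and>
     (SUP x\<in>D3. \<integral>\<^sup>+\<omega>. inv_pow \<gamma> (absorption_time X cem \<omega>) \<partial>P x) < \<infinity>"

text \<open>
  On the constant \<open>\<gamma>\<close>: if (H2) holds for some \<open>\<gamma>\<close>, it holds for every larger constant below \<open>\<theta>\<^sub>0\<^sup>Y\<close>. When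
  \<open>\<gamma> < \<theta>\<^sub>1\<^sup>Y\<close>, the function \<open>x \<mapsto> E\<^sub>x(\<gamma> ^ (-(T\<^sub>K \<and> \<tau>)))\<close> may be infinite on \<open>D\<^sub>2\<close>, which (H2) does not
  control (for instance if \<open>D\<^sub>1\<close> and \<open>D\<^sub>3\<close> are empty). The exponential weight \<open>\<phi>\<^sub>1\<close> is therefore taken with an
  arbitrary constant \<open>g\<close> such that \<open>\<gamma> \<le> g < \<theta>\<^sub>0\<^sup>Y\<close> and \<open>\<theta>\<^sub>1\<^sup>Y < g\<close>; in particular with \<open>g = \<gamma>\<close> as soon
  as \<open>\<theta>\<^sub>1\<^sup>Y < \<gamma>\<close>. Such \<open>g\<close> always exist, since \<open>\<theta>\<^sub>1\<^sup>Y < \<theta>\<^sub>2\<^sup>Y \<le> \<theta>\<^sub>0\<^sup>Y\<close>.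
\<close>

end

theory Submission
  imports Defs
begin

text \<open>
  Let \<open>R\<close> be the transition kernel of \<open>X\<close> on \<open>E\<close>, killed at \<open>cem\<close> and divided by the decay parameter
  \<open>\<theta>0\<close> of \<open>Y\<close>. The theorem follows from a spectral gap for \<open>R\<close> (\<open>spectral_gap\<close>): there are a probability
  measure \<open>\<nu>\<close> with \<open>\<nu> R = \<nu>\<close>, a function \<open>\<eta> \<ge> 0\<close> with \<open>R \<eta> = \<eta>\<close> and \<open>\<nu>(\<eta>) = 1\<close>, and constants \<open>Z\<close> and \<open>\<alpha> < 1\<close>
  such that \<open>|R^n f - \<nu>(f) \<eta>| \<le> Z \<alpha>^n \<phi>1\<close> whenever \<open>|f| \<le> \<phi>1\<close>. The conditional law at time \<open>n\<close> integrates \<open>f\<close> to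
  \<open>\<mu>(R^n f) / \<mu>(R^n 1)\<close>. As \<open>R^n 1\<close> dominates a multiple of \<open>\<phi>2\<close> (\<open>phi2_le_mass\<close>), the gap turns into the rate of
  convergence (\<open>convergence\<close>), and the rate implies the uniqueness of the quasi-stationary distribution.
  The value at \<open>f = 1\<close> identifies \<open>\<eta>\<close> as the limit of \<open>\<theta>0^(-n) P_x(n < \<tau>)\<close>.

  Two properties of \<open>R\<close> produce the gap. The weight \<open>\<phi>1(x) = E_x(g^(-(T_K \<and> \<tau>)))\<close> contracts outside \<open>K\<close>, at rate
  \<open>g / \<theta>0 < 1\<close>. And on \<open>K\<close> the masses \<open>R^n 1\<close> stay between two positive constants. The upper limit of \<open>R^n 1\<close> is
  then subharmonic, by Fatou's lemma, and its images under \<open>R^n\<close> increase to \<open>\<eta>\<close> (\<open>harmonic_ennreal\<close>).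
  Dually, the quasi-stationary distribution \<open>\<nu>Y\<close> of \<open>Y\<close> is subinvariant under \<open>R\<close>, since \<open>X\<close> has more surviving
  paths than \<open>Y\<close>, and its images increase to a multiple of \<open>\<nu>\<close> (\<open>invariant_measure\<close>). The contraction is the one
  of Harris' theorem, but modulo \<open>\<eta>\<close> instead of modulo constants: on the set where \<open>\<phi>1 \<le> L \<eta>\<close> some power of \<open>R\<close>
  dominates \<open>\<epsilon> \<eta>(x) m\<close> (\<open>small_set\<close>), and elsewhere the drift contracts (\<open>contraction\<close>). The formulation modulo
  \<open>\<eta>\<close> covers the points where \<open>\<eta>\<close> vanishes, such as those of \<open>D3\<close>, where an h-transform is unavailable.

  The bounds on the masses come from Assumption (E) for \<open>Y\<close> (\<open>mass_comparison\<close>). They extend to \<open>X\<close> because a path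
  which enters \<open>D3\<close> survives \<open>k\<close> more steps with probability of order \<open>\<gamma>^k\<close> only, where \<open>\<gamma> < \<theta>0\<close> (\<open>survival_X\<close>).
  The weight is finite (\<open>W_finite\<close>): on \<open>D2\<close> it is at most a multiple of \<open>\<phi>1Y\<close>, because \<open>\<theta>1Y < g\<close>; on \<open>D3\<close> it is
  bounded; and on \<open>D1\<close> it is controlled by the discounted position at the exit from \<open>D1\<close>, which is what
  the moments in (H2) measure. Finally \<open>\<phi>2\<close> is a finite sum of the functions \<open>\<theta>2^(-k) P_x(X_k \<in> K)\<close>, normalised,
  with \<open>g < \<theta>2 < \<theta>0\<close>; it grows at rate \<open>\<theta>2\<close> by the gap applied to the indicator of \<open>K\<close>.
\<close>

section \<open>Powers of positive kernels\<close>

definition kernel_op :: "('a \<Rightarrow> 'a measure) \<Rightarrow> ('a \<Rightarrow> ennreal) \<Rightarrow> 'a \<Rightarrow> ennreal" where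
  "kernel_op \<kappa> f x = (\<integral>\<^sup>+y. f y \<partial>\<kappa> x)"

text \<open>
  The masses of the kernel are arbitrary, since it will be divided by the decay parameter, after which it is
  no longer sub-Markov.
\<close>

locale positive_kernel =
  fixes M :: "'a measure" and \<kappa> :: "'a \<Rightarrow> 'a measure"
  assumes sets_kernel: "x \<in> space M \<Longrightarrow> sets (\<kappa> x) = sets M"
    and measurable_kernel_op: "f \<in> borel_measurable M \<Longrightarrow> kernel_op \<kappa> f \<in> borel_measurable M"
begin

abbreviation R :: "('a \<Rightarrow> ennreal) \<Rightarrow> 'a \<Rightarrow> ennreal" where "R \<equiv> kernel_op \<kappa>"

lemma space_kernel: "x \<in> space M \<Longrightarrow> space (\<kappa> x) = space M"
  using sets_kernel sets_eq_imp_space_eq by blast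

lemma measurable_kernel_iff:
  "x \<in> space M \<Longrightarrow> f \<in> borel_measurable (\<kappa> x) \<longleftrightarrow> f \<in> borel_measurable M"
  using measurable_cong_sets[OF sets_kernel refl] by blast

lemma pow_measurable: "f \<in> borel_measurable M \<Longrightarrow> (R ^^ n) f \<in> borel_measurable M"
  by (induction n) (auto intro: measurable_kernel_op)

lemma R_mono: "(\<And>y. y \<in> space M \<Longrightarrow> f y \<le> g y) \<Longrightarrow> x \<in> space M \<Longrightarrow> R f x \<le> R g x"
  by (auto simp: kernel_op_def space_kernel intro!: nn_integral_mono)

lemma pow_mono:
  "(\<And>y. y \<in> space M \<Longrightarrow> f y \<le> g y) \<Longrightarrow> x \<in> space M \<Longrightarrow> (R ^^ n) f x \<le> (R ^^ n) g x"
  by (induction n arbitrary: x) (auto intro: R_mono)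

lemma pow_cong:
  "(\<And>y. y \<in> space M \<Longrightarrow> f y = g y) \<Longrightarrow> x \<in> space M \<Longrightarrow> (R ^^ n) f x = (R ^^ n) g x"
  by (intro antisym pow_mono) auto

lemma R_cong: "(\<And>y. y \<in> space M \<Longrightarrow> f y = g y) \<Longrightarrow> x \<in> space M \<Longrightarrow> R f x = R g x"
  by (intro antisym R_mono) auto

lemma R_add:
  assumes "f \<in> borel_measurable M" "g \<in> borel_measurable M" "x \<in> space M"
  shows "R (\<lambda>y. f y + g y) x = R f x + R g x"
  unfolding kernel_op_def using assms by (intro nn_integral_add) (auto simp: measurable_kernel_iff)

lemma R_cmult:
  assumes "f \<in> borel_measurable M" "x \<in> space M"
  shows "R (\<lambda>y. c * f y) x = c * R f x"
  unfolding kernel_op_def using assms by (intro nn_integral_cmult) (auto simp: measurable_kernel_iff)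

lemma R_sum:
  fixes n :: nat
  assumes "\<And>k. F k \<in> borel_measurable M" "x \<in> space M"
  shows "R (\<lambda>y. \<Sum>k<n. c k * F k y) x = (\<Sum>k<n. c k * R (F k) x)"
proof (induction n)
  case 0
  then show ?case by (simp add: kernel_op_def)
next
  case (Suc n)
  have "R (\<lambda>y. \<Sum>k<Suc n. c k * F k y) x = R (\<lambda>y. (\<Sum>k<n. c k * F k y) + c n * F n y) x" by simp
  also have "\<dots> = R (\<lambda>y. \<Sum>k<n. c k * F k y) x + R (\<lambda>y. c n * F n y) x"
    using assms by (intro R_add) auto
  finally show ?case using Suc assms by (simp add: R_cmult)
qed

lemma pow_add:
  assumes "f \<in> borel_measurable M" "g \<in> borel_measurable M" "x \<in> space M"
  shows "(R ^^ n) (\<lambda>y. f y + g y) x = (R ^^ n) f x + (R ^^ n) g x"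
  using assms(3)
proof (induction n arbitrary: x)
  case (Suc n)
  have "(R ^^ Suc n) (\<lambda>y. f y + g y) x = R (\<lambda>y. (R ^^ n) f y + (R ^^ n) g y) x"
    using Suc by (auto intro!: R_cong)
  also have "\<dots> = (R ^^ Suc n) f x + (R ^^ Suc n) g x"
    using assms Suc by (simp add: R_add pow_measurable)
  finally show ?case .
qed auto

lemma pow_cmult:
  assumes "f \<in> borel_measurable M" "x \<in> space M"
  shows "(R ^^ n) (\<lambda>y. c * f y) x = c * (R ^^ n) f x"
  using assms(2)
proof (induction n arbitrary: x)
  case (Suc n)
  have "(R ^^ Suc n) (\<lambda>y. c * f y) x = R (\<lambda>y. c * (R ^^ n) f y) x"
    using Suc by (auto intro!: R_cong)
  also have "\<dots> = c * (R ^^ Suc n) f x"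
    using assms Suc by (simp add: R_cmult pow_measurable)
  finally show ?case .
qed auto

lemma R_SUP:
  assumes "\<And>i. F i \<in> borel_measurable M" "\<And>i y. y \<in> space M \<Longrightarrow> F i y \<le> F (Suc i) y" "x \<in> space M"
  shows "R (\<lambda>y. SUP i. F i y) x = (SUP i. R (F i) x)"
  unfolding kernel_op_def using assms
  by (intro nn_integral_monotone_convergence_SUP_AE) (auto simp: measurable_kernel_iff space_kernel)

lemma pow_SUP:
  assumes "\<And>i. F i \<in> borel_measurable M" "\<And>i y. y \<in> space M \<Longrightarrow> F i y \<le> F (Suc i) y" "x \<in> space M"
  shows "(R ^^ n) (\<lambda>y. SUP i. F i y) x = (SUP i. (R ^^ n) (F i) x)"
  using assms(3)
proof (induction n arbitrary: x)
  case (Suc n)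
  have "(R ^^ Suc n) (\<lambda>y. SUP i. F i y) x = R (\<lambda>y. SUP i. (R ^^ n) (F i) y) x"
    using Suc by (auto intro!: R_cong)
  also have "\<dots> = (SUP i. R ((R ^^ n) (F i)) x)"
    using assms Suc by (intro R_SUP) (auto intro: pow_measurable pow_mono)
  finally show ?case by simp
qed auto

lemma pow_Suc_right: "(R ^^ Suc n) f = (R ^^ n) (R f)"
  by (simp add: funpow_swap1)

lemma pow_plus: "(R ^^ (m + n)) f = (R ^^ m) ((R ^^ n) f)"
  by (simp add: funpow_add)

text \<open>
  Both sides are additive and monotone-continuous in \<open>f\<close>, so (E1), which speaks of events, extends to
  nonnegative functions.
\<close>

lemma minorisation_from_sets:
  assumes m: "sets m = sets M" and x: "x \<in> space M"
    and A: "\<And>A. A \<in> sets M \<Longrightarrow> c * emeasure m A \<le> (R ^^ n) (indicator A) x"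
    and f: "f \<in> borel_measurable M"
  shows "c * (\<integral>\<^sup>+y. f y \<partial>m) \<le> (R ^^ n) f x"
  using f
proof (induction rule: borel_measurable_induct)
  case (cong f g)
  then have "(\<integral>\<^sup>+y. f y \<partial>m) = (\<integral>\<^sup>+y. g y \<partial>m)"
    by (auto intro!: nn_integral_cong simp: sets_eq_imp_space_eq[OF m])
  moreover have "(R ^^ n) f x = (R ^^ n) g x"
    using cong x by (intro pow_cong) auto
  ultimately show ?case using cong by simp
next
  case (set A)
  then show ?case using A m by simp
next
  case (mult u v)
  have "u \<in> borel_measurable m" using mult m by (simp cong: measurable_cong_sets)
  then have "c * (\<integral>\<^sup>+y. v * u y \<partial>m) = v * (c * (\<integral>\<^sup>+y. u y \<partial>m))"
    by (simp add: nn_integral_cmult mult_ac)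
  also have "\<dots> \<le> v * (R ^^ n) u x" using mult by (intro mult_left_mono) auto
  finally show ?case using mult x by (simp add: pow_cmult)
next
  case (add u v)
  have "u \<in> borel_measurable m" "v \<in> borel_measurable m" using add m by (simp_all cong: measurable_cong_sets)
  then have "c * (\<integral>\<^sup>+y. v y + u y \<partial>m) = c * (\<integral>\<^sup>+y. v y \<partial>m) + c * (\<integral>\<^sup>+y. u y \<partial>m)"
    by (simp add: nn_integral_add distrib_left)
  also have "\<dots> \<le> (R ^^ n) v x + (R ^^ n) u x" using add by (intro add_mono) auto
  finally show ?case using add x by (simp add: pow_add)
next
  case (seq U)
  have U: "\<And>i. U i \<in> borel_measurable m" using seq m by (simp cong: measurable_cong_sets)
  have "c * (\<integral>\<^sup>+y. (SUP i. U i y) \<partial>m) = (SUP i. c * (\<integral>\<^sup>+y. U i y \<partial>m))"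
    using U seq by (subst nn_integral_monotone_convergence_SUP) (auto simp: SUP_mult_left_ennreal)
  also have "\<dots> \<le> (SUP i. (R ^^ n) (U i) x)" using seq by (intro SUP_mono') auto
  also have "\<dots> = (R ^^ n) (\<lambda>y. SUP i. U i y) x"
    using seq x by (intro pow_SUP[symmetric]) (auto simp: incseq_Suc_iff le_fun_def)
  finally show ?case by (simp add: SUP_apply[abs_def] image_comp)
qed

end

text \<open>
  Monotone continuity of the functional is countable additivity on indicators. This form of the
  representation serves to define a measure as an increasing limit of measures.
\<close>

lemma measure_of_functional:
  fixes \<Phi> :: "('a \<Rightarrow> ennreal) \<Rightarrow> ennreal"
  assumes cong: "\<And>f g. (\<And>x. x \<in> space M \<Longrightarrow> f x = g x) \<Longrightarrow> \<Phi> f = \<Phi> g"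
    and add: "\<And>f g. f \<in> borel_measurable M \<Longrightarrow> g \<in> borel_measurable M \<Longrightarrow> \<Phi> (\<lambda>x. f x + g x) = \<Phi> f + \<Phi> g"
    and cmult: "\<And>c f. f \<in> borel_measurable M \<Longrightarrow> \<Phi> (\<lambda>x. c * f x) = c * \<Phi> f"
    and SUP: "\<And>F. (\<And>i. F i \<in> borel_measurable M) \<Longrightarrow> incseq F \<Longrightarrow> \<Phi> (\<lambda>x. SUP i. F i x) = (SUP i::nat. \<Phi> (F i))"
  obtains \<nu> where "sets \<nu> = sets M" "\<And>f. f \<in> borel_measurable M \<Longrightarrow> (\<integral>\<^sup>+x. f x \<partial>\<nu>) = \<Phi> f"
proof -
  define \<nu> where "\<nu> = measure_of (space M) (sets M) (\<lambda>A. \<Phi> (indicator A))"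
  have sets: "sets \<nu> = sets M" by (simp add: \<nu>_def)
  have zero: "\<Phi> (\<lambda>_. 0) = 0" using cmult[of "\<lambda>_. 0" 0] by simp
  have sum: "\<Phi> (\<lambda>x. \<Sum>i<n. f i x) = (\<Sum>i<n. \<Phi> (f i))" if "\<And>i. f i \<in> borel_measurable M" for f and n :: nat
    using that by (induction n) (auto simp: zero add)
  have "countably_additive (sets M) (\<lambda>A. \<Phi> (indicator A))"
  proof (rule countably_additiveI)
    fix A :: "nat \<Rightarrow> 'a set" assume A: "range A \<subseteq> sets M" "disjoint_family A"
    have "\<Phi> (indicator (\<Union> (range A))) = \<Phi> (\<lambda>x. SUP n. \<Sum>i<n. indicator (A i) x)"
      using A by (intro cong) (simp add: suminf_indicator[symmetric] suminf_eq_SUP)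
    also have "\<dots> = (SUP n. \<Phi> (\<lambda>x. \<Sum>i<n. indicator (A i) x))"
      using A by (intro SUP) (auto intro!: incseq_SucI le_funI borel_measurable_sum)
    also have "\<dots> = (\<Sum>i. \<Phi> (indicator (A i)))"
      using A by (subst sum) (auto simp: suminf_eq_SUP)
    finally show "(\<Sum>i. \<Phi> (indicator (A i))) = \<Phi> (indicator (\<Union> (range A)))" ..
  qed
  moreover have "positive (sets M) (\<lambda>A. \<Phi> (indicator A))"
    using cong[of "indicator {}" "\<lambda>_. 0"] by (simp add: positive_def zero)
  ultimately have emeasure: "emeasure \<nu> A = \<Phi> (indicator A)" if "A \<in> sets M" for A
    using that unfolding \<nu>_def by (intro emeasure_measure_of_sigma) (auto simp: sets.sigma_algebra_axioms)
  have "(\<integral>\<^sup>+x. f x \<partial>\<nu>) = \<Phi> f" if "f \<in> borel_measurable M" for f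
    using that
  proof (induction rule: borel_measurable_induct)
    case (cong f g)
    then have "\<Phi> f = \<Phi> g" by (intro assms(1))
    then show ?case
      using cong nn_integral_cong[of \<nu> f g] by (auto simp: sets_eq_imp_space_eq[OF sets])
  next
    case (set A)
    then show ?case by (simp add: emeasure sets)
  next
    case (mult u c)
    have "u \<in> borel_measurable \<nu>" using mult sets by (simp cong: measurable_cong_sets)
    then show ?case using mult by (simp add: nn_integral_cmult cmult)
  next
    case (add u v)
    have "u \<in> borel_measurable \<nu>" "v \<in> borel_measurable \<nu>" using add sets by (simp_all cong: measurable_cong_sets)
    then show ?case using add by (simp add: nn_integral_add assms(2))
  next
    case (seq U)
    have U: "\<And>i. U i \<in> borel_measurable \<nu>" using seq sets by (simp cong: measurable_cong_sets)
    show ?case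
      using seq U by (simp add: SUP_apply[abs_def] image_comp SUP nn_integral_monotone_convergence_SUP)
  qed
  then show thesis using sets that by blast
qed

section \<open>Harmonic functions and invariant measures under a drift condition\<close>

text \<open>
  The constants \<open>a\<close> and \<open>b\<close> express that the kernel is normalised to have growth rate \<open>1\<close> on \<open>K\<close>.
\<close>

locale lyapunov_kernel = positive_kernel M \<kappa> for M :: "'a measure" and \<kappa> +
  fixes K :: "'a set" and V :: "'a \<Rightarrow> real" and \<rho> C a b :: real
  assumes K_sets [measurable]: "K \<in> sets M" and K_nonempty: "K \<noteq> {}"
    and V_measurable [measurable]: "V \<in> borel_measurable M"
    and V_ge_1: "x \<in> space M \<Longrightarrow> 1 \<le> V x"
    and rho: "0 < \<rho>" "\<rho> < 1" and C_pos: "0 < C"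
    and drift: "x \<in> space M \<Longrightarrow>
      R (\<lambda>y. ennreal (V y)) x \<le> ennreal \<rho> * ennreal (V x) + ennreal C * indicator K x"
    and a_pos: "0 < a"
    and mass_ge: "x \<in> K \<Longrightarrow> ennreal a \<le> (R ^^ n) (\<lambda>_. 1) x"
    and mass_le: "x \<in> K \<Longrightarrow> (R ^^ n) (\<lambda>_. 1) x \<le> ennreal b"
begin

lemma K_space: "x \<in> K \<Longrightarrow> x \<in> space M"
  using sets.sets_into_space[OF K_sets] by auto

lemma V_ennreal_measurable [measurable]: "(\<lambda>y. ennreal (V y)) \<in> borel_measurable M"
  by measurable

lemma V_ge_1': "x \<in> space M \<Longrightarrow> 1 \<le> ennreal (V x)"
  using V_ge_1[of x] by (simp add: one_ennreal.rep_eq flip: ennreal_1)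

lemma b_ge_1: "1 \<le> b"
proof -
  obtain x where "x \<in> K" using K_nonempty by auto
  then show ?thesis using mass_le[of x 0] by (simp add: ennreal_ge_1)
qed

lemma a_le_1: "a \<le> 1"
proof -
  obtain x where "x \<in> K" using K_nonempty by auto
  then show ?thesis using mass_ge[of x 0] by (simp add: ennreal_le_1)
qed

lemma drift_off_K: "x \<in> space M \<Longrightarrow> x \<notin> K \<Longrightarrow> R (\<lambda>y. ennreal (V y)) x \<le> ennreal (V x)"
proof -
  assume x: "x \<in> space M" "x \<notin> K"
  have "R (\<lambda>y. ennreal (V y)) x \<le> ennreal \<rho> * ennreal (V x)" using drift[OF x(1)] x(2) by simp
  also have "\<dots> \<le> 1 * ennreal (V x)" using rho by (intro mult_right_mono) (auto simp: ennreal_le_1)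
  finally show ?thesis by simp
qed

text \<open>Outside \<open>K\<close> the weight is superharmonic, so a bound on \<open>K\<close> propagates to the whole space.\<close>

lemma mass_le_V: "x \<in> space M \<Longrightarrow> (R ^^ n) (\<lambda>_. 1) x \<le> ennreal b * ennreal (V x)"
proof (induction n arbitrary: x)
  case 0
  have "1 * 1 \<le> ennreal b * ennreal (V x)"
    using 0 b_ge_1 V_ge_1'[OF 0] by (intro mult_mono) (auto simp: ennreal_ge_1)
  then show ?case by simp
next
  case (Suc n)
  show ?case
  proof (cases "x \<in> K")
    case True
    have "(R ^^ Suc n) (\<lambda>_. 1) x \<le> ennreal b * 1" using mass_le[OF True, of "Suc n"] by simp
    also have "\<dots> \<le> ennreal b * ennreal (V x)" using V_ge_1'[OF Suc.prems] by (intro mult_left_mono) auto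
    finally show ?thesis .
  next
    case False
    have "(R ^^ Suc n) (\<lambda>_. 1) x \<le> R (\<lambda>y. ennreal b * ennreal (V y)) x"
      using Suc by (auto intro!: R_mono)
    also have "\<dots> = ennreal b * R (\<lambda>y. ennreal (V y)) x"
      using Suc.prems by (simp add: R_cmult)
    also have "\<dots> \<le> ennreal b * ennreal (V x)"
      using drift_off_K[OF Suc.prems False] by (intro mult_left_mono) auto
    finally show ?thesis .
  qed
qed

definition D where "D = 1 + C * b / (1 - \<rho>)"

lemma D_ge_1: "1 \<le> D"
  unfolding D_def using C_pos b_ge_1 rho by simp

lemma D_step: "\<rho> * D + C * b \<le> D"
proof -
  have "(1 - \<rho>) * D = (1 - \<rho>) + C * b" unfolding D_def using rho by (simp add: field_simps)
  then show ?thesis using rho by (simp add: algebra_simps)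
qed

text \<open>
  By the drift condition \<open>R^(n+1) V \<le> \<rho> R^n V + C R^n 1\<close>, and \<open>D\<close> solves \<open>\<rho> D + C b \<le> D\<close>.
\<close>

lemma pow_V_le: "x \<in> space M \<Longrightarrow> (R ^^ n) (\<lambda>y. ennreal (V y)) x \<le> ennreal D * ennreal (V x)"
proof (induction n)
  case 0
  have "1 * ennreal (V x) \<le> ennreal D * ennreal (V x)"
    using D_ge_1 by (intro mult_right_mono) (auto simp: ennreal_ge_1)
  then show ?case by simp
next
  case (Suc n)
  have "(R ^^ Suc n) (\<lambda>y. ennreal (V y)) x = (R ^^ n) (R (\<lambda>y. ennreal (V y))) x"
    unfolding pow_Suc_right ..
  also have "\<dots> \<le> (R ^^ n) (\<lambda>y. ennreal \<rho> * ennreal (V y) + ennreal C * 1) x"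
    using Suc.prems by (intro pow_mono order_trans[OF drift] add_mono mult_left_mono) (auto simp: indicator_def)
  also have "\<dots> = ennreal \<rho> * (R ^^ n) (\<lambda>y. ennreal (V y)) x + ennreal C * (R ^^ n) (\<lambda>_. 1) x"
    using Suc.prems by (subst pow_add) (simp_all only: pow_cmult borel_measurable_times_ennreal
        borel_measurable_const V_ennreal_measurable)
  also have "\<dots> \<le> ennreal \<rho> * (ennreal D * ennreal (V x)) + ennreal C * (ennreal b * ennreal (V x))"
    using Suc.IH[OF Suc.prems] mass_le_V[OF Suc.prems] by (intro add_mono mult_left_mono) auto
  also have "\<dots> = ennreal ((\<rho> * D + C * b) * V x)"
    using rho D_ge_1 C_pos b_ge_1 V_ge_1[OF Suc.prems]
    by (simp add: ennreal_mult ennreal_plus distrib_left mult_ac)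
  also have "\<dots> \<le> ennreal (D * V x)"
    using D_step V_ge_1[OF Suc.prems] by (intro ennreal_leI mult_right_mono) auto
  finally show ?case using D_ge_1 V_ge_1[OF Suc.prems] by (simp add: ennreal_mult)
qed

text \<open>
  By Fatou's lemma the upper limit of the masses is subharmonic, and the powers of the kernel
  increase it to a harmonic function.
\<close>

lemma harmonic_ennreal:
  obtains h where "h \<in> borel_measurable M" "\<And>x. x \<in> space M \<Longrightarrow> R h x = h x"
    "\<And>x. x \<in> space M \<Longrightarrow> h x \<le> ennreal (b * D * V x)" "\<And>x. x \<in> K \<Longrightarrow> ennreal a \<le> h x"
proof -
  define u where "u n = (R ^^ n) (\<lambda>_. 1)" for n
  have u [measurable]: "u n \<in> borel_measurable M" for n
    unfolding u_def by (intro pow_measurable) auto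
  define l where "l x = limsup (\<lambda>n. u n x)" for x
  have l [measurable]: "l \<in> borel_measurable M"
    unfolding l_def by measurable
  have l_le: "l x \<le> ennreal b * ennreal (V x)" if "x \<in> space M" for x
    unfolding l_def u_def using mass_le_V[OF that] by (intro Limsup_bounded) auto
  have l_sub: "l x \<le> R l x" if x: "x \<in> space M" for x
  proof -
    have "l x = limsup (\<lambda>n. u (n + 1) x)" unfolding l_def using limsup_shift[of "\<lambda>n. u n x"] by simp
    also have "\<dots> = limsup (\<lambda>n. \<integral>\<^sup>+y. u n y \<partial>\<kappa> x)" by (simp add: u_def kernel_op_def)
    also have "\<dots> \<le> (\<integral>\<^sup>+y. limsup (\<lambda>n. u n y) \<partial>\<kappa> x)"
    proof (rule nn_integral_limsup)
      show "u n \<in> borel_measurable (\<kappa> x)" for n using x by (simp add: measurable_kernel_iff)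
      show "(\<lambda>y. ennreal b * ennreal (V y)) \<in> borel_measurable (\<kappa> x)"
        using x by (simp add: measurable_kernel_iff)
      show "AE y in \<kappa> x. u n y \<le> ennreal b * ennreal (V y)" for n
        unfolding u_def using x by (auto simp: space_kernel intro!: mass_le_V AE_I2)
      have "(\<integral>\<^sup>+y. ennreal b * ennreal (V y) \<partial>\<kappa> x) = ennreal b * R (\<lambda>y. ennreal (V y)) x"
        using x by (simp add: kernel_op_def nn_integral_cmult measurable_kernel_iff)
      also have "\<dots> < \<infinity>"
        using pow_V_le[OF x, of 1] by (auto simp: ennreal_mult_less_top intro: le_less_trans)
      finally show "(\<integral>\<^sup>+y. ennreal b * ennreal (V y) \<partial>\<kappa> x) < \<infinity>" .
    qed
    finally show ?thesis unfolding kernel_op_def l_def .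
  qed
  define h where "h x = (SUP n. (R ^^ n) l x)" for x
  have inc: "(R ^^ n) l x \<le> (R ^^ Suc n) l x" if "x \<in> space M" for x n
    unfolding pow_Suc_right using that l_sub by (intro pow_mono)
  have "h \<in> borel_measurable M" unfolding h_def by (measurable, intro pow_measurable l)
  moreover have "R h x = h x" if x: "x \<in> space M" for x
  proof -
    have "R h x = (SUP n. (R ^^ Suc n) l x)"
      unfolding h_def using x inc by (subst R_SUP) (auto intro: pow_measurable l)
    also have "\<dots> = h x"
      unfolding h_def using inc[OF x] by (intro antisym SUP_least) (blast intro: SUP_upper2 order_trans)+
    finally show ?thesis .
  qed
  moreover have "h x \<le> ennreal (b * D * V x)" if x: "x \<in> space M" for x
    unfolding h_def
  proof (rule SUP_least)
    fix n
    have "(R ^^ n) l x \<le> (R ^^ n) (\<lambda>y. ennreal b * ennreal (V y)) x"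
      using x l_le by (intro pow_mono) auto
    also have "\<dots> \<le> ennreal b * (ennreal D * ennreal (V x))"
      using x pow_V_le[OF x] by (subst pow_cmult) (auto intro: mult_left_mono)
    also have "\<dots> = ennreal (b * D * V x)"
      using b_ge_1 D_ge_1 V_ge_1[OF x] by (simp add: ennreal_mult mult_ac)
    finally show "(R ^^ n) l x \<le> ennreal (b * D * V x)" .
  qed
  moreover have "ennreal a \<le> h x" if x: "x \<in> K" for x
  proof -
    have "ennreal a \<le> l x"
      unfolding l_def u_def using mass_ge[OF x] by (intro le_Limsup) auto
    also have "\<dots> \<le> h x" unfolding h_def by (rule SUP_upper2[of 0]) auto
    finally show ?thesis .
  qed
  ultimately show thesis using that by blast
qed

text \<open>Dually, iterating the kernel on a subinvariant measure yields an invariant one.\<close>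

lemma invariant_measure:
  assumes mu: "sets \<mu> = sets M" "(\<integral>\<^sup>+x. ennreal (V x) \<partial>\<mu>) < \<infinity>" "0 < emeasure \<mu> K"
    and sub: "\<And>f. f \<in> borel_measurable M \<Longrightarrow> (\<integral>\<^sup>+x. f x \<partial>\<mu>) \<le> (\<integral>\<^sup>+x. R f x \<partial>\<mu>)"
  obtains \<nu> where "prob_space \<nu>" "sets \<nu> = sets M" "(\<integral>\<^sup>+x. ennreal (V x) \<partial>\<nu>) < \<infinity>" "0 < emeasure \<nu> K"
    "\<And>f. f \<in> borel_measurable M \<Longrightarrow> (\<integral>\<^sup>+x. R f x \<partial>\<nu>) = (\<integral>\<^sup>+x. f x \<partial>\<nu>)"
proof -
  have bm: "f \<in> borel_measurable \<mu> \<longleftrightarrow> f \<in> borel_measurable M" for f :: "'a \<Rightarrow> ennreal"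
    using measurable_cong_sets[OF mu(1) refl] by blast
  have sp: "space \<mu> = space M" using mu(1) by (rule sets_eq_imp_space_eq)
  define I where "I n f = (\<integral>\<^sup>+x. (R ^^ n) f x \<partial>\<mu>)" for n f
  define \<Phi> where "\<Phi> f = (SUP n. I n f)" for f
  have I_inc: "incseq (\<lambda>n. I n f)" if "f \<in> borel_measurable M" for f
    unfolding I_def by (intro incseq_SucI) (simp, rule sub, rule pow_measurable[OF that])
  have Phi_le: "\<Phi> f \<le> c * (\<integral>\<^sup>+x. ennreal (V x) \<partial>\<mu>)" 
    if "\<And>n x. x \<in> space M \<Longrightarrow> (R ^^ n) f x \<le> c * ennreal (V x)" for f c
  proof -
    have "I n f \<le> (\<integral>\<^sup>+x. c * ennreal (V x) \<partial>\<mu>)" for n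
      unfolding I_def using that by (intro nn_integral_mono) (auto simp: sp)
    then show ?thesis unfolding \<Phi>_def by (intro SUP_least) (simp add: nn_integral_cmult bm)
  qed
  obtain \<nu>0 where n0: "sets \<nu>0 = sets M" "\<And>f. f \<in> borel_measurable M \<Longrightarrow> (\<integral>\<^sup>+x. f x \<partial>\<nu>0) = \<Phi> f"
  proof (rule measure_of_functional[of M \<Phi>])
    fix f g :: "'a \<Rightarrow> ennreal" assume "\<And>x. x \<in> space M \<Longrightarrow> f x = g x"
    then show "\<Phi> f = \<Phi> g"
      unfolding \<Phi>_def I_def by (intro SUP_cong refl nn_integral_cong pow_cong) (auto simp: sp)
  next
    fix f g :: "'a \<Rightarrow> ennreal" assume fg: "f \<in> borel_measurable M" "g \<in> borel_measurable M"
    have "I n (\<lambda>x. f x + g x) = I n f + I n g" for n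
    proof -
      have "I n (\<lambda>x. f x + g x) = (\<integral>\<^sup>+x. (R ^^ n) f x + (R ^^ n) g x \<partial>\<mu>)"
        unfolding I_def using fg by (intro nn_integral_cong pow_add) (auto simp: sp)
      also have "\<dots> = I n f + I n g"
        unfolding I_def using fg by (intro nn_integral_add) (auto simp: bm intro: pow_measurable)
      finally show ?thesis .
    qed
    then show "\<Phi> (\<lambda>x. f x + g x) = \<Phi> f + \<Phi> g"
      unfolding \<Phi>_def using I_inc fg by (simp add: ennreal_SUP_add)
  next
    fix c and f :: "'a \<Rightarrow> ennreal" assume f: "f \<in> borel_measurable M"
    have "I n (\<lambda>x. c * f x) = c * I n f" for n
    proof -
      have "I n (\<lambda>x. c * f x) = (\<integral>\<^sup>+x. c * (R ^^ n) f x \<partial>\<mu>)"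
        unfolding I_def using f by (intro nn_integral_cong pow_cmult) (auto simp: sp)
      also have "\<dots> = c * I n f"
        unfolding I_def using f by (intro nn_integral_cmult) (auto simp: bm intro: pow_measurable)
      finally show ?thesis .
    qed
    then show "\<Phi> (\<lambda>x. c * f x) = c * \<Phi> f" unfolding \<Phi>_def by (simp add: SUP_mult_left_ennreal)
  next
    fix F :: "nat \<Rightarrow> 'a \<Rightarrow> ennreal" assume F: "\<And>i. F i \<in> borel_measurable M" "incseq F"
    have "I n (\<lambda>x. SUP i. F i x) = (SUP i. I n (F i))" for n
    proof -
      have "I n (\<lambda>x. SUP i. F i x) = (\<integral>\<^sup>+x. (SUP i. (R ^^ n) (F i) x) \<partial>\<mu>)"
        unfolding I_def using F by (intro nn_integral_cong pow_SUP) (auto simp: sp incseq_Suc_iff le_fun_def)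
      also have "\<dots> = (SUP i. I n (F i))"
        unfolding I_def using F
        by (intro nn_integral_monotone_convergence_SUP_AE)
          (auto simp: bm sp incseq_Suc_iff le_fun_def intro!: pow_measurable pow_mono AE_I2)
      finally show ?thesis .
    qed
    then show "\<Phi> (\<lambda>x. SUP i. F i x) = (SUP i. \<Phi> (F i))"
      unfolding \<Phi>_def by simp (rule SUP_commute)
  qed blast
  have invariant: "\<Phi> (R f) = \<Phi> f" if f: "f \<in> borel_measurable M" for f
  proof -
    have "\<Phi> (R f) = (SUP n. I (Suc n) f)" unfolding \<Phi>_def I_def pow_Suc_right ..
    also have "\<dots> = \<Phi> f"
      unfolding \<Phi>_def using incseq_SucD[OF I_inc[OF f]]
      by (intro antisym SUP_least) (blast intro: SUP_upper2 order_trans)+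
    finally show ?thesis .
  qed
  have Phi_ge: "(\<integral>\<^sup>+x. f x \<partial>\<mu>) \<le> \<Phi> f" for f
    unfolding \<Phi>_def by (rule SUP_upper2[of 0]) (auto simp: I_def)
  have "0 < emeasure \<mu> K" by fact
  also have "\<dots> \<le> emeasure \<nu>0 K"
    using Phi_ge[of "indicator K"] n0(2)[of "indicator K"] mu(1) n0(1) by simp
  finally have pos: "0 < emeasure \<nu>0 K" .
  define Z where "Z = emeasure \<nu>0 (space M)"
  have Z_pos: "0 < Z"
    unfolding Z_def using pos emeasure_mono[of K "space M" \<nu>0] n0(1) sets.sets_into_space[OF K_sets]
    by (auto intro: less_le_trans)
  have Z_1: "Z = \<Phi> (\<lambda>_. 1)"
    unfolding Z_def using n0(2)[of "\<lambda>_. 1"] by (simp add: sets_eq_imp_space_eq[OF n0(1)])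
  have Z_fin: "Z < \<infinity>"
    using Phi_le[OF mass_le_V] mu(2) unfolding Z_1
    by (auto simp: ennreal_mult_less_top intro: le_less_trans)
  have V_fin: "\<Phi> (\<lambda>x. ennreal (V x)) < \<infinity>"
    using Phi_le[OF pow_V_le] mu(2) by (auto simp: ennreal_mult_less_top intro: le_less_trans)
  define \<nu> where "\<nu> = scale_measure (1 / Z) \<nu>0"
  have int: "(\<integral>\<^sup>+x. f x \<partial>\<nu>) = 1 / Z * \<Phi> f" if "f \<in> borel_measurable M" for f
    unfolding \<nu>_def using that n0 by (subst nn_integral_scale_measure) (simp_all cong: measurable_cong_sets)
  have inv_fin: "1 / Z < \<infinity>" and inv_pos: "0 < 1 / Z"
    using Z_pos Z_fin by (auto simp: ennreal_divide_eq_top_iff less_top[symmetric] ennreal_zero_less_divide)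
  have "emeasure \<nu> (space \<nu>) = 1"
    using Z_pos Z_fin unfolding \<nu>_def
    by (simp add: space_scale_measure Z_def sets_eq_imp_space_eq[OF n0(1)] ennreal_divide_times
        ennreal_divide_self less_top[symmetric])
  then have "prob_space \<nu>" by (rule prob_spaceI)
  moreover have "sets \<nu> = sets M" unfolding \<nu>_def by (simp add: n0)
  moreover have "(\<integral>\<^sup>+x. ennreal (V x) \<partial>\<nu>) < \<infinity>"
    using V_fin inv_fin by (simp add: int ennreal_mult_less_top)
  moreover have "0 < emeasure \<nu> K"
    unfolding \<nu>_def using pos inv_pos by (simp add: ennreal_zero_less_mult_iff)
  moreover have "(\<integral>\<^sup>+x. R f x \<partial>\<nu>) = (\<integral>\<^sup>+x. f x \<partial>\<nu>)" if "f \<in> borel_measurable M" for f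
    using that by (simp add: int measurable_kernel_op invariant)
  ultimately show thesis using that by blast
qed

end

section \<open>The kernel on functions bounded by the weight\<close>

context lyapunov_kernel
begin

text \<open>
  The Bochner integral is \<open>0\<close> on functions which are not integrable. \<open>T\<close> is therefore only used on functions
  bounded by a multiple of \<open>V\<close>, on which it is linear and monotone and which it maps to themselves.
\<close>

definition T :: "('a \<Rightarrow> real) \<Rightarrow> 'a \<Rightarrow> real" where
  "T f x = (\<integral>y. f y \<partial>\<kappa> x)"

definition V_bounded :: "('a \<Rightarrow> real) \<Rightarrow> bool" where
  "V_bounded f \<longleftrightarrow> f \<in> borel_measurable M \<and> (\<exists>c. \<forall>x\<in>space M. \<bar>f x\<bar> \<le> c * V x)"

lemma V_boundedI:
  "f \<in> borel_measurable M \<Longrightarrow> (\<And>x. x \<in> space M \<Longrightarrow> \<bar>f x\<bar> \<le> c * V x) \<Longrightarrow> V_bounded f"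
  unfolding V_bounded_def by blast

lemma V_bounded_measurable: "V_bounded f \<Longrightarrow> f \<in> borel_measurable M"
  unfolding V_bounded_def by simp

lemma V_boundedE:
  assumes "V_bounded f"
  obtains c where "0 \<le> c" "\<And>x. x \<in> space M \<Longrightarrow> \<bar>f x\<bar> \<le> c * V x"
proof -
  obtain c where c: "\<And>x. x \<in> space M \<Longrightarrow> \<bar>f x\<bar> \<le> c * V x"
    using assms unfolding V_bounded_def by auto
  have "\<bar>f x\<bar> \<le> max 0 c * V x" if "x \<in> space M" for x
    using c[OF that] V_ge_1[OF that] mult_right_mono[of c "max 0 c" "V x"] by linarith
  then show thesis using that[of "max 0 c"] by auto
qed

lemma V_nonneg: "x \<in> space M \<Longrightarrow> 0 \<le> V x"
  using V_ge_1[of x] by simp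

lemma V_bounded_V: "V_bounded V"
  using V_nonneg by (intro V_boundedI[where c=1]) auto

lemma V_bounded_const: "V_bounded (\<lambda>_. c)"
  using V_ge_1 mult_left_mono[of 1 "V x" "\<bar>c\<bar>" for x]
  by (intro V_boundedI[where c="\<bar>c\<bar>"]) auto

lemma V_bounded_indicator: "A \<in> sets M \<Longrightarrow> V_bounded (indicator A)"
  using V_ge_1 by (intro V_boundedI[where c=1]) (auto simp: indicator_def intro: order_trans[OF zero_le_one])

lemma V_bounded_add:
  assumes "V_bounded f" "V_bounded g" shows "V_bounded (\<lambda>x. f x + g x)"
proof -
  note assms[THEN V_bounded_measurable, measurable]
  obtain c d where cd: "\<And>x. x \<in> space M \<Longrightarrow> \<bar>f x\<bar> \<le> c * V x" "\<And>x. x \<in> space M \<Longrightarrow> \<bar>g x\<bar> \<le> d * V x"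
    using assms V_boundedE by metis
  have "\<bar>f x + g x\<bar> \<le> (c + d) * V x" if "x \<in> space M" for x
    using cd(1)[OF that] cd(2)[OF that] abs_triangle_ineq[of "f x" "g x"] unfolding distrib_right by linarith
  then show ?thesis using assms by (intro V_boundedI) auto
qed

lemma V_bounded_cmult:
  assumes "V_bounded f" shows "V_bounded (\<lambda>x. c * f x)"
proof -
  note assms[THEN V_bounded_measurable, measurable]
  obtain d where d: "\<And>x. x \<in> space M \<Longrightarrow> \<bar>f x\<bar> \<le> d * V x"
    using assms V_boundedE by metis
  have "\<bar>c * f x\<bar> \<le> (\<bar>c\<bar> * d) * V x" if "x \<in> space M" for x
    using mult_left_mono[OF d[OF that], of "\<bar>c\<bar>"] by (simp add: abs_mult mult.assoc)
  then show ?thesis using assms by (intro V_boundedI) auto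
qed

lemma V_bounded_diff: "V_bounded f \<Longrightarrow> V_bounded g \<Longrightarrow> V_bounded (\<lambda>x. f x - g x)"
  using V_bounded_add[of f "\<lambda>x. - 1 * g x"] V_bounded_cmult[of g "- 1"] by simp

lemma V_bounded_integrable:
  assumes "V_bounded f" "sets \<mu> = sets M" "(\<integral>\<^sup>+x. ennreal (V x) \<partial>\<mu>) < \<infinity>"
  shows "integrable \<mu> f"
proof -
  have [measurable]: "V \<in> borel_measurable \<mu>" "f \<in> borel_measurable \<mu>"
    using assms V_bounded_measurable by (simp_all cong: measurable_cong_sets)
  have sp: "space \<mu> = space M" using assms(2) by (rule sets_eq_imp_space_eq)
  obtain c where c: "\<And>x. x \<in> space M \<Longrightarrow> \<bar>f x\<bar> \<le> c * V x" "0 \<le> c"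
    using assms V_boundedE by metis
  have "integrable \<mu> V"
    using V_ge_1 assms(3) by (intro integrableI_nonneg AE_I2) (auto simp: sp V_nonneg)
  then have "integrable \<mu> (\<lambda>x. c * V x)" by simp
  then show ?thesis
  proof (rule Bochner_Integration.integrable_bound)
    show "AE x in \<mu>. norm (f x) \<le> norm (c * V x)"
      using c V_nonneg by (intro AE_I2) (auto simp: sp abs_mult)
  qed simp
qed

lemma V_kernel_finite: "x \<in> space M \<Longrightarrow> (\<integral>\<^sup>+y. ennreal (V y) \<partial>\<kappa> x) < \<infinity>"
  using pow_V_le[of x 1] by (auto simp: kernel_op_def ennreal_mult_less_top intro: le_less_trans)

lemma T_integrable: "V_bounded f \<Longrightarrow> x \<in> space M \<Longrightarrow> integrable (\<kappa> x) f"
  by (intro V_bounded_integrable sets_kernel V_kernel_finite)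

lemma T_cong: "(\<And>y. y \<in> space M \<Longrightarrow> f y = g y) \<Longrightarrow> x \<in> space M \<Longrightarrow> T f x = T g x"
  unfolding T_def by (intro Bochner_Integration.integral_cong) (auto simp: space_kernel)

lemma T_mono:
  "V_bounded f \<Longrightarrow> V_bounded g \<Longrightarrow> (\<And>y. y \<in> space M \<Longrightarrow> f y \<le> g y) \<Longrightarrow> x \<in> space M \<Longrightarrow> T f x \<le> T g x"
  unfolding T_def by (intro integral_mono T_integrable) (auto simp: space_kernel)

lemma T_add: "V_bounded f \<Longrightarrow> V_bounded g \<Longrightarrow> x \<in> space M \<Longrightarrow> T (\<lambda>y. f y + g y) x = T f x + T g x"
  unfolding T_def by (intro Bochner_Integration.integral_add T_integrable)

lemma T_cmult: "T (\<lambda>y. c * f y) x = c * T f x"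
  unfolding T_def by simp

lemma T_nonneg: "(\<And>y. y \<in> space M \<Longrightarrow> 0 \<le> f y) \<Longrightarrow> x \<in> space M \<Longrightarrow> 0 \<le> T f x"
  unfolding T_def by (intro Bochner_Integration.integral_nonneg) (auto simp: space_kernel)

lemma T_eq_R:
  "V_bounded f \<Longrightarrow> (\<And>y. y \<in> space M \<Longrightarrow> 0 \<le> f y) \<Longrightarrow> x \<in> space M \<Longrightarrow>
    ennreal (T f x) = R (\<lambda>y. ennreal (f y)) x"
  unfolding T_def kernel_op_def
  by (intro nn_integral_eq_integral[symmetric] T_integrable AE_I2) (auto simp: space_kernel)

lemma T_V_le: "x \<in> space M \<Longrightarrow> T V x \<le> \<rho> * V x + C * indicator K x"
proof -
  assume x: "x \<in> space M"
  have "ennreal (T V x) = R (\<lambda>y. ennreal (V y)) x"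
    using x V_ge_1 by (intro T_eq_R V_bounded_V) (auto intro: V_nonneg)
  also have "\<dots> \<le> ennreal \<rho> * ennreal (V x) + ennreal C * indicator K x" by (rule drift[OF x])
  also have "\<dots> = ennreal (\<rho> * V x + C * indicator K x)"
    using rho C_pos V_ge_1[OF x] by (simp add: ennreal_plus ennreal_mult ennreal_indicator)
  finally show ?thesis
    using rho C_pos V_ge_1[OF x] by (subst (asm) ennreal_le_iff) (auto intro!: add_nonneg_nonneg)
qed

lemma V_bounded_T:
  assumes "V_bounded f" shows "V_bounded (T f)"
proof -
  have f: "f \<in> borel_measurable M" by (rule V_bounded_measurable[OF assms])
  have "T f x = enn2real (R (\<lambda>y. ennreal (f y)) x) - enn2real (R (\<lambda>y. ennreal (- f y)) x)"
    if "x \<in> space M" for x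
    using real_lebesgue_integral_def[OF T_integrable[OF assms that]] by (simp add: T_def kernel_op_def)
  moreover have "(\<lambda>x. enn2real (R (\<lambda>y. ennreal (f y)) x) - enn2real (R (\<lambda>y. ennreal (- f y)) x)) \<in> borel_measurable M"
  proof -
    have [measurable]: "R (\<lambda>y. ennreal (f y)) \<in> borel_measurable M" "R (\<lambda>y. ennreal (- f y)) \<in> borel_measurable M"
      using f by (auto intro!: measurable_kernel_op)
    show ?thesis by measurable
  qed
  ultimately have meas: "T f \<in> borel_measurable M" by (simp cong: measurable_cong)
  obtain c where c: "0 \<le> c" "\<And>x. x \<in> space M \<Longrightarrow> \<bar>f x\<bar> \<le> c * V x" using V_boundedE[OF assms] by metis
  have "\<bar>T f x\<bar> \<le> c * (\<rho> + C) * V x" if x: "x \<in> space M" for x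
  proof -
    have V: "V_bounded (\<lambda>y. c * V y)" by (intro V_bounded_cmult V_bounded_V)
    have "\<bar>f y\<bar> \<le> c * V y" if "y \<in> space M" for y using c that by blast
    then have "T f x \<le> T (\<lambda>y. c * V y) x" "T (\<lambda>y. - 1 * f y) x \<le> T (\<lambda>y. c * V y) x"
      using x by (intro T_mono V assms V_bounded_cmult; fastforce simp: abs_le_iff)+
    then have "\<bar>T f x\<bar> \<le> c * T V x" unfolding T_cmult by auto
    also have "\<dots> \<le> c * (\<rho> * V x + C * V x)"
      using T_V_le[OF x] C_pos V_ge_1[OF x] c(1)
      by (intro mult_left_mono order_trans[OF T_V_le[OF x]] add_left_mono) (auto simp: indicator_def)
    finally show ?thesis by (simp add: algebra_simps)
  qed
  with meas show ?thesis by (rule V_boundedI)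
qed

lemma V_bounded_pow: "V_bounded f \<Longrightarrow> V_bounded ((T ^^ n) f)"
  by (induction n) (auto intro: V_bounded_T)

lemma Tpow_mono:
  assumes "V_bounded f" "V_bounded g" "\<And>y. y \<in> space M \<Longrightarrow> f y \<le> g y" "x \<in> space M"
  shows "(T ^^ n) f x \<le> (T ^^ n) g x"
  using assms(4) by (induction n arbitrary: x) (auto intro!: T_mono V_bounded_pow assms)

lemma Tpow_cmult: "x \<in> space M \<Longrightarrow> (T ^^ n) (\<lambda>y. c * f y) x = c * (T ^^ n) f x"
proof (induction n arbitrary: x)
  case (Suc n)
  have "(T ^^ Suc n) (\<lambda>y. c * f y) x = T (\<lambda>y. c * (T ^^ n) f y) x"
    using Suc by (auto intro: T_cong)
  then show ?case by (simp add: T_cmult)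
qed auto

lemma Tpow_add:
  assumes "V_bounded f" "V_bounded g" "x \<in> space M"
  shows "(T ^^ n) (\<lambda>y. f y + g y) x = (T ^^ n) f x + (T ^^ n) g x"
  using assms(3)
proof (induction n arbitrary: x)
  case (Suc n)
  have "(T ^^ Suc n) (\<lambda>y. f y + g y) x = T (\<lambda>y. (T ^^ n) f y + (T ^^ n) g y) x"
    using Suc by (auto intro: T_cong)
  then show ?case using Suc.prems assms by (simp add: T_add V_bounded_pow)
qed auto

lemma Tpow_diff:
  assumes "V_bounded f" "V_bounded g" "x \<in> space M"
  shows "(T ^^ n) (\<lambda>y. f y - g y) x = (T ^^ n) f x - (T ^^ n) g x"
  using Tpow_add[OF assms(1) V_bounded_cmult[OF assms(2), of "- 1"] assms(3)] Tpow_cmult[OF assms(3), of n "- 1" g]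
  by simp

lemma Tpow_nonneg: "(\<And>y. y \<in> space M \<Longrightarrow> 0 \<le> f y) \<Longrightarrow> x \<in> space M \<Longrightarrow> 0 \<le> (T ^^ n) f x"
  by (induction n arbitrary: x) (auto intro: T_nonneg)

lemma Tpow_eq_pow:
  assumes "V_bounded f" "\<And>y. y \<in> space M \<Longrightarrow> 0 \<le> f y" "x \<in> space M"
  shows "ennreal ((T ^^ n) f x) = (R ^^ n) (\<lambda>y. ennreal (f y)) x"
  using assms(3)
proof (induction n arbitrary: x)
  case (Suc n)
  have "ennreal ((T ^^ Suc n) f x) = R (\<lambda>y. ennreal ((T ^^ n) f y)) x"
    using assms Suc.prems by (auto intro!: T_eq_R V_bounded_pow Tpow_nonneg)
  also have "\<dots> = (R ^^ Suc n) (\<lambda>y. ennreal (f y)) x"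
    using Suc by (auto intro!: R_cong)
  finally show ?case .
qed auto

lemma Tpow_Suc_right: "(T ^^ Suc n) f = (T ^^ n) (T f)"
  by (simp add: funpow_swap1)

lemma Tpow_plus: "(T ^^ (m + n)) f = (T ^^ m) ((T ^^ n) f)"
  by (simp add: funpow_add)

lemma Tpow_V_le: "x \<in> space M \<Longrightarrow> (T ^^ n) V x \<le> D * V x"
proof -
  assume x: "x \<in> space M"
  have "ennreal ((T ^^ n) V x) = (R ^^ n) (\<lambda>y. ennreal (V y)) x"
    using x V_ge_1 by (intro Tpow_eq_pow V_bounded_V) (auto intro: V_nonneg)
  also have "\<dots> \<le> ennreal (D * V x)"
    using pow_V_le[OF x] D_ge_1 V_ge_1[OF x] by (simp add: ennreal_mult)
  finally show ?thesis
    using D_ge_1 V_ge_1[OF x] by (subst (asm) ennreal_le_iff) auto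
qed

lemma Tpow_abs_le:
  assumes "V_bounded f" "\<And>y. y \<in> space M \<Longrightarrow> \<bar>f y\<bar> \<le> V y" "x \<in> space M"
  shows "\<bar>(T ^^ n) f x\<bar> \<le> D * V x"
proof -
  have "- V y \<le> f y \<and> f y \<le> V y" if "y \<in> space M" for y
    using assms(2)[OF that] by linarith
  then have "(T ^^ n) f x \<le> (T ^^ n) V x" "(T ^^ n) (\<lambda>y. - 1 * V y) x \<le> (T ^^ n) f x"
    using assms by (auto intro!: Tpow_mono V_bounded_V V_bounded_cmult[of V "- 1", simplified])
  with Tpow_V_le[OF assms(3), of n] Tpow_cmult[OF assms(3), of n "- 1" V] show ?thesis by simp
qed

lemma Tpow_harmonic:
  "(\<And>y. y \<in> space M \<Longrightarrow> T h y = h y) \<Longrightarrow> x \<in> space M \<Longrightarrow> (T ^^ n) h x = h x"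
proof (induction n arbitrary: x)
  case (Suc n)
  have "(T ^^ Suc n) h x = T ((T ^^ n) h) x" by simp
  also have "\<dots> = T h x" by (rule T_cong) (use Suc in auto)
  finally show ?case using Suc.prems by simp
qed auto

text \<open>
  Real-valued form of \<open>harmonic_ennreal\<close>; the bound by \<open>V\<close> makes the harmonic function finite.
\<close>

lemma harmonic:
  obtains h where "V_bounded h" "\<And>x. 0 \<le> h x" "\<And>x. x \<in> space M \<Longrightarrow> T h x = h x"
    "\<And>x. x \<in> K \<Longrightarrow> a \<le> h x"
proof -
  obtain h where h: "h \<in> borel_measurable M" "\<And>x. x \<in> space M \<Longrightarrow> R h x = h x"
    "\<And>x. x \<in> space M \<Longrightarrow> h x \<le> ennreal (b * D * V x)" "\<And>x. x \<in> K \<Longrightarrow> ennreal a \<le> h x"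
    using harmonic_ennreal by metis
  have fin: "ennreal (enn2real (h x)) = h x" if "x \<in> space M" for x
    using h(3)[OF that] by (intro ennreal_enn2real) (auto intro: le_less_trans)
  have le: "enn2real (h x) \<le> b * D * V x" if "x \<in> space M" for x
    using h(3)[OF that] b_ge_1 D_ge_1 V_ge_1[OF that] by (intro enn2real_leI) auto
  have bdd: "V_bounded (\<lambda>x. enn2real (h x))"
    using h(1) le by (intro V_boundedI) auto
  moreover have "T (\<lambda>x. enn2real (h x)) x = enn2real (h x)" if x: "x \<in> space M" for x
  proof -
    have "ennreal (T (\<lambda>x. enn2real (h x)) x) = R (\<lambda>y. ennreal (enn2real (h y))) x"
      using x bdd by (intro T_eq_R) auto
    also have "\<dots> = R h x" by (rule R_cong[OF fin x])
    also have "\<dots> = ennreal (enn2real (h x))" unfolding h(2)[OF x] fin[OF x] ..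
    finally show ?thesis using x by (subst (asm) ennreal_inj) (auto intro: T_nonneg)
  qed
  moreover have "a \<le> enn2real (h x)" if x: "x \<in> K" for x
    using h(4)[OF x] fin[OF K_space[OF x]] a_pos by (metis ennreal_le_iff enn2real_nonneg)
  ultimately show thesis using that[of "\<lambda>x. enn2real (h x)"] by auto
qed

end

section \<open>Minorisation on small sets\<close>

locale harris_kernel = lyapunov_kernel M \<kappa> K V \<rho> C a b
  for M :: "'a measure" and \<kappa> K V \<rho> C a b +
  fixes n1 :: nat and c1 v :: real and m :: "'a measure"
  assumes m_prob: "prob_space m" and m_sets [measurable_cong]: "sets m = sets M" and m_K: "emeasure m K = 1"
    and c1_pos: "0 < c1"
    and minorised: "x \<in> K \<Longrightarrow> A \<in> sets M \<Longrightarrow> ennreal c1 * emeasure m A \<le> (R ^^ n1) (indicator A) x"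
    and V_le_K: "x \<in> K \<Longrightarrow> V x \<le> v"
    and returns: "x \<in> K \<Longrightarrow> \<exists>n4. \<forall>n\<ge>n4. 0 < (R ^^ n) (indicator K) x"
begin

lemma minorised_fun:
  "x \<in> K \<Longrightarrow> f \<in> borel_measurable M \<Longrightarrow> ennreal c1 * (\<integral>\<^sup>+y. f y \<partial>m) \<le> (R ^^ n1) f x"
  using minorisation_from_sets[OF m_sets K_space] minorised by blast

lemma space_m: "space m = space M"
  using m_sets by (rule sets_eq_imp_space_eq)

lemma AE_m_K: "AE x in m. x \<in> K"
  using prob_space.AE_in_set_eq_1[OF m_prob, of K] m_K m_sets
  by (simp add: measure_def)

lemma m_V_finite: "(\<integral>\<^sup>+x. ennreal (V x) \<partial>m) < \<infinity>"
proof -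
  have "(\<integral>\<^sup>+x. ennreal (V x) \<partial>m) \<le> (\<integral>\<^sup>+x. ennreal v \<partial>m)"
    using AE_m_K by (intro nn_integral_mono_AE) (auto elim!: eventually_mono intro: ennreal_leI V_le_K)
  also have "\<dots> = ennreal v"
    using prob_space.emeasure_space_1[OF m_prob] by simp
  finally show ?thesis by (auto intro: le_less_trans)
qed

lemma m_integrable: "V_bounded f \<Longrightarrow> integrable m f"
  by (intro V_bounded_integrable m_sets m_V_finite)

text \<open>
  The chain started from \<open>m\<close> is in \<open>K\<close> with positive probability at all large times, because for
  some \<open>j\<close> the set of points which return at all times after \<open>j\<close> is charged by \<open>m\<close>.
\<close>

lemma m_returns: "\<exists>j. \<forall>n\<ge>j. 0 < (\<integral>\<^sup>+x. (R ^^ n) (indicator K) x \<partial>m)"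
proof -
  define A where "A j = {x \<in> space M. \<forall>n\<in>{j..}. 0 < (R ^^ n) (indicator K) x}" for j :: nat
  have [measurable]: "(R ^^ n) (indicator K) \<in> borel_measurable M" for n by (intro pow_measurable) auto
  have A: "A j \<in> sets m" for j unfolding A_def m_sets by measurable
  have "\<exists>j. emeasure m (A j) \<noteq> 0"
  proof (rule ccontr)
    assume "\<not> ?thesis"
    then have "emeasure m (\<Union>j. A j) = 0" using A by (intro emeasure_UN_eq_0) auto
    moreover have "K \<subseteq> (\<Union>j. A j)"
    proof
      fix x assume "x \<in> K"
      then show "x \<in> (\<Union>j. A j)" using returns[of x] K_space[of x] by (simp add: A_def Ball_def)
    qed
    then have "emeasure m K \<le> emeasure m (\<Union>j. A j)" using A by (intro emeasure_mono) auto
    ultimately show False using m_K by simp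
  qed
  then obtain j where j: "emeasure m (A j) \<noteq> 0" by blast
  have "0 < (\<integral>\<^sup>+x. (R ^^ n) (indicator K) x \<partial>m)" if "n \<ge> j" for n
  proof (rule ccontr)
    assume "\<not> ?thesis"
    then have "AE x in m. (R ^^ n) (indicator K) x = 0"
      by (subst nn_integral_0_iff_AE[symmetric]) auto
    then have "AE x in m. x \<notin> A j" using that by (auto elim!: eventually_mono simp: A_def)
    then show False using j A[of j] by (subst (asm) AE_iff_measurable[of "A j"]) (auto dest: sets.sets_into_space)
  qed
  then show ?thesis by blast
qed

text \<open>
  At time \<open>n1 + k + n1\<close>: the first \<open>n1\<close> steps lead from \<open>K\<close> to \<open>m\<close>, the next \<open>k\<close> steps back to \<open>K\<close>, and the last
  \<open>n1\<close> steps to \<open>m\<close> again. As all large \<open>k\<close> are allowed, so are all large times.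
\<close>

lemma minorised_large_times:
  "\<exists>N. \<forall>n\<ge>N. \<exists>\<beta>>0. \<forall>x\<in>K. \<forall>f\<in>borel_measurable M. ennreal \<beta> * (\<integral>\<^sup>+y. f y \<partial>m) \<le> (R ^^ n) f x"
proof -
  obtain j where j: "\<And>n. n \<ge> j \<Longrightarrow> 0 < (\<integral>\<^sup>+x. (R ^^ n) (indicator K) x \<partial>m)" using m_returns by blast
  have "\<exists>\<beta>>0. \<forall>x\<in>K. \<forall>f\<in>borel_measurable M. ennreal \<beta> * (\<integral>\<^sup>+y. f y \<partial>m) \<le> (R ^^ n) f x"
    if n: "n \<ge> n1 + (j + n1)" for n
  proof -
    define k where "k = n - 2 * n1"
    have k: "k \<ge> j" "n = n1 + (k + n1)" using n by (auto simp: k_def)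
    define B where "B = ennreal c1 * (ennreal c1 * (\<integral>\<^sup>+x. (R ^^ k) (indicator K) x \<partial>m))"
    have "0 < B" using j[OF k(1)] c1_pos by (auto simp: B_def ennreal_zero_less_mult_iff)
    then obtain \<beta> where beta: "0 < \<beta>" "ennreal \<beta> \<le> B"
    proof (cases B)
      case (real r)
      then show ?thesis using \<open>0 < B\<close> that[of r] by auto
    next
      case top
      then show ?thesis using that[of 1] by auto
    qed
    have "ennreal \<beta> * (\<integral>\<^sup>+y. f y \<partial>m) \<le> (R ^^ n) f x" if x: "x \<in> K" and f: "f \<in> borel_measurable M" for x f
    proof -
      define I where "I = (\<integral>\<^sup>+y. f y \<partial>m)"
      have [measurable]: "(R ^^ k) (indicator K) \<in> borel_measurable M" by (intro pow_measurable) auto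
      have "ennreal \<beta> * I \<le> B * I" using beta by (intro mult_right_mono) auto
      also have "\<dots> = ennreal c1 * (\<integral>\<^sup>+y. (ennreal c1 * I) * (R ^^ k) (indicator K) y \<partial>m)"
        by (simp add: B_def nn_integral_cmult mult_ac)
      also have "\<dots> = ennreal c1 * (\<integral>\<^sup>+y. (R ^^ k) (\<lambda>z. (ennreal c1 * I) * indicator K z) y \<partial>m)"
        by (intro arg_cong[where f="\<lambda>t. ennreal c1 * t"] nn_integral_cong pow_cmult[symmetric]) (auto simp: space_m)
      also have "\<dots> \<le> ennreal c1 * (\<integral>\<^sup>+y. (R ^^ k) ((R ^^ n1) f) y \<partial>m)"
        using minorised_fun[OF _ f]
        by (intro mult_left_mono nn_integral_mono pow_mono) (auto simp: space_m I_def indicator_def)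
      also have "\<dots> \<le> (R ^^ n1) ((R ^^ k) ((R ^^ n1) f)) x"
        by (intro minorised_fun x pow_measurable f)
      also have "\<dots> = (R ^^ n) f x" unfolding k(2) pow_plus ..
      finally show ?thesis unfolding I_def .
    qed
    with beta(1) show ?thesis by blast
  qed
  then show ?thesis by blast
qed

lemma Tpow_minorised:
  assumes f: "V_bounded f" "\<And>y. y \<in> space M \<Longrightarrow> 0 \<le> f y" and x: "x \<in> K" and "0 \<le> \<beta>"
    and R: "\<And>f. f \<in> borel_measurable M \<Longrightarrow> ennreal \<beta> * (\<integral>\<^sup>+y. f y \<partial>m) \<le> (R ^^ n) f x"
  shows "\<beta> * (\<integral>y. f y \<partial>m) \<le> (T ^^ n) f x"
proof -
  have [measurable]: "f \<in> borel_measurable M" by (rule V_bounded_measurable[OF f(1)])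
  have "ennreal (\<beta> * (\<integral>y. f y \<partial>m)) = ennreal \<beta> * (\<integral>\<^sup>+y. ennreal (f y) \<partial>m)"
    using f assms(4) by (subst nn_integral_eq_integral[OF m_integrable]) (auto simp: space_m ennreal_mult' intro!: AE_I2)
  also have "\<dots> \<le> (R ^^ n) (\<lambda>y. ennreal (f y)) x" by (rule R) measurable
  also have "\<dots> = ennreal ((T ^^ n) f x)" using f K_space[OF x] by (intro Tpow_eq_pow[symmetric])
  finally show ?thesis using f K_space[OF x] by (subst (asm) ennreal_le_iff) (auto intro: Tpow_nonneg)
qed

text \<open>
  Where the weight is comparable to the harmonic function \<open>h\<close>, the drift condition forces a visit to
  \<open>K\<close> before some fixed time \<open>J\<close>; from \<open>K\<close> the kernel is minorised at all large
  times, so at a later fixed time the minorisation holds whatever the time of the visit.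
\<close>

lemma small_set:
  assumes h: "V_bounded h" "\<And>x. 0 \<le> h x" "\<And>x. x \<in> space M \<Longrightarrow> T h x = h x" and L: "0 < L"
  obtains N \<epsilon> where "0 < N" "0 < \<epsilon>"
    "\<And>x f. x \<in> space M \<Longrightarrow> V x \<le> L * h x \<Longrightarrow> V_bounded f \<Longrightarrow> (\<And>y. y \<in> space M \<Longrightarrow> 0 \<le> f y) \<Longrightarrow>
      \<epsilon> * h x * (\<integral>y. f y \<partial>m) \<le> (T ^^ N) f x"
proof -
  obtain H0 where H0: "0 \<le> H0" "\<And>x. x \<in> space M \<Longrightarrow> \<bar>h x\<bar> \<le> H0 * V x" using V_boundedE[OF h(1)] by metis
  define H where "H = H0 + 1"
  have H: "0 < H" "\<And>x. x \<in> space M \<Longrightarrow> h x \<le> H * V x"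
    using H0 V_nonneg unfolding H_def distrib_right by (auto simp: abs_le_iff intro: add_increasing2)
  have "\<forall>\<^sub>F n in sequentially. \<rho> ^ n < 1 / (2 * H * L)"
    using rho H(1) L by (intro order_tendstoD(2)[OF LIMSEQ_power_zero]) auto
  then obtain J' where J': "\<And>n. n \<ge> J' \<Longrightarrow> \<rho> ^ n < 1 / (2 * H * L)" unfolding eventually_sequentially by blast
  define J where "J = Suc J'"
  have J: "0 < J" "H * \<rho> ^ J * L \<le> 1 / 2"
    using J'[of J] H(1) L by (auto simp: J_def field_simps)
  have K: "V_bounded (indicator K)" by (intro V_bounded_indicator K_sets)
  have sum_bound: "(T ^^ n) V x \<le> \<rho> ^ n * V x + C * (\<Sum>j<n. (T ^^ j) (indicator K) x)"
    if x: "x \<in> space M" for n x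
  proof (induction n)
    case (Suc n)
    have "(T ^^ Suc n) V x = (T ^^ n) (T V) x" unfolding Tpow_Suc_right ..
    also have "\<dots> \<le> (T ^^ n) (\<lambda>y. \<rho> * V y + C * indicator K y) x"
      using x T_V_le by (intro Tpow_mono V_bounded_T V_bounded_add V_bounded_cmult V_bounded_V K)
    also have "\<dots> = \<rho> * (T ^^ n) V x + C * (T ^^ n) (indicator K) x"
      using x by (simp add: Tpow_add V_bounded_cmult V_bounded_V K Tpow_cmult)
    also have "\<rho> * (T ^^ n) V x \<le> \<rho> * (\<rho> ^ n * V x) + \<rho> * (C * (\<Sum>j<n. (T ^^ j) (indicator K) x))"
      using Suc rho by (subst distrib_left[symmetric], intro mult_left_mono) auto
    also have "\<rho> * (C * (\<Sum>j<n. (T ^^ j) (indicator K) x)) \<le> 1 * (C * (\<Sum>j<n. (T ^^ j) (indicator K) x))"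
      using rho C_pos x by (intro mult_right_mono mult_nonneg_nonneg sum_nonneg Tpow_nonneg) auto
    finally show ?case by (simp add: algebra_simps)
  qed auto
  obtain N0 where N0: "\<And>n. n \<ge> N0 \<Longrightarrow> \<exists>\<beta>>0. \<forall>x\<in>K. \<forall>f\<in>borel_measurable M. ennreal \<beta> * (\<integral>\<^sup>+y. f y \<partial>m) \<le> (R ^^ n) f x"
    using minorised_large_times by blast
  then obtain \<beta> where beta: "\<And>n. n \<ge> N0 \<Longrightarrow> 0 < \<beta> n"
    "\<And>n x f. n \<ge> N0 \<Longrightarrow> x \<in> K \<Longrightarrow> f \<in> borel_measurable M \<Longrightarrow> ennreal (\<beta> n) * (\<integral>\<^sup>+y. f y \<partial>m) \<le> (R ^^ n) f x"
    by metis
  define \<beta>m where "\<beta>m = Min (\<beta> ` {N0..N0 + J})"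
  have bm: "0 < \<beta>m" "\<And>n. n \<in> {N0..N0 + J} \<Longrightarrow> \<beta>m \<le> \<beta> n"
    unfolding \<beta>m_def using beta(1) by (auto simp: Min_gr_iff)
  define \<delta> where "\<delta> = 1 / (2 * H * C * J)"
  have delta: "0 < \<delta>" unfolding \<delta>_def using H(1) C_pos J(1) by simp
  show thesis
  proof (rule that[of "J + N0" "\<beta>m * \<delta>"])
    show "0 < J + N0" "0 < \<beta>m * \<delta>" using J(1) bm(1) delta by auto
    fix x f assume x: "x \<in> space M" "V x \<le> L * h x" and f: "V_bounded f" "\<And>y. y \<in> space M \<Longrightarrow> 0 \<le> f y"
    have mf: "0 \<le> (\<integral>y. f y \<partial>m)" using f(2) by (intro Bochner_Integration.integral_nonneg) (auto simp: space_m)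
    \<comment> \<open>Without a visit to \<open>K\<close> before time \<open>J\<close> at most half of \<open>h x\<close> could be recovered.\<close>
    have "h x = (T ^^ J) h x" using h(3) x(1) by (rule Tpow_harmonic[symmetric])
    also have "\<dots> \<le> (T ^^ J) (\<lambda>y. H * V y) x"
      using x(1) H(2) by (intro Tpow_mono h V_bounded_cmult V_bounded_V)
    also have "\<dots> = H * (T ^^ J) V x" using x(1) by (rule Tpow_cmult)
    also have "\<dots> \<le> H * (\<rho> ^ J * (L * h x) + C * (\<Sum>j<J. (T ^^ j) (indicator K) x))"
      using H(1) rho x(2)
      by (intro mult_left_mono order_trans[OF sum_bound[OF x(1)]] add_right_mono) auto
    also have "\<dots> = (H * \<rho> ^ J * L) * h x + H * C * (\<Sum>j<J. (T ^^ j) (indicator K) x)" by (simp add: algebra_simps)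
    also have "\<dots> \<le> 1 / 2 * h x + H * C * (\<Sum>j<J. (T ^^ j) (indicator K) x)"
      using h(2) J(2) by (intro add_right_mono mult_right_mono) auto
    finally have sum: "h x \<le> 2 * H * C * (\<Sum>j<J. (T ^^ j) (indicator K) x)" by simp
    have "\<exists>j<J. \<delta> * h x \<le> (T ^^ j) (indicator K) x"
    proof (rule ccontr)
      assume "\<not> ?thesis"
      then have "(\<Sum>j<J. (T ^^ j) (indicator K) x) < (\<Sum>j<J. \<delta> * h x)"
        using J(1) by (intro sum_strict_mono) (auto simp: not_le)
      then have "2 * H * C * (\<Sum>j<J. (T ^^ j) (indicator K) x) < 2 * H * C * (J * (\<delta> * h x))"
        using H(1) C_pos by (intro mult_strict_left_mono) auto
      also have "\<dots> = h x" using H(1) C_pos J(1) by (simp add: \<delta>_def)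
      finally show False using sum by simp
    qed
    then obtain j where j: "j < J" "\<delta> * h x \<le> (T ^^ j) (indicator K) x" by blast
    define k where "k = J + N0 - j"
    have k: "J + N0 = j + k" "k \<in> {N0..N0 + J}" using j(1) by (auto simp: k_def)
    have "\<beta>m * \<delta> * h x * (\<integral>y. f y \<partial>m) = (\<beta>m * (\<integral>y. f y \<partial>m)) * (\<delta> * h x)" by simp
    also have "\<dots> \<le> (\<beta>m * (\<integral>y. f y \<partial>m)) * (T ^^ j) (indicator K) x"
      using j(2) bm(1) mf by (intro mult_left_mono) auto
    also have "\<dots> = (T ^^ j) (\<lambda>y. (\<beta>m * (\<integral>y. f y \<partial>m)) * indicator K y) x"
      using x(1) by (rule Tpow_cmult[symmetric])
    also have "\<dots> \<le> (T ^^ j) ((T ^^ k) f) x"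
    proof (rule Tpow_mono[OF _ _ _ x(1)])
      fix y assume y: "y \<in> space M"
      show "\<beta>m * (\<integral>y. f y \<partial>m) * indicator K y \<le> (T ^^ k) f y"
      proof (cases "y \<in> K")
        case True
        have "\<beta>m * (\<integral>y. f y \<partial>m) \<le> \<beta> k * (\<integral>y. f y \<partial>m)"
          using bm(2)[OF k(2)] mf by (intro mult_right_mono)
        also have "\<dots> \<le> (T ^^ k) f y"
          using f True k(2) beta by (intro Tpow_minorised) (auto intro: less_imp_le)
        finally show ?thesis using True by simp
      next
        case False
        then show ?thesis using f y by (auto intro: Tpow_nonneg)
      qed
    qed (intro V_bounded_cmult K V_bounded_pow f)+
    also have "\<dots> = (T ^^ (J + N0)) f x" unfolding k(1) Tpow_plus ..
    finally show "\<beta>m * \<delta> * h x * (\<integral>y. f y \<partial>m) \<le> (T ^^ (J + N0)) f x" .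
  qed
qed

end

section \<open>Contraction and spectral gap\<close>

context harris_kernel
begin

text \<open>
  Weighted contraction modulo the harmonic function. With \<open>w = h + \<beta> V\<close>, the oscillation of \<open>f\<close> is
  reduced on the small set by the minorisation, where the constant \<open>c = \<epsilon> m(f)\<close> is subtracted, and
  off the small set by the drift. As \<open>\<beta>\<close> and \<open>c\<close> are both of order \<open>\<epsilon>\<close>, the level \<open>L\<close> of the small
  set can be chosen before \<open>\<epsilon>\<close>.
\<close>

lemma contraction:
  assumes h: "V_bounded h" "\<And>x. 0 \<le> h x" "\<And>x. x \<in> space M \<Longrightarrow> T h x = h x" "\<And>x. x \<in> K \<Longrightarrow> a \<le> h x"
  obtains N \<alpha> \<beta> where "0 < N" "0 < \<alpha>" "\<alpha> < 1" "0 < \<beta>"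
    "\<And>f. V_bounded f \<Longrightarrow> (\<And>x. x \<in> space M \<Longrightarrow> \<bar>f x\<bar> \<le> h x + \<beta> * V x) \<Longrightarrow>
      \<exists>c. \<forall>x\<in>space M. \<bar>(T ^^ N) f x - c * h x\<bar> \<le> \<alpha> * (h x + \<beta> * V x)"
proof -
  \<comment> \<open>On \<open>K\<close> the harmonic function is at least \<open>a\<close>, so the drift gives \<open>T V \<le> \<rho> V + (C / a) h\<close>, and \<open>G\<close> sums the errors.\<close>
  define G where "G = C / a / (1 - \<rho>)"
  have G: "0 < G" "\<rho> * G + C / a = G"
    using C_pos a_pos rho by (auto simp: G_def field_simps)
  have V_pow: "(T ^^ n) V x \<le> \<rho> ^ n * V x + G * h x" if x: "x \<in> space M" for n x
  proof (induction n)
    case 0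
    then show ?case using G h(2)[of x] by simp
  next
    case (Suc n)
    have "(T ^^ Suc n) V x = (T ^^ n) (T V) x" unfolding Tpow_Suc_right ..
    also have "\<dots> \<le> (T ^^ n) (\<lambda>y. \<rho> * V y + C / a * h y) x"
    proof (rule Tpow_mono[OF _ _ _ x])
      fix y assume y: "y \<in> space M"
      have "C * indicator K y \<le> C / a * h y"
        using h(2)[of y] h(4)[of y] C_pos a_pos by (auto simp: indicator_def field_simps)
      then show "T V y \<le> \<rho> * V y + C / a * h y" using T_V_le[OF y] by simp
    qed (intro V_bounded_T V_bounded_add V_bounded_cmult V_bounded_V h)+
    also have "\<dots> = \<rho> * (T ^^ n) V x + C / a * (T ^^ n) h x"
      using x by (simp only: Tpow_add V_bounded_cmult V_bounded_V h Tpow_cmult)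
    also have "\<dots> \<le> \<rho> * (\<rho> ^ n * V x + G * h x) + C / a * h x"
      using Suc rho C_pos a_pos Tpow_harmonic[OF h(3) x] by (intro add_mono mult_left_mono) auto
    also have "\<dots> = \<rho> ^ Suc n * V x + (\<rho> * G + C / a) * h x" by (simp add: algebra_simps)
    finally show ?case unfolding G(2) .
  qed
  define p q where "p = (\<integral>y. h y \<partial>m)" and "q = (\<integral>y. V y \<partial>m)"
  have "a = (\<integral>y. a \<partial>m)" using prob_space.prob_space[OF m_prob] by simp
  also have "\<dots> \<le> p"
    unfolding p_def using AE_m_K h(4)
    by (intro integral_mono_AE m_integrable V_bounded_const h) (auto elim!: eventually_mono)
  finally have p: "0 < p" using a_pos by simp
  have q: "0 \<le> q" unfolding q_def by (intro Bochner_Integration.integral_nonneg) (auto simp: space_m V_nonneg)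
  \<comment> \<open>Off the small set \<open>h\<close> is at most \<open>V / L\<close>; this \<open>L\<close> makes the drift absorb the term \<open>c h\<close>.\<close>
  define L where "L = 4 * G * (2 * p + q) / (p * (1 - \<rho>))"
  have L: "0 < L" unfolding L_def using G p q rho by (intro divide_pos_pos mult_pos_pos) auto
  obtain N \<epsilon>0 where N: "0 < N" "0 < \<epsilon>0"
    "\<And>x f. x \<in> space M \<Longrightarrow> V x \<le> L * h x \<Longrightarrow> V_bounded f \<Longrightarrow> (\<And>y. y \<in> space M \<Longrightarrow> 0 \<le> f y) \<Longrightarrow>
      \<epsilon>0 * h x * (\<integral>y. f y \<partial>m) \<le> (T ^^ N) f x"
    using small_set[OF h(1-3) L] by metis
  \<comment> \<open>The upper bounds on \<open>\<epsilon>\<close> ensure \<open>\<beta> \<le> 1\<close>.\<close>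
  define \<epsilon> where "\<epsilon> = min \<epsilon>0 (min (1 / p) (2 * G / p))"
  have eps: "0 < \<epsilon>" "\<epsilon> \<le> \<epsilon>0" "\<epsilon> * p \<le> 1" "\<epsilon> * p \<le> 2 * G"
  proof -
    show "0 < \<epsilon>" "\<epsilon> \<le> \<epsilon>0" unfolding \<epsilon>_def using N(2) p G by auto
    have "\<epsilon> \<le> 1 / p" "\<epsilon> \<le> 2 * G / p" unfolding \<epsilon>_def by auto
    then show "\<epsilon> * p \<le> 1" "\<epsilon> * p \<le> 2 * G" using p by (simp_all add: pos_le_divide_eq)
  qed
  \<comment> \<open>With this \<open>\<beta>\<close> the drift adds to the coefficient of \<open>h\<close> half of what the minorisation removes.\<close>
  define \<beta> where "\<beta> = \<epsilon> * p / (2 * G)"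
  have beta: "0 < \<beta>" "\<beta> \<le> 1" "\<beta> * G = \<epsilon> * p / 2"
    using eps p G by (auto simp: \<beta>_def)
  define \<alpha> where "\<alpha> = max (1 - \<epsilon> * p / 2) ((1 + \<rho>) / 2)"
  have alpha: "1 - \<epsilon> * p / 2 \<le> \<alpha>" "(1 + \<rho>) / 2 \<le> \<alpha>" "\<rho> \<le> \<alpha>" "0 < \<alpha>" "\<alpha> < 1"
    using mult_pos_pos[OF eps(1) p] rho unfolding \<alpha>_def by (auto simp: max_def)
  define w where "w x = h x + \<beta> * V x" for x
  have w: "V_bounded w" "\<And>x. x \<in> space M \<Longrightarrow> 0 \<le> w x"
    unfolding w_def using h(2) V_nonneg beta by (auto intro!: V_bounded_add V_bounded_cmult V_bounded_V h(1))
  have w_pow: "(T ^^ N) w x \<le> (1 + \<epsilon> * p / 2) * h x + \<beta> * \<rho> * V x" if x: "x \<in> space M" for x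
  proof -
    have "\<rho> ^ N \<le> \<rho> ^ 1" using rho N(1) by (intro power_decreasing) auto
    then have "\<rho> ^ N * V x \<le> \<rho> * V x" using V_nonneg[OF x] by (intro mult_right_mono) auto
    then have "(T ^^ N) V x \<le> \<rho> * V x + G * h x" using V_pow[OF x, of N] by linarith
    then have "\<beta> * (T ^^ N) V x \<le> \<beta> * (\<rho> * V x + G * h x)" using beta by (intro mult_left_mono) auto
    moreover have "(T ^^ N) w x = h x + \<beta> * (T ^^ N) V x"
      unfolding w_def using x
      by (simp only: Tpow_add V_bounded_cmult V_bounded_V h Tpow_cmult Tpow_harmonic[OF h(3)])
    moreover have "\<beta> * (\<rho> * V x + G * h x) = \<beta> * \<rho> * V x + (\<beta> * G) * h x" by (simp add: algebra_simps)
    ultimately have "(T ^^ N) w x \<le> h x + \<beta> * \<rho> * V x + (\<beta> * G) * h x" by linarith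
    then show ?thesis unfolding beta(3) by (simp add: distrib_right)
  qed
  have mw: "p \<le> (\<integral>y. w y \<partial>m)" "(\<integral>y. w y \<partial>m) \<le> p + q"
  proof -
    have "(\<integral>y. w y \<partial>m) = p + \<beta> * q"
      unfolding w_def p_def q_def using m_integrable[OF h(1)] m_integrable[OF V_bounded_V] by simp
    moreover have "0 \<le> \<beta> * q" using beta q by simp
    moreover have "\<beta> * q \<le> 1 * q" using beta q by (intro mult_right_mono)
    ultimately show "p \<le> (\<integral>y. w y \<partial>m)" "(\<integral>y. w y \<partial>m) \<le> p + q" by auto
  qed
  have main: "\<bar>(T ^^ N) f x - (\<epsilon> * (\<integral>y. f y \<partial>m)) * h x\<bar> \<le> \<alpha> * w x"
    if f: "V_bounded f" "\<And>x. x \<in> space M \<Longrightarrow> \<bar>f x\<bar> \<le> w x" and x: "x \<in> space M" for f x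
  proof -
    define c where "c = \<epsilon> * (\<integral>y. f y \<partial>m)"
    have nonneg: "0 \<le> w y - f y" "0 \<le> w y + f y" if "y \<in> space M" for y using f(2)[OF that] by auto
    have pow: "(T ^^ N) (\<lambda>y. w y - f y) x = (T ^^ N) w x - (T ^^ N) f x"
        "(T ^^ N) (\<lambda>y. w y + f y) x = (T ^^ N) w x + (T ^^ N) f x"
      using x w f by (simp_all only: Tpow_diff Tpow_add)
    have int: "(\<integral>y. w y - f y \<partial>m) = (\<integral>y. w y \<partial>m) - (\<integral>y. f y \<partial>m)"
        "(\<integral>y. w y + f y \<partial>m) = (\<integral>y. w y \<partial>m) + (\<integral>y. f y \<partial>m)"
      using m_integrable[OF w(1)] m_integrable[OF f(1)] by simp_all
    show ?thesis
    proof (cases "V x \<le> L * h x")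
      case True
      have minor: "\<epsilon> * h x * (\<integral>y. g y \<partial>m) \<le> (T ^^ N) g x"
        if g: "V_bounded g" "\<And>y. y \<in> space M \<Longrightarrow> 0 \<le> g y" for g
      proof -
        have "\<epsilon> * h x * (\<integral>y. g y \<partial>m) \<le> \<epsilon>0 * h x * (\<integral>y. g y \<partial>m)"
          using g eps h(2)[of x]
          by (intro mult_right_mono Bochner_Integration.integral_nonneg) (auto simp: space_m)
        then show ?thesis using N(3)[OF x True g] by linarith
      qed
      have "\<epsilon> * h x * (\<integral>y. w y - f y \<partial>m) \<le> (T ^^ N) (\<lambda>y. w y - f y) x"
        by (intro minor V_bounded_diff w f nonneg)
      moreover have "\<epsilon> * h x * (\<integral>y. w y + f y \<partial>m) \<le> (T ^^ N) (\<lambda>y. w y + f y) x"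
        by (intro minor V_bounded_add w f nonneg)
      ultimately have "\<bar>(T ^^ N) f x - c * h x\<bar> \<le> (T ^^ N) w x - \<epsilon> * h x * (\<integral>y. w y \<partial>m)"
        unfolding pow int c_def abs_le_iff by (auto simp: algebra_simps)
      also have "\<epsilon> * h x * p \<le> \<epsilon> * h x * (\<integral>y. w y \<partial>m)"
        using eps h(2)[of x] mw by (intro mult_left_mono) auto
      then have "(T ^^ N) w x - \<epsilon> * h x * (\<integral>y. w y \<partial>m) \<le> (1 - \<epsilon> * p / 2) * h x + \<rho> * (\<beta> * V x)"
        using w_pow[OF x] by (simp add: algebra_simps)
      also have "\<dots> \<le> \<alpha> * h x + \<alpha> * (\<beta> * V x)"
        using alpha h(2)[of x] V_nonneg[OF x] beta by (intro add_mono mult_right_mono) auto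
      finally show ?thesis unfolding c_def w_def by (simp add: algebra_simps)
    next
      case False
      then have hV: "h x * L \<le> V x" by (simp add: mult.commute)
      have "\<bar>\<integral>y. f y \<partial>m\<bar> \<le> (\<integral>y. w y \<partial>m)"
        using m_integrable[OF w(1)] m_integrable[OF f(1)] f(2)
        by (intro order_trans[OF integral_abs_bound] Bochner_Integration.integral_mono) (auto simp: space_m)
      then have "\<bar>c\<bar> \<le> \<epsilon> * (p + q)"
        unfolding c_def abs_mult using eps mw by (auto intro: mult_left_mono)
      then have c: "\<bar>c * h x\<bar> \<le> \<epsilon> * (p + q) * h x"
        unfolding abs_mult using h(2)[of x] by (auto intro: mult_right_mono)
      have "0 \<le> (T ^^ N) (\<lambda>y. w y - f y) x" "0 \<le> (T ^^ N) (\<lambda>y. w y + f y) x"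
        by (intro Tpow_nonneg nonneg x; assumption)+
      then have "\<bar>(T ^^ N) f x\<bar> \<le> (T ^^ N) w x" unfolding pow by auto
      then have "\<bar>(T ^^ N) f x - c * h x\<bar> \<le> (1 + \<epsilon> * p / 2) * h x + \<beta> * \<rho> * V x + \<epsilon> * (p + q) * h x"
        using c w_pow[OF x] abs_triangle_ineq4[of "(T ^^ N) f x" "c * h x"] by linarith
      also have "\<dots> \<le> \<alpha> * (h x + \<beta> * V x)"
      proof -
        have "(1 - \<alpha> + \<epsilon> * p / 2 + \<epsilon> * (p + q)) * h x \<le> (\<epsilon> * (2 * p + q)) * h x"
          using alpha h(2)[of x] by (intro mult_right_mono) (auto simp: algebra_simps)
        also have "\<epsilon> * (2 * p + q) = \<beta> * ((1 - \<rho>) / 2) * L"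
          unfolding L_def \<beta>_def using p G rho by (simp add: field_simps)
        also have "\<beta> * ((1 - \<rho>) / 2) * L * h x = \<beta> * ((1 - \<rho>) / 2) * (h x * L)" by simp
        also have "\<dots> \<le> \<beta> * ((1 - \<rho>) / 2) * V x"
          using hV beta rho by (intro mult_left_mono) auto
        also have "\<dots> \<le> \<beta> * (\<alpha> - \<rho>) * V x"
          using alpha beta V_nonneg[OF x] by (intro mult_right_mono mult_left_mono) (auto simp: field_simps)
        finally show ?thesis by (simp add: algebra_simps)
      qed
      finally show ?thesis unfolding c_def w_def .
    qed
  qed
  show thesis
  proof (rule that[OF N(1) alpha(4,5) beta(1)])
    fix f assume "V_bounded f" "\<And>x. x \<in> space M \<Longrightarrow> \<bar>f x\<bar> \<le> h x + \<beta> * V x"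
    then show "\<exists>c. \<forall>x\<in>space M. \<bar>(T ^^ N) f x - c * h x\<bar> \<le> \<alpha> * (h x + \<beta> * V x)"
      using main[of f] unfolding w_def by blast
  qed
qed

text \<open>
  Iterating the contraction brings \<open>T^(N k) f\<close> within \<open>\<alpha>^k w\<close> of some multiple \<open>c h\<close>. Integration against the
  invariant measure identifies \<open>c\<close> as \<open>\<nu>(f) / \<nu>(h)\<close> up to the same error, and \<open>\<eta> = h / \<nu>(h)\<close>. The times which are not
  multiples of \<open>N\<close> only cost a constant.
\<close>

lemma spectral_gap:
  assumes nu: "prob_space \<nu>" "sets \<nu> = sets M" "(\<integral>\<^sup>+x. ennreal (V x) \<partial>\<nu>) < \<infinity>" "0 < emeasure \<nu> K"
    and inv: "\<And>f. f \<in> borel_measurable M \<Longrightarrow> (\<integral>\<^sup>+x. R f x \<partial>\<nu>) = (\<integral>\<^sup>+x. f x \<partial>\<nu>)"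
  obtains \<eta> \<alpha> B a' where "V_bounded \<eta>" "\<And>x. 0 \<le> \<eta> x" "0 < a'" "\<And>x. x \<in> K \<Longrightarrow> a' \<le> \<eta> x"
    "0 < \<alpha>" "\<alpha> < 1" "0 < B"
    "\<And>f n x. f \<in> borel_measurable M \<Longrightarrow> (\<And>y. y \<in> space M \<Longrightarrow> \<bar>f y\<bar> \<le> V y) \<Longrightarrow> x \<in> space M \<Longrightarrow>
      \<bar>(T ^^ n) f x - (\<integral>y. f y \<partial>\<nu>) * \<eta> x\<bar> \<le> B * \<alpha> ^ n * V x"
proof -
  interpret nu: prob_space \<nu> by (rule nu(1))
  have sp: "space \<nu> = space M" using nu(2) by (rule sets_eq_imp_space_eq)
  have nu_int: "integrable \<nu> f" if "V_bounded f" for f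
    using that nu by (intro V_bounded_integrable)
  have nu_T: "(\<integral>x. T f x \<partial>\<nu>) = (\<integral>x. f x \<partial>\<nu>)" if f: "V_bounded f" for f
  proof -
    have nonneg: "(\<integral>x. T g x \<partial>\<nu>) = (\<integral>x. g x \<partial>\<nu>)" if g: "V_bounded g" "\<And>x. x \<in> space M \<Longrightarrow> 0 \<le> g x" for g
    proof -
      have "ennreal (\<integral>x. T g x \<partial>\<nu>) = (\<integral>\<^sup>+x. ennreal (T g x) \<partial>\<nu>)"
        using g by (intro nn_integral_eq_integral[symmetric] nu_int V_bounded_T AE_I2) (auto simp: sp intro: T_nonneg)
      also have "\<dots> = (\<integral>\<^sup>+x. R (\<lambda>y. ennreal (g y)) x \<partial>\<nu>)"
        using g by (intro nn_integral_cong T_eq_R) (auto simp: sp)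
      also have "\<dots> = (\<integral>\<^sup>+x. ennreal (g x) \<partial>\<nu>)"
        using V_bounded_measurable[OF g(1)] by (intro inv) measurable
      also have "\<dots> = ennreal (\<integral>x. g x \<partial>\<nu>)"
        using g by (intro nn_integral_eq_integral nu_int AE_I2) (auto simp: sp)
      finally show ?thesis
        using g by (subst (asm) ennreal_inj) (auto simp: sp intro!: Bochner_Integration.integral_nonneg T_nonneg)
    qed
    obtain c where c: "0 \<le> c" "\<And>x. x \<in> space M \<Longrightarrow> \<bar>f x\<bar> \<le> c * V x" using V_boundedE[OF f] by metis
    have cV: "V_bounded (\<lambda>x. c * V x)" by (intro V_bounded_cmult V_bounded_V)
    have "(\<integral>x. T (\<lambda>y. f y + c * V y) x \<partial>\<nu>) = (\<integral>x. f x + c * V x \<partial>\<nu>)"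
      using c f by (intro nonneg V_bounded_add cV) (auto simp: abs_le_iff real_0_le_add_iff add.commute)
    moreover have "(\<integral>x. T (\<lambda>y. f y + c * V y) x \<partial>\<nu>) = (\<integral>x. T f x + T (\<lambda>y. c * V y) x \<partial>\<nu>)"
      using f cV by (intro Bochner_Integration.integral_cong) (auto simp: sp T_add)
    moreover have "(\<integral>x. T (\<lambda>y. c * V y) x \<partial>\<nu>) = (\<integral>x. c * V x \<partial>\<nu>)"
      using c V_nonneg by (intro nonneg cV) auto
    ultimately show ?thesis
      using nu_int[OF f] nu_int[OF cV] nu_int[OF V_bounded_T[OF f]] nu_int[OF V_bounded_T[OF cV]] by simp
  qed
  have nu_Tpow: "(\<integral>x. (T ^^ n) f x \<partial>\<nu>) = (\<integral>x. f x \<partial>\<nu>)" if "V_bounded f" for f n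
    using that by (induction n) (auto simp: nu_T V_bounded_pow)
  obtain h where h: "V_bounded h" "\<And>x. 0 \<le> h x" "\<And>x. x \<in> space M \<Longrightarrow> T h x = h x" "\<And>x. x \<in> K \<Longrightarrow> a \<le> h x"
    using harmonic by metis
  obtain N \<alpha> \<beta> where N: "0 < N" "0 < \<alpha>" "\<alpha> < 1" "0 < \<beta>"
    "\<And>f. V_bounded f \<Longrightarrow> (\<And>x. x \<in> space M \<Longrightarrow> \<bar>f x\<bar> \<le> h x + \<beta> * V x) \<Longrightarrow>
      \<exists>c. \<forall>x\<in>space M. \<bar>(T ^^ N) f x - c * h x\<bar> \<le> \<alpha> * (h x + \<beta> * V x)"
    using contraction[OF h] by metis
  define w where "w x = h x + \<beta> * V x" for x
  have w: "V_bounded w" "\<And>x. x \<in> space M \<Longrightarrow> 0 \<le> w x"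
    unfolding w_def using h(2) V_nonneg N by (auto intro!: V_bounded_add V_bounded_cmult V_bounded_V h(1))
  have iter: "\<exists>c. \<forall>x\<in>space M. \<bar>(T ^^ (N * k)) f x - c * h x\<bar> \<le> \<alpha> ^ k * w x"
    if f: "V_bounded f" "\<And>x. x \<in> space M \<Longrightarrow> \<bar>f x\<bar> \<le> w x" for f k
  proof (induction k)
    case 0
    then show ?case using f by (intro exI[of _ 0]) simp
  next
    case (Suc k)
    then obtain c where c: "\<And>x. x \<in> space M \<Longrightarrow> \<bar>(T ^^ (N * k)) f x - c * h x\<bar> \<le> \<alpha> ^ k * w x" by blast
    define g where "g x = 1 / \<alpha> ^ k * ((T ^^ (N * k)) f x - c * h x)" for x
    have fk: "V_bounded ((T ^^ (N * k)) f)" "V_bounded (\<lambda>x. c * h x)" "V_bounded (\<lambda>x. (T ^^ (N * k)) f x - c * h x)"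
      by (intro V_bounded_cmult V_bounded_diff V_bounded_pow f h)+
    have "V_bounded g" unfolding g_def by (intro V_bounded_cmult fk)
    moreover have "\<bar>g x\<bar> \<le> h x + \<beta> * V x" if "x \<in> space M" for x
      using c[OF that] N unfolding g_def w_def abs_mult by (simp add: field_simps)
    ultimately obtain d where d: "\<And>x. x \<in> space M \<Longrightarrow> \<bar>(T ^^ N) g x - d * h x\<bar> \<le> \<alpha> * w x"
      using N(5) unfolding w_def by blast
    have "\<bar>(T ^^ (N * Suc k)) f x - (c + \<alpha> ^ k * d) * h x\<bar> \<le> \<alpha> ^ Suc k * w x" if x: "x \<in> space M" for x
    proof -
      have "(T ^^ N) g x = 1 / \<alpha> ^ k * ((T ^^ N) ((T ^^ (N * k)) f) x - c * h x)"
        unfolding g_def using x fk by (simp only: Tpow_cmult Tpow_diff Tpow_harmonic[OF h(3)])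
      then have "\<alpha> ^ k * (T ^^ N) g x = (T ^^ (N * Suc k)) f x - c * h x"
        using N by (simp add: Tpow_plus)
      then have "(T ^^ (N * Suc k)) f x - (c + \<alpha> ^ k * d) * h x = \<alpha> ^ k * ((T ^^ N) g x - d * h x)"
        by (simp add: algebra_simps)
      also have "\<bar>\<dots>\<bar> \<le> \<alpha> ^ k * (\<alpha> * w x)"
        unfolding abs_mult using d[OF x] N by (intro mult_mono) auto
      finally show ?thesis by (simp add: mult_ac)
    qed
    then show ?case by blast
  qed
  have "0 < (\<integral>x. a * indicator K x \<partial>\<nu>)"
    using nu(4) a_pos nu(2) by (simp add: nu.emeasure_eq_measure)
  also have "\<dots> \<le> (\<integral>x. h x \<partial>\<nu>)"
    using h(2,4) K_sets by (intro Bochner_Integration.integral_mono nu_int V_bounded_cmult V_bounded_indicator h(1)) (auto simp: indicator_def)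
  finally have hpos: "0 < (\<integral>x. h x \<partial>\<nu>)" .
  define z where "z = (\<integral>x. h x \<partial>\<nu>)"
  have z: "0 < z" using hpos z_def by simp
  define \<eta> where "\<eta> x = 1 / z * h x" for x
  have eta: "V_bounded \<eta>" "\<And>x. 0 \<le> \<eta> x" "\<And>x. x \<in> K \<Longrightarrow> a / z \<le> \<eta> x"
    unfolding \<eta>_def using h z V_bounded_cmult[OF h(1), of "1 / z"] by (auto intro!: divide_right_mono)
  define W where "W = (\<integral>x. w x \<partial>\<nu>)"
  have W: "0 \<le> W" unfolding W_def using w(2) by (intro Bochner_Integration.integral_nonneg) (auto simp: sp)
  have gap: "\<bar>(T ^^ (N * k)) f x - (\<integral>y. f y \<partial>\<nu>) * \<eta> x\<bar> \<le> \<alpha> ^ k * (w x + W * \<eta> x)"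
    if f: "V_bounded f" "\<And>x. x \<in> space M \<Longrightarrow> \<bar>f x\<bar> \<le> w x" and x: "x \<in> space M" for f k x
  proof -
    obtain c where c: "\<And>x. x \<in> space M \<Longrightarrow> \<bar>(T ^^ (N * k)) f x - c * h x\<bar> \<le> \<alpha> ^ k * w x"
      using iter[OF f] by blast
    have fk: "V_bounded ((T ^^ (N * k)) f)" "V_bounded (\<lambda>x. c * h x)" "V_bounded (\<lambda>x. (T ^^ (N * k)) f x - c * h x)"
      by (intro V_bounded_cmult V_bounded_diff V_bounded_pow f h)+
    have "(\<integral>y. f y \<partial>\<nu>) - c * z = (\<integral>y. (T ^^ (N * k)) f y - c * h y \<partial>\<nu>)"
      using nu_int[OF fk(1)] nu_int[OF h(1)] nu_Tpow[OF f(1)] by (simp add: z_def)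
    also have "\<bar>\<dots>\<bar> \<le> (\<integral>y. \<alpha> ^ k * w y \<partial>\<nu>)"
      using nu_int[OF fk(3)] nu_int[OF w(1)] c
      by (intro order_trans[OF integral_abs_bound] Bochner_Integration.integral_mono) (auto simp: sp)
    also have "\<dots> = \<alpha> ^ k * W" by (simp add: W_def)
    finally have "\<bar>(\<integral>y. f y \<partial>\<nu>) - c * z\<bar> * \<eta> x \<le> \<alpha> ^ k * W * \<eta> x"
      using eta(2) by (intro mult_right_mono)
    then have "\<bar>c * h x - (\<integral>y. f y \<partial>\<nu>) * \<eta> x\<bar> \<le> \<alpha> ^ k * W * \<eta> x"
    proof -
      have "c * h x - (\<integral>y. f y \<partial>\<nu>) * \<eta> x = (c * z - (\<integral>y. f y \<partial>\<nu>)) * \<eta> x"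
        unfolding \<eta>_def using z by (simp add: field_simps)
      then have "\<bar>c * h x - (\<integral>y. f y \<partial>\<nu>) * \<eta> x\<bar> = \<bar>(\<integral>y. f y \<partial>\<nu>) - c * z\<bar> * \<eta> x"
        using eta(2)[of x] by (simp add: abs_mult abs_minus_commute)
      then show ?thesis using \<open>\<bar>(\<integral>y. f y \<partial>\<nu>) - c * z\<bar> * \<eta> x \<le> \<alpha> ^ k * W * \<eta> x\<close> by simp
    qed
    with c[OF x] have "\<bar>(T ^^ (N * k)) f x - (\<integral>y. f y \<partial>\<nu>) * \<eta> x\<bar> \<le> \<alpha> ^ k * w x + \<alpha> ^ k * W * \<eta> x"
      by linarith
    then show ?thesis by (simp add: algebra_simps)
  qed
  obtain E where E: "0 \<le> E" "\<And>x. x \<in> space M \<Longrightarrow> \<bar>w x + W * \<eta> x\<bar> \<le> E * V x"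
    using V_boundedE[OF V_bounded_add[OF w(1) V_bounded_cmult[OF eta(1)]]] by metis
  define \<alpha>' where "\<alpha>' = root N \<alpha>"
  have alpha': "0 < \<alpha>'" "\<alpha>' < 1" "\<alpha>' ^ N = \<alpha>"
    unfolding \<alpha>'_def using N by (auto simp: real_root_gt_zero real_root_lt_1_iff real_root_pow_pos)
  define B where "B = D / \<beta> * E / \<alpha> + 1"
  have B: "0 < B" unfolding B_def using D_ge_1 N E by (intro add_nonneg_pos divide_nonneg_nonneg mult_nonneg_nonneg) auto
  have "\<bar>(T ^^ n) f x - (\<integral>y. f y \<partial>\<nu>) * \<eta> x\<bar> \<le> B * \<alpha>' ^ n * V x"
    if f: "f \<in> borel_measurable M" "\<And>y. y \<in> space M \<Longrightarrow> \<bar>f y\<bar> \<le> V y" and x: "x \<in> space M" for f n x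
  proof -
    define k r where "k = n div N" and "r = n mod N"
    have n: "n = N * k + r" "r < N" using N(1) by (auto simp: k_def r_def)
    have fV: "V_bounded f" using f by (intro V_boundedI[where c=1]) auto
    define s where "s = \<beta> / D"
    have s: "0 < s" using N D_ge_1 by (simp add: s_def)
    define g where "g y = s * (T ^^ r) f y" for y
    have g: "V_bounded g" unfolding g_def by (intro V_bounded_cmult V_bounded_pow fV)
    have "\<bar>g y\<bar> \<le> w y" if y: "y \<in> space M" for y
    proof -
      have "\<bar>g y\<bar> \<le> s * (D * V y)"
        unfolding g_def abs_mult using Tpow_abs_le[OF fV f(2) y] s by (intro mult_mono) auto
      also have "\<dots> = \<beta> * V y" using D_ge_1 by (simp add: s_def)
      also have "\<dots> \<le> w y" unfolding w_def using h(2) by simp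
      finally show ?thesis .
    qed
    then have "\<bar>(T ^^ (N * k)) g x - (\<integral>y. g y \<partial>\<nu>) * \<eta> x\<bar> \<le> \<alpha> ^ k * (w x + W * \<eta> x)"
      using g x by (intro gap)
    also have "\<dots> \<le> \<alpha> ^ k * (E * V x)" using E(2)[OF x] N by (intro mult_left_mono) (auto simp: abs_le_iff)
    also have "(T ^^ (N * k)) g x = s * (T ^^ n) f x"
      unfolding g_def n(1) Tpow_plus using x by (rule Tpow_cmult)
    also have "(\<integral>y. g y \<partial>\<nu>) = s * (\<integral>y. f y \<partial>\<nu>)"
      unfolding g_def using nu_Tpow[OF fV] by simp
    finally have "s * \<bar>(T ^^ n) f x - (\<integral>y. f y \<partial>\<nu>) * \<eta> x\<bar> \<le> \<alpha> ^ k * (E * V x)"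
      using s abs_mult[of s "(T ^^ n) f x - (\<integral>y. f y \<partial>\<nu>) * \<eta> x"]
      by (simp add: right_diff_distrib mult.assoc)
    then have "\<bar>(T ^^ n) f x - (\<integral>y. f y \<partial>\<nu>) * \<eta> x\<bar> \<le> 1 / s * (\<alpha> ^ k * (E * V x))"
      using s by (simp add: field_simps)
    also have "\<dots> = (D / \<beta> * E) * \<alpha> ^ k * V x" by (simp add: s_def)
    also have "\<dots> \<le> (D / \<beta> * E) * (\<alpha>' ^ n / \<alpha>) * V x"
    proof -
      have "\<alpha> ^ k * \<alpha> = \<alpha>' ^ (N * k + N)" unfolding alpha'(3)[symmetric] by (simp add: power_mult power_add)
      also have "\<dots> \<le> \<alpha>' ^ n" unfolding n(1) using alpha' n(2) by (intro power_decreasing) auto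
      finally have "\<alpha> ^ k \<le> \<alpha>' ^ n / \<alpha>" using N by (simp add: field_simps)
      then show ?thesis using D_ge_1 N E V_nonneg[OF x] by (intro mult_right_mono mult_left_mono) auto
    qed
    also have "\<dots> = (D / \<beta> * E / \<alpha>) * (\<alpha>' ^ n * V x)" by simp
    also have "\<dots> \<le> B * (\<alpha>' ^ n * V x)"
      unfolding B_def using alpha' V_nonneg[OF x] by (intro mult_right_mono mult_nonneg_nonneg) auto
    finally show ?thesis by simp
  qed
  then show thesis
    using that[of \<eta> "a / z" \<alpha>' B] eta a_pos z alpha' B by auto
qed

end

section \<open>Comparison of masses under opposite drift conditions\<close>

context positive_kernel
begin

text \<open>
  The hypotheses are those of Assumption (E) for a kernel normalised by the decay parameter of its
  quasi-stationary distribution \<open>\<nu>\<close>. On \<open>K\<close> the powers of the two weights \<open>\<phi>\<close> and \<open>\<psi>\<close> are comparable. Off \<open>K\<close> the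
  weight \<open>\<phi>\<close> contracts faster than \<open>R^n \<psi> y\<close> can decrease in \<open>n\<close>, whence \<open>R^n 1 \<le> A (R^n \<psi> y) \<phi>\<close> on the whole
  space for \<open>y\<close> in \<open>K\<close>. Integrating against \<open>\<nu>\<close>, where the left side has integral \<open>1\<close>, bounds \<open>R^n \<psi> y\<close> from below. The
  upper bound is the Harnack inequality (E3) integrated over \<open>K\<close>.
\<close>

lemma mass_comparison:
  fixes \<phi> \<psi> :: "'a \<Rightarrow> real"
  assumes K: "K \<in> sets M" "K \<noteq> {}"
    and phi: "\<phi> \<in> borel_measurable M" "\<psi> \<in> borel_measurable M"
      "\<And>x. x \<in> space M \<Longrightarrow> 1 \<le> \<phi> x" "\<And>x. x \<in> K \<Longrightarrow> \<phi> x \<le> v"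
      "0 < i" "\<And>x. x \<in> K \<Longrightarrow> i \<le> \<psi> x" "\<And>x. x \<in> space M \<Longrightarrow> 0 \<le> \<psi> x \<and> \<psi> x \<le> 1"
    and const: "0 < \<rho>" "\<rho> < \<sigma>" "0 \<le> \<delta>" "0 < \<zeta>" "\<rho> < 1"
    and drift1: "\<And>x. x \<in> space M \<Longrightarrow> R (\<lambda>y. ennreal (\<phi> y)) x \<le> ennreal (\<rho> * \<phi> x + \<delta> * indicator K x)"
    and drift2: "\<And>x. x \<in> space M \<Longrightarrow> ennreal (\<sigma> * \<psi> x) \<le> R (\<lambda>y. ennreal (\<psi> y)) x"
    and harnack: "\<And>x y n. x \<in> K \<Longrightarrow> y \<in> K \<Longrightarrow> (R ^^ n) (\<lambda>_. 1) x \<le> ennreal \<zeta> * (R ^^ n) (\<lambda>_. 1) y"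
    and nu: "prob_space \<nu>" "sets \<nu> = sets M" "(\<integral>\<^sup>+x. ennreal (\<phi> x) \<partial>\<nu>) < \<infinity>"
      "\<And>f. f \<in> borel_measurable M \<Longrightarrow> (\<integral>\<^sup>+x. R f x \<partial>\<nu>) = (\<integral>\<^sup>+x. f x \<partial>\<nu>)"
  obtains a b where "0 < a" "0 < emeasure \<nu> K"
    "\<And>x n. x \<in> K \<Longrightarrow> ennreal a \<le> (R ^^ n) (\<lambda>_. 1) x" "\<And>x n. x \<in> K \<Longrightarrow> (R ^^ n) (\<lambda>_. 1) x \<le> ennreal b"
proof -
  interpret nu: prob_space \<nu> by (rule nu(1))
  have sp: "space \<nu> = space M" using nu(2) by (rule sets_eq_imp_space_eq)
  have bm: "f \<in> borel_measurable \<nu> \<longleftrightarrow> f \<in> borel_measurable M" for f :: "'a \<Rightarrow> ennreal"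
    using measurable_cong_sets[OF nu(2) refl] by blast
  note K(1)[measurable] phi(1,2)[measurable]
  have KM: "x \<in> space M" if "x \<in> K" for x using that sets.sets_into_space[OF K(1)] by auto
  define F1 F2 where "F1 = (\<lambda>y. ennreal (\<phi> y))" and "F2 = (\<lambda>y. ennreal (\<psi> y))"
  have F [measurable]: "F1 \<in> borel_measurable M" "F2 \<in> borel_measurable M" unfolding F1_def F2_def by measurable
  have F_ge: "1 \<le> F1 x" if "x \<in> space M" for x
    unfolding F1_def using phi(3)[OF that] by (simp add: ennreal_ge_1)
  have F2_le: "F2 x \<le> 1" if "x \<in> space M" for x
    unfolding F2_def using phi(7)[OF that] by (simp add: ennreal_le_1)
  have d1: "R F1 x \<le> ennreal \<rho> * F1 x + ennreal \<delta> * indicator K x" if x: "x \<in> space M" for x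
  proof -
    have "ennreal (\<rho> * \<phi> x + \<delta> * indicator K x) = ennreal \<rho> * F1 x + ennreal \<delta> * indicator K x"
      unfolding F1_def using const phi(3)[OF x] by (simp add: ennreal_plus ennreal_mult ennreal_indicator)
    with drift1[OF x] show ?thesis unfolding F1_def by simp
  qed
  have d2: "ennreal \<sigma> * F2 x \<le> R F2 x" if x: "x \<in> space M" for x
    using drift2[OF x] const phi(7)[OF x] unfolding F2_def by (simp add: ennreal_mult)
  have pow_meas: "(R ^^ n) f \<in> borel_measurable \<nu>" if "f \<in> borel_measurable M" for f n
    using that by (simp add: bm pow_measurable)
  \<comment> \<open>The invariant measure charges \<open>K\<close>, since the drift is strict outside \<open>K\<close>.\<close>
  have nuK: "0 < emeasure \<nu> K"
  proof (rule ccontr)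
    assume "\<not> ?thesis"
    then have 0: "emeasure \<nu> K = 0" by simp
    define I where "I = (\<integral>\<^sup>+x. F1 x \<partial>\<nu>)"
    have "I = (\<integral>\<^sup>+x. R F1 x \<partial>\<nu>)" unfolding I_def by (rule nu(4)[symmetric]) measurable
    also have "\<dots> \<le> (\<integral>\<^sup>+x. ennreal \<rho> * F1 x + ennreal \<delta> * indicator K x \<partial>\<nu>)"
      using d1 by (intro nn_integral_mono) (auto simp: sp)
    also have "\<dots> = ennreal \<rho> * I"
      unfolding I_def using 0 K(1) nu(2) by (subst nn_integral_add) (auto simp: bm nn_integral_cmult)
    finally have le: "I \<le> ennreal \<rho> * I" .
    have fin: "I < \<infinity>" using nu(3) unfolding I_def F1_def .
    have "1 = (\<integral>\<^sup>+x. 1 \<partial>\<nu>)" using nu.emeasure_space_1 by simp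
    also have "\<dots> \<le> I" unfolding I_def using F_ge by (intro nn_integral_mono) (auto simp: sp)
    finally have "1 \<le> I" .
    with fin obtain r where r: "I = ennreal r" "1 \<le> r" by (cases I) (auto simp: ennreal_ge_1)
    with le const have "r \<le> \<rho> * r" by (simp add: ennreal_mult'[symmetric])
    with r const show False by (simp add: mult_le_cancel_right1)
  qed
  obtain y0 where y0: "y0 \<in> K" using K(2) by blast
  \<comment> \<open>On \<open>K\<close> the powers of the two weights are comparable, as their ratio satisfies a contractive recursion.\<close>
  define c where "c = max (v / i) (\<delta> / i / (\<sigma> - \<rho>))"
  have "1 \<le> v" using phi(3)[OF KM[OF y0]] phi(4)[OF y0] by linarith
  then have c: "0 < c" "v \<le> c * i" "\<rho> * c + \<delta> / i \<le> \<sigma> * c"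
  proof -
    show "0 < c" unfolding c_def using \<open>1 \<le> v\<close> phi(5) by (simp add: less_max_iff_disj)
    have "v / i \<le> c" "\<delta> / i / (\<sigma> - \<rho>) \<le> c" unfolding c_def by auto
    then show "v \<le> c * i" "\<rho> * c + \<delta> / i \<le> \<sigma> * c" using phi(5) const by (auto simp: field_simps)
  qed
  have ratio: "(R ^^ n) F1 x \<le> ennreal c * (R ^^ n) F2 x" if x: "x \<in> K" for n x
  proof (induction n)
    case 0
    have "\<phi> x \<le> c * \<psi> x" using phi(4)[OF x] c mult_left_mono[OF phi(6)[OF x], of c] by linarith
    then show ?case unfolding F1_def F2_def using c by (simp add: ennreal_mult'[symmetric] ennreal_leI)
  next
    case (Suc n)
    have xM: "x \<in> space M" by (rule KM[OF x])
    have "(R ^^ Suc n) F1 x \<le> (R ^^ n) (\<lambda>y. ennreal \<rho> * F1 y + ennreal (\<delta> / i) * F2 y) x"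
      unfolding pow_Suc_right
    proof (rule pow_mono[OF _ xM])
      fix y assume y: "y \<in> space M"
      have "ennreal \<delta> * indicator K y \<le> ennreal (\<delta> / i) * F2 y"
      proof (cases "y \<in> K")
        case True
        have "\<delta> \<le> \<delta> / i * \<psi> y" using phi(5) phi(6)[OF True] const by (simp add: field_simps mult_left_mono)
        then show ?thesis unfolding F2_def using True const phi(5) by (simp add: ennreal_mult'[symmetric] ennreal_leI)
      qed simp
      then show "R F1 y \<le> ennreal \<rho> * F1 y + ennreal (\<delta> / i) * F2 y"
        by (intro order_trans[OF d1[OF y]] add_left_mono)
    qed
    also have "\<dots> = ennreal \<rho> * (R ^^ n) F1 x + ennreal (\<delta> / i) * (R ^^ n) F2 x"
      using xM F by (subst pow_add) (auto simp: pow_cmult)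
    also have "\<dots> \<le> ennreal \<rho> * (ennreal c * (R ^^ n) F2 x) + ennreal (\<delta> / i) * (R ^^ n) F2 x"
      using Suc by (intro add_right_mono mult_left_mono) auto
    also have "\<dots> = ennreal (\<rho> * c + \<delta> / i) * (R ^^ n) F2 x"
      using const c phi(5) by (simp add: ennreal_plus ennreal_mult distrib_left mult_ac)
    also have "\<dots> \<le> ennreal (\<sigma> * c) * (R ^^ n) F2 x"
      using c(3) by (intro mult_right_mono ennreal_leI) auto
    also have "\<dots> = ennreal c * (R ^^ n) (\<lambda>y. ennreal \<sigma> * F2 y) x"
      using xM F const c by (simp add: pow_cmult ennreal_mult mult_ac)
    also have "\<dots> \<le> ennreal c * (R ^^ Suc n) F2 x"
      unfolding pow_Suc_right using d2 xM by (intro mult_left_mono pow_mono) auto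
    finally show ?case .
  qed
  define A where "A = \<zeta> * c"
  have A: "0 < A" unfolding A_def using const c by simp
  have on_K: "(R ^^ n) (\<lambda>_. 1) x \<le> ennreal A * (R ^^ n) F2 y" if "x \<in> K" "y \<in> K" for n x y
  proof -
    have "(R ^^ n) (\<lambda>_. 1) x \<le> ennreal \<zeta> * (R ^^ n) (\<lambda>_. 1) y" by (rule harnack[OF that])
    also have "\<dots> \<le> ennreal \<zeta> * (R ^^ n) F1 y"
      using F_ge KM[OF that(2)] by (intro mult_left_mono pow_mono) auto
    also have "\<dots> \<le> ennreal \<zeta> * (ennreal c * (R ^^ n) F2 y)" using ratio[OF that(2)] by (intro mult_left_mono) auto
    also have "\<dots> = ennreal A * (R ^^ n) F2 y" unfolding A_def using const c by (simp add: ennreal_mult mult_ac)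
    finally show ?thesis .
  qed
  have everywhere: "(R ^^ n) (\<lambda>_. 1) x \<le> ennreal A * (R ^^ n) F2 y * F1 x" if "x \<in> space M" "y \<in> K" for n x y
    using that(1)
  proof (induction n arbitrary: x)
    case 0
    have "1 \<le> ennreal A * F2 y" using on_K[of y y 0] that(2) by simp
    then have "1 * 1 \<le> ennreal A * F2 y * F1 x" using F_ge[OF 0] by (intro mult_mono) auto
    then show ?case by simp
  next
    case (Suc n)
    show ?case
    proof (cases "x \<in> K")
      case True
      have "(R ^^ Suc n) (\<lambda>_. 1) x \<le> ennreal A * (R ^^ Suc n) F2 y * 1"
        using on_K[OF True that(2), of "Suc n"] by simp
      also have "\<dots> \<le> ennreal A * (R ^^ Suc n) F2 y * F1 x"
        using F_ge[OF Suc.prems] by (intro mult_left_mono) auto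
      finally show ?thesis .
    next
      case False
      have "(R ^^ Suc n) (\<lambda>_. 1) x \<le> R (\<lambda>z. ennreal A * (R ^^ n) F2 y * F1 z) x"
        using Suc by (auto intro!: R_mono)
      also have "\<dots> = ennreal A * (R ^^ n) F2 y * R F1 x"
        using Suc.prems F by (simp add: R_cmult)
      also have "\<dots> \<le> ennreal A * (R ^^ n) F2 y * (ennreal \<sigma> * F1 x)"
      proof (intro mult_left_mono)
        have "R F1 x \<le> ennreal \<rho> * F1 x" using d1[OF Suc.prems] False by simp
        also have "\<dots> \<le> ennreal \<sigma> * F1 x" using const by (intro mult_right_mono ennreal_leI) auto
        finally show "R F1 x \<le> ennreal \<sigma> * F1 x" .
      qed auto
      also have "\<dots> = ennreal A * (R ^^ n) (\<lambda>z. ennreal \<sigma> * F2 z) y * F1 x"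
        using F KM[OF that(2)] by (simp add: pow_cmult mult_ac)
      also have "\<dots> \<le> ennreal A * (R ^^ Suc n) F2 y * F1 x"
        unfolding pow_Suc_right using d2 KM[OF that(2)] by (intro mult_left_mono mult_right_mono pow_mono) auto
      finally show ?thesis .
    qed
  qed
  have inv: "(\<integral>\<^sup>+x. (R ^^ n) (\<lambda>_. 1) x \<partial>\<nu>) = 1" for n
  proof (induction n)
    case 0
    then show ?case using nu.emeasure_space_1 by simp
  next
    case (Suc n)
    then show ?case using nu(4)[of "(R ^^ n) (\<lambda>_. 1)"] by (simp add: pow_measurable)
  qed
  define I where "I = enn2real (\<integral>\<^sup>+x. F1 x \<partial>\<nu>)"
  have I: "(\<integral>\<^sup>+x. F1 x \<partial>\<nu>) = ennreal I" "0 \<le> I"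
    unfolding I_def using nu(3) by (auto simp: F1_def)
  have lower: "ennreal (1 / (A * (I + 1))) \<le> (R ^^ n) (\<lambda>_. 1) y" if y: "y \<in> K" for n y
  proof -
    have yM: "y \<in> space M" by (rule KM[OF y])
    have "(\<integral>\<^sup>+x. (R ^^ n) (\<lambda>_. 1) x \<partial>\<nu>) \<le> (\<integral>\<^sup>+x. ennreal A * (R ^^ n) F2 y * F1 x \<partial>\<nu>)"
      using everywhere[OF _ y] by (intro nn_integral_mono) (auto simp: sp)
    then have "1 \<le> (\<integral>\<^sup>+x. ennreal A * (R ^^ n) F2 y * F1 x \<partial>\<nu>)" unfolding inv .
    also have "\<dots> = ennreal A * (R ^^ n) F2 y * ennreal I"
      using I by (simp add: nn_integral_cmult bm)
    also have "\<dots> \<le> ennreal A * (R ^^ n) (\<lambda>_. 1) y * ennreal (I + 1)"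
      using F2_le yM by (intro mult_mono mult_left_mono pow_mono ennreal_leI) auto
    also have "\<dots> = ennreal (A * (I + 1)) * (R ^^ n) (\<lambda>_. 1) y"
      using A I by (simp add: ennreal_mult mult_ac)
    finally have "ennreal (1 / (A * (I + 1))) * 1 \<le> ennreal (1 / (A * (I + 1))) * (ennreal (A * (I + 1)) * (R ^^ n) (\<lambda>_. 1) y)"
      by (intro mult_left_mono) auto
    also have "\<dots> = (R ^^ n) (\<lambda>_. 1) y"
      using A I by (simp add: mult.assoc[symmetric] ennreal_mult[symmetric])
    finally show ?thesis by simp
  qed
  define k where "k = measure \<nu> K"
  have k: "emeasure \<nu> K = ennreal k" "0 < k"
    using nuK unfolding k_def by (auto simp: nu.emeasure_eq_measure)
  have upper: "(R ^^ n) (\<lambda>_. 1) x \<le> ennreal (\<zeta> / k)" if x: "x \<in> K" for n x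
  proof -
    have "(R ^^ n) (\<lambda>_. 1) x * ennreal k = (\<integral>\<^sup>+y. (R ^^ n) (\<lambda>_. 1) x * indicator K y \<partial>\<nu>)"
      using K(1) nu(2) by (simp add: nn_integral_cmult k(1))
    also have "\<dots> \<le> (\<integral>\<^sup>+y. ennreal \<zeta> * (R ^^ n) (\<lambda>_. 1) y \<partial>\<nu>)"
      using harnack[OF x] by (intro nn_integral_mono) (auto simp: indicator_def)
    also have "\<dots> = ennreal \<zeta>" using inv by (simp add: nn_integral_cmult pow_meas)
    finally have "(R ^^ n) (\<lambda>_. 1) x * ennreal k * ennreal (1 / k) \<le> ennreal \<zeta> * ennreal (1 / k)"
      by (intro mult_right_mono) auto
    then show ?thesis
      using k(2) const by (simp add: mult.assoc ennreal_mult[symmetric])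
  qed
  show thesis
    by (rule that[of "1 / (A * (I + 1))" "\<zeta> / k"]) (use A I nuK lower upper in auto)
qed

end

section \<open>The Markov property and killed kernels\<close>

lemma less_hitting_time_iff: "enat n < hitting_time X A \<omega> \<longleftrightarrow> (\<forall>k\<le>n. X k \<omega> \<notin> A)"
proof
  assume "enat n < hitting_time X A \<omega>"
  then show "\<forall>k\<le>n. X k \<omega> \<notin> A"
    unfolding hitting_time_def by (auto dest!: less_le_trans[OF _ Inf_lower])
next
  assume *: "\<forall>k\<le>n. X k \<omega> \<notin> A"
  have "enat (Suc n) \<le> hitting_time X A \<omega>"
    unfolding hitting_time_def using * by (intro Inf_greatest) (auto simp: not_less_eq_eq[symmetric])
  then show "enat n < hitting_time X A \<omega>" by (rule less_le_trans[rotated]) simp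
qed

lemma hitting_time_eq_iff: "hitting_time X A \<omega> = enat n \<longleftrightarrow> X n \<omega> \<in> A \<and> (\<forall>k<n. X k \<omega> \<notin> A)"
proof (cases n)
  case 0
  then show ?thesis using less_hitting_time_iff[of 0 X A \<omega>]
    by (auto simp: zero_enat_def[symmetric])
next
  case (Suc m)
  have "hitting_time X A \<omega> = enat n \<longleftrightarrow> \<not> enat n < hitting_time X A \<omega> \<and> enat m < hitting_time X A \<omega>"
    unfolding Suc by (cases "hitting_time X A \<omega>") auto
  then show ?thesis unfolding less_hitting_time_iff Suc by (auto simp: le_Suc_eq less_Suc_eq_le)
qed

definition stays :: "'w measure \<Rightarrow> (nat \<Rightarrow> 'w \<Rightarrow> 'a) \<Rightarrow> 'a set \<Rightarrow> nat \<Rightarrow> 'w set" where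
  "stays \<Omega> X A n = {\<omega> \<in> space \<Omega>. \<forall>k\<le>n. X k \<omega> \<in> A}"

text \<open>
  The scale \<open>s\<close> is \<open>1\<close> for probabilities, \<open>1 / \<theta>0\<close> for the normalised kernel and \<open>1 / g\<close> for discounted counts.
\<close>

definition killed_kernel ::
  "'a measure \<Rightarrow> ('a \<Rightarrow> 'w measure) \<Rightarrow> (nat \<Rightarrow> 'w \<Rightarrow> 'a) \<Rightarrow> 'a set \<Rightarrow> ennreal \<Rightarrow> 'a \<Rightarrow> 'a measure" where
  "killed_kernel S P X A s x = scale_measure s (restrict_space (distr (P x) S (X 1)) A)"

context absorbed_markov_process
begin

lemma P_space: "x \<in> space S \<Longrightarrow> prob_space (P x)" "x \<in> space S \<Longrightarrow> sets (P x) = sets \<Omega>"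
    "x \<in> space S \<Longrightarrow> space (P x) = space \<Omega>"
proof -
  assume "x \<in> space S"
  then have *: "P x \<in> space (prob_algebra \<Omega>)" using P_kernel by (rule measurable_space[rotated])
  then show "prob_space (P x)" "sets (P x) = sets \<Omega>" by (auto simp: space_prob_algebra)
  then show "space (P x) = space \<Omega>" by (intro sets_eq_imp_space_eq)
qed

lemma measurable_P: "x \<in> space S \<Longrightarrow> measurable (P x) N = measurable \<Omega> N"
  by (intro measurable_cong_sets P_space refl)

lemma X_space: "\<omega> \<in> space \<Omega> \<Longrightarrow> X n \<omega> \<in> space S"
  using X_measurable by (rule measurable_space)

lemma P_measurable_subprob: "P \<in> S \<rightarrow>\<^sub>M subprob_algebra \<Omega>"
  using P_kernel by (rule measurable_prob_algebraD)

lemma measurable_expectation: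
  "f \<in> borel_measurable \<Omega> \<Longrightarrow> (\<lambda>x. \<integral>\<^sup>+\<omega>. f \<omega> \<partial>P x) \<in> borel_measurable S"
  by (rule nn_integral_measurable_subprob_algebra2[OF _ P_measurable_subprob]) simp

lemma stays_sets [measurable]:
  assumes "A \<in> sets S" shows "stays \<Omega> X A n \<in> sets \<Omega>"
proof -
  have "(\<Inter>k\<in>{..n}. X k -` A \<inter> space \<Omega>) \<in> sets \<Omega>"
    using measurable_sets[OF X_measurable assms] by (intro sets.finite_INT) auto
  moreover have "(\<Inter>k\<in>{..n}. X k -` A \<inter> space \<Omega>) = stays \<Omega> X A n" by (auto simp: stays_def)
  ultimately show ?thesis by simp
qed

lemma measurable_extend:
  fixes f :: "'a \<Rightarrow> ennreal"
  assumes "A \<in> sets S" "f \<in> borel_measurable (restrict_space S A)"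
  shows "(\<lambda>x. f x * indicator A x) \<in> borel_measurable S"
  using assms by (subst (asm) borel_measurable_restrict_space_iff_ennreal) auto

lemma nn_integral_initial:
  assumes x: "x \<in> space S" and f: "f \<in> borel_measurable S"
  shows "(\<integral>\<^sup>+\<omega>. f (X 0 \<omega>) \<partial>P x) = f x"
proof -
  have "(\<integral>\<^sup>+\<omega>. f (X 0 \<omega>) \<partial>P x) = (\<integral>\<^sup>+y. f y \<partial>distr (P x) S (X 0))"
    using f x X_measurable by (intro nn_integral_distr[symmetric]) (auto simp: measurable_P)
  also have "\<dots> = f x" unfolding starts_at[OF x] using x f by (rule nn_integral_return)
  finally show ?thesis .
qed

lemma kernel_op_killed:
  assumes A: "A \<in> sets S" and x: "x \<in> space S" and f: "f \<in> borel_measurable (restrict_space S A)"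
  shows "kernel_op (killed_kernel S P X A s) f x = s * (\<integral>\<^sup>+\<omega>. f (X 1 \<omega>) * indicator A (X 1 \<omega>) \<partial>P x)"
proof -
  have sp: "A \<inter> space (distr (P x) S (X 1)) \<in> sets (distr (P x) S (X 1))"
    using A by (simp add: sets.Int_space_eq2)
  have "f \<in> borel_measurable (restrict_space (distr (P x) S (X 1)) A)"
    using f by (simp cong: measurable_cong_sets sets_restrict_space_cong)
  then have "kernel_op (killed_kernel S P X A s) f x = s * (\<integral>\<^sup>+y. f y \<partial>restrict_space (distr (P x) S (X 1)) A)"
    unfolding kernel_op_def killed_kernel_def by (rule nn_integral_scale_measure)
  also have "(\<integral>\<^sup>+y. f y \<partial>restrict_space (distr (P x) S (X 1)) A) = (\<integral>\<^sup>+y. f y * indicator A y \<partial>distr (P x) S (X 1))"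
    by (rule nn_integral_restrict_space[OF sp])
  also have "\<dots> = (\<integral>\<^sup>+\<omega>. f (X 1 \<omega>) * indicator A (X 1 \<omega>) \<partial>P x)"
    using measurable_extend[OF A f] x X_measurable[of 1]
    by (intro nn_integral_distr) (auto simp: measurable_P)
  finally show ?thesis .
qed

lemma positive_killed_kernel:
  assumes A: "A \<in> sets S"
  shows "positive_kernel (restrict_space S A) (killed_kernel S P X A s)"
proof
  fix x assume "x \<in> space (restrict_space S A)"
  show "sets (killed_kernel S P X A s x) = sets (restrict_space S A)"
    unfolding killed_kernel_def by (simp cong: sets_restrict_space_cong)
next
  fix f :: "'a \<Rightarrow> ennreal" assume f: "f \<in> borel_measurable (restrict_space S A)"
  note X_measurable[measurable] measurable_extend[OF A f, measurable]
  have "(\<lambda>x. s * (\<integral>\<^sup>+\<omega>. f (X 1 \<omega>) * indicator A (X 1 \<omega>) \<partial>P x)) \<in> borel_measurable S"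
    by (intro borel_measurable_times_ennreal measurable_expectation measurable_compose[OF X_measurable measurable_extend[OF A f]]) auto
  then have "(\<lambda>x. s * (\<integral>\<^sup>+\<omega>. f (X 1 \<omega>) * indicator A (X 1 \<omega>) \<partial>P x)) \<in> borel_measurable (restrict_space S A)"
    by (rule measurable_restrict_space1)
  then show "kernel_op (killed_kernel S P X A s) f \<in> borel_measurable (restrict_space S A)"
    by (rule iffD1[OF measurable_cong, rotated]) (auto simp: space_restrict_space kernel_op_killed[OF A _ f])
qed

text \<open>
  For an indicator \<open>g\<close> this is the defining property of the conditional expectation; the general case
  follows by linearity and monotone convergence.
\<close>

lemma markov_nn_integral:
  assumes x: "x \<in> space S" and F: "F \<in> sets (natural_filtration S \<Omega> X n)" and g: "g \<in> borel_measurable S"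
  shows "(\<integral>\<^sup>+\<omega>. g (X (Suc n) \<omega>) * indicator F \<omega> \<partial>P x) =
    (\<integral>\<^sup>+\<omega>. (\<integral>\<^sup>+\<omega>'. g (X 1 \<omega>') \<partial>P (X n \<omega>)) * indicator F \<omega> \<partial>P x)"
proof -
  interpret Px: prob_space "P x" by (rule P_space(1)[OF x])
  have sp: "space (P x) = space \<Omega>" and se: "sets (P x) = sets \<Omega>" using P_space[OF x] by auto
  note X_measurable[measurable] se[measurable_cong]
  let ?G = "{X i -` B \<inter> space \<Omega> | i B. i \<le> n \<and> B \<in> sets S}"
  have gen: "(\<Union>i\<le>n. {X i -` B \<inter> space \<Omega> | B. B \<in> sets S}) = ?G" by auto
  have sub: "?G \<subseteq> sets \<Omega>" using measurable_sets[OF X_measurable] by auto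
  have fsp: "space (natural_filtration S \<Omega> X n) = space \<Omega>"
    unfolding natural_filtration_def gen by (rule space_measure_of) auto
  have fse: "sets (natural_filtration S \<Omega> X n) \<subseteq> sets \<Omega>"
    unfolding natural_filtration_def gen by (subst sets_measure_of) (use sub in \<open>auto intro!: sets.sigma_sets_subset\<close>)
  have subalg: "subalgebra (P x) (natural_filtration S \<Omega> X n)"
    unfolding subalgebra_def using fsp fse sp se by auto
  interpret fs: finite_measure_subalgebra "P x" "natural_filtration S \<Omega> X n"
    by (intro finite_measure_subalgebra.intro finite_measure_subalgebra_axioms.intro subalg Px.finite_measure_axioms)
  have F' [measurable]: "F \<in> sets \<Omega>" using F fse by auto
  have kernel [measurable]: "(\<lambda>\<omega>. \<integral>\<^sup>+\<omega>'. u (X 1 \<omega>') \<partial>P (X n \<omega>)) \<in> borel_measurable (P x)"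
    if [measurable]: "u \<in> borel_measurable S" for u
    using measurable_compose[OF X_measurable[of n] measurable_expectation[of "\<lambda>\<omega>'. u (X 1 \<omega>')"]]
    by (simp add: measurable_P[OF x])
  show ?thesis
    using g
  proof (induction rule: borel_measurable_induct)
    case (cong f g)
    have "(\<integral>\<^sup>+\<omega>. f (X (Suc n) \<omega>) * indicator F \<omega> \<partial>P x) = (\<integral>\<^sup>+\<omega>. g (X (Suc n) \<omega>) * indicator F \<omega> \<partial>P x)"
      using cong by (intro nn_integral_cong) (auto simp: sp X_space)
    moreover have "(\<integral>\<^sup>+\<omega>'. f (X 1 \<omega>') \<partial>P y) = (\<integral>\<^sup>+\<omega>'. g (X 1 \<omega>') \<partial>P y)" if "y \<in> space S" for y
      using cong that by (intro nn_integral_cong) (auto simp: P_space X_space)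
    then have "(\<integral>\<^sup>+\<omega>. (\<integral>\<^sup>+\<omega>'. f (X 1 \<omega>') \<partial>P (X n \<omega>)) * indicator F \<omega> \<partial>P x)
      = (\<integral>\<^sup>+\<omega>. (\<integral>\<^sup>+\<omega>'. g (X 1 \<omega>') \<partial>P (X n \<omega>)) * indicator F \<omega> \<partial>P x)"
      by (intro nn_integral_cong) (auto simp: sp X_space)
    ultimately show ?case using cong by simp
  next
    case (set B)
    note set[measurable]
    have int: "integrable (P x) (\<lambda>\<omega>. indicator B (X (Suc n) \<omega>) :: real)"
      by (intro Px.integrable_const_bound[where B=1]) (auto simp: indicator_def)
    have one: "(\<integral>\<^sup>+\<omega>'. indicator B (X 1 \<omega>') \<partial>P y) = ennreal (\<P>(\<omega>' in P y. X 1 \<omega>' \<in> B))" if y: "y \<in> space S" for y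
    proof -
      interpret Py: prob_space "P y" by (rule P_space(1)[OF y])
      have "(\<integral>\<^sup>+\<omega>'. indicator B (X 1 \<omega>') \<partial>P y) = (\<integral>\<^sup>+\<omega>'. indicator {\<omega>' \<in> space (P y). X 1 \<omega>' \<in> B} \<omega>' \<partial>P y)"
        by (intro nn_integral_cong) (auto simp: indicator_def)
      also have "\<dots> = emeasure (P y) {\<omega>' \<in> space (P y). X 1 \<omega>' \<in> B}"
        using P_space[OF y] by (intro nn_integral_indicator) (simp, measurable)
      finally show ?thesis by (simp add: Py.emeasure_eq_measure)
    qed
    have prob_meas: "(\<lambda>\<omega>. \<P>(\<omega>' in P (X n \<omega>). X 1 \<omega>' \<in> B)) \<in> borel_measurable (P x)"
    proof -
      have "(\<lambda>\<omega>. enn2real (\<integral>\<^sup>+\<omega>'. indicator B (X 1 \<omega>') \<partial>P (X n \<omega>))) \<in> borel_measurable (P x)"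
        by (intro borel_measurable_enn2real kernel borel_measurable_indicator set)
      then show ?thesis
        by (rule iffD1[OF measurable_cong, rotated]) (simp add: sp X_space one del: One_nat_def)
    qed
    have "(\<integral>\<^sup>+\<omega>. indicator B (X (Suc n) \<omega>) * indicator F \<omega> \<partial>P x)
        = (\<integral>\<^sup>+\<omega>. ennreal (indicator F \<omega> * indicator B (X (Suc n) \<omega>)) \<partial>P x)"
      by (intro nn_integral_cong) (auto simp: indicator_def)
    also have "\<dots> = ennreal (\<integral>\<omega>. indicator F \<omega> * indicator B (X (Suc n) \<omega>) \<partial>P x)"
      by (intro nn_integral_eq_integral Px.integrable_const_bound[where B=1]) (auto simp: indicator_def)
    also have "(\<integral>\<omega>. indicator F \<omega> * indicator B (X (Suc n) \<omega>) \<partial>P x) =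
        (\<integral>\<omega>. indicator F \<omega> * real_cond_exp (P x) (natural_filtration S \<Omega> X n) (\<lambda>\<omega>. indicator B (X (Suc n) \<omega>)) \<omega> \<partial>P x)"
      using fs.real_cond_exp_intA[OF int F] by (simp add: set_lebesgue_integral_def)
    also have "\<dots> = (\<integral>\<omega>. indicator F \<omega> * \<P>(\<omega>' in P (X n \<omega>). X 1 \<omega>' \<in> B) \<partial>P x)"
    proof (rule integral_cong_AE)
      show "AE \<omega> in P x. indicator F \<omega> * real_cond_exp (P x) (natural_filtration S \<Omega> X n) (\<lambda>\<omega>. indicator B (X (Suc n) \<omega>)) \<omega>
          = indicator F \<omega> * \<P>(\<omega>' in P (X n \<omega>). X 1 \<omega>' \<in> B)"
        using markov[OF x set, of n] by eventually_elim simp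
    qed (use F' prob_meas in \<open>auto intro!: borel_measurable_times simp: measurable_P[OF x]\<close>)
    also have "ennreal \<dots> = (\<integral>\<^sup>+\<omega>. ennreal (indicator F \<omega> * \<P>(\<omega>' in P (X n \<omega>). X 1 \<omega>' \<in> B)) \<partial>P x)"
    proof (rule nn_integral_eq_integral[symmetric])
      show "integrable (P x) (\<lambda>\<omega>. indicator F \<omega> * \<P>(\<omega>' in P (X n \<omega>). X 1 \<omega>' \<in> B))"
        using prob_meas P_space(1) F'
        by (intro Px.integrable_const_bound[where B=1] AE_I2 borel_measurable_times)
          (auto simp: indicator_def sp X_space intro: prob_space.prob_le_1)
    qed (auto intro!: AE_I2)
    also have "\<dots> = (\<integral>\<^sup>+\<omega>. (\<integral>\<^sup>+\<omega>'. indicator B (X 1 \<omega>') \<partial>P (X n \<omega>)) * indicator F \<omega> \<partial>P x)"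
      using one by (intro nn_integral_cong) (auto simp: sp X_space indicator_def simp del: One_nat_def)
    finally show ?case .
  next
    case (mult u v)
    note mult(2)[measurable]
    have "(\<integral>\<^sup>+\<omega>'. v * u (X 1 \<omega>') \<partial>P y) = v * (\<integral>\<^sup>+\<omega>'. u (X 1 \<omega>') \<partial>P y)" if "y \<in> space S" for y
      using that by (intro nn_integral_cmult) (simp add: measurable_P)
    then have "(\<integral>\<^sup>+\<omega>. (\<integral>\<^sup>+\<omega>'. v * u (X 1 \<omega>') \<partial>P (X n \<omega>)) * indicator F \<omega> \<partial>P x)
      = (\<integral>\<^sup>+\<omega>. v * ((\<integral>\<^sup>+\<omega>'. u (X 1 \<omega>') \<partial>P (X n \<omega>)) * indicator F \<omega>) \<partial>P x)"
      by (intro nn_integral_cong) (auto simp: sp X_space mult.assoc)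
    then show ?case using mult.IH kernel[OF mult(2)] by (simp add: nn_integral_cmult mult.assoc)
  next
    case (add u v)
    have uv [measurable]: "u \<in> borel_measurable S" "v \<in> borel_measurable S" using add by auto
    have "(\<integral>\<^sup>+\<omega>'. v (X 1 \<omega>') + u (X 1 \<omega>') \<partial>P y) = (\<integral>\<^sup>+\<omega>'. v (X 1 \<omega>') \<partial>P y) + (\<integral>\<^sup>+\<omega>'. u (X 1 \<omega>') \<partial>P y)"
      if "y \<in> space S" for y
      using that by (intro nn_integral_add) (simp_all add: measurable_P)
    then have "(\<integral>\<^sup>+\<omega>. (\<integral>\<^sup>+\<omega>'. v (X 1 \<omega>') + u (X 1 \<omega>') \<partial>P (X n \<omega>)) * indicator F \<omega> \<partial>P x)
      = (\<integral>\<^sup>+\<omega>. (\<integral>\<^sup>+\<omega>'. v (X 1 \<omega>') \<partial>P (X n \<omega>)) * indicator F \<omega> + (\<integral>\<^sup>+\<omega>'. u (X 1 \<omega>') \<partial>P (X n \<omega>)) * indicator F \<omega> \<partial>P x)"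
      by (intro nn_integral_cong) (auto simp: sp X_space distrib_right)
    then show ?case using add.IH kernel[OF uv(1)] kernel[OF uv(2)]
      by (simp add: nn_integral_add distrib_right)
  next
    case (seq U)
    note seq(1)[measurable]
    have inc: "U i y \<le> U (Suc i) y" for i y using seq by (simp add: incseq_Suc_iff le_fun_def)
    have "(\<integral>\<^sup>+\<omega>. (SUP i. U i (X (Suc n) \<omega>)) * indicator F \<omega> \<partial>P x)
        = (SUP i. \<integral>\<^sup>+\<omega>. U i (X (Suc n) \<omega>) * indicator F \<omega> \<partial>P x)"
      unfolding SUP_mult_right_ennreal
      by (intro nn_integral_monotone_convergence_SUP incseq_SucI le_funI mult_right_mono inc) auto
    also have "\<dots> = (SUP i. \<integral>\<^sup>+\<omega>. (\<integral>\<^sup>+\<omega>'. U i (X 1 \<omega>') \<partial>P (X n \<omega>)) * indicator F \<omega> \<partial>P x)"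
      using seq by simp
    also have "\<dots> = (\<integral>\<^sup>+\<omega>. (SUP i. \<integral>\<^sup>+\<omega>'. U i (X 1 \<omega>') \<partial>P (X n \<omega>)) * indicator F \<omega> \<partial>P x)"
      unfolding SUP_mult_right_ennreal
      by (intro nn_integral_monotone_convergence_SUP[symmetric] incseq_SucI le_funI mult_right_mono nn_integral_mono inc)
        (use kernel[OF seq(1)] in \<open>auto simp del: One_nat_def\<close>)
    also have "\<dots> = (\<integral>\<^sup>+\<omega>. (\<integral>\<^sup>+\<omega>'. (SUP i. U i (X 1 \<omega>')) \<partial>P (X n \<omega>)) * indicator F \<omega> \<partial>P x)"
      using inc
      by (intro nn_integral_cong arg_cong2[where f="(*)"] refl nn_integral_monotone_convergence_SUP[symmetric] incseq_SucI le_funI)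
        (auto simp: sp X_space measurable_P)
    finally show ?case by (simp add: SUP_apply[abs_def] image_comp)
  qed
qed

lemma stays_filtration:
  assumes "A \<in> sets S" shows "stays \<Omega> X A n \<in> sets (natural_filtration S \<Omega> X n)"
proof -
  have "(\<Inter>k\<in>{..n}. X k -` A \<inter> space \<Omega>) \<in> sets (natural_filtration S \<Omega> X n)"
    using assms unfolding natural_filtration_def by (intro sets.finite_INT) (auto intro!: in_measure_of)
  moreover have "(\<Inter>k\<in>{..n}. X k -` A \<inter> space \<Omega>) = stays \<Omega> X A n" by (auto simp: stays_def)
  ultimately show ?thesis by simp
qed

text \<open>
  This identity expresses all probabilities and expectations of the theorem as powers of kernels.
\<close>

lemma pow_killed:
  assumes A: "A \<in> sets S" and x: "x \<in> A" and f: "f \<in> borel_measurable (restrict_space S A)"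
  shows "(kernel_op (killed_kernel S P X A s) ^^ n) f x = s ^ n * (\<integral>\<^sup>+\<omega>. f (X n \<omega>) * indicator (stays \<Omega> X A n) \<omega> \<partial>P x)"
  using f
proof (induction n arbitrary: f)
  case 0
  have xS: "x \<in> space S" using sets.sets_into_space[OF A] x by auto
  have "(\<integral>\<^sup>+\<omega>. f (X 0 \<omega>) * indicator (stays \<Omega> X A 0) \<omega> \<partial>P x) = (\<integral>\<^sup>+\<omega>. f (X 0 \<omega>) * indicator A (X 0 \<omega>) \<partial>P x)"
    by (intro nn_integral_cong) (auto simp: stays_def indicator_def P_space[OF xS])
  also have "\<dots> = f x" using nn_integral_initial[OF xS measurable_extend[OF A 0]] x by simp
  finally show ?case by simp
next
  case (Suc n)
  have xS: "x \<in> space S" using sets.sets_into_space[OF A] x by auto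
  interpret positive_kernel "restrict_space S A" "killed_kernel S P X A s" by (rule positive_killed_kernel[OF A])
  note X_measurable[measurable]
  let ?g = "\<lambda>y. f y * indicator A y"
  have g: "?g \<in> borel_measurable S" by (rule measurable_extend[OF A Suc.prems])
  have gk: "(\<lambda>\<omega>. \<integral>\<^sup>+\<omega>'. ?g (X 1 \<omega>') \<partial>P (X n \<omega>)) \<in> borel_measurable (P x)"
    using measurable_compose[OF X_measurable[of n] measurable_expectation[of "\<lambda>\<omega>'. ?g (X 1 \<omega>')"]]
      measurable_compose[OF X_measurable[of 1] g]
    by (simp add: measurable_P[OF xS])
  have "(kernel_op (killed_kernel S P X A s) ^^ Suc n) f x = (R ^^ n) (R f) x" unfolding pow_Suc_right ..
  also have "\<dots> = s ^ n * (\<integral>\<^sup>+\<omega>. R f (X n \<omega>) * indicator (stays \<Omega> X A n) \<omega> \<partial>P x)"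
    by (rule Suc.IH[OF measurable_kernel_op[OF Suc.prems]])
  also have "(\<integral>\<^sup>+\<omega>. R f (X n \<omega>) * indicator (stays \<Omega> X A n) \<omega> \<partial>P x)
      = (\<integral>\<^sup>+\<omega>. s * ((\<integral>\<^sup>+\<omega>'. ?g (X 1 \<omega>') \<partial>P (X n \<omega>)) * indicator (stays \<Omega> X A n) \<omega>) \<partial>P x)"
    using P_space[OF xS]
    by (intro nn_integral_cong) (auto simp: X_space kernel_op_killed[OF A _ Suc.prems] mult.assoc)
  also have "\<dots> = s * (\<integral>\<^sup>+\<omega>. (\<integral>\<^sup>+\<omega>'. ?g (X 1 \<omega>') \<partial>P (X n \<omega>)) * indicator (stays \<Omega> X A n) \<omega> \<partial>P x)"
    using gk A by (intro nn_integral_cmult borel_measurable_times_ennreal) (auto simp: measurable_P[OF xS])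
  also have "(\<integral>\<^sup>+\<omega>. (\<integral>\<^sup>+\<omega>'. ?g (X 1 \<omega>') \<partial>P (X n \<omega>)) * indicator (stays \<Omega> X A n) \<omega> \<partial>P x)
      = (\<integral>\<^sup>+\<omega>. ?g (X (Suc n) \<omega>) * indicator (stays \<Omega> X A n) \<omega> \<partial>P x)"
    by (rule markov_nn_integral[OF xS stays_filtration[OF A] g, symmetric])
  also have "\<dots> = (\<integral>\<^sup>+\<omega>. f (X (Suc n) \<omega>) * indicator (stays \<Omega> X A (Suc n)) \<omega> \<partial>P x)"
    by (intro nn_integral_cong) (auto simp: stays_def indicator_def le_Suc_eq)
  finally show ?case by (simp add: mult_ac)
qed

end

section \<open>Killed processes and conditional laws\<close>

context absorbed_markov_process
begin

text \<open>
  \<open>Z\<close> is the process \<open>X\<close> killed when it leaves \<open>A\<close>, on the same probability space. For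
  \<open>Z = X\<close> and \<open>A = E\<close>, absorption at \<open>cem\<close> holds almost surely only, whence the last clause.
\<close>

definition killed_version :: "(nat \<Rightarrow> 'w \<Rightarrow> 'a) \<Rightarrow> 'a set \<Rightarrow> bool" where
  "killed_version Z A \<longleftrightarrow> A \<in> sets S \<and> cem \<notin> A \<and>
    (\<forall>n. Z n \<in> \<Omega> \<rightarrow>\<^sub>M S) \<and>
    (\<forall>\<omega>\<in>space \<Omega>. \<forall>n. Z n \<omega> \<in> A \<union> {cem} \<and> (\<omega> \<in> stays \<Omega> X A n \<longrightarrow> Z n \<omega> = X n \<omega>) \<and>
      (enat n < absorption_time Z cem \<omega> \<longleftrightarrow> \<omega> \<in> stays \<Omega> X A n)) \<and>
    (\<forall>x\<in>A. AE \<omega> in P x. \<forall>n. Z n \<omega> \<in> A \<longrightarrow> \<omega> \<in> stays \<Omega> X A n)"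

lemma killed_version_X: "killed_version X (space S - {cem})"
proof -
  have "AE \<omega> in P x. \<forall>n. X n \<omega> \<in> space S - {cem} \<longrightarrow> \<omega> \<in> stays \<Omega> X (space S - {cem}) n"
    if "x \<in> space S" for x
    using absorbed[OF that] AE_space
  proof eventually_elim
    case (elim \<omega>)
    then have \<omega>: "\<omega> \<in> space \<Omega>" using P_space[OF that] by simp
    show ?case
    proof (intro allI impI)
      fix n assume "X n \<omega> \<in> space S - {cem}"
      then have "enat n < absorption_time X cem \<omega>" using elim(1) by (auto simp: not_le[symmetric])
      then show "\<omega> \<in> stays \<Omega> X (space S - {cem}) n"
        using \<omega> X_space by (auto simp: less_hitting_time_iff stays_def)
    qed
  qed
  then show ?thesis
    unfolding killed_version_def using cem_measurable X_measurable X_space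
    by (auto simp: less_hitting_time_iff stays_def)
qed

lemma killed_version_killed_process:
  assumes B: "B \<in> sets S" "cem \<in> B"
  shows "killed_version (killed_process X cem B) (space S - B)"
proof -
  have iff: "enat n < hitting_time X B \<omega> \<longleftrightarrow> \<omega> \<in> stays \<Omega> X (space S - B) n" if "\<omega> \<in> space \<Omega>" for n \<omega>
    using that X_space by (auto simp: less_hitting_time_iff stays_def)
  have mono: "\<omega> \<in> stays \<Omega> X A n \<Longrightarrow> k \<le> n \<Longrightarrow> \<omega> \<in> stays \<Omega> X A k" for \<omega> A n k
    by (auto simp: stays_def)
  have cem: "cem \<in> space S" using sets.sets_into_space[OF cem_measurable] by auto
  have "killed_process X cem B n \<in> \<Omega> \<rightarrow>\<^sub>M S" for n
  proof -
    have "(\<lambda>\<omega>. if \<omega> \<in> stays \<Omega> X (space S - B) n then X n \<omega> else cem) \<in> \<Omega> \<rightarrow>\<^sub>M S"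
      using stays_sets[of "space S - B" n] B cem
      by (intro measurable_If_set X_measurable measurable_const) (auto intro: sets.Int sets.top)
    then show ?thesis
      by (rule iffD1[OF measurable_cong, rotated]) (simp add: killed_process_def iff)
  qed
  moreover have "enat n < absorption_time (killed_process X cem B) cem \<omega> \<longleftrightarrow> \<omega> \<in> stays \<Omega> X (space S - B) n"
    if "\<omega> \<in> space \<Omega>" for n \<omega>
  proof -
    have "enat n < absorption_time (killed_process X cem B) cem \<omega> \<longleftrightarrow> (\<forall>k\<le>n. \<omega> \<in> stays \<Omega> X (space S - B) k)"
      using that B(2) by (auto simp: less_hitting_time_iff[of n "killed_process X cem B"] killed_process_def iff stays_def)
    then show ?thesis using mono by blast
  qed
  moreover have "killed_process X cem B n \<omega> \<in> (space S - B) \<union> {cem}" if "\<omega> \<in> space \<Omega>" for n \<omega>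
    using that by (auto simp: killed_process_def iff stays_def)
  moreover have "\<omega> \<in> stays \<Omega> X (space S - B) n"
    if "\<omega> \<in> space \<Omega>" "killed_process X cem B n \<omega> \<in> space S - B" for n \<omega>
    using that B(2) by (auto simp: killed_process_def iff split: if_splits)
  moreover have "AE \<omega> in P x. \<forall>n. killed_process X cem B n \<omega> \<in> space S - B \<longrightarrow> \<omega> \<in> stays \<Omega> X (space S - B) n"
    if "x \<in> space S - B" for x
    using AE_space[of "P x"] P_space[of x] that calculation(4) by (auto elim!: eventually_mono)
  moreover have "\<omega> \<in> stays \<Omega> X (space S - B) n \<longrightarrow> killed_process X cem B n \<omega> = X n \<omega>"
    if "\<omega> \<in> space \<Omega>" for n \<omega>
    using that by (simp add: killed_process_def iff)
  moreover have "space S - B \<in> sets S" "cem \<notin> space S - B" using B by auto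
  ultimately show ?thesis
    unfolding killed_version_def by blast
qed

abbreviation (input) "RK s A \<equiv> kernel_op (killed_kernel S P X A s)"

lemma killed_versionD:
  assumes "killed_version Z A"
  shows "A \<in> sets S" "cem \<notin> A" "Z n \<in> \<Omega> \<rightarrow>\<^sub>M S" "\<omega> \<in> space \<Omega> \<Longrightarrow> Z n \<omega> \<in> A \<union> {cem}"
    "\<omega> \<in> stays \<Omega> X A n \<Longrightarrow> Z n \<omega> = X n \<omega>"
    "\<omega> \<in> space \<Omega> \<Longrightarrow> enat n < absorption_time Z cem \<omega> \<longleftrightarrow> \<omega> \<in> stays \<Omega> X A n"
    "x \<in> A \<Longrightarrow> AE \<omega> in P x. \<forall>n. Z n \<omega> \<in> A \<longrightarrow> \<omega> \<in> stays \<Omega> X A n"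
    "x \<in> A \<Longrightarrow> x \<in> space S" "\<omega> \<in> stays \<Omega> X A n \<Longrightarrow> X n \<omega> \<in> A"
proof -
  show "A \<in> sets S" using assms unfolding killed_version_def by blast
  then show "x \<in> A \<Longrightarrow> x \<in> space S" using sets.sets_into_space by auto
qed (use assms in \<open>auto simp: killed_version_def stays_def\<close>)

lemma pow_killed_1:
  assumes "A \<in> sets S" "x \<in> A" "f \<in> borel_measurable (restrict_space S A)"
  shows "(RK 1 A ^^ n) f x = (\<integral>\<^sup>+\<omega>. f (X n \<omega>) * indicator (stays \<Omega> X A n) \<omega> \<partial>P x)"
  using pow_killed[OF assms, where s=1 and n=n] by simp

lemma pow_killed_scale:
  assumes "A \<in> sets S" "x \<in> A" "f \<in> borel_measurable (restrict_space S A)"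
  shows "(RK s A ^^ n) f x = s ^ n * (RK 1 A ^^ n) f x"
  unfolding pow_killed_1[OF assms] by (rule pow_killed[OF assms])

lemma one_step_killed:
  assumes Z: "killed_version Z A" and x: "x \<in> A" and f: "f \<in> borel_measurable (restrict_space S A)"
  shows "one_step cem P Z f x = RK 1 A (\<lambda>y. ennreal (f y)) x"
proof -
  note D = killed_versionD[OF Z]
  have "RK 1 A (\<lambda>y. ennreal (f y)) x = (\<integral>\<^sup>+\<omega>. ennreal (f (X 1 \<omega>)) * indicator (stays \<Omega> X A 1) \<omega> \<partial>P x)"
    using pow_killed_1[OF D(1) x, of "\<lambda>y. ennreal (f y)" 1] f by simp
  also have "\<dots> = one_step cem P Z f x"
    unfolding one_step_def using D(5,6) P_space(3)[OF D(8)[OF x]]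
    by (intro nn_integral_cong) (auto simp: indicator_def one_enat_def)
  finally show ?thesis ..
qed

lemma survival_killed:
  assumes Z: "killed_version Z A" and x: "x \<in> A"
  shows "emeasure (P x) {\<omega> \<in> space (P x). enat n < absorption_time Z cem \<omega>} = (RK 1 A ^^ n) (\<lambda>_. 1) x"
proof -
  note D = killed_versionD[OF Z]
  have "{\<omega> \<in> space (P x). enat n < absorption_time Z cem \<omega>} = stays \<Omega> X A n"
    using D(6) P_space(3)[OF D(8)[OF x]] by (auto simp: stays_def)
  then show ?thesis
    using pow_killed_1[OF D(1) x, of "\<lambda>_. 1" n] stays_sets[OF D(1)] P_space(2)[OF D(8)[OF x]] by simp
qed

text \<open>
  An event \<open>Z n \<in> B\<close> with \<open>B \<subseteq> A\<close> excludes, up to a null set, that the path has left \<open>A\<close> before.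
\<close>

lemma prob_killed:
  assumes Z: "killed_version Z A" and x: "x \<in> A" and B: "B \<in> sets S" "B \<subseteq> A"
  shows "ennreal (\<P>(\<omega> in P x. Z n \<omega> \<in> B)) = (RK 1 A ^^ n) (indicator B) x"
proof -
  note D = killed_versionD[OF Z]
  have xS: "x \<in> space S" by (rule D(8)[OF x])
  interpret Px: prob_space "P x" by (rule P_space[OF xS])
  have meas: "{\<omega> \<in> space (P x). Z n \<omega> \<in> B} \<in> sets (P x)"
    using measurable_sets[OF D(3) B(1), of n] P_space[OF xS] by (simp add: vimage_def Int_def conj_commute)
  have "indicator B \<in> borel_measurable (restrict_space S A)"
    using B(1) by (intro measurable_restrict_space1) auto
  then have "(RK 1 A ^^ n) (indicator B) x = (\<integral>\<^sup>+\<omega>. indicator B (X n \<omega>) * indicator (stays \<Omega> X A n) \<omega> \<partial>P x)"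
    by (rule pow_killed_1[OF D(1) x])
  also have "\<dots> = (\<integral>\<^sup>+\<omega>. indicator {\<omega> \<in> space (P x). Z n \<omega> \<in> B} \<omega> \<partial>P x)"
    using D(7)[OF x] AE_space
    by (intro nn_integral_cong_AE, eventually_elim) (use B(2) D(5) in \<open>auto simp: indicator_def\<close>)
  also have "\<dots> = ennreal (\<P>(\<omega> in P x. Z n \<omega> \<in> B))"
    using meas by (simp add: Px.emeasure_eq_measure)
  finally show ?thesis ..
qed

lemma start_measure:
  assumes mu: "\<mu> \<in> space (prob_algebra (restrict_space S A))"
  shows "prob_space (\<mu> \<bind> P)" "sets (\<mu> \<bind> P) = sets \<Omega>" "space (\<mu> \<bind> P) = space \<Omega>"
    "f \<in> borel_measurable \<Omega> \<Longrightarrow> (\<integral>\<^sup>+\<omega>. f \<omega> \<partial>(\<mu> \<bind> P)) = (\<integral>\<^sup>+x. (\<integral>\<^sup>+\<omega>. f \<omega> \<partial>P x) \<partial>\<mu>)"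
proof -
  have mu': "sets \<mu> = sets (restrict_space S A)" "prob_space \<mu>" using mu by (auto simp: space_prob_algebra)
  have "P \<in> restrict_space S A \<rightarrow>\<^sub>M prob_algebra \<Omega>" using P_kernel by (rule measurable_restrict_space1)
  then have "P \<in> \<mu> \<rightarrow>\<^sub>M prob_algebra \<Omega>" using mu' by (simp cong: measurable_cong_sets)
  then have Ps: "P \<in> \<mu> \<rightarrow>\<^sub>M subprob_algebra \<Omega>" by (rule measurable_prob_algebraD)
  have PA: "P \<in> restrict_space S A \<rightarrow>\<^sub>M prob_algebra \<Omega>" using P_kernel by (rule measurable_restrict_space1)
  show "prob_space (\<mu> \<bind> P)" by (rule prob_space_bind'[OF mu PA])
  show "sets (\<mu> \<bind> P) = sets \<Omega>" by (rule sets_bind'[OF mu PA])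
  then show "space (\<mu> \<bind> P) = space \<Omega>" by (intro sets_eq_imp_space_eq)
  show "(\<integral>\<^sup>+\<omega>. f \<omega> \<partial>(\<mu> \<bind> P)) = (\<integral>\<^sup>+x. (\<integral>\<^sup>+\<omega>. f \<omega> \<partial>P x) \<partial>\<mu>)" if "f \<in> borel_measurable \<Omega>"
    using that Ps by (rule nn_integral_bind)
qed

lemma start_survival:
  assumes Z: "killed_version Z A" and mu: "\<mu> \<in> space (prob_algebra (restrict_space S A))"
  shows "emeasure (\<mu> \<bind> P) {\<omega> \<in> space (\<mu> \<bind> P). enat n < absorption_time Z cem \<omega>} = (\<integral>\<^sup>+x. (RK 1 A ^^ n) (\<lambda>_. 1) x \<partial>\<mu>)"
    and "\<P>(\<omega> in \<mu> \<bind> P. enat n < absorption_time Z cem \<omega>) = enn2real (\<integral>\<^sup>+x. (RK 1 A ^^ n) (\<lambda>_. 1) x \<partial>\<mu>)"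
proof -
  note D = killed_versionD[OF Z]
  have mu': "sets \<mu> = sets (restrict_space S A)" "prob_space \<mu>" using mu by (auto simp: space_prob_algebra)
  have sp: "space \<mu> = A" using sets_eq_imp_space_eq[OF mu'(1)] sets.sets_into_space[OF D(1)] by (auto simp: space_restrict_space)
  note st = start_measure[OF mu]
  have eq: "{\<omega> \<in> space (\<mu> \<bind> P). enat n < absorption_time Z cem \<omega>} = stays \<Omega> X A n"
    using D(6) st(3) by (auto simp: stays_def)
  have "emeasure (\<mu> \<bind> P) (stays \<Omega> X A n) = (\<integral>\<^sup>+\<omega>. indicator (stays \<Omega> X A n) \<omega> \<partial>(\<mu> \<bind> P))"
    using stays_sets[OF D(1)] st(2) by simp
  also have "\<dots> = (\<integral>\<^sup>+x. (\<integral>\<^sup>+\<omega>. indicator (stays \<Omega> X A n) \<omega> \<partial>P x) \<partial>\<mu>)"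
    using stays_sets[OF D(1)] by (intro st(4)) auto
  also have "\<dots> = (\<integral>\<^sup>+x. (RK 1 A ^^ n) (\<lambda>_. 1) x \<partial>\<mu>)"
    using pow_killed_1[OF D(1), of _ "\<lambda>_. 1" n] by (intro nn_integral_cong) (auto simp: sp)
  finally show *: "emeasure (\<mu> \<bind> P) {\<omega> \<in> space (\<mu> \<bind> P). enat n < absorption_time Z cem \<omega>} = (\<integral>\<^sup>+x. (RK 1 A ^^ n) (\<lambda>_. 1) x \<partial>\<mu>)"
    unfolding eq .
  then show "\<P>(\<omega> in \<mu> \<bind> P. enat n < absorption_time Z cem \<omega>) = enn2real (\<integral>\<^sup>+x. (RK 1 A ^^ n) (\<lambda>_. 1) x \<partial>\<mu>)"
    by (simp add: measure_def)
qed

lemma cond_law_killed: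
  assumes Z: "killed_version Z A" and mu: "\<mu> \<in> space (prob_algebra (restrict_space S A))"
    and S': "sets S' = sets (restrict_space S (A \<union> {cem}))"
  shows "sets (cond_law S' cem P Z \<mu> n) = sets (restrict_space S A)"
    and "f \<in> borel_measurable (restrict_space S A) \<Longrightarrow>
      (\<integral>\<^sup>+x. f x \<partial>cond_law S' cem P Z \<mu> n) = (\<integral>\<^sup>+x. (RK 1 A ^^ n) f x \<partial>\<mu>) / (\<integral>\<^sup>+x. (RK 1 A ^^ n) (\<lambda>_. 1) x \<partial>\<mu>)"
proof -
  note D = killed_versionD[OF Z]
  have mu': "sets \<mu> = sets (restrict_space S A)" "prob_space \<mu>" using mu by (auto simp: space_prob_algebra)
  have sp: "space \<mu> = A" using sets_eq_imp_space_eq[OF mu'(1)] sets.sets_into_space[OF D(1)] by (auto simp: space_restrict_space)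
  note st = start_measure[OF mu]
  have Ac: "A \<union> {cem} \<in> sets S" by (intro sets.Un D(1) cem_measurable)
  have spS': "space S' = A \<union> {cem}"
    using sets_eq_imp_space_eq[OF S'] sets.sets_into_space[OF Ac] by (auto simp: space_restrict_space)
  have diff: "space S' - {cem} = A" unfolding spS' using D(2) by auto
  have A': "A \<in> sets S'" unfolding S' using D(1) Ac by (auto simp: sets_restrict_space_iff)
  have ZS': "Z n \<in> \<Omega> \<rightarrow>\<^sub>M S'"
  proof -
    have "Z n \<in> \<Omega> \<rightarrow>\<^sub>M restrict_space S (A \<union> {cem})"
      using D(3,4) by (intro measurable_restrict_space2) auto
    then show ?thesis using S' by (simp cong: measurable_cong_sets)
  qed
  let ?B = "{\<omega> \<in> space (\<mu> \<bind> P). enat n < absorption_time Z cem \<omega>}"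
  have B: "?B = stays \<Omega> X A n" using D(6) st(3) by (auto simp: stays_def)
  let ?U = "uniform_measure (\<mu> \<bind> P) ?B"
  have cl: "cond_law S' cem P Z \<mu> n = restrict_space (distr ?U S' (Z n)) A"
    unfolding cond_law_def diff ..
  have "sets (restrict_space (distr ?U S' (Z n)) A) = sets (restrict_space S' A)"
    by (simp cong: sets_restrict_space_cong)
  also have "\<dots> = sets (restrict_space (restrict_space S (A \<union> {cem})) A)"
    by (rule sets_restrict_space_cong[OF S'])
  also have "\<dots> = sets (restrict_space S A)"
  proof -
    have "(A \<union> {cem}) \<inter> A = A" by auto
    then show ?thesis unfolding sets_restrict_restrict_space by simp
  qed
  finally show sets: "sets (cond_law S' cem P Z \<mu> n) = sets (restrict_space S A)" unfolding cl .
  assume f: "f \<in> borel_measurable (restrict_space S A)"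
  have ext: "(\<lambda>x. f x * indicator A x) \<in> borel_measurable S" by (rule measurable_extend[OF D(1) f])
  then have "(\<lambda>x. f x * indicator A x) \<in> borel_measurable (restrict_space S (A \<union> {cem}))"
    by (rule measurable_restrict_space1)
  then have ext': "(\<lambda>x. f x * indicator A x) \<in> borel_measurable S'" using S' by (simp cong: measurable_cong_sets)
  have "(\<integral>\<^sup>+x. f x \<partial>cond_law S' cem P Z \<mu> n) = (\<integral>\<^sup>+x. f x * indicator A x \<partial>distr ?U S' (Z n))"
    unfolding cl using A' by (intro nn_integral_restrict_space) (simp add: sets.Int_space_eq2)
  also have "\<dots> = (\<integral>\<^sup>+\<omega>. f (Z n \<omega>) * indicator A (Z n \<omega>) \<partial>?U)"
    using ext' ZS' st(2) by (intro nn_integral_distr) (simp_all cong: measurable_cong_sets)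
  also have "\<dots> = (\<integral>\<^sup>+\<omega>. f (Z n \<omega>) * indicator A (Z n \<omega>) * indicator ?B \<omega> \<partial>(\<mu> \<bind> P)) / emeasure (\<mu> \<bind> P) ?B"
    using measurable_compose[OF ZS' ext'] stays_sets[OF D(1), of n] st(2) unfolding B
    by (intro nn_integral_uniform_measure) (simp_all cong: measurable_cong_sets)
  also have "(\<integral>\<^sup>+\<omega>. f (Z n \<omega>) * indicator A (Z n \<omega>) * indicator ?B \<omega> \<partial>(\<mu> \<bind> P))
      = (\<integral>\<^sup>+\<omega>. (f (X n \<omega>) * indicator A (X n \<omega>)) * indicator (stays \<Omega> X A n) \<omega> \<partial>(\<mu> \<bind> P))"
    unfolding B using D(5) by (intro nn_integral_cong) (auto simp: indicator_def)
  also have "\<dots> = (\<integral>\<^sup>+x. (\<integral>\<^sup>+\<omega>. (f (X n \<omega>) * indicator A (X n \<omega>)) * indicator (stays \<Omega> X A n) \<omega> \<partial>P x) \<partial>\<mu>)"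
    by (rule st(4)[OF borel_measurable_times_ennreal[OF measurable_compose[OF X_measurable ext]
          borel_measurable_indicator[OF stays_sets[OF D(1)]]]])
  also have "\<dots> = (\<integral>\<^sup>+x. (RK 1 A ^^ n) f x \<partial>\<mu>)"
  proof (rule nn_integral_cong)
    fix x assume "x \<in> space \<mu>"
    then have "(RK 1 A ^^ n) f x = (\<integral>\<^sup>+\<omega>. f (X n \<omega>) * indicator (stays \<Omega> X A n) \<omega> \<partial>P x)"
      using pow_killed_1[OF D(1) _ f] sp by simp
    then show "(\<integral>\<^sup>+\<omega>. (f (X n \<omega>) * indicator A (X n \<omega>)) * indicator (stays \<Omega> X A n) \<omega> \<partial>P x) = (RK 1 A ^^ n) f x"
      using D(9) by (simp, intro nn_integral_cong) (auto simp: indicator_def)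
  qed
  finally show "(\<integral>\<^sup>+x. f x \<partial>cond_law S' cem P Z \<mu> n) = (\<integral>\<^sup>+x. (RK 1 A ^^ n) f x \<partial>\<mu>) / (\<integral>\<^sup>+x. (RK 1 A ^^ n) (\<lambda>_. 1) x \<partial>\<mu>)"
    unfolding start_survival(1)[OF Z mu] .
qed

end

section \<open>The process with three classes of states\<close>

locale reducible_process = absorbed_markov_process S cem \<Omega> P X
  for S :: "'a measure" and cem and \<Omega> :: "'w measure" and P X +
  fixes D1 D2 D3 K :: "'a set" and SY :: "'a measure" and Y :: "nat \<Rightarrow> 'w \<Rightarrow> 'a"
    and \<phi>1Y \<phi>2Y :: "'a \<Rightarrow> real" and \<theta>1Y \<theta>2Y \<theta>0 \<gamma> :: real and \<nu>Y :: "'a measure"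
  assumes partition: "reducible_partition S cem P X D1 D2 D3"
    and SY_eq: "SY = restrict_space S (D2 \<union> {cem})"
    and Y_eq: "Y = killed_process X cem (D1 \<union> D3 \<union> {cem})"
    and H1: "assumption_E SY cem P Y K \<phi>1Y \<phi>2Y \<theta>1Y \<theta>2Y"
    and qsd_Y: "is_qsd_for SY cem P Y \<phi>1Y \<phi>2Y \<nu>Y"
    and decay_Y: "is_decay_parameter cem P Y \<nu>Y \<theta>0"
    and H2: "hypothesis_H2 S cem P X D1 D2 D3 \<phi>1Y \<theta>0 \<gamma>"
begin

abbreviation (input) "E \<equiv> space S - {cem}"

lemma D_sets [measurable]: "D1 \<in> sets S" "D2 \<in> sets S" "D3 \<in> sets S"
  and D_disjoint: "D1 \<inter> D2 = {}" "D1 \<inter> D3 = {}" "D2 \<inter> D3 = {}"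
  and D_union: "D1 \<union> D2 \<union> D3 = E"
  and access_D2: "x \<in> D2 \<Longrightarrow> AE \<omega> in P x. min (hitting_time X D3 \<omega>) (absorption_time X cem \<omega>) < hitting_time X D1 \<omega>"
  and access_D3: "x \<in> D3 \<Longrightarrow> AE \<omega> in P x. absorption_time X cem \<omega> < hitting_time X (D1 \<union> D2) \<omega>"
  using partition unfolding reducible_partition_def by blast+

lemma E_sets [measurable]: "E \<in> sets S"
  using cem_measurable by auto

lemma D_space: "x \<in> D1 \<Longrightarrow> x \<in> space S" "x \<in> D2 \<Longrightarrow> x \<in> space S" "x \<in> D3 \<Longrightarrow> x \<in> space S"
  and D_E: "x \<in> D1 \<Longrightarrow> x \<in> E" "x \<in> D2 \<Longrightarrow> x \<in> E" "x \<in> D3 \<Longrightarrow> x \<in> E"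
  and D_notin: "x \<in> D2 \<Longrightarrow> x \<notin> D1" "x \<in> D3 \<Longrightarrow> x \<notin> D1" "x \<in> D3 \<Longrightarrow> x \<notin> D2"
  using D_union D_disjoint by auto

lemma killed_version_Y: "killed_version Y D2"
proof -
  have "space S - (D1 \<union> D3 \<union> {cem}) = D2" using D_union D_disjoint by auto
  moreover have "D1 \<union> D3 \<union> {cem} \<in> sets S" by (intro sets.Un D_sets cem_measurable)
  ultimately show ?thesis
    unfolding Y_eq using killed_version_killed_process[of "D1 \<union> D3 \<union> {cem}"] by simp
qed

lemma space_SY: "space SY - {cem} = D2" "space SY = D2 \<union> {cem}"
  unfolding SY_eq using D_union sets.sets_into_space[OF cem_measurable] by (auto simp: space_restrict_space)

lemma sets_live_SY: "sets (live_space SY cem) = sets (restrict_space S D2)"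
proof -
  have "(D2 \<union> {cem}) \<inter> D2 = D2" by auto
  then show ?thesis unfolding space_SY(1) unfolding SY_eq sets_restrict_restrict_space by simp
qed

lemma K_D2: "x \<in> K \<Longrightarrow> x \<in> D2" and K_sets [measurable]: "K \<in> sets S"
proof -
  have *: "K \<in> sets SY" "K \<subseteq> space SY - {cem}" using H1 unfolding assumption_E_def by auto
  then show "x \<in> K \<Longrightarrow> x \<in> D2" unfolding space_SY by auto
  have "D2 \<union> {cem} \<in> sets S" by (intro sets.Un D_sets cem_measurable)
  with *(1) show "K \<in> sets S" unfolding SY_eq by (simp add: sets_restrict_space_iff sets.Int_space_eq2)
qed

text \<open>
  Assumption (E) for \<open>Y\<close> in terms of powers of its kernel; \<open>i\<close> and \<open>v\<close> bound the two weights on \<open>K\<close>, and the ratio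
  in (E3) becomes an inequality between any two points of \<open>K\<close>.
\<close>

lemma H1E:
  obtains n1 c1 c2 c3 m v i where
    "0 < c1" "0 < c2" "0 < c3" "prob_space m" "sets m = sets (restrict_space S K)"
    "\<And>x B. x \<in> K \<Longrightarrow> B \<in> sets S \<Longrightarrow> B \<subseteq> D2 \<Longrightarrow> ennreal c1 * emeasure m (B \<inter> K) \<le> (RK 1 D2 ^^ n1) (indicator B) x"
    "\<And>x. x \<in> K \<Longrightarrow> \<phi>1Y x \<le> v" "0 < i" "\<And>x. x \<in> K \<Longrightarrow> i \<le> \<phi>2Y x"
    "\<And>x. x \<in> D2 \<Longrightarrow> 0 \<le> \<phi>2Y x \<and> \<phi>2Y x \<le> 1"
    "\<And>x. x \<in> D2 \<Longrightarrow> RK 1 D2 (\<lambda>y. ennreal (\<phi>1Y y)) x \<le> ennreal (\<theta>1Y * \<phi>1Y x + c2 * indicator K x)"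
    "\<And>x. x \<in> D2 \<Longrightarrow> ennreal (\<theta>2Y * \<phi>2Y x) \<le> RK 1 D2 (\<lambda>y. ennreal (\<phi>2Y y)) x"
    "\<And>x y n. x \<in> K \<Longrightarrow> y \<in> K \<Longrightarrow> (RK 1 D2 ^^ n) (\<lambda>_. 1) x \<le> ennreal c3 * (RK 1 D2 ^^ n) (\<lambda>_. 1) y"
    "\<And>x. x \<in> K \<Longrightarrow> \<exists>n4. \<forall>n\<ge>n4. 0 < (RK 1 D2 ^^ n) (indicator K) x"
    "\<phi>1Y \<in> borel_measurable (restrict_space S D2)" "\<phi>2Y \<in> borel_measurable (restrict_space S D2)"
    "0 < \<theta>1Y" "\<theta>1Y < \<theta>2Y" "\<And>x. x \<in> D2 \<Longrightarrow> 1 \<le> \<phi>1Y x" "K \<noteq> {}" "0 < n1"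
proof -
  from H1 have meas: "\<phi>1Y \<in> borel_measurable (restrict_space S D2)" "\<phi>2Y \<in> borel_measurable (restrict_space S D2)"
    unfolding assumption_E_def measurable_cong_sets[OF sets_live_SY refl] by auto
  have theta: "0 < \<theta>1Y" "\<theta>1Y < \<theta>2Y" using H1 unfolding assumption_E_def by auto
  from H1 obtain n1 c1 c2 c3 m where 0:
    "0 < n1 \<and> 0 < c1 \<and> 0 < c2 \<and> 0 < c3 \<and> m \<in> space (prob_algebra (restrict_space SY K)) \<and>
    (\<forall>x\<in>K. \<forall>A\<in>sets (live_space SY cem). c1 * measure m (A \<inter> K) \<le> \<P>(\<omega> in P x. Y n1 \<omega> \<in> A)) \<and>
    (\<forall>x\<in>space SY - {cem}. 1 \<le> \<phi>1Y x) \<and> bdd_above (\<phi>1Y ` K) \<and> 0 < (INF x\<in>K. \<phi>2Y x) \<and>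
    (\<forall>x\<in>space SY - {cem}. 0 \<le> \<phi>2Y x \<and> \<phi>2Y x \<le> 1) \<and>
    (\<forall>x\<in>space SY - {cem}. one_step cem P Y \<phi>1Y x \<le> ennreal (\<theta>1Y * \<phi>1Y x + c2 * indicator K x) \<and>
      ennreal (\<theta>2Y * \<phi>2Y x) \<le> one_step cem P Y \<phi>2Y x) \<and>
    (SUP n.
           (SUP y\<in>K. emeasure (P y) {\<omega> \<in> space (P y). enat n < absorption_time Y cem \<omega>}) /
           (INF y\<in>K. emeasure (P y) {\<omega> \<in> space (P y). enat n < absorption_time Y cem \<omega>}))
          \<le> ennreal c3 \<and>
    (\<forall>x\<in>K. \<exists>n4. \<forall>n\<ge>n4. 0 < \<P>(\<omega> in P x. Y n \<omega> \<in> K))"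
    unfolding assumption_E_def by (elim conjE exE) (rule that, intro conjI)
  then have n1: "0 < n1" by blast
  from 0 have *:
    "0 < c1" "0 < c2" "0 < c3" "m \<in> space (prob_algebra (restrict_space SY K))"
    "\<And>x A. x\<in>K \<Longrightarrow> A\<in>sets (live_space SY cem) \<Longrightarrow> c1 * measure m (A \<inter> K) \<le> \<P>(\<omega> in P x. Y n1 \<omega> \<in> A)"
    "\<And>x. x\<in>D2 \<Longrightarrow> 1 \<le> \<phi>1Y x" "bdd_above (\<phi>1Y ` K)" "0 < (INF x\<in>K. \<phi>2Y x)"
    "\<And>x. x\<in>D2 \<Longrightarrow> 0 \<le> \<phi>2Y x \<and> \<phi>2Y x \<le> 1"
    "\<And>x. x\<in>D2 \<Longrightarrow> one_step cem P Y \<phi>1Y x \<le> ennreal (\<theta>1Y * \<phi>1Y x + c2 * indicator K x)"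
    "\<And>x. x\<in>D2 \<Longrightarrow> ennreal (\<theta>2Y * \<phi>2Y x) \<le> one_step cem P Y \<phi>2Y x"
    "(SUP n.
           (SUP y\<in>K. emeasure (P y) {\<omega> \<in> space (P y). enat n < absorption_time Y cem \<omega>}) /
           (INF y\<in>K. emeasure (P y) {\<omega> \<in> space (P y). enat n < absorption_time Y cem \<omega>}))
          \<le> ennreal c3"
    "\<And>x. x\<in>K \<Longrightarrow> \<exists>n4. \<forall>n\<ge>n4. 0 < \<P>(\<omega> in P x. Y n \<omega> \<in> K)"
    unfolding space_SY(1) by (meson)+
  note KV = killed_version_Y
  have KD: "K \<subseteq> D2" using K_D2 by auto
  have "sets (restrict_space SY K) = sets (restrict_space S K)"
  proof -
    have "(D2 \<union> {cem}) \<inter> K = K" using KD by auto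
    then show ?thesis unfolding SY_eq sets_restrict_restrict_space by simp
  qed
  then have m: "prob_space m" "sets m = sets (restrict_space S K)"
    using *(4) by (auto simp: space_prob_algebra)
  interpret m: prob_space m by (rule m(1))
  have "space m = K" using sets_eq_imp_space_eq[OF m(2)] KD D_space by (auto simp: space_restrict_space)
  then have ne: "K \<noteq> {}" using m.not_empty by simp
  obtain v where v: "\<And>x. x \<in> K \<Longrightarrow> \<phi>1Y x \<le> v" using *(7) by (auto simp: bdd_above_def)
  have bdd: "bdd_below (\<phi>2Y ` K)" using *(9) KD by (auto intro!: bdd_belowI[where m=0])
  show thesis
  proof (rule that[of c1 c2 c3 m n1 v "INF x\<in>K. \<phi>2Y x"])
    fix x B assume x: "x \<in> K" and B: "B \<in> sets S" "B \<subseteq> D2"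
    have "B \<in> sets (live_space SY cem)" unfolding sets_live_SY using B by (simp add: sets_restrict_space_iff)
    then have "ennreal (c1 * measure m (B \<inter> K)) \<le> ennreal (\<P>(\<omega> in P x. Y n1 \<omega> \<in> B))"
      by (intro ennreal_leI *(5) x)
    then show "ennreal c1 * emeasure m (B \<inter> K) \<le> (RK 1 D2 ^^ n1) (indicator B) x"
      using prob_killed[OF KV K_D2[OF x] B, of n1] *(1) by (simp add: m.emeasure_eq_measure ennreal_mult')
  next
    fix x y n assume x: "x \<in> K" and y: "y \<in> K"
    let ?f = "\<lambda>y. (RK 1 D2 ^^ n) (\<lambda>_. 1) y"
    let ?S = "SUP y\<in>K. ?f y" and ?I = "INF y\<in>K. ?f y"
    have eq: "emeasure (P y) {\<omega> \<in> space (P y). enat n < absorption_time Y cem \<omega>} = ?f y" if "y \<in> K" for y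
      using survival_killed[OF KV K_D2[OF that], of n] .
    have le1: "?f y \<le> 1" if "y \<in> K" for y
      unfolding eq[OF that, symmetric] by (intro prob_space.emeasure_le_1 P_space D_space(2) K_D2 that)
    have "?S / ?I = (SUP y\<in>K. emeasure (P y) {\<omega> \<in> space (P y). enat n < absorption_time Y cem \<omega>}) /
           (INF y\<in>K. emeasure (P y) {\<omega> \<in> space (P y). enat n < absorption_time Y cem \<omega>})"
      using eq by (intro arg_cong2[where f="(/)"] SUP_cong INF_cong) auto
    also have "\<dots> \<le> ennreal c3" by (rule order_trans[OF SUP_upper *(12)]) simp
    finally have SI: "?S / ?I \<le> ennreal c3" .
    have "?I \<le> 1" by (rule order_trans[OF INF_lower[OF y, of ?f] le1[OF y]])
    then have I_fin: "?I < \<infinity>" by (rule le_less_trans) simp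
    have "?S \<le> ennreal c3 * ?I"
    proof (cases "?I = 0")
      case True
      then have "?S = 0" using SI by (cases "?S = 0") (auto simp: ennreal_divide_zero top_unique)
      then show ?thesis by simp
    next
      case False
      have "?S = ?S / ?I * ?I"
        using False I_fin by (simp add: ennreal_divide_times ennreal_mult_divide_eq less_top[symmetric])
      also have "\<dots> \<le> ennreal c3 * ?I" using SI by (intro mult_right_mono) auto
      finally show ?thesis .
    qed
    also have "\<dots> \<le> ennreal c3 * ?f y" using y by (intro mult_left_mono INF_lower) auto
    finally show "?f x \<le> ennreal c3 * ?f y" by (rule order_trans[OF SUP_upper[OF x]])
  next
    fix x assume x: "x \<in> K"
    obtain n4 where "\<And>n. n \<ge> n4 \<Longrightarrow> 0 < \<P>(\<omega> in P x. Y n \<omega> \<in> K)" using *(13)[OF x] by blast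
    then show "\<exists>n4. \<forall>n\<ge>n4. 0 < (RK 1 D2 ^^ n) (indicator K) x"
      unfolding prob_killed[OF KV K_D2[OF x] K_sets KD, symmetric] by (auto intro!: exI[of _ n4])
  next
    fix x assume x: "x \<in> D2"
    show "RK 1 D2 (\<lambda>y. ennreal (\<phi>1Y y)) x \<le> ennreal (\<theta>1Y * \<phi>1Y x + c2 * indicator K x)"
      using *(10)[OF x] one_step_killed[OF KV x meas(1)] by simp
    show "ennreal (\<theta>2Y * \<phi>2Y x) \<le> RK 1 D2 (\<lambda>y. ennreal (\<phi>2Y y)) x"
      using *(11)[OF x] one_step_killed[OF KV x meas(2)] by simp
  next
    fix x assume "x \<in> K"
    then show "(INF x\<in>K. \<phi>2Y x) \<le> \<phi>2Y x" by (intro cINF_lower bdd)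
  qed (use * n1 m v ne meas theta in auto)
qed

lemma theta0: "0 < \<theta>0" "\<theta>0 \<le> 1"
  using decay_Y unfolding is_decay_parameter_def by auto

lemma gamma: "0 < \<gamma>" "\<gamma> < \<theta>0" "\<gamma> < 1"
  using H2 theta0 unfolding hypothesis_H2_def by auto

text \<open>
  Conditioning at time \<open>1\<close> divides by \<open>\<theta>0\<close>, hence quasi-stationarity is invariance under the normalised kernel.
\<close>

lemma nuY: "\<nu>Y \<in> space (prob_algebra (restrict_space S D2))" "(\<integral>\<^sup>+x. ennreal (\<phi>1Y x) \<partial>\<nu>Y) < \<infinity>"
  "f \<in> borel_measurable (restrict_space S D2) \<Longrightarrow> (\<integral>\<^sup>+x. RK (ennreal (1 / \<theta>0)) D2 f x \<partial>\<nu>Y) = (\<integral>\<^sup>+x. f x \<partial>\<nu>Y)"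
proof -
  show mem: "\<nu>Y \<in> space (prob_algebra (restrict_space S D2))"
    using qsd_Y sets_live_SY unfolding is_qsd_for_def is_qsd_def by (auto simp: space_prob_algebra)
  show "(\<integral>\<^sup>+x. ennreal (\<phi>1Y x) \<partial>\<nu>Y) < \<infinity>" using qsd_Y unfolding is_qsd_for_def by simp
  assume f: "f \<in> borel_measurable (restrict_space S D2)"
  note KV = killed_version_Y
  interpret Y: positive_kernel "restrict_space S D2" "killed_kernel S P X D2 1"
    by (rule positive_killed_kernel[OF D_sets(2)])
  have sets_nu: "sets \<nu>Y = sets (restrict_space S D2)" using mem by (simp add: space_prob_algebra)
  have sp: "space \<nu>Y = D2" using sets_eq_imp_space_eq[OF sets_nu] D_space by (auto simp: space_restrict_space)
  have "cond_law SY cem P Y \<nu>Y 1 = \<nu>Y" using qsd_Y unfolding is_qsd_for_def is_qsd_def by blast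
  then have eq: "(\<integral>\<^sup>+x. f x \<partial>\<nu>Y) = (\<integral>\<^sup>+x. RK 1 D2 f x \<partial>\<nu>Y) / (\<integral>\<^sup>+x. RK 1 D2 (\<lambda>_. 1) x \<partial>\<nu>Y)"
    using cond_law_killed(2)[OF KV mem, of SY f 1] f SY_eq by simp
  have Z: "(\<integral>\<^sup>+x. RK 1 D2 (\<lambda>_. 1) x \<partial>\<nu>Y) = ennreal \<theta>0"
  proof -
    have "enn2real (\<integral>\<^sup>+x. RK 1 D2 (\<lambda>_. 1) x \<partial>\<nu>Y) = \<theta>0 ^ 1"
      using decay_Y start_survival(2)[OF KV mem, of 1] unfolding is_decay_parameter_def by simp
    then show ?thesis using theta0 enn2real_eq_posreal_iff by simp
  qed
  have "(\<integral>\<^sup>+x. RK 1 D2 f x \<partial>\<nu>Y) = ennreal \<theta>0 * (\<integral>\<^sup>+x. f x \<partial>\<nu>Y)"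
    unfolding eq Z ennreal_times_divide using theta0
    by (subst mult.commute, subst ennreal_mult_divide_eq) auto
  moreover have "(\<integral>\<^sup>+x. RK (ennreal (1 / \<theta>0)) D2 f x \<partial>\<nu>Y) = ennreal (1 / \<theta>0) * (\<integral>\<^sup>+x. RK 1 D2 f x \<partial>\<nu>Y)"
  proof -
    have "(\<integral>\<^sup>+x. RK (ennreal (1 / \<theta>0)) D2 f x \<partial>\<nu>Y) = (\<integral>\<^sup>+x. ennreal (1 / \<theta>0) * RK 1 D2 f x \<partial>\<nu>Y)"
      using pow_killed_scale[OF D_sets(2) _ f, where s="ennreal (1 / \<theta>0)" and n=1] by (intro nn_integral_cong) (simp add: sp)
    also have "\<dots> = ennreal (1 / \<theta>0) * (\<integral>\<^sup>+x. RK 1 D2 f x \<partial>\<nu>Y)"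
      using Y.measurable_kernel_op[OF f] sets_nu by (intro nn_integral_cmult) (simp cong: measurable_cong_sets)
    finally show ?thesis .
  qed
  ultimately show "(\<integral>\<^sup>+x. RK (ennreal (1 / \<theta>0)) D2 f x \<partial>\<nu>Y) = (\<integral>\<^sup>+x. f x \<partial>\<nu>Y)"
    using theta0 by (simp add: mult.assoc[symmetric] ennreal_mult[symmetric])
qed

lemma survival_Y:
  assumes "\<theta>1Y < \<theta>0"
  obtains a b where "0 < a" "0 < emeasure \<nu>Y K"
    "\<And>x n. x \<in> K \<Longrightarrow> ennreal a \<le> (RK (ennreal (1 / \<theta>0)) D2 ^^ n) (\<lambda>_. 1) x"
    "\<And>x n. x \<in> K \<Longrightarrow> (RK (ennreal (1 / \<theta>0)) D2 ^^ n) (\<lambda>_. 1) x \<le> ennreal b"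
proof -
  obtain n1 c1 c2 c3 m v i where Y:
    "0 < c2" "0 < c3" "\<And>x. x \<in> K \<Longrightarrow> \<phi>1Y x \<le> v" "0 < i" "\<And>x. x \<in> K \<Longrightarrow> i \<le> \<phi>2Y x"
    "\<And>x. x \<in> D2 \<Longrightarrow> 0 \<le> \<phi>2Y x \<and> \<phi>2Y x \<le> 1"
    "\<And>x. x \<in> D2 \<Longrightarrow> RK 1 D2 (\<lambda>y. ennreal (\<phi>1Y y)) x \<le> ennreal (\<theta>1Y * \<phi>1Y x + c2 * indicator K x)"
    "\<And>x. x \<in> D2 \<Longrightarrow> ennreal (\<theta>2Y * \<phi>2Y x) \<le> RK 1 D2 (\<lambda>y. ennreal (\<phi>2Y y)) x"
    "\<And>x y n. x \<in> K \<Longrightarrow> y \<in> K \<Longrightarrow> (RK 1 D2 ^^ n) (\<lambda>_. 1) x \<le> ennreal c3 * (RK 1 D2 ^^ n) (\<lambda>_. 1) y"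
    "\<phi>1Y \<in> borel_measurable (restrict_space S D2)" "\<phi>2Y \<in> borel_measurable (restrict_space S D2)"
    "0 < \<theta>1Y" "\<theta>1Y < \<theta>2Y" "\<And>x. x \<in> D2 \<Longrightarrow> 1 \<le> \<phi>1Y x" "K \<noteq> {}"
    by (rule H1E) blast
  let ?s = "ennreal (1 / \<theta>0)"
  interpret Y: positive_kernel "restrict_space S D2" "killed_kernel S P X D2 ?s"
    by (rule positive_killed_kernel[OF D_sets(2)])
  have sp: "space (restrict_space S D2) = D2" using D_space by (auto simp: space_restrict_space)
  have nu: "prob_space \<nu>Y" "sets \<nu>Y = sets (restrict_space S D2)" using nuY(1) by (auto simp: space_prob_algebra)
  have scale: "(RK ?s D2 ^^ n) f x = ?s ^ n * (RK 1 D2 ^^ n) f x" if "x \<in> D2" "f \<in> borel_measurable (restrict_space S D2)" for f x n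
    using pow_killed_scale[OF D_sets(2) that] .
  have scale1: "RK ?s D2 f x = ?s * RK 1 D2 f x" if "x \<in> D2" "f \<in> borel_measurable (restrict_space S D2)" for f x
    using scale[OF that, of 1] by simp
  show thesis
  proof (rule Y.mass_comparison[where K=K and \<phi>=\<phi>1Y and \<psi>=\<phi>2Y and v=v and i=i and \<rho>="\<theta>1Y / \<theta>0" and \<sigma>="\<theta>2Y / \<theta>0"
        and \<delta>="c2 / \<theta>0" and \<zeta>=c3 and \<nu>=\<nu>Y])
    show "K \<in> sets (restrict_space S D2)" using K_sets K_D2 by (auto simp: sets_restrict_space_iff)
    show "\<theta>1Y / \<theta>0 < \<theta>2Y / \<theta>0" using Y(13) theta0 by (simp add: divide_strict_right_mono)
    fix x assume "x \<in> space (restrict_space S D2)"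
    then have x: "x \<in> D2" unfolding sp .
    have "RK ?s D2 (\<lambda>y. ennreal (\<phi>1Y y)) x \<le> ?s * ennreal (\<theta>1Y * \<phi>1Y x + c2 * indicator K x)"
      using Y(7)[OF x] Y(10) x by (subst scale1) (auto intro!: mult_left_mono)
    also have "\<dots> = ennreal (1 / \<theta>0 * (\<theta>1Y * \<phi>1Y x + c2 * indicator K x))"
      using theta0 by (intro ennreal_mult'[symmetric]) auto
    also have "1 / \<theta>0 * (\<theta>1Y * \<phi>1Y x + c2 * indicator K x) = \<theta>1Y / \<theta>0 * \<phi>1Y x + c2 / \<theta>0 * indicator K x"
      by (simp add: distrib_left)
    finally show "RK ?s D2 (\<lambda>y. ennreal (\<phi>1Y y)) x \<le> ennreal (\<theta>1Y / \<theta>0 * \<phi>1Y x + c2 / \<theta>0 * indicator K x)" .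
    have "ennreal (\<theta>2Y / \<theta>0 * \<phi>2Y x) = ?s * ennreal (\<theta>2Y * \<phi>2Y x)"
      using theta0 by (subst ennreal_mult'[symmetric]) auto
    also have "\<dots> \<le> RK ?s D2 (\<lambda>y. ennreal (\<phi>2Y y)) x"
      using Y(8)[OF x] Y(11) x by (subst scale1) (auto intro!: mult_left_mono)
    finally show "ennreal (\<theta>2Y / \<theta>0 * \<phi>2Y x) \<le> RK ?s D2 (\<lambda>y. ennreal (\<phi>2Y y)) x" .
  next
    fix x y n assume x: "x \<in> K" and y: "y \<in> K"
    show "(RK ?s D2 ^^ n) (\<lambda>_. 1) x \<le> ennreal c3 * (RK ?s D2 ^^ n) (\<lambda>_. 1) y"
      using mult_left_mono[OF Y(9)[OF x y, of n], of "?s ^ n"] K_D2[OF x] K_D2[OF y]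
      by (simp add: scale mult_ac)
  next
    fix a b assume "0 < a" "0 < emeasure \<nu>Y K" "\<And>x n. x \<in> K \<Longrightarrow> ennreal a \<le> (RK ?s D2 ^^ n) (\<lambda>_. 1) x"
      "\<And>x n. x \<in> K \<Longrightarrow> (RK ?s D2 ^^ n) (\<lambda>_. 1) x \<le> ennreal b"
    then show thesis by (rule that)
  qed (use Y(1-6,10-15) theta0 assms nu nuY(2,3) in \<open>auto simp: sp\<close>)
qed

end

section \<open>Survival probabilities started from the small set\<close>

text \<open>
  A geometric sum stopped at \<open>t\<close>. It turns exponential moments into series of survival probabilities, which
  are powers of kernels; for \<open>t = \<infinity>\<close> both sides are infinite because \<open>g < 1\<close>.
\<close>

lemma inv_pow_series:
  assumes g: "0 < g" "g < 1"
  shows "inv_pow g t = 1 + ennreal (1 / g - 1) * (\<Sum>n. ennreal ((1 / g) ^ n) * indicator {n. enat n < t} n)"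
proof -
  have pos: "0 < 1 / g - 1" "1 < 1 / g" using g by auto
  have partial: "1 + ennreal (1 / g - 1) * (\<Sum>n<N. ennreal ((1 / g) ^ n)) = ennreal ((1 / g) ^ N)" for N
  proof -
    have "(1 / g - 1) * (\<Sum>n<N. (1 / g) ^ n) = (1 / g) ^ N - 1" by (rule power_diff_1_eq[symmetric])
    then have "1 + (1 / g - 1) * (\<Sum>n<N. (1 / g) ^ n) = (1 / g) ^ N" by simp
    moreover have "1 + ennreal (1 / g - 1) * (\<Sum>n<N. ennreal ((1 / g) ^ n)) = ennreal (1 + (1 / g - 1) * (\<Sum>n<N. (1 / g) ^ n))"
      using pos g by (simp add: sum_ennreal ennreal_plus ennreal_mult sum_nonneg flip: ennreal_1)
    ultimately show ?thesis by simp
  qed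
  show ?thesis
  proof (cases t)
    case (enat N)
    have "(\<Sum>n. ennreal ((1 / g) ^ n) * indicator {n. enat n < t} n) = (\<Sum>n<N. ennreal ((1 / g) ^ n) * indicator {n. enat n < t} n)"
      by (intro suminf_finite) (auto simp: enat)
    also have "\<dots> = (\<Sum>n<N. ennreal ((1 / g) ^ n))" by (intro sum.cong) (auto simp: enat)
    finally show ?thesis
      using partial[of N] g by (simp add: enat inv_pow_def power_int_minus power_one_over inverse_eq_divide)
  next
    case infinity
    have "ennreal (of_nat k) \<le> 1 + ennreal (1 / g - 1) * (\<Sum>n. ennreal ((1 / g) ^ n) * indicator {n. enat n < t} n)" for k :: nat
    proof -
      obtain N where "real k < (1 / g) ^ N" using real_arch_pow[OF pos(2)] by blast
      then have "ennreal (of_nat k) \<le> ennreal ((1 / g) ^ N)" by (intro ennreal_leI) simp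
      also have "\<dots> = 1 + ennreal (1 / g - 1) * (\<Sum>n<N. ennreal ((1 / g) ^ n) * indicator {n. enat n < t} n)"
        using partial[of N] by (simp add: infinity)
      also have "\<dots> \<le> 1 + ennreal (1 / g - 1) * (\<Sum>n. ennreal ((1 / g) ^ n) * indicator {n. enat n < t} n)"
        by (intro add_left_mono mult_left_mono sum_le_suminf) auto
      finally show ?thesis .
    qed
    note le = this
    have "1 + ennreal (1 / g - 1) * (\<Sum>n. ennreal ((1 / g) ^ n) * indicator {n. enat n < t} n) = \<infinity>"
    proof (rule ccontr)
      assume "\<not> ?thesis"
      then obtain k :: nat where "1 + ennreal (1 / g - 1) * (\<Sum>n. ennreal ((1 / g) ^ n) * indicator {n. enat n < t} n) < of_nat k"
        using ennreal_Ex_less_of_nat by (metis infinity_ennreal_def less_top)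
      then show False using le[of k] by (simp add: ennreal_of_nat_eq_real_of_nat)
    qed
    then show ?thesis by (simp add: infinity inv_pow_def)
  qed
qed

lemma inv_pow_mono_time: "0 < g \<Longrightarrow> g < 1 \<Longrightarrow> s \<le> t \<Longrightarrow> inv_pow g s \<le> inv_pow g t"
  unfolding inv_pow_series by (intro add_left_mono mult_left_mono suminf_le) (auto simp: indicator_def intro: less_le_trans)

lemma inv_pow_antimono_base: "0 < \<gamma> \<Longrightarrow> \<gamma> \<le> g \<Longrightarrow> inv_pow g t \<le> inv_pow \<gamma> t"
  by (cases t) (auto simp: inv_pow_def power_int_minus intro!: ennreal_leI le_imp_inverse_le power_mono)

lemma inv_pow_enat: "inv_pow g (enat n) = ennreal ((1 / g) ^ n)"
  by (simp add: inv_pow_def power_int_minus power_one_over inverse_eq_divide)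

context reducible_process
begin

lemma AE_start: "A \<in> sets S \<Longrightarrow> x \<in> A \<Longrightarrow> AE \<omega> in P x. X 0 \<omega> \<in> A"
proof -
  assume A: "A \<in> sets S" and x: "x \<in> A"
  have xS: "x \<in> space S" using sets.sets_into_space[OF A] x by auto
  have "AE y in distr (P x) S (X 0). y \<in> A"
    unfolding starts_at[OF xS] using A x xS by (subst AE_return) auto
  then show ?thesis
    using A X_measurable[of 0] by (subst (asm) AE_distr_iff) (auto simp: measurable_P[OF xS])
qed

text \<open>
  At time \<open>1\<close> the class \<open>D1\<close> could only be entered after a visit to \<open>D3\<close> or \<open>cem\<close>, hence at time \<open>0\<close>.
\<close>

lemma step_D2: "x \<in> D2 \<Longrightarrow> AE \<omega> in P x. X 1 \<omega> \<notin> D1"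
proof -
  assume x: "x \<in> D2"
  show ?thesis
    using access_D2[OF x] AE_start[OF D_sets(2) x]
  proof eventually_elim
    case (elim \<omega>)
    show ?case
    proof
      assume "X 1 \<omega> \<in> D1"
      then have "\<not> enat 1 < hitting_time X D1 \<omega>" unfolding less_hitting_time_iff by auto
      then have "\<not> enat 0 < min (hitting_time X D3 \<omega>) (absorption_time X cem \<omega>)"
        using elim(1) by (cases "min (hitting_time X D3 \<omega>) (absorption_time X cem \<omega>)"; cases "hitting_time X D1 \<omega>") auto
      then have "X 0 \<omega> \<in> D3 \<or> X 0 \<omega> = cem" unfolding min_less_iff_conj less_hitting_time_iff by auto
      then show False using elim(2) D_disjoint D_E by auto
    qed
  qed
qed

lemma step_D3: "x \<in> D3 \<Longrightarrow> AE \<omega> in P x. X 1 \<omega> \<notin> D1 \<union> D2"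
proof -
  assume x: "x \<in> D3"
  show ?thesis
    using access_D3[OF x] AE_start[OF D_sets(3) x]
  proof eventually_elim
    case (elim \<omega>)
    show ?case
    proof
      assume "X 1 \<omega> \<in> D1 \<union> D2"
      then have "\<not> enat 1 < hitting_time X (D1 \<union> D2) \<omega>" unfolding less_hitting_time_iff by auto
      then have "\<not> enat 0 < absorption_time X cem \<omega>"
        using elim(1) by (cases "absorption_time X cem \<omega>"; cases "hitting_time X (D1 \<union> D2) \<omega>") auto
      then have "X 0 \<omega> = cem" unfolding less_hitting_time_iff by auto
      then show False using elim(2) D_E by auto
    qed
  qed
qed

abbreviation (input) "step f A x \<equiv> (\<integral>\<^sup>+\<omega>. f (X 1 \<omega>) * indicator A (X 1 \<omega>) \<partial>P x)"

lemma RK_step: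
  "A \<in> sets S \<Longrightarrow> x \<in> space S \<Longrightarrow> f \<in> borel_measurable (restrict_space S A) \<Longrightarrow> RK s A f x = s * step f A x"
  by (rule kernel_op_killed)

lemma measurable_step:
  assumes A: "A \<in> sets S" and x: "x \<in> space S" and f: "f \<in> borel_measurable (restrict_space S A)"
  shows "(\<lambda>\<omega>. f (X 1 \<omega>) * indicator A (X 1 \<omega>) :: ennreal) \<in> borel_measurable (P x)"
  using measurable_compose[OF X_measurable[of 1] measurable_extend[OF A f]] by (simp only: measurable_P[OF x])

lemma measurable_sub:
  assumes "B \<subseteq> A" "B \<in> sets S" "f \<in> borel_measurable (restrict_space S A)"
  shows "f \<in> borel_measurable (restrict_space S B)"
proof -
  have "f \<in> borel_measurable (restrict_space (restrict_space S A) B)"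
    using assms(3) by (rule measurable_restrict_space1)
  moreover have "sets (restrict_space (restrict_space S A) B) = sets (restrict_space S B)"
    using assms(1) by (simp add: sets_restrict_restrict_space Int_absorb1)
  ultimately show ?thesis by (simp cong: measurable_cong_sets)
qed

lemma step_split:
  assumes x: "x \<in> space S" and f: "f \<in> borel_measurable (restrict_space S E)"
  shows "step f E x = step f D1 x + step f D2 x + step f D3 x"
proof -
  have m: "(\<lambda>\<omega>. f (X 1 \<omega>) * indicator D (X 1 \<omega>)) \<in> borel_measurable (P x)" if "D \<in> {D1, D2, D3}" for D
    using that D_E D_sets by (intro measurable_step x measurable_sub[OF _ _ f]) auto
  have "step f E x = (\<integral>\<^sup>+\<omega>. f (X 1 \<omega>) * indicator D1 (X 1 \<omega>) + f (X 1 \<omega>) * indicator D2 (X 1 \<omega>) + f (X 1 \<omega>) * indicator D3 (X 1 \<omega>) \<partial>P x)"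
    using D_union D_disjoint by (intro nn_integral_cong) (auto simp: indicator_def)
  also have "\<dots> = step f D1 x + step f D2 x + step f D3 x"
    using m by (subst nn_integral_add; (subst nn_integral_add)?) auto
  finally show ?thesis .
qed

lemma step_zero: "AE \<omega> in P x. X 1 \<omega> \<notin> A \<Longrightarrow> step f A x = 0"
proof -
  assume "AE \<omega> in P x. X 1 \<omega> \<notin> A"
  then have "step f A x = (\<integral>\<^sup>+\<omega>. 0 \<partial>P x)" by (intro nn_integral_cong_AE) (auto elim!: eventually_mono)
  then show ?thesis by simp
qed

lemma step_D2_D1: "x \<in> D2 \<Longrightarrow> step f D1 x = 0"
  by (intro step_zero step_D2)

lemma step_D3_D12: "x \<in> D3 \<Longrightarrow> step f D1 x = 0" "x \<in> D3 \<Longrightarrow> step f D2 x = 0"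
  by (intro step_zero eventually_mono[OF step_D3]; simp)+

lemma D3_moment:
  obtains M where "1 \<le> M" "\<And>x. x \<in> D3 \<Longrightarrow> (\<integral>\<^sup>+\<omega>. inv_pow \<gamma> (absorption_time X cem \<omega>) \<partial>P x) \<le> ennreal M"
proof -
  let ?S = "SUP x\<in>D3. \<integral>\<^sup>+\<omega>. inv_pow \<gamma> (absorption_time X cem \<omega>) \<partial>P x"
  have fin: "?S < \<infinity>" using H2 unfolding hypothesis_H2_def by blast
  have "(\<integral>\<^sup>+\<omega>. inv_pow \<gamma> (absorption_time X cem \<omega>) \<partial>P x) \<le> ennreal (max 1 (enn2real ?S))" if "x \<in> D3" for x
  proof -
    have "(\<integral>\<^sup>+\<omega>. inv_pow \<gamma> (absorption_time X cem \<omega>) \<partial>P x) \<le> ?S" using that by (intro SUP_upper)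
    also have "\<dots> = ennreal (enn2real ?S)" using fin by (intro ennreal_enn2real[symmetric]) simp
    also have "\<dots> \<le> ennreal (max 1 (enn2real ?S))" by (intro ennreal_leI) simp
    finally show ?thesis .
  qed
  then show thesis by (intro that[of "max 1 (enn2real ?S)"]) auto
qed

lemma D3_survival:
  assumes M: "1 \<le> M" "\<And>x. x \<in> D3 \<Longrightarrow> (\<integral>\<^sup>+\<omega>. inv_pow \<gamma> (absorption_time X cem \<omega>) \<partial>P x) \<le> ennreal M"
    and x: "x \<in> D3"
  shows "(RK 1 E ^^ n) (\<lambda>_. 1) x \<le> ennreal (M * \<gamma> ^ n)"
proof -
  have xS: "x \<in> space S" by (rule D_space(3)[OF x])
  have "ennreal ((1 / \<gamma>) ^ n) * (RK 1 E ^^ n) (\<lambda>_. 1) x = ennreal ((1 / \<gamma>) ^ n) * (\<integral>\<^sup>+\<omega>. indicator (stays \<Omega> X E n) \<omega> \<partial>P x)"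
    using pow_killed_1[OF E_sets D_E(3)[OF x], of "\<lambda>_. 1" n] by simp
  also have "\<dots> = (\<integral>\<^sup>+\<omega>. ennreal ((1 / \<gamma>) ^ n) * indicator (stays \<Omega> X E n) \<omega> \<partial>P x)"
    using stays_sets[OF E_sets, of n] P_space(2)[OF xS] by (intro nn_integral_cmult[symmetric]) auto
  also have "\<dots> \<le> (\<integral>\<^sup>+\<omega>. inv_pow \<gamma> (absorption_time X cem \<omega>) \<partial>P x)"
  proof (intro nn_integral_mono)
    fix \<omega> assume "\<omega> \<in> space (P x)"
    show "ennreal ((1 / \<gamma>) ^ n) * indicator (stays \<Omega> X E n) \<omega> \<le> inv_pow \<gamma> (absorption_time X cem \<omega>)"
    proof (cases "\<omega> \<in> stays \<Omega> X E n")
      case True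
      then have "enat n < absorption_time X cem \<omega>" by (auto simp: less_hitting_time_iff stays_def)
      then have "inv_pow \<gamma> (enat n) \<le> inv_pow \<gamma> (absorption_time X cem \<omega>)"
        using gamma by (intro inv_pow_mono_time) auto
      then show ?thesis using True by (simp add: inv_pow_enat)
    qed simp
  qed
  also have "\<dots> \<le> ennreal M" by (rule M(2)[OF x])
  finally have "ennreal (\<gamma> ^ n) * (ennreal ((1 / \<gamma>) ^ n) * (RK 1 E ^^ n) (\<lambda>_. 1) x) \<le> ennreal (\<gamma> ^ n) * ennreal M"
    by (intro mult_left_mono) auto
  then show ?thesis
    using gamma M(1) by (simp add: mult.assoc[symmetric] ennreal_mult[symmetric] power_mult_distrib[symmetric] mult.commute)
qed

lemma RK_D2_le_E:
  assumes f: "f \<in> borel_measurable (restrict_space S E)" and x: "x \<in> D2"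
  shows "(RK s D2 ^^ n) f x \<le> (RK s E ^^ n) f x"
proof -
  have f2: "f \<in> borel_measurable (restrict_space S D2)" using D_E D_sets by (intro measurable_sub[OF _ _ f]) auto
  show ?thesis
    unfolding pow_killed[OF D_sets(2) x f2] pow_killed[OF E_sets D_E(2)[OF x] f]
    using D_E by (intro mult_left_mono nn_integral_mono) (auto simp: indicator_def stays_def)
qed

text \<open>
  A path of \<open>X\<close> started from \<open>D2\<close> which survives until time \<open>n\<close> either stays in \<open>D2\<close>, or has entered
  \<open>D3\<close>, from where survival is exponentially less likely than survival of \<open>Y\<close>.
\<close>

lemma survival_from_D2:
  assumes M: "1 \<le> M" "\<And>x. x \<in> D3 \<Longrightarrow> (\<integral>\<^sup>+\<omega>. inv_pow \<gamma> (absorption_time X cem \<omega>) \<partial>P x) \<le> ennreal M"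
    and x: "x \<in> D2"
  shows "(RK 1 E ^^ n) (\<lambda>_. 1) x \<le> (RK 1 D2 ^^ n) (\<lambda>_. 1) x + (\<Sum>k<n. ennreal (M * \<gamma> ^ (n - 1 - k)) * (RK 1 D2 ^^ k) (\<lambda>_. 1) x)"
  using x
proof (induction n arbitrary: x)
  case 0
  then show ?case by simp
next
  case (Suc n)
  interpret E: positive_kernel "restrict_space S E" "killed_kernel S P X E 1" by (rule positive_killed_kernel[OF E_sets])
  interpret D: positive_kernel "restrict_space S D2" "killed_kernel S P X D2 1" by (rule positive_killed_kernel[OF D_sets(2)])
  have xS: "x \<in> space S" by (rule D_space(2)[OF Suc.prems])
  interpret Px: prob_space "P x" by (rule P_space[OF xS])
  have sp2: "space (restrict_space S D2) = D2" using D_space by (auto simp: space_restrict_space)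
  let ?u = "(RK 1 E ^^ n) (\<lambda>_. 1)"
  let ?v = "\<lambda>k. (RK 1 D2 ^^ k) (\<lambda>_. 1)"
  let ?z = "\<lambda>y. ?v n y + (\<Sum>k<n. ennreal (M * \<gamma> ^ (n - 1 - k)) * ?v k y)"
  have u: "?u \<in> borel_measurable (restrict_space S E)" by (intro E.pow_measurable) auto
  have u2: "?u \<in> borel_measurable (restrict_space S D2)" using D_E D_sets by (intro measurable_sub[OF _ _ u]) auto
  have v [measurable]: "?v k \<in> borel_measurable (restrict_space S D2)" for k by (intro D.pow_measurable) auto
  have "(RK 1 E ^^ Suc n) (\<lambda>_. 1) x = step ?u E x" using RK_step[OF E_sets xS u, of 1] by simp
  also have "step ?u E x = step ?u D2 x + step ?u D3 x"
    unfolding step_split[OF xS u] step_D2_D1[OF Suc.prems] by simp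
  finally have total: "(RK 1 E ^^ Suc n) (\<lambda>_. 1) x = step ?u D2 x + step ?u D3 x" .
  have "step ?u D2 x = RK 1 D2 ?u x" using RK_step[OF D_sets(2) xS u2, of 1] by simp
  also have "\<dots> \<le> RK 1 D2 ?z x" using Suc by (intro D.R_mono) (auto simp: sp2)
  also have "\<dots> = ?v (Suc n) x + (\<Sum>k<n. ennreal (M * \<gamma> ^ (n - 1 - k)) * ?v (Suc k) x)"
  proof -
    have xM: "x \<in> space (restrict_space S D2)" using Suc.prems sp2 by simp
    have "RK 1 D2 ?z x = RK 1 D2 (?v n) x + RK 1 D2 (\<lambda>y. \<Sum>k<n. ennreal (M * \<gamma> ^ (n - 1 - k)) * ?v k y) x"
      by (rule D.R_add[OF v _ xM]) measurable
    also have "RK 1 D2 (\<lambda>y. \<Sum>k<n. ennreal (M * \<gamma> ^ (n - 1 - k)) * ?v k y) x = (\<Sum>k<n. ennreal (M * \<gamma> ^ (n - 1 - k)) * RK 1 D2 (?v k) x)"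
      by (rule D.R_sum[OF v xM])
    finally show ?thesis by simp
  qed
  finally have inD2: "step ?u D2 x \<le> ?v (Suc n) x + (\<Sum>k<n. ennreal (M * \<gamma> ^ (n - 1 - k)) * ?v (Suc k) x)" .
  have "step ?u D3 x \<le> (\<integral>\<^sup>+\<omega>. ennreal (M * \<gamma> ^ n) \<partial>P x)"
    using D3_survival[OF M] by (intro nn_integral_mono) (auto simp: indicator_def)
  also have "\<dots> = ennreal (M * \<gamma> ^ n) * ?v 0 x" by (simp add: Px.emeasure_space_1)
  finally have "(RK 1 E ^^ Suc n) (\<lambda>_. 1) x \<le> ?v (Suc n) x + (\<Sum>k<n. ennreal (M * \<gamma> ^ (n - 1 - k)) * ?v (Suc k) x) + ennreal (M * \<gamma> ^ n) * ?v 0 x"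
    unfolding total by (intro add_mono inD2)
  also have "\<dots> = ?v (Suc n) x + (\<Sum>k<Suc n. ennreal (M * \<gamma> ^ (Suc n - 1 - k)) * ?v k x)"
    unfolding sum.lessThan_Suc_shift by (simp add: add_ac)
  finally show ?case .
qed

text \<open>
  The lower bound is inherited from \<open>Y\<close>. In the upper bound, the time spent in \<open>D3\<close> contributes a geometric
  series of ratio \<open>\<gamma> / \<theta>0 < 1\<close>.
\<close>

lemma survival_X:
  assumes "\<theta>1Y < \<theta>0"
  obtains a b where "0 < a" "0 < emeasure \<nu>Y K"
    "\<And>x n. x \<in> K \<Longrightarrow> ennreal a \<le> (RK (ennreal (1 / \<theta>0)) E ^^ n) (\<lambda>_. 1) x"
    "\<And>x n. x \<in> K \<Longrightarrow> (RK (ennreal (1 / \<theta>0)) E ^^ n) (\<lambda>_. 1) x \<le> ennreal b"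
proof -
  let ?s = "ennreal (1 / \<theta>0)"
  obtain a b where ab: "0 < a" "0 < emeasure \<nu>Y K"
    "\<And>x n. x \<in> K \<Longrightarrow> ennreal a \<le> (RK ?s D2 ^^ n) (\<lambda>_. 1) x"
    "\<And>x n. x \<in> K \<Longrightarrow> (RK ?s D2 ^^ n) (\<lambda>_. 1) x \<le> ennreal b"
    using survival_Y[OF assms] by metis
  obtain M where M: "1 \<le> M" "\<And>x. x \<in> D3 \<Longrightarrow> (\<integral>\<^sup>+\<omega>. inv_pow \<gamma> (absorption_time X cem \<omega>) \<partial>P x) \<le> ennreal M"
    using D3_moment by metis
  define b' where "b' = max 0 b"
  define r where "r = \<gamma> / \<theta>0"
  have r: "0 < r" "r < 1" using gamma theta0 by (auto simp: r_def)
  have b': "0 \<le> b'" unfolding b'_def by simp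
  have v: "(RK 1 D2 ^^ k) (\<lambda>_. 1) x \<le> ennreal (b' * \<theta>0 ^ k)" if x: "x \<in> K" for x k
  proof -
    have "?s ^ k * (RK 1 D2 ^^ k) (\<lambda>_. 1) x \<le> ennreal b'"
      using ab(4)[OF x, of k] pow_killed_scale[OF D_sets(2) K_D2[OF x], where f="\<lambda>_. 1" and s="?s" and n=k]
      by (auto simp: b'_def intro: order_trans ennreal_leI)
    then have "ennreal (\<theta>0 ^ k) * (?s ^ k * (RK 1 D2 ^^ k) (\<lambda>_. 1) x) \<le> ennreal (\<theta>0 ^ k) * ennreal b'"
      by (intro mult_left_mono) auto
    then show ?thesis
      using theta0 b' by (simp add: mult.assoc[symmetric] ennreal_mult[symmetric] ennreal_power power_mult_distrib[symmetric] mult.commute)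
  qed
  have upper: "(RK ?s E ^^ n) (\<lambda>_. 1) x \<le> ennreal (b' + M * b' / \<theta>0 / (1 - r))" if x: "x \<in> K" for x n
  proof -
    have "(RK ?s E ^^ n) (\<lambda>_. 1) x = ?s ^ n * (RK 1 E ^^ n) (\<lambda>_. 1) x"
      using pow_killed_scale[OF E_sets D_E(2)[OF K_D2[OF x]], where f="\<lambda>_. 1" and s="?s" and n=n] by simp
    also have "\<dots> \<le> ?s ^ n * (ennreal (b' * \<theta>0 ^ n) + (\<Sum>k<n. ennreal (M * \<gamma> ^ (n - 1 - k)) * ennreal (b' * \<theta>0 ^ k)))"
      using v[OF x] by (intro mult_left_mono order_trans[OF survival_from_D2[OF M K_D2[OF x]]] add_mono sum_mono) auto
    also have "\<dots> = ennreal ((1 / \<theta>0) ^ n * (b' * \<theta>0 ^ n + (\<Sum>k<n. M * \<gamma> ^ (n - 1 - k) * (b' * \<theta>0 ^ k))))"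
      using theta0 gamma M(1) b'
      by (simp add: ennreal_power ennreal_mult[symmetric] sum_ennreal ennreal_plus[symmetric] sum_nonneg del: ennreal_plus)
    also have "\<dots> \<le> ennreal (b' + M * b' / \<theta>0 / (1 - r))"
    proof (rule ennreal_leI)
      have "(1 / \<theta>0) ^ n * (M * \<gamma> ^ (n - 1 - k) * (b' * \<theta>0 ^ k)) = M * b' / \<theta>0 * r ^ (n - 1 - k)" if "k < n" for k
      proof -
        have "n = Suc (k + (n - 1 - k))" using that by simp
        then have "\<theta>0 ^ n = \<theta>0 * \<theta>0 ^ k * \<theta>0 ^ (n - 1 - k)" by (metis power_Suc power_add mult.assoc)
        then show ?thesis using theta0 by (simp add: r_def power_divide field_simps)
      qed
      then have "(1 / \<theta>0) ^ n * (\<Sum>k<n. M * \<gamma> ^ (n - 1 - k) * (b' * \<theta>0 ^ k)) = (\<Sum>k<n. M * b' / \<theta>0 * r ^ (n - 1 - k))"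
        unfolding sum_distrib_left by (intro sum.cong) auto
      also have "\<dots> = M * b' / \<theta>0 * (\<Sum>k<n. r ^ k)"
        unfolding sum_distrib_left[symmetric] by (subst sum.nat_diff_reindex[symmetric]) simp
      also have "\<dots> \<le> M * b' / \<theta>0 * (1 / (1 - r))"
        using r M(1) b' theta0 sum_le_suminf[of "\<lambda>k. r ^ k" "{..<n}"] suminf_geometric[of r] summable_geometric[of r]
        by (intro mult_left_mono) auto
      finally show "(1 / \<theta>0) ^ n * (b' * \<theta>0 ^ n + (\<Sum>k<n. M * \<gamma> ^ (n - 1 - k) * (b' * \<theta>0 ^ k))) \<le> b' + M * b' / \<theta>0 / (1 - r)"
        using theta0 by (simp add: distrib_left power_one_over)
    qed
    finally show ?thesis .
  qed
  have lower: "ennreal a \<le> (RK ?s E ^^ n) (\<lambda>_. 1) x" if "x \<in> K" for x n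
    using ab(3)[OF that, of n] RK_D2_le_E[OF _ K_D2[OF that], of "\<lambda>_. 1"] by (auto intro: order_trans)
  show thesis by (rule that[OF ab(1,2) lower upper])
qed

end

section \<open>The exponential weight\<close>

locale reducible_weight = reducible_process S cem \<Omega> P X D1 D2 D3 K SY Y \<phi>1Y \<phi>2Y \<theta>1Y \<theta>2Y \<theta>0 \<gamma> \<nu>Y
  for S :: "'a measure" and cem and \<Omega> :: "'w measure" and P X D1 D2 D3 K SY Y \<phi>1Y \<phi>2Y \<theta>1Y \<theta>2Y \<theta>0 \<gamma> \<nu>Y +
  fixes g :: real
  assumes g_bounds: "\<gamma> \<le> g" "\<theta>1Y < g" "g < \<theta>0"
begin

lemma g: "0 < g" "g < 1" "1 < 1 / g" "0 < 1 / g - 1"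
proof -
  show g: "0 < g" "g < 1" using gamma theta0 g_bounds by auto
  then show "1 < 1 / g" "0 < 1 / g - 1" by auto
qed

abbreviation (input) "B \<equiv> E - K"

lemma B_sets [measurable]: "B \<in> sets S"
  using E_sets K_sets by auto

definition weight :: "'a \<Rightarrow> ennreal" where
  "weight x = (\<integral>\<^sup>+\<omega>. inv_pow g (min (hitting_time X K \<omega>) (absorption_time X cem \<omega>)) \<partial>P x)"

text \<open>
  \<open>W\<close> is the expected discounted number of steps before \<open>K\<close> or \<open>cem\<close> is reached. It carries the same
  information as the weight, but is a series with nonnegative terms and partial sums \<open>GS\<close>, to which
  inductive bounds apply before finiteness is known.
\<close>

definition G :: "nat \<Rightarrow> 'a \<Rightarrow> ennreal" where
  "G n x = ennreal ((1 / g) ^ n) * (\<integral>\<^sup>+\<omega>. indicator (stays \<Omega> X B n) \<omega> \<partial>P x)"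

definition W :: "'a \<Rightarrow> ennreal" where
  "W x = (\<Sum>n. G n x)"

lemma G_measurable [measurable]: "G n \<in> borel_measurable S"
  unfolding G_def using stays_sets[OF B_sets, of n]
  by (intro borel_measurable_times_ennreal measurable_expectation) auto

lemma W_measurable [measurable]: "W \<in> borel_measurable S"
  unfolding W_def by measurable

lemma weight_eq: "x \<in> E \<Longrightarrow> weight x = 1 + ennreal (1 / g - 1) * W x"
proof -
  assume "x \<in> E"
  then have x: "x \<in> space S" by simp
  interpret Px: prob_space "P x" by (rule P_space[OF x])
  have m: "stays \<Omega> X B n \<in> sets (P x)" for n using stays_sets[OF B_sets] P_space(2)[OF x] by simp
  have "weight x = (\<integral>\<^sup>+\<omega>. 1 + ennreal (1 / g - 1) * (\<Sum>n. ennreal ((1 / g) ^ n) * indicator (stays \<Omega> X B n) \<omega>) \<partial>P x)"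
    unfolding weight_def
  proof (intro nn_integral_cong)
    fix \<omega> assume "\<omega> \<in> space (P x)"
    then have \<omega>: "\<omega> \<in> space \<Omega>" using P_space(3)[OF x] by simp
    have "indicator {n. enat n < min (hitting_time X K \<omega>) (absorption_time X cem \<omega>)} n = (indicator (stays \<Omega> X B n) \<omega> :: ennreal)" for n
      using \<omega> X_space by (auto simp: indicator_def less_hitting_time_iff stays_def)
    then show "inv_pow g (min (hitting_time X K \<omega>) (absorption_time X cem \<omega>)) =
        1 + ennreal (1 / g - 1) * (\<Sum>n. ennreal ((1 / g) ^ n) * indicator (stays \<Omega> X B n) \<omega>)"
      unfolding inv_pow_series[OF g(1,2)] by simp
  qed
  also have "\<dots> = 1 + ennreal (1 / g - 1) * (\<Sum>n. \<integral>\<^sup>+\<omega>. ennreal ((1 / g) ^ n) * indicator (stays \<Omega> X B n) \<omega> \<partial>P x)"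
    using m by (subst nn_integral_add) (auto simp: nn_integral_cmult nn_integral_suminf Px.emeasure_space_1)
  also have "\<dots> = 1 + ennreal (1 / g - 1) * W x"
    unfolding W_def G_def using m by (simp add: nn_integral_cmult)
  finally show ?thesis .
qed

lemma G_eq_pow: "x \<in> B \<Longrightarrow> G n x = (RK (ennreal (1 / g)) B ^^ n) (\<lambda>_. 1) x"
  unfolding G_def using g pow_killed[OF B_sets, where f="\<lambda>_. 1" and n=n and x=x and s="ennreal (1 / g)"]
  by (simp add: ennreal_power)

lemma G_K: "x \<in> K \<Longrightarrow> G n x = 0"
proof -
  assume x: "x \<in> K"
  have "AE \<omega> in P x. indicator (stays \<Omega> X B n) \<omega> = (0::ennreal)"
    using AE_start[OF K_sets x] by eventually_elim (auto simp: stays_def indicator_def)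
  then have "(\<integral>\<^sup>+\<omega>. indicator (stays \<Omega> X B n) \<omega> \<partial>P x) = (\<integral>\<^sup>+\<omega>. 0 \<partial>P x)" by (rule nn_integral_cong_AE)
  then show ?thesis by (simp add: G_def)
qed

lemma restrict_measurable: "f \<in> borel_measurable S \<Longrightarrow> f \<in> borel_measurable (restrict_space S A)"
  by (rule measurable_restrict_space1)

lemma G_Suc: "x \<in> B \<Longrightarrow> G (Suc n) x = ennreal (1 / g) * step (G n) B x"
proof -
  assume x: "x \<in> B"
  interpret R: positive_kernel "restrict_space S B" "killed_kernel S P X B (ennreal (1 / g))"
    by (rule positive_killed_kernel[OF B_sets])
  have "G (Suc n) x = RK (ennreal (1 / g)) B ((RK (ennreal (1 / g)) B ^^ n) (\<lambda>_. 1)) x"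
    using G_eq_pow[OF x, of "Suc n"] by simp
  also have "\<dots> = RK (ennreal (1 / g)) B (G n) x"
    using x by (intro R.R_cong) (auto simp: G_eq_pow space_restrict_space)
  also have "\<dots> = ennreal (1 / g) * step (G n) B x"
    using x by (intro RK_step restrict_measurable) auto
  finally show ?thesis .
qed

lemma step_mono_set:
  "(\<And>y. y \<in> A \<Longrightarrow> f y \<le> f' y) \<Longrightarrow> A \<subseteq> A' \<Longrightarrow> step f A x \<le> step f' A' x"
  by (intro nn_integral_mono) (auto simp: indicator_def)

lemma step_const: "x \<in> space S \<Longrightarrow> step (\<lambda>_. c) A x \<le> c"
proof -
  assume x: "x \<in> space S"
  interpret Px: prob_space "P x" by (rule P_space[OF x])
  have "step (\<lambda>_. c) A x \<le> (\<integral>\<^sup>+\<omega>. c \<partial>P x)" by (intro nn_integral_mono) (auto simp: indicator_def)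
  then show ?thesis by (simp add: Px.emeasure_space_1)
qed

definition GS :: "nat \<Rightarrow> 'a \<Rightarrow> ennreal" where
  "GS N x = (\<Sum>n<N. G n x)"

lemma GS_measurable [measurable]: "GS N \<in> borel_measurable S"
  unfolding GS_def by measurable

lemma W_eq_SUP: "W x = (SUP N. GS N x)"
  unfolding W_def GS_def by (rule suminf_eq_SUP)

lemma GS_K: "x \<in> K \<Longrightarrow> GS N x = 0"
  by (simp add: GS_def G_K)

lemma GS_Suc: "x \<in> B \<Longrightarrow> GS (Suc N) x = 1 + ennreal (1 / g) * step (GS N) B x"
proof -
  assume x: "x \<in> B"
  have "step (GS N) B x = (\<Sum>n<N. step (G n) B x)"
  proof -
    have "step (GS N) B x = (\<integral>\<^sup>+\<omega>. (\<Sum>n<N. G n (X 1 \<omega>) * indicator B (X 1 \<omega>)) \<partial>P x)"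
      unfolding GS_def by (simp add: sum_distrib_right)
    also have "\<dots> = (\<Sum>n<N. step (G n) B x)"
      using x by (intro nn_integral_sum measurable_step restrict_measurable) auto
    finally show ?thesis .
  qed
  then have "ennreal (1 / g) * step (GS N) B x = (\<Sum>n<N. G (Suc n) x)"
    using G_Suc[OF x] by (simp add: sum_distrib_left)
  moreover have "G 0 x = 1" using G_eq_pow[OF x, of 0] by simp
  ultimately show ?thesis unfolding GS_def sum.lessThan_Suc_shift by simp
qed

lemma W_step: "x \<in> B \<Longrightarrow> W x = 1 + ennreal (1 / g) * step W B x"
proof -
  assume x: "x \<in> B"
  have inc: "incseq (\<lambda>N. GS N y)" for y unfolding GS_def by (intro incseq_SucI) simp
  have "W x = (SUP N. GS (Suc N) x)"
    unfolding W_eq_SUP using incseq_SucD[OF inc[of x]]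
    by (intro antisym SUP_least) (blast intro: SUP_upper2 order_trans)+
  also have "\<dots> = 1 + ennreal (1 / g) * (SUP N. step (GS N) B x)"
    unfolding GS_Suc[OF x] by (simp add: ennreal_SUP_add_right SUP_mult_left_ennreal)
  also have "(SUP N. step (GS N) B x) = (\<integral>\<^sup>+\<omega>. (SUP N. GS N (X 1 \<omega>) * indicator B (X 1 \<omega>)) \<partial>P x)"
    using x inc
    by (intro nn_integral_monotone_convergence_SUP[symmetric] measurable_step restrict_measurable incseq_SucI le_funI mult_right_mono)
      (auto intro: incseq_SucD)
  also have "\<dots> = step W B x" unfolding W_eq_SUP by (simp add: SUP_mult_right_ennreal)
  finally show ?thesis .
qed

lemma weight_K: "x \<in> K \<Longrightarrow> weight x = 1"
  using K_D2 D_E by (subst weight_eq) (auto simp: W_def G_K)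

lemma weight_ge_1: "x \<in> E \<Longrightarrow> 1 \<le> weight x"
  by (simp add: weight_eq)

lemma weight_measurable: "weight \<in> borel_measurable (restrict_space S E)"
proof -
  have "(\<lambda>x. 1 + ennreal (1 / g - 1) * W x) \<in> borel_measurable (restrict_space S E)"
    by (intro restrict_measurable) measurable
  then show ?thesis by (rule iffD1[OF measurable_cong, rotated]) (simp add: weight_eq space_restrict_space)
qed

lemma step_weight:
  assumes x: "x \<in> space S"
  shows "step weight E x \<le> 1 + ennreal (1 / g - 1) * step W B x"
proof -
  have "step weight E x = (\<integral>\<^sup>+\<omega>. indicator E (X 1 \<omega>) + ennreal (1 / g - 1) * (W (X 1 \<omega>) * indicator B (X 1 \<omega>)) \<partial>P x)"
    by (intro nn_integral_cong) (auto simp: indicator_def weight_eq W_def G_K)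
  also have "\<dots> = step (\<lambda>_. 1) E x + ennreal (1 / g - 1) * step W B x"
    using measurable_step[OF E_sets x, of "\<lambda>_. 1"] measurable_step[OF B_sets x restrict_measurable[OF W_measurable]]
    by (simp add: nn_integral_add nn_integral_cmult)
  also have "\<dots> \<le> 1 + ennreal (1 / g - 1) * step W B x"
    by (intro add_right_mono step_const x)
  finally show ?thesis .
qed

text \<open>
  The recursion \<open>g W = g + step W\<close> of \<open>W_step\<close>, with the constant \<open>(1 / g - 1) g\<close> added on both sides to avoid the
  subtraction of possibly infinite quantities.
\<close>

lemma weight_drift_off_K:
  assumes x: "x \<in> B"
  shows "step weight E x \<le> ennreal g * weight x"
proof -
  have xS: "x \<in> space S" using x by simp
  have gW: "ennreal g * W x = ennreal g + step W B x"
    unfolding W_step[OF x] distrib_left using g by (simp add: mult.assoc[symmetric] ennreal_mult[symmetric])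
  have one: "ennreal g + ennreal (1 / g - 1) * ennreal g = 1"
    using g by (simp add: ennreal_mult[symmetric] ennreal_plus[symmetric] field_simps del: ennreal_plus)
  have "ennreal (1 / g - 1) * ennreal g + step weight E x \<le> 1 + ennreal (1 / g - 1) * (ennreal g + step W B x)"
    using step_weight[OF xS] by (simp add: distrib_left add.commute add.left_commute add_left_mono)
  also have "\<dots> = ennreal (1 / g - 1) * ennreal g + ennreal g * weight x"
    unfolding gW[symmetric] using x by (subst one[symmetric], subst weight_eq) (auto simp: distrib_left mult_ac add_ac)
  finally show ?thesis by (subst (asm) ennreal_add_left_cancel_le) (auto simp: ennreal_mult_eq_top_iff)
qed

lemma measurable_phi1Y: "(\<lambda>y. ennreal (\<phi>1Y y)) \<in> borel_measurable (restrict_space S D2)"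
proof -
  have "\<phi>1Y \<in> borel_measurable (restrict_space S D2)"
    using H1 unfolding assumption_E_def measurable_cong_sets[OF sets_live_SY refl] by (elim conjE)
  then show ?thesis by measurable
qed

text \<open>
  On \<open>D2\<close> the drift of \<open>\<phi>1Y\<close> at rate \<open>\<theta>1Y < g\<close> bounds the weight, the excursions to \<open>D3\<close> adding
  a constant.
\<close>

lemma GS_bounds:
  obtains A Mw where "0 < A" "0 < Mw" "\<And>x N. x \<in> D3 \<Longrightarrow> GS N x \<le> ennreal Mw"
    "\<And>x N. x \<in> D2 \<Longrightarrow> GS N x \<le> ennreal (A * \<phi>1Y x)"
proof -
  obtain M where M: "1 \<le> M" "\<And>x. x \<in> D3 \<Longrightarrow> (\<integral>\<^sup>+\<omega>. inv_pow \<gamma> (absorption_time X cem \<omega>) \<partial>P x) \<le> ennreal M"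
    using D3_moment by metis
  define Mw where "Mw = M / (1 / g - 1)"
  have Mw: "0 < Mw" using M(1) g by (auto simp: Mw_def)
  have GS_W: "GS N x \<le> W x" for N x unfolding W_eq_SUP by (intro SUP_upper) auto
  have D3: "GS N x \<le> ennreal Mw" if x: "x \<in> D3" for N x
  proof -
    have "ennreal (1 / g - 1) * W x \<le> weight x" using D_E(3)[OF x] by (simp add: weight_eq)
    also have "\<dots> \<le> (\<integral>\<^sup>+\<omega>. inv_pow \<gamma> (absorption_time X cem \<omega>) \<partial>P x)"
      unfolding weight_def using g gamma g_bounds
      by (intro nn_integral_mono order_trans[OF inv_pow_mono_time inv_pow_antimono_base]) auto
    also have "\<dots> \<le> ennreal M" by (rule M(2)[OF x])
    finally have "ennreal (1 / (1 / g - 1)) * (ennreal (1 / g - 1) * W x) \<le> ennreal (1 / (1 / g - 1)) * ennreal M"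
      by (intro mult_left_mono) auto
    moreover have "ennreal (1 / (1 / g - 1)) * (ennreal (1 / g - 1) * W x) = W x"
      using g by (simp add: mult.assoc[symmetric] ennreal_mult[symmetric])
    moreover have "ennreal (1 / (1 / g - 1)) * ennreal M = ennreal Mw"
      using g M(1) by (simp add: Mw_def ennreal_mult[symmetric])
    ultimately show ?thesis using GS_W[of N x] by simp
  qed
  obtain n1 c1 c2 c3 m v i where Y:
    "\<And>x. x \<in> D2 \<Longrightarrow> RK 1 D2 (\<lambda>y. ennreal (\<phi>1Y y)) x \<le> ennreal (\<theta>1Y * \<phi>1Y x + c2 * indicator K x)"
    "0 < \<theta>1Y" "\<And>x. x \<in> D2 \<Longrightarrow> 1 \<le> \<phi>1Y x"
    by (rule H1E) blast
  define A where "A = (1 + Mw / g) / (1 - \<theta>1Y / g)"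
  have quot: "0 < 1 - \<theta>1Y / g" using g g_bounds by simp
  have A: "0 < A" "1 + Mw / g + A * (\<theta>1Y / g) = A"
  proof -
    show "0 < A" unfolding A_def using quot Mw g by (intro divide_pos_pos add_pos_pos) auto
    have "A * (1 - \<theta>1Y / g) = 1 + Mw / g"
      unfolding A_def using quot by (metis less_irrefl nonzero_divide_eq_eq)
    then show "1 + Mw / g + A * (\<theta>1Y / g) = A" by (simp add: algebra_simps)
  qed
  have D2: "GS N x \<le> ennreal (A * \<phi>1Y x)" if "x \<in> D2" for N x
    using that
  proof (induction N arbitrary: x)
    case 0
    then show ?case by (simp add: GS_def)
  next
    case (Suc N)
    show ?case
    proof (cases "x \<in> K")
      case True
      then show ?thesis by (simp add: GS_K)
    next
      case False
      have xB: "x \<in> B" and xS: "x \<in> space S" using False D_E(2)[OF Suc.prems] by auto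
      have "step (GS N) B x \<le> step (GS N) E x" by (intro step_mono_set) auto
      also have "\<dots> = step (GS N) D2 x + step (GS N) D3 x"
        unfolding step_split[OF xS restrict_measurable[OF GS_measurable]] step_D2_D1[OF Suc.prems] by simp
      also have "\<dots> \<le> step (\<lambda>y. ennreal A * ennreal (\<phi>1Y y)) D2 x + step (\<lambda>_. ennreal Mw) D3 x"
        using Suc.IH D3 A(1) by (intro add_mono step_mono_set) (auto simp: ennreal_mult')
      also have "step (\<lambda>y. ennreal A * ennreal (\<phi>1Y y)) D2 x = ennreal A * RK 1 D2 (\<lambda>y. ennreal (\<phi>1Y y)) x"
        using measurable_step[OF D_sets(2) xS measurable_phi1Y] RK_step[OF D_sets(2) xS measurable_phi1Y, of 1]
        by (simp add: mult.assoc nn_integral_cmult)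
      also have "ennreal A * RK 1 D2 (\<lambda>y. ennreal (\<phi>1Y y)) x + step (\<lambda>_. ennreal Mw) D3 x \<le> ennreal A * ennreal (\<theta>1Y * \<phi>1Y x) + ennreal Mw"
        using Y(1)[OF Suc.prems] False by (intro add_mono mult_left_mono step_const xS) auto
      also have "\<dots> = ennreal (A * (\<theta>1Y * \<phi>1Y x) + Mw)"
        using A(1) Mw Y(2) Y(3)[OF Suc.prems] by (simp add: ennreal_mult ennreal_plus)
      finally have "GS (Suc N) x \<le> 1 + ennreal (1 / g) * ennreal (A * (\<theta>1Y * \<phi>1Y x) + Mw)"
        unfolding GS_Suc[OF xB] by (intro add_left_mono mult_left_mono) auto
      also have "\<dots> = ennreal (1 + 1 / g * (A * (\<theta>1Y * \<phi>1Y x) + Mw))"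
      proof -
        have nonneg: "0 \<le> A * (\<theta>1Y * \<phi>1Y x) + Mw" using A(1) Mw Y(2) Y(3)[OF Suc.prems] by simp
        have "ennreal (1 + 1 / g * (A * (\<theta>1Y * \<phi>1Y x) + Mw)) = ennreal 1 + ennreal (1 / g * (A * (\<theta>1Y * \<phi>1Y x) + Mw))"
          using nonneg g by (intro ennreal_plus mult_nonneg_nonneg) auto
        also have "ennreal (1 / g * (A * (\<theta>1Y * \<phi>1Y x) + Mw)) = ennreal (1 / g) * ennreal (A * (\<theta>1Y * \<phi>1Y x) + Mw)"
          using nonneg g by (intro ennreal_mult) auto
        finally show ?thesis by simp
      qed
      also have "\<dots> \<le> ennreal (A * \<phi>1Y x)"
      proof (rule ennreal_leI)
        have "1 + 1 / g * (A * (\<theta>1Y * \<phi>1Y x) + Mw) = (1 + Mw / g) * 1 + A * (\<theta>1Y / g) * \<phi>1Y x"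
          using g by (simp add: field_simps)
        also have "\<dots> \<le> (1 + Mw / g) * \<phi>1Y x + A * (\<theta>1Y / g) * \<phi>1Y x"
          using Y(3)[OF Suc.prems] Mw g by (intro add_right_mono mult_left_mono) auto
        also have "\<dots> = (1 + Mw / g + A * (\<theta>1Y / g)) * \<phi>1Y x" by (simp add: algebra_simps)
        finally show "1 + 1 / g * (A * (\<theta>1Y * \<phi>1Y x) + Mw) \<le> A * \<phi>1Y x" unfolding A(2) .
      qed
      finally show ?thesis .
    qed
  qed
  show thesis by (rule that[OF A(1) Mw D3 D2])
qed

text \<open>
  Along almost every path at most one term of each series is nonzero, that of the exit time from \<open>D1\<close>, and it
  equals the integrand of (H2). Unlike that integrand, the terms depend on finitely many coordinates, hence are
  measurable.
\<close>

lemma D1_exit_moment: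
  assumes x: "x \<in> D1"
  shows "(\<integral>\<^sup>+\<omega>. (\<Sum>N. ennreal ((1 / \<gamma>) ^ Suc N) * (ennreal (\<phi>1Y (X (Suc N) \<omega>)) * indicator D2 (X (Suc N) \<omega>)) * indicator (stays \<Omega> X D1 N) \<omega>) \<partial>P x) < \<infinity>"
    and "(\<integral>\<^sup>+\<omega>. (\<Sum>N. ennreal ((1 / \<gamma>) ^ Suc N) * indicator (D3 \<union> {cem}) (X (Suc N) \<omega>) * indicator (stays \<Omega> X D1 N) \<omega>) \<partial>P x) < \<infinity>"
    and "AE \<omega> in P x. \<exists>N. (\<forall>n. \<omega> \<in> stays \<Omega> X D1 n \<longleftrightarrow> n \<le> N) \<and> X (Suc N) \<omega> \<in> D2 \<union> (D3 \<union> {cem})"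
proof -
  have xS: "x \<in> space S" by (rule D_space(1)[OF x])
  have fin: "(\<integral>\<^sup>+\<omega>. inv_pow \<gamma> (hitting_time X D2 \<omega>) * ennreal (\<phi>1Y (X (the_enat (hitting_time X D2 \<omega>)) \<omega>))
              * indicator {\<omega>. hitting_time X D2 \<omega> < min (hitting_time X D3 \<omega>) (absorption_time X cem \<omega>)} \<omega> \<partial>P x) < \<infinity>"
    "(\<integral>\<^sup>+\<omega>. inv_pow \<gamma> (min (hitting_time X D3 \<omega>) (absorption_time X cem \<omega>))
              * indicator {\<omega>. min (hitting_time X D3 \<omega>) (absorption_time X cem \<omega>) < hitting_time X D2 \<omega>} \<omega> \<partial>P x) < \<infinity>"
    and exit: "AE \<omega> in P x. hitting_time X (space S - D1) \<omega> < \<infinity>"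
    using H2 x unfolding hypothesis_H2_def by auto
  have compl: "space S - D1 = D2 \<union> (D3 \<union> {cem})"
    using D_union D_disjoint sets.sets_into_space[OF cem_measurable] by auto
  show ex: "AE \<omega> in P x. \<exists>N. (\<forall>n. \<omega> \<in> stays \<Omega> X D1 n \<longleftrightarrow> n \<le> N) \<and> X (Suc N) \<omega> \<in> D2 \<union> (D3 \<union> {cem})"
    using exit AE_start[OF D_sets(1) x] AE_space
  proof eventually_elim
    case (elim \<omega>)
    have \<omega>: "\<omega> \<in> space \<Omega>" using elim(3) P_space(3)[OF xS] by simp
    obtain t where t: "hitting_time X (space S - D1) \<omega> = enat t" using elim(1) by auto
    then have *: "X t \<omega> \<in> space S - D1" "\<And>k. k < t \<Longrightarrow> X k \<omega> \<in> D1"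
      using X_space[OF \<omega>] unfolding hitting_time_eq_iff by auto
    obtain N where N: "t = Suc N" using * elim(2) by (cases t) auto
    have "\<omega> \<in> stays \<Omega> X D1 n \<longleftrightarrow> n \<le> N" for n
    proof
      assume "\<omega> \<in> stays \<Omega> X D1 n"
      then have "\<not> Suc N \<le> n" using *(1) unfolding N stays_def by auto
      then show "n \<le> N" by simp
    qed (use * \<omega> in \<open>auto simp: N stays_def\<close>)
    then show ?case using *(1) unfolding N compl by blast
  qed
  have single: "(\<Sum>k. f k :: ennreal) = f N" if "\<And>k. k \<noteq> N \<Longrightarrow> f k = 0" for f N
    using suminf_finite[of "{N}" f] that by simp
  let ?J1 = "\<lambda>N \<omega>. ennreal ((1 / \<gamma>) ^ Suc N) * (ennreal (\<phi>1Y (X (Suc N) \<omega>)) * indicator D2 (X (Suc N) \<omega>)) * indicator (stays \<Omega> X D1 N) \<omega>"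
  let ?J2 = "\<lambda>N \<omega>. ennreal ((1 / \<gamma>) ^ Suc N) * indicator (D3 \<union> {cem}) (X (Suc N) \<omega>) * indicator (stays \<Omega> X D1 N) \<omega>"
  have path: "(\<Sum>k. ?J1 k \<omega>) = ?J1 N \<omega>" "(\<Sum>k. ?J2 k \<omega>) = ?J2 N \<omega>"
    "\<And>A. X (Suc N) \<omega> \<in> A \<Longrightarrow> A \<inter> D1 = {} \<Longrightarrow> hitting_time X A \<omega> = enat (Suc N)"
    "\<And>A. X (Suc N) \<omega> \<notin> A \<Longrightarrow> A \<inter> D1 = {} \<Longrightarrow> enat (Suc N) < hitting_time X A \<omega>"
    if N: "\<forall>n. \<omega> \<in> stays \<Omega> X D1 n \<longleftrightarrow> n \<le> N" "X (Suc N) \<omega> \<in> D2 \<union> (D3 \<union> {cem})" for \<omega> N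
  proof -
    have in_D1: "X k \<omega> \<in> D1" if "k \<le> N" for k using N(1) that unfolding stays_def by auto
    have out: "X (Suc k) \<omega> \<notin> D2 \<and> X (Suc k) \<omega> \<notin> D3 \<union> {cem}" if "k < N" for k
      using in_D1[of "Suc k"] that D_disjoint D_E(1) by auto
    have zero: "\<omega> \<notin> stays \<Omega> X D1 k \<or> X (Suc k) \<omega> \<notin> D2 \<and> X (Suc k) \<omega> \<notin> D3 \<union> {cem}" if "k \<noteq> N" for k
      using that out[of k] N(1) by (cases "k < N") auto
    show "(\<Sum>k. ?J1 k \<omega>) = ?J1 N \<omega>" "(\<Sum>k. ?J2 k \<omega>) = ?J2 N \<omega>"
      by (rule single; use zero in \<open>fastforce simp: indicator_def\<close>)+
    show "hitting_time X A \<omega> = enat (Suc N)" if "X (Suc N) \<omega> \<in> A" "A \<inter> D1 = {}" for A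
      unfolding hitting_time_eq_iff using that in_D1 by (auto simp: less_Suc_eq_le)
    show "enat (Suc N) < hitting_time X A \<omega>" if "X (Suc N) \<omega> \<notin> A" "A \<inter> D1 = {}" for A
      unfolding less_hitting_time_iff using that in_D1 by (auto simp: le_Suc_eq)
  qed
  have cemD1: "{cem} \<inter> D1 = {}" using D_E(1) by auto
  have "(\<integral>\<^sup>+\<omega>. (\<Sum>N. ?J1 N \<omega>) \<partial>P x) \<le> (\<integral>\<^sup>+\<omega>. inv_pow \<gamma> (hitting_time X D2 \<omega>) * ennreal (\<phi>1Y (X (the_enat (hitting_time X D2 \<omega>)) \<omega>))
              * indicator {\<omega>. hitting_time X D2 \<omega> < min (hitting_time X D3 \<omega>) (absorption_time X cem \<omega>)} \<omega> \<partial>P x)"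
  proof (rule nn_integral_mono_AE, use ex in eventually_elim)
    case (elim \<omega>)
    then obtain N where N: "\<forall>n. \<omega> \<in> stays \<Omega> X D1 n \<longleftrightarrow> n \<le> N" "X (Suc N) \<omega> \<in> D2 \<union> (D3 \<union> {cem})" by blast
    show ?case
    proof (cases "X (Suc N) \<omega> \<in> D2")
      case True
      have "hitting_time X D2 \<omega> = enat (Suc N)" using path(3)[OF N True] D_disjoint by auto
      moreover have "X (Suc N) \<omega> \<notin> D3" "X (Suc N) \<omega> \<notin> {cem}" using True D_disjoint D_E(2) by auto
      then have "enat (Suc N) < hitting_time X D3 \<omega>" "enat (Suc N) < absorption_time X cem \<omega>"
        using path(4)[OF N] D_disjoint cemD1 by auto
      ultimately show ?thesis unfolding path(1)[OF N] by (simp add: inv_pow_enat indicator_def)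
    next
      case False
      then show ?thesis unfolding path(1)[OF N] by simp
    qed
  qed
  then show "(\<integral>\<^sup>+\<omega>. (\<Sum>N. ?J1 N \<omega>) \<partial>P x) < \<infinity>" using fin(1) by (rule le_less_trans)
  have "(\<integral>\<^sup>+\<omega>. (\<Sum>N. ?J2 N \<omega>) \<partial>P x) \<le> (\<integral>\<^sup>+\<omega>. inv_pow \<gamma> (min (hitting_time X D3 \<omega>) (absorption_time X cem \<omega>))
              * indicator {\<omega>. min (hitting_time X D3 \<omega>) (absorption_time X cem \<omega>) < hitting_time X D2 \<omega>} \<omega> \<partial>P x)"
  proof (rule nn_integral_mono_AE, use ex in eventually_elim)
    case (elim \<omega>)
    then obtain N where N: "\<forall>n. \<omega> \<in> stays \<Omega> X D1 n \<longleftrightarrow> n \<le> N" "X (Suc N) \<omega> \<in> D2 \<union> (D3 \<union> {cem})" by blast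
    show ?case
    proof (cases "X (Suc N) \<omega> \<in> D3 \<union> {cem}")
      case True
      then have "X (Suc N) \<omega> \<notin> D2" using D_disjoint D_E(2) by auto
      then have "enat (Suc N) < hitting_time X D2 \<omega>" using path(4)[OF N] D_disjoint by auto
      moreover have "min (hitting_time X D3 \<omega>) (absorption_time X cem \<omega>) = enat (Suc N)"
      proof (cases "X (Suc N) \<omega> \<in> D3")
        case True
        then have "X (Suc N) \<omega> \<notin> {cem}" using D_E(3) by auto
        then have "hitting_time X D3 \<omega> = enat (Suc N)" "enat (Suc N) < absorption_time X cem \<omega>"
          using path(3)[OF N True] path(4)[OF N] D_disjoint cemD1 by auto
        then show ?thesis by (simp add: min_absorb1 less_imp_le)
      next
        case False
        then have "enat (Suc N) < hitting_time X D3 \<omega>" "absorption_time X cem \<omega> = enat (Suc N)"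
          using True path(3)[OF N, of "{cem}"] path(4)[OF N False] D_disjoint cemD1 by auto
        then show ?thesis by (simp add: min_absorb2 less_imp_le)
      qed
      ultimately show ?thesis unfolding path(2)[OF N] by (simp add: inv_pow_enat indicator_def)
    next
      case False
      then show ?thesis unfolding path(2)[OF N] by simp
    qed
  qed
  then show "(\<integral>\<^sup>+\<omega>. (\<Sum>N. ?J2 N \<omega>) \<partial>P x) < \<infinity>" using fin(2) by (rule le_less_trans)
qed

lemma phi1Y_ge_1:
  assumes "x \<in> D2" shows "1 \<le> \<phi>1Y x"
proof (rule H1E)
  assume "\<And>x. x \<in> D2 \<Longrightarrow> 1 \<le> \<phi>1Y x"
  then show ?thesis using assms .
qed

text \<open>
  On \<open>D1\<close> the value of \<open>W\<close> is the discounted number of steps before the exit from \<open>D1\<close>, plus its discounted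
  value at the exit point, which the bounds on \<open>D2\<close> and \<open>D3\<close> control.
\<close>

lemma W_finite: "x \<in> E \<Longrightarrow> W x < \<infinity>"
proof -
  obtain A Mw where AM: "0 < A" "0 < Mw" "\<And>x N. x \<in> D3 \<Longrightarrow> GS N x \<le> ennreal Mw"
    "\<And>x N. x \<in> D2 \<Longrightarrow> GS N x \<le> ennreal (A * \<phi>1Y x)"
    using GS_bounds by metis
  define h where "h y = 1 + (ennreal (A / g) * (ennreal (\<phi>1Y y) * indicator D2 y) + ennreal (Mw / g) * indicator D3 y)" for y
  define r where "r y = (\<integral>\<^sup>+\<omega>. h (X 1 \<omega>) \<partial>P y)" for y
  have phi_S [measurable]: "(\<lambda>y. ennreal (\<phi>1Y y) * indicator D2 y) \<in> borel_measurable S"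
    by (rule measurable_extend[OF D_sets(2) measurable_phi1Y])
  have h [measurable]: "h \<in> borel_measurable S" unfolding h_def by measurable
  have hX [measurable]: "(\<lambda>\<omega>. h (X n \<omega>)) \<in> borel_measurable \<Omega>" for n
    by (rule measurable_compose[OF X_measurable h])
  have r [measurable]: "r \<in> borel_measurable S" unfolding r_def by (rule measurable_expectation[OF hX])
  let ?s = "ennreal (1 / g)"
  interpret R: positive_kernel "restrict_space S D1" "killed_kernel S P X D1 ?s" by (rule positive_killed_kernel[OF D_sets(1)])
  have sp1: "space (restrict_space S D1) = D1" using D_space by (auto simp: space_restrict_space)
  have GS_le: "GS N x \<le> (\<Sum>n<N. (R.R ^^ n) r x)" if "x \<in> D1" for x N
    using that
  proof (induction N arbitrary: x)
    case 0
    then show ?case by (simp add: GS_def)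
  next
    case (Suc N)
    have xB: "x \<in> B" and xS: "x \<in> space S" using Suc.prems D_E(1) D_notin K_D2 by auto
    interpret Px: prob_space "P x" by (rule P_space[OF xS])
    have m2 [measurable]: "(\<lambda>\<omega>. ennreal (\<phi>1Y (X 1 \<omega>)) * indicator D2 (X 1 \<omega>)) \<in> borel_measurable (P x)"
      by (rule measurable_step[OF D_sets(2) xS measurable_phi1Y])
    have m3 [measurable]: "(\<lambda>\<omega>. indicator D3 (X 1 \<omega>) :: ennreal) \<in> borel_measurable (P x)"
      using measurable_step[OF D_sets(3) xS, of "\<lambda>_. 1"] by (simp del: One_nat_def)
    let ?b = "\<lambda>\<omega>. ennreal A * (ennreal (\<phi>1Y (X 1 \<omega>)) * indicator D2 (X 1 \<omega>)) + ennreal Mw * indicator D3 (X 1 \<omega>)"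
    have b [measurable]: "?b \<in> borel_measurable (P x)"
      by (intro borel_measurable_add borel_measurable_times_ennreal m2 m3 borel_measurable_const)
    let ?e = "\<lambda>\<omega>. ?s * (ennreal A * (ennreal (\<phi>1Y (X 1 \<omega>)) * indicator D2 (X 1 \<omega>)) + ennreal Mw * indicator D3 (X 1 \<omega>))"
    have "step (GS N) B x \<le> step (GS N) E x" by (intro step_mono_set) auto
    also have "\<dots> = step (GS N) D1 x + step (GS N) D2 x + step (GS N) D3 x"
      by (rule step_split[OF xS restrict_measurable[OF GS_measurable]])
    also have "\<dots> \<le> step (GS N) D1 x + step (\<lambda>y. ennreal A * ennreal (\<phi>1Y y)) D2 x + step (\<lambda>_. ennreal Mw) D3 x"
      using AM by (intro add_mono step_mono_set order_refl) (auto simp: ennreal_mult')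
    also have "\<dots> = step (GS N) D1 x + (\<integral>\<^sup>+\<omega>. ennreal A * (ennreal (\<phi>1Y (X 1 \<omega>)) * indicator D2 (X 1 \<omega>)) + ennreal Mw * indicator D3 (X 1 \<omega>) \<partial>P x)"
      unfolding add.assoc
      by (subst nn_integral_add) (auto simp: mult.assoc simp del: One_nat_def intro!: borel_measurable_times_ennreal m2 m3)
    finally have "?s * step (GS N) B x \<le> ?s * (step (GS N) D1 x + (\<integral>\<^sup>+\<omega>. ennreal A * (ennreal (\<phi>1Y (X 1 \<omega>)) * indicator D2 (X 1 \<omega>)) + ennreal Mw * indicator D3 (X 1 \<omega>) \<partial>P x))"
      by (intro mult_left_mono) auto
    also have "\<dots> = ?s * step (GS N) D1 x + (\<integral>\<^sup>+\<omega>. ?e \<omega> \<partial>P x)"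
      by (subst nn_integral_cmult[OF b]) (rule distrib_left)
    finally have "GS (Suc N) x \<le> (1 + (\<integral>\<^sup>+\<omega>. ?e \<omega> \<partial>P x)) + ?s * step (GS N) D1 x"
      unfolding GS_Suc[OF xB] by (simp add: add_ac)
    also have "1 + (\<integral>\<^sup>+\<omega>. ?e \<omega> \<partial>P x) = (\<integral>\<^sup>+\<omega>. 1 + ?e \<omega> \<partial>P x)"
      using borel_measurable_times_ennreal[OF borel_measurable_const b, of ?s]
      by (subst nn_integral_add) (auto simp: Px.emeasure_space_1 simp del: One_nat_def)
    also have "(\<integral>\<^sup>+\<omega>. 1 + ?e \<omega> \<partial>P x) = r x"
      unfolding r_def h_def using g AM
      by (intro nn_integral_cong) (simp add: distrib_left mult.assoc[symmetric] ennreal_mult[symmetric])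
    also have "?s * step (GS N) D1 x = R.R (GS N) x"
      by (rule RK_step[OF D_sets(1) xS restrict_measurable[OF GS_measurable], symmetric])
    finally have "GS (Suc N) x \<le> r x + R.R (GS N) x" .
    also have "R.R (GS N) x \<le> R.R (\<lambda>y. \<Sum>n<N. 1 * (R.R ^^ n) r y) x"
      using Suc by (intro R.R_mono) (auto simp: sp1)
    also have "\<dots> = (\<Sum>n<N. 1 * R.R ((R.R ^^ n) r) x)"
      using Suc.prems by (intro R.R_sum R.pow_measurable restrict_measurable r) (simp add: sp1)
    finally have "GS (Suc N) x \<le> r x + (\<Sum>n<N. 1 * R.R ((R.R ^^ n) r) x)" by (simp add: add_left_mono)
    then show ?case unfolding sum.lessThan_Suc_shift by simp
  qed
  let ?F = "\<lambda>n \<omega>. ennreal ((1 / g) ^ n) * h (X (Suc n) \<omega>) * indicator (stays \<Omega> X D1 n) \<omega>"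
  let ?J1 = "\<lambda>N \<omega>. ennreal ((1 / \<gamma>) ^ Suc N) * (ennreal (\<phi>1Y (X (Suc N) \<omega>)) * indicator D2 (X (Suc N) \<omega>)) * indicator (stays \<Omega> X D1 N) \<omega>"
  let ?J2 = "\<lambda>N \<omega>. ennreal ((1 / \<gamma>) ^ Suc N) * indicator (D3 \<union> {cem}) (X (Suc N) \<omega>) * indicator (stays \<Omega> X D1 N) \<omega>"
  have single_le: "f N \<le> (\<Sum>k. f k)" for f :: "nat \<Rightarrow> ennreal" and N
    using sum_le_suminf[of f "{N}"] by simp
  define q where "q = 1 / g"
  define c where "c = 1 / (q - 1) + A + Mw"
  have q: "1 < q" "0 \<le> c" using g AM by (auto simp: q_def c_def)
  have geo: "(\<Sum>n<N. q ^ n) + q ^ N * (1 + t / g) \<le> c * q ^ Suc N * u"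
    if "t \<le> (A + Mw) * u" "1 \<le> u" "0 \<le> t" for N t u
  proof -
    have "(\<Sum>n<N. q ^ n) + q ^ N * (1 + t / g) = (\<Sum>n<Suc N. q ^ n) + q ^ Suc N * t"
      using g by (simp add: q_def field_simps)
    also have "(\<Sum>n<Suc N. q ^ n) = (q ^ Suc N - 1) / (q - 1)"
      unfolding power_diff_1_eq[of q "Suc N"] using q by (simp del: sum.lessThan_Suc power_Suc)
    also have "\<dots> \<le> 1 / (q - 1) * q ^ Suc N * 1" using q by (simp add: divide_right_mono)
    also have "\<dots> \<le> 1 / (q - 1) * q ^ Suc N * u" using q that by (intro mult_left_mono) auto
    also have "q ^ Suc N * t \<le> q ^ Suc N * ((A + Mw) * u)" using q that by (intro mult_left_mono) auto
    finally show ?thesis by (simp add: c_def algebra_simps)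
  qed
  have path: "(\<Sum>n<k. ?F n \<omega>) \<le> ennreal c * ((\<Sum>N. ?J1 N \<omega>) + (\<Sum>N. ?J2 N \<omega>))"
    if N: "\<forall>n. \<omega> \<in> stays \<Omega> X D1 n \<longleftrightarrow> n \<le> N" "X (Suc N) \<omega> \<in> D2 \<union> (D3 \<union> {cem})" for \<omega> N k
  proof -
    have in_D1: "X n \<omega> \<in> D1" if "n \<le> N" for n using N(1) that unfolding stays_def by auto
    have h1: "h (X (Suc n) \<omega>) = 1" if "n < N" for n
      using in_D1[of "Suc n"] that D_disjoint by (auto simp: h_def indicator_def)
    have "(\<Sum>n<k. ?F n \<omega>) \<le> (\<Sum>n\<in>{..<k} \<union> {..<Suc N}. ?F n \<omega>)" by (intro sum_mono2) auto
    also have "\<dots> = (\<Sum>n<Suc N. ?F n \<omega>)" using N(1) by (intro sum.mono_neutral_right) (auto simp: indicator_def)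
    also have "\<dots> = (\<Sum>n<N. ?F n \<omega>) + ?F N \<omega>" by simp
    also have "(\<Sum>n<N. ?F n \<omega>) = (\<Sum>n<N. ennreal (q ^ n))" using h1 N(1) by (intro sum.cong) (auto simp: q_def)
    also have "\<dots> = ennreal (\<Sum>n<N. q ^ n)" using q by (intro sum_ennreal) auto
    also have "?F N \<omega> = ennreal (q ^ N) * h (X (Suc N) \<omega>)" using N(1) by (simp add: q_def)
    finally have F: "(\<Sum>n<k. ?F n \<omega>) \<le> ennreal (\<Sum>n<N. q ^ n) + ennreal (q ^ N) * h (X (Suc N) \<omega>)" .
    have bound: "(\<Sum>n<k. ?F n \<omega>) \<le> ennreal c * (ennreal ((1 / \<gamma>) ^ Suc N) * ennreal u)"
      if ht: "h (X (Suc N) \<omega>) = ennreal (1 + t / g)" and t: "t \<le> (A + Mw) * u" "1 \<le> u" "0 \<le> t" for t u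
    proof -
      have "ennreal (\<Sum>n<N. q ^ n) + ennreal (q ^ N) * h (X (Suc N) \<omega>) = ennreal ((\<Sum>n<N. q ^ n) + q ^ N * (1 + t / g))"
        unfolding ht using q t g by (subst ennreal_plus) (auto simp: ennreal_mult sum_nonneg)
      also have "\<dots> \<le> ennreal (c * q ^ Suc N * u)" by (intro ennreal_leI geo t)
      also have "\<dots> \<le> ennreal (c * (1 / \<gamma>) ^ Suc N * u)"
        using q t gamma g_bounds g unfolding q_def
        by (intro ennreal_leI mult_right_mono mult_left_mono power_mono divide_left_mono) auto
      also have "\<dots> = ennreal c * (ennreal ((1 / \<gamma>) ^ Suc N) * ennreal u)"
        using q gamma by (simp add: mult.assoc ennreal_mult' del: power_Suc)
      finally show ?thesis using F by (rule order_trans[rotated])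
    qed
    show ?thesis
    proof (cases "X (Suc N) \<omega> \<in> D2")
      case True
      let ?p = "\<phi>1Y (X (Suc N) \<omega>)"
      have p: "1 \<le> ?p" by (rule phi1Y_ge_1[OF True])
      have "h (X (Suc N) \<omega>) = ennreal (1 + (A * ?p) / g)"
        unfolding h_def using True D_disjoint AM(1) g p
        by (auto simp: indicator_def ennreal_mult[symmetric] ennreal_plus)
      then have "(\<Sum>n<k. ?F n \<omega>) \<le> ennreal c * (ennreal ((1 / \<gamma>) ^ Suc N) * ennreal ?p)"
        using p AM by (intro bound) (auto simp: distrib_right)
      also have "\<dots> = ennreal c * ?J1 N \<omega>" using True N(1) by simp
      also have "?J1 N \<omega> \<le> (\<Sum>N. ?J1 N \<omega>)" by (rule single_le)
      finally show ?thesis by (simp add: distrib_left add_increasing2 mult_left_mono)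
    next
      case False
      have "h (X (Suc N) \<omega>) = ennreal (1 + (Mw * indicator D3 (X (Suc N) \<omega>)) / g)"
        unfolding h_def using False AM(2) g by (auto simp: indicator_def ennreal_plus)
      then have "(\<Sum>n<k. ?F n \<omega>) \<le> ennreal c * (ennreal ((1 / \<gamma>) ^ Suc N) * ennreal 1)"
        using AM by (intro bound) (auto simp: indicator_def)
      also have "\<dots> = ennreal c * ?J2 N \<omega>" using False N by (simp add: indicator_def)
      also have "?J2 N \<omega> \<le> (\<Sum>N. ?J2 N \<omega>)" by (rule single_le)
      finally show ?thesis by (simp add: distrib_left add_increasing mult_left_mono)
    qed
  qed
  have D1: "W x < \<infinity>" if x: "x \<in> D1" for x
  proof -
    have xS: "x \<in> space S" by (rule D_space(1)[OF x])
    have st [measurable]: "stays \<Omega> X D1 n \<in> sets (P x)" for n using stays_sets[OF D_sets(1)] P_space(2)[OF xS] by simp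
    have XP [measurable]: "X n \<in> P x \<rightarrow>\<^sub>M S" for n using X_measurable by (simp add: measurable_P[OF xS])
    have hP [measurable]: "(\<lambda>\<omega>. h (X n \<omega>)) \<in> borel_measurable (P x)" for n by measurable
    have cemS [measurable]: "D3 \<union> {cem} \<in> sets S" by (intro sets.Un D_sets cem_measurable)
    have "GS k x \<le> (\<integral>\<^sup>+\<omega>. ennreal c * ((\<Sum>N. ?J1 N \<omega>) + (\<Sum>N. ?J2 N \<omega>)) \<partial>P x)" for k
    proof -
      have "(R.R ^^ n) r x = (\<integral>\<^sup>+\<omega>. ?F n \<omega> \<partial>P x)" for n
      proof -
        have "(R.R ^^ n) r x = ?s ^ n * (\<integral>\<^sup>+\<omega>. r (X n \<omega>) * indicator (stays \<Omega> X D1 n) \<omega> \<partial>P x)"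
          by (rule pow_killed[OF D_sets(1) x restrict_measurable[OF r]])
        also have "\<dots> = ?s ^ n * (\<integral>\<^sup>+\<omega>. h (X (Suc n) \<omega>) * indicator (stays \<Omega> X D1 n) \<omega> \<partial>P x)"
          unfolding r_def using markov_nn_integral[OF xS stays_filtration[OF D_sets(1)] h] by simp
        also have "\<dots> = (\<integral>\<^sup>+\<omega>. ?F n \<omega> \<partial>P x)"
          using g by (subst nn_integral_cmult[symmetric]) (auto simp: ennreal_power mult.assoc)
        finally show ?thesis .
      qed
      then have "GS k x \<le> (\<Sum>n<k. \<integral>\<^sup>+\<omega>. ?F n \<omega> \<partial>P x)" using GS_le[OF x] by simp
      also have "\<dots> = (\<integral>\<^sup>+\<omega>. (\<Sum>n<k. ?F n \<omega>) \<partial>P x)" by (intro nn_integral_sum[symmetric]) measurable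
      also have "\<dots> \<le> (\<integral>\<^sup>+\<omega>. ennreal c * ((\<Sum>N. ?J1 N \<omega>) + (\<Sum>N. ?J2 N \<omega>)) \<partial>P x)"
        using D1_exit_moment(3)[OF x] by (intro nn_integral_mono_AE, eventually_elim) (use path in blast)
      finally show ?thesis .
    qed
    then have "W x \<le> (\<integral>\<^sup>+\<omega>. ennreal c * ((\<Sum>N. ?J1 N \<omega>) + (\<Sum>N. ?J2 N \<omega>)) \<partial>P x)"
      unfolding W_eq_SUP by (intro SUP_least)
    also have "\<dots> = ennreal c * ((\<integral>\<^sup>+\<omega>. (\<Sum>N. ?J1 N \<omega>) \<partial>P x) + (\<integral>\<^sup>+\<omega>. (\<Sum>N. ?J2 N \<omega>) \<partial>P x))"
    proof -
      have m1: "(\<lambda>\<omega>. \<Sum>N. ?J1 N \<omega>) \<in> borel_measurable (P x)"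
        by (rule borel_measurable_suminf_order[OF borel_measurable_times_ennreal[OF borel_measurable_times_ennreal[OF
              borel_measurable_const measurable_compose[OF XP phi_S]] borel_measurable_indicator[OF st]]])
      have m2: "(\<lambda>\<omega>. \<Sum>N. ?J2 N \<omega>) \<in> borel_measurable (P x)" by measurable
      show ?thesis using m1 m2 by (subst nn_integral_cmult, simp, subst nn_integral_add) auto
    qed
    also have "\<dots> < \<infinity>" using D1_exit_moment(1,2)[OF x] by (simp add: ennreal_mult_less_top)
    finally show ?thesis .
  qed
  assume "x \<in> E"
  then consider "x \<in> D1" | "x \<in> D2" | "x \<in> D3" using D_union by auto
  then show "W x < \<infinity>"
  proof cases
    case 1
    then show ?thesis by (rule D1)
  next
    case 2
    then have "W x \<le> ennreal (A * \<phi>1Y x)" unfolding W_eq_SUP using AM by (intro SUP_least)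
    then show ?thesis by (rule le_less_trans) simp
  next
    case 3
    then have "W x \<le> ennreal Mw" unfolding W_eq_SUP using AM by (intro SUP_least)
    then show ?thesis by (rule le_less_trans) simp
  qed
qed

lemma weight_finite: "x \<in> E \<Longrightarrow> weight x < \<infinity>"
  using W_finite by (simp add: weight_eq ennreal_mult_less_top)

lemma weight_bounds:
  obtains A M where "0 < A" "0 < M" "\<And>x. x \<in> D3 \<Longrightarrow> weight x \<le> ennreal M"
    "\<And>x. x \<in> D2 \<Longrightarrow> weight x \<le> ennreal (A * \<phi>1Y x)"
proof -
  obtain A Mw where AM: "0 < A" "0 < Mw" "\<And>x N. x \<in> D3 \<Longrightarrow> GS N x \<le> ennreal Mw"
    "\<And>x N. x \<in> D2 \<Longrightarrow> GS N x \<le> ennreal (A * \<phi>1Y x)"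
    using GS_bounds by metis
  let ?k = "1 / g - 1"
  have D3: "weight x \<le> ennreal (1 + ?k * Mw)" if "x \<in> D3" for x
  proof -
    have "W x \<le> ennreal Mw" unfolding W_eq_SUP using AM that by (intro SUP_least)
    then have "weight x \<le> 1 + ennreal ?k * ennreal Mw"
      unfolding weight_eq[OF D_E(3)[OF that]] by (intro add_left_mono mult_left_mono) auto
    also have "\<dots> = ennreal (1 + ?k * Mw)"
      using g AM(2) by (subst ennreal_plus) (auto simp: ennreal_mult)
    finally show ?thesis .
  qed
  have D2: "weight x \<le> ennreal ((1 + ?k * A) * \<phi>1Y x)" if "x \<in> D2" for x
  proof -
    have p: "1 \<le> \<phi>1Y x" by (rule phi1Y_ge_1[OF that])
    have "W x \<le> ennreal (A * \<phi>1Y x)" unfolding W_eq_SUP using AM that by (intro SUP_least)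
    then have "weight x \<le> ennreal (\<phi>1Y x) + ennreal ?k * ennreal (A * \<phi>1Y x)"
      unfolding weight_eq[OF D_E(2)[OF that]] using p by (intro add_mono mult_left_mono) (auto simp: ennreal_ge_1)
    also have "\<dots> = ennreal (\<phi>1Y x + ?k * (A * \<phi>1Y x))"
      using g AM(1) p by (subst ennreal_plus) (auto simp: ennreal_mult)
    finally show ?thesis by (simp add: algebra_simps)
  qed
  have "0 < ?k * A" "0 < ?k * Mw" using g AM by auto
  then show thesis by (intro that[of "1 + ?k * A" "1 + ?k * Mw"] D2 D3) auto
qed

lemma weight_drift_K:
  obtains c where "0 < c" "\<And>x. x \<in> K \<Longrightarrow> step weight E x \<le> ennreal c"
proof -
  obtain A M where AM: "0 < A" "0 < M" "\<And>x. x \<in> D3 \<Longrightarrow> weight x \<le> ennreal M"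
    "\<And>x. x \<in> D2 \<Longrightarrow> weight x \<le> ennreal (A * \<phi>1Y x)"
    using weight_bounds by metis
  obtain n1 c1 c2 c3 m v i where Y: "0 < c2" "\<And>x. x \<in> K \<Longrightarrow> \<phi>1Y x \<le> v"
    "\<And>x. x \<in> D2 \<Longrightarrow> RK 1 D2 (\<lambda>y. ennreal (\<phi>1Y y)) x \<le> ennreal (\<theta>1Y * \<phi>1Y x + c2 * indicator K x)"
    "0 < \<theta>1Y"
    by (rule H1E) blast
  define c where "c = A * (\<theta>1Y * max 0 v + c2) + M"
  have c: "0 < c" unfolding c_def using AM Y by (intro add_nonneg_pos mult_nonneg_nonneg add_nonneg_nonneg) auto
  have "step weight E x \<le> ennreal c" if x: "x \<in> K" for x
  proof -
    have xD: "x \<in> D2" and xS: "x \<in> space S" using K_D2[OF x] D_space by auto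
    have "step weight E x = step weight D2 x + step weight D3 x"
      unfolding step_split[OF xS weight_measurable] step_D2_D1[OF xD] by simp
    also have "\<dots> \<le> step (\<lambda>y. ennreal A * ennreal (\<phi>1Y y)) D2 x + step (\<lambda>_. ennreal M) D3 x"
      using AM by (intro add_mono step_mono_set) (auto simp: ennreal_mult')
    also have "step (\<lambda>y. ennreal A * ennreal (\<phi>1Y y)) D2 x = ennreal A * RK 1 D2 (\<lambda>y. ennreal (\<phi>1Y y)) x"
      using measurable_step[OF D_sets(2) xS measurable_phi1Y] RK_step[OF D_sets(2) xS measurable_phi1Y, of 1]
      by (simp add: mult.assoc nn_integral_cmult)
    also have "ennreal A * RK 1 D2 (\<lambda>y. ennreal (\<phi>1Y y)) x + step (\<lambda>_. ennreal M) D3 x \<le> ennreal A * ennreal (\<theta>1Y * max 0 v + c2) + ennreal M"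
    proof -
      have "\<phi>1Y x \<le> max 0 v" using Y(2)[OF x] by simp
      then have "\<theta>1Y * \<phi>1Y x + c2 * indicator K x \<le> \<theta>1Y * max 0 v + c2"
        using x Y(4) by (intro add_mono mult_left_mono) auto
      then have "RK 1 D2 (\<lambda>y. ennreal (\<phi>1Y y)) x \<le> ennreal (\<theta>1Y * max 0 v + c2)"
        by (intro order_trans[OF Y(3)[OF xD]] ennreal_leI)
      then show ?thesis by (intro add_mono mult_left_mono step_const xS) auto
    qed
    also have "\<dots> = ennreal c"
      unfolding c_def using AM Y by (subst ennreal_plus) (auto simp: ennreal_mult)
    finally show ?thesis .
  qed
  with c show thesis by (rule that)
qed

end

section \<open>Consequences of the spectral gap\<close>

context reducible_weight
begin

abbreviation (input) "M \<equiv> restrict_space S E"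
abbreviation (input) "s0 \<equiv> ennreal (1 / \<theta>0)"

lemma space_M: "space M = E"
  by (auto simp: space_restrict_space)

lemma RK_pow_s0: "x \<in> E \<Longrightarrow> f \<in> borel_measurable M \<Longrightarrow> (RK s0 E ^^ n) f x = s0 ^ n * (RK 1 E ^^ n) f x"
  by (rule pow_killed_scale[OF E_sets])

lemma RK_1_s0: "x \<in> E \<Longrightarrow> f \<in> borel_measurable M \<Longrightarrow> RK s0 E f x = s0 * RK 1 E f x"
  using RK_pow_s0[of x f 1] by simp

lemma step_E: "x \<in> E \<Longrightarrow> f \<in> borel_measurable M \<Longrightarrow> RK 1 E f x = step f E x"
  using RK_step[OF E_sets, of x f 1] by simp

lemma K_M: "K \<in> sets M" and K_E: "x \<in> K \<Longrightarrow> x \<in> E"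
  using K_sets K_D2 D_E by (auto simp: sets_restrict_space_iff)

lemma indicator_M: "A \<in> sets S \<Longrightarrow> indicator A \<in> borel_measurable M"
  by (intro restrict_measurable) auto

text \<open>(E1) and (E4) carry over from \<open>Y\<close>, because the kernel of \<open>X\<close>, which kills fewer paths, is larger on \<open>D2\<close>.\<close>

lemma minorisation_X:
  obtains n1 c1 m where "0 < n1" "0 < c1" "prob_space m" "sets m = sets (restrict_space S K)"
    "\<And>x A. x \<in> K \<Longrightarrow> A \<in> sets S \<Longrightarrow> ennreal c1 * emeasure m (A \<inter> K) \<le> (RK 1 E ^^ n1) (indicator A) x"
    "\<And>x. x \<in> K \<Longrightarrow> \<exists>n4. \<forall>n\<ge>n4. 0 < (RK 1 E ^^ n) (indicator K) x"
proof -
  obtain n1 c1 c2 c3 m v i where n1: "0 < n1" and Y: "0 < c1" "prob_space m" "sets m = sets (restrict_space S K)"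
    "\<And>x B. x \<in> K \<Longrightarrow> B \<in> sets S \<Longrightarrow> B \<subseteq> D2 \<Longrightarrow> ennreal c1 * emeasure m (B \<inter> K) \<le> (RK 1 D2 ^^ n1) (indicator B) x"
    "\<And>x. x \<in> K \<Longrightarrow> \<exists>n4. \<forall>n\<ge>n4. 0 < (RK 1 D2 ^^ n) (indicator K) x"
    by (rule H1E) blast
  interpret E: positive_kernel M "killed_kernel S P X E 1" by (rule positive_killed_kernel[OF E_sets])
  have 1: "ennreal c1 * emeasure m (A \<inter> K) \<le> (RK 1 E ^^ n1) (indicator A) x" if x: "x \<in> K" and A: "A \<in> sets S" for x A
  proof -
    have "A \<inter> K = (A \<inter> D2) \<inter> K" using K_D2 by auto
    then have "ennreal c1 * emeasure m (A \<inter> K) \<le> (RK 1 D2 ^^ n1) (indicator (A \<inter> D2)) x"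
      using Y(4)[OF x, of "A \<inter> D2"] A by auto
    also have "\<dots> \<le> (RK 1 E ^^ n1) (indicator (A \<inter> D2)) x"
      using A by (intro RK_D2_le_E indicator_M K_D2 x) auto
    also have "\<dots> \<le> (RK 1 E ^^ n1) (indicator A) x"
      using K_E[OF x] by (intro E.pow_mono) (auto simp: space_M indicator_def)
    finally show ?thesis .
  qed
  have 2: "\<exists>n4. \<forall>n\<ge>n4. 0 < (RK 1 E ^^ n) (indicator K) x" if x: "x \<in> K" for x
  proof -
    obtain n4 where "\<And>n. n \<ge> n4 \<Longrightarrow> 0 < (RK 1 D2 ^^ n) (indicator K) x" using Y(5)[OF x] by blast
    then show ?thesis
      using RK_D2_le_E[OF indicator_M[OF K_sets] K_D2[OF x], where s=1] by (intro exI[of _ n4]) (meson less_le_trans)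
  qed
  show thesis by (rule that[OF n1 Y(1-3) 1 2])
qed

text \<open>
  The probability \<open>m\<close> of (E1) lives on \<open>K\<close> and is extended by zero to \<open>E\<close>.
\<close>

lemma harris_X:
  obtains \<rho> C a b n1 c1 v m where
    "harris_kernel M (killed_kernel S P X E s0) K (\<lambda>x. enn2real (weight x)) \<rho> C a b n1 c1 v m"
    "0 < emeasure \<nu>Y K"
proof -
  have lt: "\<theta>1Y < \<theta>0" using g_bounds by simp
  obtain a b where ab: "0 < a" "0 < emeasure \<nu>Y K"
    "\<And>x n. x \<in> K \<Longrightarrow> ennreal a \<le> (RK s0 E ^^ n) (\<lambda>_. 1) x"
    "\<And>x n. x \<in> K \<Longrightarrow> (RK s0 E ^^ n) (\<lambda>_. 1) x \<le> ennreal b"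
    using survival_X[OF lt] by metis
  obtain n1 c1 m where m: "0 < c1" "prob_space m" "sets m = sets (restrict_space S K)"
    "\<And>x A. x \<in> K \<Longrightarrow> A \<in> sets S \<Longrightarrow> ennreal c1 * emeasure m (A \<inter> K) \<le> (RK 1 E ^^ n1) (indicator A) x"
    "\<And>x. x \<in> K \<Longrightarrow> \<exists>n4. \<forall>n\<ge>n4. 0 < (RK 1 E ^^ n) (indicator K) x"
    using minorisation_X by metis
  obtain c where c: "0 < c" "\<And>x. x \<in> K \<Longrightarrow> step weight E x \<le> ennreal c"
    using weight_drift_K by metis
  interpret E: positive_kernel M "killed_kernel S P X E s0" by (rule positive_killed_kernel[OF E_sets])
  interpret m: prob_space m by (rule m(2))
  have spm: "space m = K" using sets_eq_imp_space_eq[OF m(3)] K_E by (auto simp: space_restrict_space)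
  have eq: "ennreal (enn2real (weight x)) = weight x" if "x \<in> E" for x using weight_finite[OF that] by simp
  have id: "(\<lambda>x. x) \<in> m \<rightarrow>\<^sub>M M"
  proof -
    have "(\<lambda>x. x) \<in> restrict_space S K \<rightarrow>\<^sub>M M"
      using K_E by (intro measurable_restrict_space2 measurable_restrict_space1) (auto simp: space_restrict_space)
    then show ?thesis using m(3) by (simp cong: measurable_cong_sets)
  qed
  define m' where "m' = distr m M (\<lambda>x. x)"
  have m': "emeasure m' A = emeasure m (A \<inter> K)" if "A \<in> sets M" for A
    unfolding m'_def using that id by (subst emeasure_distr) (auto simp: spm)
  have "harris_kernel M (killed_kernel S P X E s0) K (\<lambda>x. enn2real (weight x)) (g / \<theta>0) (c / \<theta>0) a b n1 (c1 * (1 / \<theta>0) ^ n1) 1 m'"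
  proof (intro harris_kernel.intro lyapunov_kernel.intro lyapunov_kernel_axioms.intro harris_kernel_axioms.intro)
    show "positive_kernel M (killed_kernel S P X E s0)" by (rule E.positive_kernel_axioms)
    show "K \<in> sets M" by (rule K_M)
    show "K \<noteq> {}" using m.not_empty spm by simp
    show "(\<lambda>x. enn2real (weight x)) \<in> borel_measurable M"
      by (intro borel_measurable_enn2real weight_measurable)
    show "1 \<le> enn2real (weight x)" if "x \<in> space M" for x
      using weight_ge_1[of x] weight_finite[of x] that enn2real_mono[of 1 "weight x"] by (simp add: space_M)
    show "0 < g / \<theta>0" "g / \<theta>0 < 1" "0 < c / \<theta>0" using g g_bounds theta0 c by auto
    show "RK s0 E (\<lambda>y. ennreal (enn2real (weight y))) x \<le> ennreal (g / \<theta>0) * ennreal (enn2real (weight x)) + ennreal (c / \<theta>0) * indicator K x"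
      if "x \<in> space M" for x
    proof -
      have x: "x \<in> E" using that by (simp add: space_M)
      have "RK s0 E (\<lambda>y. ennreal (enn2real (weight y))) x = RK s0 E weight x"
        using that by (intro E.R_cong) (auto simp: space_M eq)
      also have "\<dots> = s0 * step weight E x"
        using x weight_measurable by (simp add: RK_1_s0 step_E)
      also have "\<dots> \<le> s0 * (ennreal g * weight x + ennreal c * indicator K x)"
        using c(2)[of x] weight_drift_off_K[of x] x by (intro mult_left_mono) (cases "x \<in> K"; auto intro: add_increasing)+
      also have "\<dots> = ennreal (g / \<theta>0) * weight x + ennreal (c / \<theta>0) * indicator K x"
        using g c theta0 by (simp add: distrib_left mult.assoc[symmetric] ennreal_mult[symmetric])
      finally show ?thesis by (simp add: eq[OF x])
    qed
    show "0 < a" "\<And>x n. x \<in> K \<Longrightarrow> ennreal a \<le> (RK s0 E ^^ n) (\<lambda>_. 1) x"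
      "\<And>x n. x \<in> K \<Longrightarrow> (RK s0 E ^^ n) (\<lambda>_. 1) x \<le> ennreal b" by (fact ab)+
    show "prob_space m'" unfolding m'_def by (rule m.prob_space_distr[OF id])
    show "sets m' = sets M" by (simp add: m'_def)
    show "emeasure m' K = 1" using m'[OF K_M] m.emeasure_space_1 spm by simp
    show "0 < c1 * (1 / \<theta>0) ^ n1" using m(1) theta0 by simp
    show "ennreal (c1 * (1 / \<theta>0) ^ n1) * emeasure m' A \<le> (RK s0 E ^^ n1) (indicator A) x" if x: "x \<in> K" and A: "A \<in> sets M" for x A
    proof -
      have AS: "A \<in> sets S" using A E_sets by (auto simp: sets_restrict_space_iff)
      have "ennreal (c1 * (1 / \<theta>0) ^ n1) * emeasure m' A = s0 ^ n1 * (ennreal c1 * emeasure m (A \<inter> K))"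
        using m(1) theta0 m'[OF A] by (simp add: ennreal_mult ennreal_power mult_ac)
      also have "\<dots> \<le> s0 ^ n1 * (RK 1 E ^^ n1) (indicator A) x" by (intro mult_left_mono m(4) x AS) auto
      also have "\<dots> = (RK s0 E ^^ n1) (indicator A) x" by (rule RK_pow_s0[OF K_E[OF x] indicator_M[OF AS], symmetric])
      finally show ?thesis .
    qed
    show "enn2real (weight x) \<le> 1" if "x \<in> K" for x using weight_K[OF that] by simp
    show "\<exists>n4. \<forall>n\<ge>n4. 0 < (RK s0 E ^^ n) (indicator K) x" if x: "x \<in> K" for x
      using m(5)[OF x] theta0 unfolding RK_pow_s0[OF K_E[OF x] indicator_M[OF K_sets]]
      by (auto simp: ennreal_zero_less_mult_iff ennreal_power)
  qed
  then show thesis using ab(2) by (rule that)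
qed

end

text \<open>
  The data provided by the spectral gap are fixed, so that \<open>\<nu>\<close>, \<open>\<eta>\<close> and the constants are shared by the
  conclusions of the theorem.
\<close>

locale quasi_limit = reducible_weight S cem \<Omega> P X D1 D2 D3 K SY Y \<phi>1Y \<phi>2Y \<theta>1Y \<theta>2Y \<theta>0 \<gamma> \<nu>Y g
    + H: harris_kernel "restrict_space S (space S - {cem})" "killed_kernel S P X (space S - {cem}) (ennreal (1 / \<theta>0))" K \<phi>1 \<rho> C a b n1 c1 v m
  for S :: "'a measure" and cem and \<Omega> :: "'w measure" and P X D1 D2 D3 K SY Y \<phi>1Y \<phi>2Y \<theta>1Y \<theta>2Y \<theta>0 \<gamma> \<nu>Y g \<phi>1 \<rho> C a b n1 c1 v m +
  fixes \<nu> :: "'a measure" and \<eta> :: "'a \<Rightarrow> real" and \<alpha> Z a' :: real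
  assumes phi1: "x \<in> E \<Longrightarrow> ennreal (\<phi>1 x) = weight x"
    and nu_prob: "prob_space \<nu>" and nu_sets: "sets \<nu> = sets (restrict_space S (space S - {cem}))"
    and nu_phi1: "(\<integral>\<^sup>+x. ennreal (\<phi>1 x) \<partial>\<nu>) < \<infinity>" and nu_K: "0 < emeasure \<nu> K"
    and nu_inv: "f \<in> borel_measurable (restrict_space S (space S - {cem})) \<Longrightarrow> (\<integral>\<^sup>+x. H.R f x \<partial>\<nu>) = (\<integral>\<^sup>+x. f x \<partial>\<nu>)"
    and eta: "H.V_bounded \<eta>" "\<And>x. 0 \<le> \<eta> x" "0 < a'" "\<And>x. x \<in> K \<Longrightarrow> a' \<le> \<eta> x"
    and alpha: "0 < \<alpha>" "\<alpha> < 1" "0 < Z"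
    and gap: "\<And>f n x. f \<in> borel_measurable (restrict_space S (space S - {cem})) \<Longrightarrow> (\<And>y. y \<in> space (restrict_space S (space S - {cem})) \<Longrightarrow> \<bar>f y\<bar> \<le> \<phi>1 y) \<Longrightarrow>
      x \<in> space (restrict_space S (space S - {cem})) \<Longrightarrow> \<bar>(H.T ^^ n) f x - (\<integral>y. f y \<partial>\<nu>) * \<eta> x\<bar> \<le> Z * \<alpha> ^ n * \<phi>1 x"
begin

lemma Tpow_RK:
  assumes f: "H.V_bounded f" "\<And>y. y \<in> E \<Longrightarrow> 0 \<le> f y" and x: "x \<in> E"
  shows "(RK 1 E ^^ n) (\<lambda>y. ennreal (f y)) x = ennreal (\<theta>0 ^ n * (H.T ^^ n) f x)"
proof -
  have m: "(\<lambda>y. ennreal (f y)) \<in> borel_measurable M" using H.V_bounded_measurable[OF f(1)] by measurable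
  have nn: "0 \<le> (H.T ^^ n) f x" using f x by (intro H.Tpow_nonneg) (auto simp: space_M)
  have "ennreal ((H.T ^^ n) f x) = s0 ^ n * (RK 1 E ^^ n) (\<lambda>y. ennreal (f y)) x"
    using f x RK_pow_s0[OF x m, of n] by (subst H.Tpow_eq_pow) (auto simp: space_M)
  then have "ennreal (\<theta>0 ^ n) * ennreal ((H.T ^^ n) f x) = ennreal (\<theta>0 ^ n) * (s0 ^ n * (RK 1 E ^^ n) (\<lambda>y. ennreal (f y)) x)"
    by simp
  also have "\<dots> = (RK 1 E ^^ n) (\<lambda>y. ennreal (f y)) x"
    using theta0 by (simp add: mult.assoc[symmetric] ennreal_power ennreal_mult[symmetric] power_mult_distrib[symmetric])
  finally show ?thesis using theta0 nn by (simp add: ennreal_mult)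
qed

lemma one_bounded: "H.V_bounded (\<lambda>_. 1)"
  by (rule H.V_bounded_const)

lemma K_bounded: "H.V_bounded (indicator K)"
  by (rule H.V_bounded_indicator[OF K_M])

lemma survival_X_real: "x \<in> E \<Longrightarrow> \<P>(\<omega> in P x. enat n < absorption_time X cem \<omega>) = \<theta>0 ^ n * (H.T ^^ n) (\<lambda>_. 1) x"
proof -
  assume x: "x \<in> E"
  have "emeasure (P x) {\<omega> \<in> space (P x). enat n < absorption_time X cem \<omega>} = ennreal (\<theta>0 ^ n * (H.T ^^ n) (\<lambda>_. 1) x)"
    unfolding survival_killed[OF killed_version_X x] using Tpow_RK[OF one_bounded _ x, of n] by simp
  then show ?thesis
    using theta0 x by (simp add: measure_def H.Tpow_nonneg space_M)
qed

lemma V_sum_limit: "x \<in> E \<Longrightarrow> (\<lambda>n. Z * \<alpha> ^ n * \<phi>1 x) \<longlonglongrightarrow> 0"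
proof -
  have "(\<lambda>n. Z * \<alpha> ^ n * \<phi>1 x) \<longlonglongrightarrow> Z * 0 * \<phi>1 x"
    using alpha by (intro tendsto_intros LIMSEQ_power_zero) auto
  then show ?thesis by simp
qed

lemma one_le_phi1: "x \<in> E \<Longrightarrow> 1 \<le> \<phi>1 x"
  using H.V_ge_1[of x] by (simp add: space_M)

lemma mass_limit: "x \<in> E \<Longrightarrow> (\<lambda>n. (H.T ^^ n) (\<lambda>_. 1) x) \<longlonglongrightarrow> \<eta> x"
proof -
  assume x: "x \<in> E"
  have "\<bar>(H.T ^^ n) (\<lambda>_. 1) x - \<eta> x\<bar> \<le> Z * \<alpha> ^ n * \<phi>1 x" for n
    using gap[of "\<lambda>_. 1" x n] x one_le_phi1 prob_space.prob_space[OF nu_prob] by (simp add: space_M)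
  then have "(\<lambda>n. (H.T ^^ n) (\<lambda>_. 1) x - \<eta> x) \<longlonglongrightarrow> 0"
    by (intro tendsto_rabs_zero_cancel[OF tendsto_sandwich[OF _ _ tendsto_const V_sum_limit[OF x]]]) auto
  then show ?thesis by (rule LIM_zero_cancel)
qed

lemma eta_limit:
  assumes x: "x \<in> E"
  shows "(\<lambda>n. \<theta>0 powi (- int n) * \<P>(\<omega> in P x. enat n < absorption_time X cem \<omega>)) \<longlonglongrightarrow> \<eta> x"
proof -
  have "\<theta>0 powi (- int n) * \<P>(\<omega> in P x. enat n < absorption_time X cem \<omega>) = (H.T ^^ n) (\<lambda>_. 1) x" for n
    unfolding survival_X_real[OF x] using theta0 by (simp add: power_int_minus)
  then show ?thesis using mass_limit[OF x] by simp
qed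

text \<open>
  Survival from \<open>D3\<close> decays at rate \<open>\<gamma>\<close>, faster than \<open>\<theta>0\<close>.
\<close>

lemma eta_D3: "x \<in> D3 \<Longrightarrow> \<eta> x = 0"
proof -
  assume x: "x \<in> D3"
  have xE: "x \<in> E" by (rule D_E(3)[OF x])
  obtain M where M: "1 \<le> M" "\<And>x. x \<in> D3 \<Longrightarrow> (\<integral>\<^sup>+\<omega>. inv_pow \<gamma> (absorption_time X cem \<omega>) \<partial>P x) \<le> ennreal M"
    using D3_moment by metis
  have nn: "0 \<le> (H.T ^^ n) (\<lambda>_. 1) x" for n using xE by (intro H.Tpow_nonneg) (auto simp: space_M)
  have le: "(H.T ^^ n) (\<lambda>_. 1) x \<le> M * (\<gamma> / \<theta>0) ^ n" for n
  proof -
    have "ennreal (\<theta>0 ^ n * (H.T ^^ n) (\<lambda>_. 1) x) \<le> ennreal (M * \<gamma> ^ n)"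
      using D3_survival[OF M x, of n] Tpow_RK[OF one_bounded _ xE, of n] by simp
    then have "\<theta>0 ^ n * (H.T ^^ n) (\<lambda>_. 1) x \<le> M * \<gamma> ^ n"
      using M(1) gamma by (subst (asm) ennreal_le_iff) auto
    then show ?thesis using theta0 by (simp add: power_divide field_simps)
  qed
  have "(\<lambda>n. M * (\<gamma> / \<theta>0) ^ n) \<longlonglongrightarrow> M * 0"
    using gamma theta0 by (intro tendsto_mult_left LIMSEQ_power_zero) auto
  then have lim: "(\<lambda>n. M * (\<gamma> / \<theta>0) ^ n) \<longlonglongrightarrow> 0" by simp
  have "(\<lambda>n. (H.T ^^ n) (\<lambda>_. 1) x) \<longlonglongrightarrow> 0"
    by (rule tendsto_sandwich[OF always_eventually[OF allI[OF nn]] always_eventually[OF allI[OF le]] tendsto_const lim])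
  then show "\<eta> x = 0" using mass_limit[OF xE] LIMSEQ_unique by blast
qed

lemma D1_M: "D1 \<in> sets M"
  using D_sets(1) D_E(1) by (auto simp: sets_restrict_space_iff)

text \<open>
  \<open>D1\<close> is not reached from \<open>K\<close>, where \<open>\<eta>\<close> is positive; the gap at a point of \<open>K\<close> then leaves no mass for \<open>D1\<close>.
\<close>

lemma nu_D1: "measure \<nu> D1 = 0"
proof -
  obtain x where x: "x \<in> K" using H.K_nonempty by auto
  have xE: "x \<in> E" by (rule K_E[OF x])
  have zero: "(RK 1 E ^^ n) (indicator D1) y = 0" if "y \<in> D2 \<union> D3" for n y
    using that
  proof (induction n arbitrary: y)
    case 0
    then show ?case using D_notin by (auto simp: indicator_def)
  next
    case (Suc n)
    interpret E: positive_kernel M "killed_kernel S P X E 1" by (rule positive_killed_kernel[OF E_sets])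
    let ?f = "(RK 1 E ^^ n) (indicator D1)"
    have f: "?f \<in> borel_measurable M" by (intro E.pow_measurable indicator_M D_sets)
    have yE: "y \<in> E" and yS: "y \<in> space S" using Suc.prems D_E by auto
    have "(RK 1 E ^^ Suc n) (indicator D1) y = step ?f E y" using step_E[OF yE f] by simp
    also have "\<dots> = step ?f D1 y + step ?f D2 y + step ?f D3 y" by (rule step_split[OF yS f])
    also have "step ?f D1 y = 0" using Suc.prems step_D2_D1 step_D3_D12(1) by blast
    also have "step ?f D2 y = (\<integral>\<^sup>+\<omega>. 0 \<partial>P y)" by (intro nn_integral_cong) (simp add: Suc.IH split: split_indicator)
    also have "step ?f D3 y = (\<integral>\<^sup>+\<omega>. 0 \<partial>P y)" by (intro nn_integral_cong) (simp add: Suc.IH split: split_indicator)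
    finally show ?case by simp
  qed
  have D1b: "H.V_bounded (indicator D1)" by (rule H.V_bounded_indicator[OF D1_M])
  have T0: "(H.T ^^ n) (indicator D1) x = 0" for n
  proof -
    have "ennreal (\<theta>0 ^ n * (H.T ^^ n) (indicator D1) x) = 0"
      using zero[of x n] K_D2[OF x] Tpow_RK[OF D1b _ xE, of n] by (simp add: ennreal_indicator)
    then have "\<theta>0 ^ n * (H.T ^^ n) (indicator D1) x \<le> 0" by (simp only: ennreal_eq_0_iff)
    moreover have "0 \<le> (H.T ^^ n) (indicator D1) x" using xE by (intro H.Tpow_nonneg) (auto simp: space_M)
    moreover have "0 < \<theta>0 ^ n" using theta0 by simp
    ultimately show ?thesis by (simp add: mult_le_0_iff)
  qed
  have "measure \<nu> D1 * \<eta> x \<le> Z * \<alpha> ^ n * \<phi>1 x" for n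
  proof -
    have "\<bar>(H.T ^^ n) (indicator D1) x - (\<integral>y. indicator D1 y \<partial>\<nu>) * \<eta> x\<bar> \<le> Z * \<alpha> ^ n * \<phi>1 x"
      using one_le_phi1 xE by (intro gap H.V_bounded_measurable[OF D1b])
        (auto simp: space_M indicator_def intro: order_trans[OF zero_le_one])
    moreover have "(\<integral>y. indicator D1 y \<partial>\<nu>) = measure \<nu> D1" using D1_M nu_sets by simp
    ultimately have "\<bar>0 - measure \<nu> D1 * \<eta> x\<bar> \<le> Z * \<alpha> ^ n * \<phi>1 x" unfolding T0 by (simp only:)
    then show ?thesis by linarith
  qed
  then have "measure \<nu> D1 * \<eta> x \<le> 0"
    using LIMSEQ_le_const[OF V_sum_limit[OF xE]] by blast
  moreover have "0 < \<eta> x" using eta(3,4) x by (auto intro: less_le_trans)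
  ultimately show ?thesis using measure_nonneg[of \<nu> D1] by (simp add: mult_le_0_iff)
qed

lemma nu_mem: "\<nu> \<in> space (prob_algebra (live_space S cem))"
  using nu_prob nu_sets by (simp add: space_prob_algebra)

lemma nu_pow: "f \<in> borel_measurable M \<Longrightarrow> (\<integral>\<^sup>+x. (RK 1 E ^^ n) f x \<partial>\<nu>) = ennreal (\<theta>0 ^ n) * (\<integral>\<^sup>+x. f x \<partial>\<nu>)"
proof -
  assume f: "f \<in> borel_measurable M"
  interpret E: positive_kernel M "killed_kernel S P X E 1" by (rule positive_killed_kernel[OF E_sets])
  have sp: "space \<nu> = E" using sets_eq_imp_space_eq[OF nu_sets] space_M by simp
  have "(\<integral>\<^sup>+x. (H.R ^^ n) f x \<partial>\<nu>) = (\<integral>\<^sup>+x. f x \<partial>\<nu>)"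
    by (induction n) (simp_all add: nu_inv H.pow_measurable f)
  moreover have "(\<integral>\<^sup>+x. s0 ^ n * (RK 1 E ^^ n) f x \<partial>\<nu>) = (\<integral>\<^sup>+x. (H.R ^^ n) f x \<partial>\<nu>)"
    using RK_pow_s0[OF _ f, of _ n] by (intro nn_integral_cong) (simp add: sp)
  ultimately have "ennreal (\<theta>0 ^ n) * (\<integral>\<^sup>+x. f x \<partial>\<nu>) = ennreal (\<theta>0 ^ n) * (\<integral>\<^sup>+x. s0 ^ n * (RK 1 E ^^ n) f x \<partial>\<nu>)"
    by simp
  also have "\<dots> = ennreal (\<theta>0 ^ n) * (s0 ^ n * (\<integral>\<^sup>+x. (RK 1 E ^^ n) f x \<partial>\<nu>))"
    using E.pow_measurable[OF f] nu_sets by (subst nn_integral_cmult) (simp_all cong: measurable_cong_sets)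
  also have "\<dots> = (\<integral>\<^sup>+x. (RK 1 E ^^ n) f x \<partial>\<nu>)"
    using theta0 by (simp add: mult.assoc[symmetric] ennreal_power ennreal_mult[symmetric] power_mult_distrib[symmetric])
  finally show ?thesis ..
qed

lemma cond_law_X:
  assumes mu: "\<mu> \<in> space (prob_algebra (live_space S cem))"
  shows "sets (cond_law S cem P X \<mu> n) = sets M"
    and "f \<in> borel_measurable M \<Longrightarrow>
      (\<integral>\<^sup>+x. f x \<partial>cond_law S cem P X \<mu> n) = (\<integral>\<^sup>+x. (RK 1 E ^^ n) f x \<partial>\<mu>) / (\<integral>\<^sup>+x. (RK 1 E ^^ n) (\<lambda>_. 1) x \<partial>\<mu>)"
proof -
  have "E \<union> {cem} = space S" using sets.sets_into_space[OF cem_measurable] by auto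
  then have "sets S = sets (restrict_space S (E \<union> {cem}))"
    unfolding \<open>E \<union> {cem} = space S\<close> by (auto simp: sets_restrict_space_iff dest: sets.sets_into_space[THEN subsetD])
  note * = cond_law_killed[OF killed_version_X mu this]
  show "sets (cond_law S cem P X \<mu> n) = sets M" by (rule *(1))
  show "f \<in> borel_measurable M \<Longrightarrow>
      (\<integral>\<^sup>+x. f x \<partial>cond_law S cem P X \<mu> n) = (\<integral>\<^sup>+x. (RK 1 E ^^ n) f x \<partial>\<mu>) / (\<integral>\<^sup>+x. (RK 1 E ^^ n) (\<lambda>_. 1) x \<partial>\<mu>)"
    by (rule *(2))
qed

lemma nu_qsd: "is_qsd S cem P X \<nu>" and nu_decay: "is_decay_parameter cem P X \<nu> \<theta>0"
proof -
  have mass: "(\<integral>\<^sup>+x. (RK 1 E ^^ n) (\<lambda>_. 1) x \<partial>\<nu>) = ennreal (\<theta>0 ^ n)" for n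
    using nu_pow[of "\<lambda>_. 1" n] prob_space.emeasure_space_1[OF nu_prob] by simp
  have "cond_law S cem P X \<nu> n = \<nu>" for n
  proof (rule measure_eqI)
    show "sets (cond_law S cem P X \<nu> n) = sets \<nu>" using cond_law_X(1)[OF nu_mem] nu_sets by simp
    fix A assume "A \<in> sets (cond_law S cem P X \<nu> n)"
    then have A: "A \<in> sets M" "A \<in> sets \<nu>" "A \<in> sets (cond_law S cem P X \<nu> n)" using cond_law_X(1)[OF nu_mem] nu_sets by auto
    have "emeasure (cond_law S cem P X \<nu> n) A = (\<integral>\<^sup>+x. indicator A x \<partial>cond_law S cem P X \<nu> n)" using A(3) by simp
    also have "\<dots> = ennreal (\<theta>0 ^ n) * emeasure \<nu> A / ennreal (\<theta>0 ^ n)"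
      using A by (subst cond_law_X(2)[OF nu_mem]) (auto simp: nu_pow mass)
    also have "\<dots> = emeasure \<nu> A"
      using theta0 by (subst mult.commute, subst ennreal_mult_divide_eq) auto
    finally show "emeasure (cond_law S cem P X \<nu> n) A = emeasure \<nu> A" .
  qed
  then show "is_qsd S cem P X \<nu>" unfolding is_qsd_def using nu_mem by blast
  show "is_decay_parameter cem P X \<nu> \<theta>0"
    unfolding is_decay_parameter_def start_survival(2)[OF killed_version_X nu_mem] mass using theta0 by simp
qed

end

section \<open>The lower weight and the convergence of conditional laws\<close>

context quasi_limit
begin

text \<open>
  Any value strictly between \<open>g\<close> and \<open>\<theta>0\<close> will do.
\<close>

definition \<theta>2 :: real where "\<theta>2 = (g + \<theta>0) / 2"

lemma theta2: "g < \<theta>2" "\<theta>2 < \<theta>0" "0 < \<theta>2"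
  using g g_bounds by (auto simp: \<theta>2_def)

text \<open>
  The probability to be in \<open>K\<close> at time \<open>k\<close>.
\<close>

definition kpow :: "nat \<Rightarrow> 'a \<Rightarrow> real" where
  "kpow k x = \<theta>0 ^ k * (H.T ^^ k) (indicator K) x"

lemma kpow_nonneg: "x \<in> E \<Longrightarrow> 0 \<le> kpow k x"
  unfolding kpow_def using theta0 by (intro mult_nonneg_nonneg H.Tpow_nonneg) (auto simp: space_M)

lemma kpow_bounded: "H.V_bounded (kpow k)"
  unfolding kpow_def[abs_def] by (intro H.V_bounded_cmult H.V_bounded_pow K_bounded)

lemma kpow_le_1: "x \<in> E \<Longrightarrow> kpow k x \<le> 1"
proof -
  assume x: "x \<in> E"
  then have xS: "x \<in> space S" by simp
  interpret Px: prob_space "P x" by (rule P_space[OF xS])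
  have "ennreal (kpow k x) = (RK 1 E ^^ k) (indicator K) x"
    unfolding kpow_def using Tpow_RK[OF K_bounded _ x, of k] by (simp add: ennreal_indicator)
  also have "\<dots> = (\<integral>\<^sup>+\<omega>. indicator K (X k \<omega>) * indicator (stays \<Omega> X E k) \<omega> \<partial>P x)"
    by (rule pow_killed_1[OF E_sets x indicator_M[OF K_sets]])
  also have "\<dots> \<le> (\<integral>\<^sup>+\<omega>. 1 \<partial>P x)" by (intro nn_integral_mono) (auto simp: indicator_def)
  also have "\<dots> = 1" by (simp add: Px.emeasure_space_1)
  finally show ?thesis by (simp add: ennreal_le_1)
qed

text \<open>
  For \<open>n \<ge> k\<close>, after a visit to \<open>K\<close> at time \<open>k\<close> the mass is at least \<open>a\<close>. For \<open>n < k\<close>, being in \<open>K\<close> at time \<open>k\<close> requires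
  survival until time \<open>n\<close>.
\<close>

lemma kpow_le_mass: "x \<in> E \<Longrightarrow> a * kpow k x \<le> (H.T ^^ n) (\<lambda>_. 1) x"
proof -
  assume x: "x \<in> E"
  have xM: "x \<in> space M" using x by (simp add: space_M)
  have Kn: "0 \<le> (H.T ^^ j) (indicator K) y" if "y \<in> E" for j y using that by (intro H.Tpow_nonneg) (auto simp: space_M)
  have pow1: "\<theta>0 ^ j \<le> 1" for j using theta0 by (intro power_le_one) auto
  show ?thesis
  proof (cases "k \<le> n")
    case True
    have lower: "a * indicator K y \<le> (H.T ^^ (n - k)) (\<lambda>_. 1) y" if y: "y \<in> space M" for y
    proof (cases "y \<in> K")
      case True
      have nn: "0 \<le> (H.T ^^ (n - k)) (\<lambda>_. 1) y" using y by (intro H.Tpow_nonneg) auto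
      have "ennreal a \<le> ennreal ((H.T ^^ (n - k)) (\<lambda>_. 1) y)"
        using H.mass_ge[OF True, of "n - k"] H.Tpow_eq_pow[OF one_bounded _ y, of "n - k"] by simp
      then show ?thesis using True nn by (simp add: ennreal_le_iff)
    next
      case False
      then show ?thesis using y by (auto intro: H.Tpow_nonneg)
    qed
    have "a * kpow k x \<le> a * (H.T ^^ k) (indicator K) x"
      unfolding kpow_def using H.a_pos Kn[OF x] pow1 mult_right_mono[OF pow1 Kn[OF x], of k k] by (intro mult_left_mono) auto
    also have "\<dots> = (H.T ^^ k) (\<lambda>y. a * indicator K y) x" by (rule H.Tpow_cmult[OF xM, symmetric])
    also have "\<dots> \<le> (H.T ^^ k) ((H.T ^^ (n - k)) (\<lambda>_. 1)) x"
      by (intro H.Tpow_mono H.V_bounded_cmult K_bounded H.V_bounded_pow one_bounded lower xM)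
    also have "\<dots> = (H.T ^^ n) (\<lambda>_. 1) x" using H.Tpow_plus[of k "n - k" "\<lambda>_. 1"] True by simp
    finally show ?thesis .
  next
    case False
    have k: "k = n + (k - n)" using False by simp
    have "kpow k x = \<theta>0 ^ n * (\<theta>0 ^ (k - n) * (H.T ^^ n) ((H.T ^^ (k - n)) (indicator K)) x)"
      unfolding kpow_def by (subst (1 2) k) (simp add: H.Tpow_plus power_add mult.assoc)
    also have "\<theta>0 ^ (k - n) * (H.T ^^ n) ((H.T ^^ (k - n)) (indicator K)) x = (H.T ^^ n) (kpow (k - n)) x"
      unfolding kpow_def[abs_def] by (rule H.Tpow_cmult[OF xM, symmetric])
    also have "\<theta>0 ^ n * (H.T ^^ n) (kpow (k - n)) x \<le> 1 * (H.T ^^ n) (\<lambda>_. 1) x"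
      using pow1 xM kpow_nonneg kpow_le_1 theta0
      by (intro mult_mono H.Tpow_mono kpow_bounded one_bounded H.Tpow_nonneg) (auto simp: space_M)
    finally have "kpow k x \<le> (H.T ^^ n) (\<lambda>_. 1) x" by simp
    moreover have "a * kpow k x \<le> 1 * kpow k x" using H.a_le_1 kpow_nonneg[OF x] by (intro mult_right_mono)
    ultimately show ?thesis by simp
  qed
qed

text \<open>
  By the gap, \<open>T^n 1_K\<close> is bounded below on \<open>K\<close> for large \<open>n\<close>, and \<open>(\<theta>0 / \<theta>2)^n\<close> tends to infinity.
\<close>

lemma return_to_K: "\<exists>N>0. \<forall>x\<in>K. 1 \<le> (\<theta>0 / \<theta>2) ^ N * (H.T ^^ N) (indicator K) x"
proof -
  define q where "q = measure \<nu> K * a'"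
  interpret n: prob_space \<nu> by (rule nu_prob)
  have "0 < measure \<nu> K" using nu_K by (simp add: n.emeasure_eq_measure)
  then have q: "0 < q" using eta(3) by (simp add: q_def)
  have r: "1 < \<theta>0 / \<theta>2" using theta2 by simp
  have K_int: "(\<integral>y. indicator K y \<partial>\<nu>) = measure \<nu> K" using K_M nu_sets by simp
  have "(\<lambda>n. Z * \<alpha> ^ n * v) \<longlonglongrightarrow> Z * 0 * v" using alpha by (intro tendsto_intros LIMSEQ_power_zero) auto
  then have "\<forall>\<^sub>F n in sequentially. Z * \<alpha> ^ n * v < q / 2" using q by (intro order_tendstoD(2)) auto
  moreover have "\<forall>\<^sub>F n in sequentially. 2 / q < (\<theta>0 / \<theta>2) ^ n"
  proof -
    obtain n0 where n0: "2 / q < (\<theta>0 / \<theta>2) ^ n0" using real_arch_pow[OF r] by blast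
    have "(\<theta>0 / \<theta>2) ^ n0 \<le> (\<theta>0 / \<theta>2) ^ n" if "n \<ge> n0" for n using r that by (intro power_increasing) auto
    then show ?thesis using n0 unfolding eventually_sequentially by (meson less_le_trans)
  qed
  moreover have "\<forall>\<^sub>F n in sequentially. 0 < n" by (rule eventually_gt_at_top)
  ultimately have "\<forall>\<^sub>F n in sequentially. 0 < n \<and> Z * \<alpha> ^ n * v < q / 2 \<and> 2 / q < (\<theta>0 / \<theta>2) ^ n"
    by eventually_elim auto
  then obtain N where N: "0 < N" "Z * \<alpha> ^ N * v < q / 2" "2 / q < (\<theta>0 / \<theta>2) ^ N"
    by (auto dest: eventually_happens)
  have "1 \<le> (\<theta>0 / \<theta>2) ^ N * (H.T ^^ N) (indicator K) x" if x: "x \<in> K" for x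
  proof -
    have xE: "x \<in> E" by (rule K_E[OF x])
    have "\<bar>(H.T ^^ N) (indicator K) x - measure \<nu> K * \<eta> x\<bar> \<le> Z * \<alpha> ^ N * \<phi>1 x"
      unfolding K_int[symmetric] using one_le_phi1 xE
      by (intro gap H.V_bounded_measurable[OF K_bounded])
        (auto simp: space_M indicator_def intro: order_trans[OF zero_le_one])
    moreover have "q \<le> measure \<nu> K * \<eta> x" unfolding q_def using eta(4)[OF x] by (intro mult_left_mono) auto
    moreover have "Z * \<alpha> ^ N * \<phi>1 x \<le> Z * \<alpha> ^ N * v" using H.V_le_K[OF x] alpha by (intro mult_left_mono) auto
    ultimately have "q / 2 \<le> (H.T ^^ N) (indicator K) x" using N(2) by linarith
    then have "2 / q * (q / 2) \<le> (\<theta>0 / \<theta>2) ^ N * (H.T ^^ N) (indicator K) x"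
      using N(3) q theta0 theta2 by (intro mult_mono) auto
    then show ?thesis using q by simp
  qed
  with N(1) show ?thesis by blast
qed

definition N2 :: nat where
  "N2 = (SOME N. 0 < N \<and> (\<forall>x\<in>K. 1 \<le> (\<theta>0 / \<theta>2) ^ N * (H.T ^^ N) (indicator K) x))"

lemma N2: "0 < N2" "x \<in> K \<Longrightarrow> 1 \<le> (\<theta>0 / \<theta>2) ^ N2 * (H.T ^^ N2) (indicator K) x"
  using someI_ex[OF return_to_K[unfolded Bex_def]] someI_ex[of "\<lambda>N. 0 < N \<and> (\<forall>x\<in>K. 1 \<le> (\<theta>0 / \<theta>2) ^ N * (H.T ^^ N) (indicator K) x)"]
    return_to_K unfolding N2_def by blast+

definition norm2 :: real where "norm2 = (\<Sum>k<N2. (1 / \<theta>2) ^ k)"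

definition \<phi>2 :: "'a \<Rightarrow> real" where
  "\<phi>2 x = 1 / norm2 * (\<Sum>k<N2. (1 / \<theta>2) ^ k * kpow k x)"

lemma norm2: "0 < norm2"
  unfolding norm2_def using N2(1) theta2 by (intro sum_pos) auto

lemma phi2_bounded: "H.V_bounded \<phi>2"
proof -
  have "H.V_bounded (\<lambda>x. \<Sum>k<n. (1 / \<theta>2) ^ k * kpow k x)" for n
    by (induction n) (simp_all only: sum.lessThan_Suc lessThan_0 sum.empty H.V_bounded_const H.V_bounded_add H.V_bounded_cmult kpow_bounded)
  then show ?thesis unfolding \<phi>2_def[abs_def] by (rule H.V_bounded_cmult)
qed

lemma phi2_nonneg: "x \<in> E \<Longrightarrow> 0 \<le> \<phi>2 x"
  unfolding \<phi>2_def using norm2 theta2 kpow_nonneg by (intro mult_nonneg_nonneg sum_nonneg) auto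

lemma phi2_le_1: "x \<in> E \<Longrightarrow> \<phi>2 x \<le> 1"
proof -
  assume x: "x \<in> E"
  have "(\<Sum>k<N2. (1 / \<theta>2) ^ k * kpow k x) \<le> (\<Sum>k<N2. (1 / \<theta>2) ^ k * 1)"
    using theta2 kpow_le_1[OF x] by (intro sum_mono mult_left_mono) auto
  also have "\<dots> = norm2" by (simp add: norm2_def)
  finally show ?thesis unfolding \<phi>2_def using norm2 by simp
qed

lemma phi2_ge_K: "x \<in> E \<Longrightarrow> 1 / norm2 * indicator K x \<le> \<phi>2 x"
proof -
  assume x: "x \<in> E"
  have "(\<Sum>k\<in>{0}. (1 / \<theta>2) ^ k * kpow k x) \<le> (\<Sum>k<N2. (1 / \<theta>2) ^ k * kpow k x)"
    using N2(1) theta2 kpow_nonneg[OF x] by (intro sum_mono2) auto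
  then have "indicator K x \<le> (\<Sum>k<N2. (1 / \<theta>2) ^ k * kpow k x)" by (simp add: kpow_def)
  then show ?thesis unfolding \<phi>2_def using norm2 by (intro mult_left_mono) auto
qed

lemma phi2_le_mass: "x \<in> E \<Longrightarrow> a * \<phi>2 x \<le> (H.T ^^ n) (\<lambda>_. 1) x"
proof -
  assume x: "x \<in> E"
  have "a * \<phi>2 x = 1 / norm2 * (\<Sum>k<N2. (1 / \<theta>2) ^ k * (a * kpow k x))"
    unfolding \<phi>2_def by (simp add: sum_distrib_left mult_ac)
  also have "\<dots> \<le> 1 / norm2 * (\<Sum>k<N2. (1 / \<theta>2) ^ k * (H.T ^^ n) (\<lambda>_. 1) x)"
    using norm2 theta2 kpow_le_mass[OF x] by (intro mult_left_mono sum_mono) auto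
  also have "\<dots> = (H.T ^^ n) (\<lambda>_. 1) x"
    unfolding sum_distrib_right[symmetric] norm2_def[symmetric] using norm2 by simp
  finally show ?thesis .
qed

text \<open>
  The sum over \<open>k < N2\<close> telescopes: one step multiplies it by \<open>\<theta>2\<close>, up to the loss of its first term, the
  indicator of \<open>K\<close>, which the new last term compensates by the choice of \<open>N2\<close>.
\<close>

lemma phi2_growth: "x \<in> E \<Longrightarrow> \<theta>2 * \<phi>2 x \<le> \<theta>0 * H.T \<phi>2 x"
proof -
  assume x: "x \<in> E"
  have xM: "x \<in> space M" using x by (simp add: space_M)
  let ?t = "\<lambda>k. (1 / \<theta>2) ^ k * kpow k x"
  have T_kpow: "\<theta>0 * H.T (kpow k) x = kpow (Suc k) x" for k
    unfolding kpow_def[abs_def] H.T_cmult by simp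
  have T_sum: "H.T (\<lambda>x. \<Sum>k<n. (1 / \<theta>2) ^ k * kpow k x) x = (\<Sum>k<n. (1 / \<theta>2) ^ k * H.T (kpow k) x) \<and>
      H.V_bounded (\<lambda>x. \<Sum>k<n. (1 / \<theta>2) ^ k * kpow k x)" for n
  proof (induction n)
    case 0
    then show ?case by (simp add: H.T_def H.V_bounded_const)
  next
    case (Suc n)
    have "H.V_bounded (\<lambda>x. (1 / \<theta>2) ^ n * kpow n x)" by (intro H.V_bounded_cmult kpow_bounded)
    with Suc xM show ?case unfolding sum.lessThan_Suc by (simp only: H.T_add H.T_cmult H.V_bounded_add)
  qed
  have last: "indicator K x \<le> ?t N2"
  proof (cases "x \<in> K")
    case True
    then show ?thesis using N2(2)[OF True] theta2 by (simp add: kpow_def power_divide)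
  next
    case False
    then show ?thesis using kpow_nonneg[OF x] theta2 by simp
  qed
  have "\<theta>0 * H.T \<phi>2 x = 1 / norm2 * (\<theta>0 * (\<Sum>k<N2. (1 / \<theta>2) ^ k * H.T (kpow k) x))"
    unfolding \<phi>2_def[abs_def] H.T_cmult using T_sum[of N2] by simp
  also have "\<theta>0 * (\<Sum>k<N2. (1 / \<theta>2) ^ k * H.T (kpow k) x) = (\<Sum>k<N2. \<theta>2 * ?t (Suc k))"
    unfolding sum_distrib_left using T_kpow theta2 by (intro sum.cong) (auto simp: mult.left_commute)
  also have "\<dots> = \<theta>2 * (\<Sum>k<N2. ?t (Suc k))" by (rule sum_distrib_left[symmetric])
  also have "(\<Sum>k<N2. ?t (Suc k)) = (\<Sum>k<N2. ?t k) + ?t N2 - ?t 0"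
    using sum.lessThan_Suc_shift[of ?t N2] sum.lessThan_Suc[of ?t N2] by linarith
  finally have eq: "\<theta>0 * H.T \<phi>2 x = 1 / norm2 * (\<theta>2 * ((\<Sum>k<N2. ?t k) + ?t N2 - ?t 0))" .
  have "?t 0 \<le> ?t N2" using last by (simp add: kpow_def)
  then have "1 / norm2 * (\<theta>2 * (\<Sum>k<N2. ?t k)) \<le> \<theta>0 * H.T \<phi>2 x"
    unfolding eq using norm2 theta2 by (intro mult_left_mono) auto
  then show ?thesis by (simp add: \<phi>2_def mult.left_commute)
qed

lemma assumption_E_X: "assumption_E S cem P X K \<phi>1 \<phi>2 g \<theta>2"
proof -
  obtain n1 c1 m where n1: "0 < n1" and m: "0 < c1" "prob_space m" "sets m = sets (restrict_space S K)"
    "\<And>x A. x \<in> K \<Longrightarrow> A \<in> sets S \<Longrightarrow> ennreal c1 * emeasure m (A \<inter> K) \<le> (RK 1 E ^^ n1) (indicator A) x"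
    "\<And>x. x \<in> K \<Longrightarrow> \<exists>n4. \<forall>n\<ge>n4. 0 < (RK 1 E ^^ n) (indicator K) x"
    using minorisation_X by metis
  obtain c where c: "0 < c" "\<And>x. x \<in> K \<Longrightarrow> step weight E x \<le> ennreal c"
    using weight_drift_K by metis
  interpret m: prob_space m by (rule m(2))
  interpret E: positive_kernel M "killed_kernel S P X E 1" by (rule positive_killed_kernel[OF E_sets])
  note KV = killed_version_X
  have KE: "K \<subseteq> E" using K_E by auto
  have ne: "K \<noteq> {}" by (rule H.K_nonempty)
  have ba: "0 < b / a" using H.b_ge_1 H.a_pos by simp
  have E1: "c1 * measure m (A \<inter> K) \<le> \<P>(\<omega> in P x. X n1 \<omega> \<in> A)" if x: "x \<in> K" and A: "A \<in> sets (live_space S cem)" for x A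
  proof -
    have A': "A \<in> sets S" "A \<subseteq> E" using A E_sets by (auto simp: sets_restrict_space_iff)
    have "ennreal (c1 * measure m (A \<inter> K)) \<le> ennreal (\<P>(\<omega> in P x. X n1 \<omega> \<in> A))"
      unfolding prob_killed[OF KV K_E[OF x] A'] using m(4)[OF x A'(1)] m(1)
      by (simp add: m.emeasure_eq_measure ennreal_mult')
    then show ?thesis by (subst (asm) ennreal_le_iff) auto
  qed
  have phi1_K: "\<phi>1 x = 1" if "x \<in> K" for x
    using phi1[OF K_E[OF that]] weight_K[OF that] by simp
  have drift1: "one_step cem P X \<phi>1 x \<le> ennreal (g * \<phi>1 x + c * indicator K x)" if x: "x \<in> E" for x
  proof -
    have "one_step cem P X \<phi>1 x = RK 1 E (\<lambda>y. ennreal (\<phi>1 y)) x" by (rule one_step_killed[OF KV x H.V_measurable])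
    also have "\<dots> = RK 1 E weight x" using x by (intro E.R_cong) (auto simp: space_M phi1)
    also have "\<dots> = step weight E x" by (rule step_E[OF x weight_measurable])
    also have "\<dots> \<le> ennreal g * weight x + ennreal c * indicator K x"
      using c(2)[of x] weight_drift_off_K[of x] x by (cases "x \<in> K"; auto intro: add_increasing)
    also have "\<dots> = ennreal (g * \<phi>1 x + c * indicator K x)"
      unfolding phi1[OF x, symmetric] using g c one_le_phi1[OF x]
      by (simp add: ennreal_plus ennreal_mult ennreal_indicator)
    finally show ?thesis .
  qed
  have drift2: "ennreal (\<theta>2 * \<phi>2 x) \<le> one_step cem P X \<phi>2 x" if x: "x \<in> E" for x
  proof -
    have "one_step cem P X \<phi>2 x = RK 1 E (\<lambda>y. ennreal (\<phi>2 y)) x"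
      by (rule one_step_killed[OF KV x H.V_bounded_measurable[OF phi2_bounded]])
    also have "\<dots> = ennreal (\<theta>0 * H.T \<phi>2 x)" using Tpow_RK[OF phi2_bounded phi2_nonneg x, of 1] by simp
    finally show ?thesis using phi2_growth[OF x] by (simp add: ennreal_leI)
  qed
  have mass: "ennreal (a * \<theta>0 ^ n) \<le> (RK 1 E ^^ n) (\<lambda>_. 1) y" "(RK 1 E ^^ n) (\<lambda>_. 1) y \<le> ennreal (b * \<theta>0 ^ n)"
    if y: "y \<in> K" for y n
  proof -
    have yE: "y \<in> E" by (rule K_E[OF y])
    have T: "ennreal ((H.T ^^ n) (\<lambda>_. 1) y) = (H.R ^^ n) (\<lambda>_. 1) y"
      using H.Tpow_eq_pow[OF one_bounded _, of y n] yE by (simp add: space_M)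
    have "0 \<le> (H.T ^^ n) (\<lambda>_. 1) y" using yE by (intro H.Tpow_nonneg) (auto simp: space_M)
    then have "a \<le> (H.T ^^ n) (\<lambda>_. 1) y" "(H.T ^^ n) (\<lambda>_. 1) y \<le> b"
      using H.mass_ge[OF y, of n] H.mass_le[OF y, of n] H.b_ge_1 unfolding T[symmetric] by auto
    then have "a * \<theta>0 ^ n \<le> \<theta>0 ^ n * (H.T ^^ n) (\<lambda>_. 1) y" "\<theta>0 ^ n * (H.T ^^ n) (\<lambda>_. 1) y \<le> b * \<theta>0 ^ n"
      using theta0 by (simp_all add: mult.commute)
    then show "ennreal (a * \<theta>0 ^ n) \<le> (RK 1 E ^^ n) (\<lambda>_. 1) y" "(RK 1 E ^^ n) (\<lambda>_. 1) y \<le> ennreal (b * \<theta>0 ^ n)"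
      using Tpow_RK[OF one_bounded _ yE, of n] by (simp_all add: ennreal_leI)
  qed
  have E3: "(SUP y\<in>K. emeasure (P y) {\<omega> \<in> space (P y). enat n < absorption_time X cem \<omega>}) /
      (INF y\<in>K. emeasure (P y) {\<omega> \<in> space (P y). enat n < absorption_time X cem \<omega>}) \<le> ennreal (b / a)" for n
  proof -
    let ?S = "SUP y\<in>K. emeasure (P y) {\<omega> \<in> space (P y). enat n < absorption_time X cem \<omega>}"
    let ?I = "INF y\<in>K. emeasure (P y) {\<omega> \<in> space (P y). enat n < absorption_time X cem \<omega>}"
    have surv: "emeasure (P y) {\<omega> \<in> space (P y). enat n < absorption_time X cem \<omega>} = (RK 1 E ^^ n) (\<lambda>_. 1) y" if "y \<in> K" for y
      by (rule survival_killed[OF KV K_E[OF that]])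
    have S: "?S \<le> ennreal (b * \<theta>0 ^ n)" by (intro SUP_least) (simp only: surv mass)
    have I: "ennreal (a * \<theta>0 ^ n) \<le> ?I" by (intro INF_greatest) (simp only: surv mass)
    obtain y where y: "y \<in> K" using ne by blast
    have "?I \<le> ennreal (b * \<theta>0 ^ n)" using mass(2)[OF y, of n] surv[OF y] by (intro INF_lower2[OF y]) simp
    then have "?I < \<infinity>" by (rule le_less_trans) simp
    then have fin: "?I \<noteq> \<infinity>" by (rule less_imp_neq)
    have pos: "?I \<noteq> 0" using I H.a_pos theta0 by (metis ennreal_eq_0_iff le_zero_eq mult_pos_pos not_le zero_less_power)
    have "?S \<le> ennreal (b / a) * ennreal (a * \<theta>0 ^ n)"
      using S H.a_pos H.b_ge_1 theta0 by (simp add: ennreal_mult[symmetric])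
    also have "\<dots> \<le> ennreal (b / a) * ?I" using I by (intro mult_left_mono) auto
    finally have "?S / ?I \<le> ennreal (b / a) * ?I / ?I" by (rule divide_right_mono_ennreal)
    also have "\<dots> = ennreal (b / a)" using pos fin by (intro ennreal_mult_divide_eq) auto
    finally show ?thesis .
  qed
  have E4: "\<exists>n4. \<forall>n\<ge>n4. 0 < \<P>(\<omega> in P x. X n \<omega> \<in> K)" if x: "x \<in> K" for x
    using m(5)[OF x] unfolding prob_killed[OF KV K_E[OF x] K_sets KE, symmetric] by simp
  have inf: "0 < (INF x\<in>K. \<phi>2 x)"
  proof -
    have "1 / norm2 \<le> (INF x\<in>K. \<phi>2 x)" using phi2_ge_K K_E by (intro cINF_greatest ne) fastforce
    then show ?thesis using norm2 by (smt (verit) divide_pos_pos)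
  qed
  show ?thesis
    unfolding assumption_E_def
  proof (intro conjI; (rule exI[of _ n1], rule exI[of _ c1], rule exI[of _ c], rule exI[of _ "b / a"], rule exI[of _ m], intro conjI)?)
    show "m \<in> space (prob_algebra (restrict_space S K))" using m by (simp add: space_prob_algebra)
    show "bdd_above (\<phi>1 ` K)" using phi1_K by (auto intro!: bdd_aboveI[where M=1])
    show "(SUP n. (SUP y\<in>K. emeasure (P y) {\<omega> \<in> space (P y). enat n < absorption_time X cem \<omega>}) /
      (INF y\<in>K. emeasure (P y) {\<omega> \<in> space (P y). enat n < absorption_time X cem \<omega>})) \<le> ennreal (b / a)"
      by (intro SUP_least E3)
    show "\<phi>2 \<in> borel_measurable (live_space S cem)" by (rule H.V_bounded_measurable[OF phi2_bounded])
    show "\<phi>1 \<in> borel_measurable (live_space S cem)" by (rule H.V_measurable)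
  qed (use n1 m(1) c(1) ba E1 theta2 g one_le_phi1 inf phi2_nonneg phi2_le_1 drift1 drift2 E4 K_sets KE in auto)
qed

lemma integrable_start:
  assumes mu: "\<mu> \<in> space (prob_algebra (live_space S cem))" "(\<integral>\<^sup>+x. ennreal (\<phi>1 x) \<partial>\<mu>) < \<infinity>" and f: "H.V_bounded f"
  shows "integrable \<mu> f"
  using mu f by (intro H.V_bounded_integrable) (auto simp: space_prob_algebra)

text \<open>
  The formula for nonnegative functions extends by linearity, as \<open>f + k \<phi>1\<close> and \<open>k \<phi>1\<close> are nonnegative.
\<close>

lemma cond_expectation:
  assumes mu: "\<mu> \<in> space (prob_algebra (live_space S cem))" "(\<integral>\<^sup>+x. ennreal (\<phi>1 x) \<partial>\<mu>) < \<infinity>"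
    and pos: "0 < (\<integral>x. (H.T ^^ n) (\<lambda>_. 1) x \<partial>\<mu>)" and f: "H.V_bounded f"
  shows "integrable (cond_law S cem P X \<mu> n) f"
    and "(\<integral>x. f x \<partial>cond_law S cem P X \<mu> n) = (\<integral>x. (H.T ^^ n) f x \<partial>\<mu>) / (\<integral>x. (H.T ^^ n) (\<lambda>_. 1) x \<partial>\<mu>)"
proof -
  let ?c = "cond_law S cem P X \<mu> n"
  let ?d = "\<integral>x. (H.T ^^ n) (\<lambda>_. 1) x \<partial>\<mu>"
  have sets_mu: "sets \<mu> = sets M" using mu(1) by (simp add: space_prob_algebra)
  have sp: "space \<mu> = E" using sets_eq_imp_space_eq[OF sets_mu] space_M by simp
  have sets_c: "sets ?c = sets M" by (rule cond_law_X(1)[OF mu(1)])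
  have spc: "space ?c = E" using sets_eq_imp_space_eq[OF sets_c] space_M by simp
  have nn: "(\<integral>\<^sup>+x. (RK 1 E ^^ n) (\<lambda>y. ennreal (h y)) x \<partial>\<mu>) = ennreal (\<theta>0 ^ n * (\<integral>x. (H.T ^^ n) h x \<partial>\<mu>))"
    if h: "H.V_bounded h" "\<And>y. y \<in> E \<Longrightarrow> 0 \<le> h y" for h
  proof -
    have "(\<integral>\<^sup>+x. (RK 1 E ^^ n) (\<lambda>y. ennreal (h y)) x \<partial>\<mu>) = (\<integral>\<^sup>+x. ennreal (\<theta>0 ^ n * (H.T ^^ n) h x) \<partial>\<mu>)"
      using h by (intro nn_integral_cong Tpow_RK) (auto simp: sp)
    also have "\<dots> = ennreal (\<integral>x. \<theta>0 ^ n * (H.T ^^ n) h x \<partial>\<mu>)"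
      using h theta0
      by (intro nn_integral_eq_integral integrable_start[OF mu] H.V_bounded_cmult H.V_bounded_pow AE_I2 mult_nonneg_nonneg H.Tpow_nonneg)
        (auto simp: sp space_M)
    finally show ?thesis by simp
  qed
  have nonneg: "integrable ?c h \<and> (\<integral>x. h x \<partial>?c) = (\<integral>x. (H.T ^^ n) h x \<partial>\<mu>) / ?d"
    if h: "H.V_bounded h" "\<And>y. y \<in> E \<Longrightarrow> 0 \<le> h y" for h
  proof -
    have hM: "h \<in> borel_measurable M" by (rule H.V_bounded_measurable[OF h(1)])
    have hc: "h \<in> borel_measurable ?c" using hM sets_c by (simp cong: measurable_cong_sets)
    have num: "0 \<le> (\<integral>x. (H.T ^^ n) h x \<partial>\<mu>)"
      using h by (intro Bochner_Integration.integral_nonneg H.Tpow_nonneg) (auto simp: sp space_M)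
    have "(\<integral>\<^sup>+x. ennreal (h x) \<partial>?c) = ennreal (\<theta>0 ^ n * (\<integral>x. (H.T ^^ n) h x \<partial>\<mu>)) / ennreal (\<theta>0 ^ n * ?d)"
      using hM nn[OF h] nn[OF one_bounded] by (subst cond_law_X(2)[OF mu(1)]) auto
    also have "\<dots> = ennreal ((\<theta>0 ^ n * (\<integral>x. (H.T ^^ n) h x \<partial>\<mu>)) / (\<theta>0 ^ n * ?d))"
      using theta0 pos num by (intro divide_ennreal) auto
    also have "(\<theta>0 ^ n * (\<integral>x. (H.T ^^ n) h x \<partial>\<mu>)) / (\<theta>0 ^ n * ?d) = (\<integral>x. (H.T ^^ n) h x \<partial>\<mu>) / ?d"
      using theta0 by simp
    finally have eq: "(\<integral>\<^sup>+x. ennreal (h x) \<partial>?c) = ennreal ((\<integral>x. (H.T ^^ n) h x \<partial>\<mu>) / ?d)" .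
    then have int: "integrable ?c h"
      using h(2) hc by (intro integrableI_nonneg AE_I2) (auto simp: spc)
    have "ennreal (\<integral>x. h x \<partial>?c) = ennreal ((\<integral>x. (H.T ^^ n) h x \<partial>\<mu>) / ?d)"
      unfolding eq[symmetric] using h(2) int by (intro nn_integral_eq_integral[symmetric] AE_I2) (auto simp: spc)
    then have "(\<integral>x. h x \<partial>?c) = (\<integral>x. (H.T ^^ n) h x \<partial>\<mu>) / ?d"
      using h(2) num pos by (subst (asm) ennreal_inj) (auto simp: spc intro!: Bochner_Integration.integral_nonneg)
    with int show ?thesis by blast
  qed
  obtain k where k: "0 \<le> k" "\<And>x. x \<in> space M \<Longrightarrow> \<bar>f x\<bar> \<le> k * \<phi>1 x" using H.V_boundedE[OF f] by metis
  have kV: "H.V_bounded (\<lambda>x. k * \<phi>1 x)" by (intro H.V_bounded_cmult H.V_bounded_V)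
  have sum: "H.V_bounded (\<lambda>x. f x + k * \<phi>1 x)" by (intro H.V_bounded_add f kV)
  have 1: "integrable ?c (\<lambda>x. f x + k * \<phi>1 x) \<and> (\<integral>x. f x + k * \<phi>1 x \<partial>?c) = (\<integral>x. (H.T ^^ n) (\<lambda>x. f x + k * \<phi>1 x) x \<partial>\<mu>) / ?d"
  proof (rule nonneg[OF sum])
    fix y assume "y \<in> E"
    then have "\<bar>f y\<bar> \<le> k * \<phi>1 y" using k(2) by (simp add: space_M)
    then show "0 \<le> f y + k * \<phi>1 y" by linarith
  qed
  have 2: "integrable ?c (\<lambda>x. k * \<phi>1 x) \<and> (\<integral>x. k * \<phi>1 x \<partial>?c) = (\<integral>x. (H.T ^^ n) (\<lambda>x. k * \<phi>1 x) x \<partial>\<mu>) / ?d"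
  proof (rule nonneg[OF kV])
    fix y assume "y \<in> E"
    then show "0 \<le> k * \<phi>1 y" using one_le_phi1[of y] k(1) by simp
  qed
  have "integrable ?c (\<lambda>x. (f x + k * \<phi>1 x) - k * \<phi>1 x)" using 1 2 by (intro Bochner_Integration.integrable_diff) auto
  then show int: "integrable ?c f" by simp
  have "(\<integral>x. f x \<partial>?c) = (\<integral>x. f x + k * \<phi>1 x \<partial>?c) - (\<integral>x. k * \<phi>1 x \<partial>?c)"
    using int 2 by simp
  also have "\<dots> = ((\<integral>x. (H.T ^^ n) (\<lambda>x. f x + k * \<phi>1 x) x \<partial>\<mu>) - (\<integral>x. (H.T ^^ n) (\<lambda>x. k * \<phi>1 x) x \<partial>\<mu>)) / ?d"
    using 1 2 by (simp add: diff_divide_distrib)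
  also have "(\<integral>x. (H.T ^^ n) (\<lambda>x. f x + k * \<phi>1 x) x \<partial>\<mu>) = (\<integral>x. (H.T ^^ n) f x + (H.T ^^ n) (\<lambda>x. k * \<phi>1 x) x \<partial>\<mu>)"
    using f kV by (intro Bochner_Integration.integral_cong refl H.Tpow_add) (auto simp: sp space_M)
  also have "\<dots> = (\<integral>x. (H.T ^^ n) f x \<partial>\<mu>) + (\<integral>x. (H.T ^^ n) (\<lambda>x. k * \<phi>1 x) x \<partial>\<mu>)"
    by (intro Bochner_Integration.integral_add integrable_start[OF mu] H.V_bounded_pow f kV)
  finally show "(\<integral>x. f x \<partial>?c) = (\<integral>x. (H.T ^^ n) f x \<partial>\<mu>) / ?d" by simp
qed

definition rate_const :: real where
  "rate_const = Z * (1 + (\<integral>x. \<phi>1 x \<partial>\<nu>)) / a"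

lemma nu_phi1_nonneg: "0 \<le> (\<integral>x. \<phi>1 x \<partial>\<nu>)"
proof -
  have "space \<nu> = E" using sets_eq_imp_space_eq[OF nu_sets] space_M by simp
  then show ?thesis using H.V_nonneg by (intro Bochner_Integration.integral_nonneg) (auto simp: space_M)
qed

lemma rate_const: "0 < rate_const"
  unfolding rate_const_def using alpha H.a_pos nu_phi1_nonneg
  by (intro divide_pos_pos mult_pos_pos add_pos_nonneg) auto

text \<open>
  The error of the quotient is \<open>\<mu>(T^n f - \<nu>(f) T^n 1) / \<mu>(T^n 1)\<close>. The gap, used for \<open>f\<close> and for \<open>1\<close>, bounds the
  numerator by a multiple of \<open>\<alpha>^n \<mu>(\<phi>1)\<close>, and the denominator is at least \<open>a \<mu>(\<phi>2)\<close>.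
\<close>

lemma convergence:
  assumes mu: "\<mu> \<in> space (prob_algebra (live_space S cem))" "(\<integral>\<^sup>+x. ennreal (\<phi>1 x) \<partial>\<mu>) < \<infinity>"
    "0 < (\<integral>\<^sup>+x. ennreal (\<phi>2 x) \<partial>\<mu>)"
  shows "weighted_tv \<phi>1 (cond_law S cem P X \<mu> n) \<nu>
    \<le> ennreal (rate_const * \<alpha> ^ n) * ((\<integral>\<^sup>+x. ennreal (\<phi>1 x) \<partial>\<mu>) / (\<integral>\<^sup>+x. ennreal (\<phi>2 x) \<partial>\<mu>))"
proof -
  let ?c = "cond_law S cem P X \<mu> n"
  let ?d = "\<integral>x. (H.T ^^ n) (\<lambda>_. 1) x \<partial>\<mu>"
  note int = integrable_start[OF mu(1,2)]
  have sets_mu: "sets \<mu> = sets M" using mu(1) by (simp add: space_prob_algebra)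
  have sp: "space \<mu> = E" using sets_eq_imp_space_eq[OF sets_mu] space_M by simp
  have spn: "space \<nu> = E" using sets_eq_imp_space_eq[OF nu_sets] space_M by simp
  have sets_c: "sets ?c = sets M" by (rule cond_law_X(1)[OF mu(1)])
  have spc: "space ?c = E" using sets_eq_imp_space_eq[OF sets_c] space_M by simp
  define p1 p2 where "p1 = (\<integral>x. \<phi>1 x \<partial>\<mu>)" and "p2 = (\<integral>x. \<phi>2 x \<partial>\<mu>)"
  have p1: "(\<integral>\<^sup>+x. ennreal (\<phi>1 x) \<partial>\<mu>) = ennreal p1"
    unfolding p1_def using one_le_phi1 by (intro nn_integral_eq_integral int H.V_bounded_V AE_I2) (auto simp: sp intro: order_trans[OF zero_le_one])
  have p2: "(\<integral>\<^sup>+x. ennreal (\<phi>2 x) \<partial>\<mu>) = ennreal p2"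
    unfolding p2_def using phi2_nonneg by (intro nn_integral_eq_integral int phi2_bounded AE_I2) (auto simp: sp)
  have p2_pos: "0 < p2" using mu(3) unfolding p2 by simp
  have p1_nn: "0 \<le> p1" unfolding p1_def using H.V_nonneg by (intro Bochner_Integration.integral_nonneg) (auto simp: sp space_M)
  have d_ge: "a * p2 \<le> ?d"
  proof -
    have "a * p2 = (\<integral>x. a * \<phi>2 x \<partial>\<mu>)" unfolding p2_def by simp
    also have "\<dots> \<le> ?d"
      using phi2_le_mass by (intro Bochner_Integration.integral_mono int H.V_bounded_cmult H.V_bounded_pow phi2_bounded one_bounded) (auto simp: sp)
    finally show ?thesis .
  qed
  have d_pos: "0 < ?d" using d_ge p2_pos H.a_pos by (auto intro: less_le_trans[OF mult_pos_pos])
  have nu_int: "integrable \<nu> h" if "H.V_bounded h" for h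
    using that nu_sets nu_phi1 by (intro H.V_bounded_integrable)
  have bound: "\<bar>(\<integral>x. f x \<partial>?c) - (\<integral>x. f x \<partial>\<nu>)\<bar> \<le> rate_const * \<alpha> ^ n * (p1 / p2)"
    if f: "f \<in> borel_measurable M" "\<And>y. y \<in> E \<Longrightarrow> \<bar>f y\<bar> \<le> \<phi>1 y" for f
  proof -
    have fV: "H.V_bounded f" using f by (intro H.V_boundedI[where c=1]) (auto simp: space_M)
    let ?nf = "\<integral>x. f x \<partial>\<nu>"
    have nf: "\<bar>?nf\<bar> \<le> (\<integral>x. \<phi>1 x \<partial>\<nu>)"
      using f(2) nu_int[OF fV] nu_int[OF H.V_bounded_V]
      by (intro order_trans[OF integral_abs_bound] Bochner_Integration.integral_mono) (auto simp: spn)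
    let ?g = "\<lambda>x. (H.T ^^ n) f x - ?nf * (H.T ^^ n) (\<lambda>_. 1) x"
    have gV: "H.V_bounded ?g" by (intro H.V_bounded_diff H.V_bounded_cmult H.V_bounded_pow fV one_bounded)
    have g_le: "\<bar>?g x\<bar> \<le> Z * (1 + (\<integral>x. \<phi>1 x \<partial>\<nu>)) * \<alpha> ^ n * \<phi>1 x" if x: "x \<in> E" for x
    proof -
      have 1: "\<bar>(H.T ^^ n) f x - ?nf * \<eta> x\<bar> \<le> Z * \<alpha> ^ n * \<phi>1 x" using x f by (intro gap) (auto simp: space_M)
      have 2: "\<bar>(H.T ^^ n) (\<lambda>_. 1) x - \<eta> x\<bar> \<le> Z * \<alpha> ^ n * \<phi>1 x"
        using gap[of "\<lambda>_. 1" x n] x one_le_phi1 prob_space.prob_space[OF nu_prob] by (simp add: space_M)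
      have "\<bar>?nf * ((H.T ^^ n) (\<lambda>_. 1) x - \<eta> x)\<bar> \<le> (\<integral>x. \<phi>1 x \<partial>\<nu>) * (Z * \<alpha> ^ n * \<phi>1 x)"
        unfolding abs_mult using 2 nf by (intro mult_mono) auto
      then have "\<bar>?g x\<bar> \<le> Z * \<alpha> ^ n * \<phi>1 x + (\<integral>x. \<phi>1 x \<partial>\<nu>) * (Z * \<alpha> ^ n * \<phi>1 x)"
        using 1 unfolding right_diff_distrib by linarith
      then show ?thesis by (simp add: algebra_simps)
    qed
    have "(\<integral>x. f x \<partial>?c) - ?nf = (\<integral>x. ?g x \<partial>\<mu>) / ?d"
    proof -
      have "(\<integral>x. ?g x \<partial>\<mu>) = (\<integral>x. (H.T ^^ n) f x \<partial>\<mu>) - ?nf * ?d"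
        using int[OF H.V_bounded_pow[OF fV]] int[OF H.V_bounded_pow[OF one_bounded]] by simp
      then show ?thesis using cond_expectation(2)[OF mu(1,2) d_pos fV] d_pos by (simp add: field_simps)
    qed
    then have "\<bar>(\<integral>x. f x \<partial>?c) - ?nf\<bar> = \<bar>\<integral>x. ?g x \<partial>\<mu>\<bar> / ?d" using d_pos by simp
    also have "\<dots> \<le> (\<integral>x. Z * (1 + (\<integral>x. \<phi>1 x \<partial>\<nu>)) * \<alpha> ^ n * \<phi>1 x \<partial>\<mu>) / ?d"
      using int[OF gV] int[OF H.V_bounded_V] g_le d_pos
      by (intro divide_right_mono order_trans[OF integral_abs_bound] Bochner_Integration.integral_mono) (auto simp: sp)
    also have "\<dots> = Z * (1 + (\<integral>x. \<phi>1 x \<partial>\<nu>)) * \<alpha> ^ n * p1 / ?d" by (simp add: p1_def)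
    also have "\<dots> \<le> Z * (1 + (\<integral>x. \<phi>1 x \<partial>\<nu>)) * \<alpha> ^ n * p1 / (a * p2)"
      using d_ge d_pos p2_pos H.a_pos alpha p1_nn nu_phi1_nonneg by (intro divide_left_mono mult_nonneg_nonneg mult_pos_pos) auto
    also have "\<dots> = rate_const * \<alpha> ^ n * (p1 / p2)" by (simp add: rate_const_def)
    finally show ?thesis .
  qed
  have "weighted_tv \<phi>1 ?c \<nu> = (SUP f\<in>{f \<in> borel_measurable ?c. \<forall>x\<in>space ?c. \<bar>f x\<bar> \<le> \<phi>1 x}. ennreal \<bar>(\<integral>x. f x \<partial>?c) - (\<integral>x. f x \<partial>\<nu>)\<bar>)"
    unfolding weighted_tv_def using cond_expectation(1)[OF mu(1,2) d_pos H.V_bounded_V] nu_int[OF H.V_bounded_V] by simp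
  also have "\<dots> \<le> ennreal (rate_const * \<alpha> ^ n * (p1 / p2))"
  proof (intro SUP_least ennreal_leI)
    fix f assume "f \<in> {f \<in> borel_measurable ?c. \<forall>x\<in>space ?c. \<bar>f x\<bar> \<le> \<phi>1 x}"
    then have "f \<in> borel_measurable ?c" "\<And>x. x \<in> E \<Longrightarrow> \<bar>f x\<bar> \<le> \<phi>1 x" unfolding spc by auto
    moreover from this(1) have "f \<in> borel_measurable M" using sets_c by (simp cong: measurable_cong_sets)
    ultimately show "\<bar>(\<integral>x. f x \<partial>?c) - (\<integral>x. f x \<partial>\<nu>)\<bar> \<le> rate_const * \<alpha> ^ n * (p1 / p2)" by (intro bound)
  qed
  also have "\<dots> = ennreal (rate_const * \<alpha> ^ n) * (ennreal p1 / ennreal p2)"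
    unfolding divide_ennreal[OF p1_nn p2_pos] using p1_nn p2_pos rate_const alpha by (intro ennreal_mult) auto
  finally show ?thesis unfolding p1 p2 .
qed

lemma nu_qsd_for: "is_qsd_for S cem P X \<phi>1 \<phi>2 \<nu>"
proof -
  have spn: "space \<nu> = E" using sets_eq_imp_space_eq[OF nu_sets] space_M by simp
  have "0 < ennreal (1 / norm2) * emeasure \<nu> K" using norm2 nu_K by (simp add: ennreal_zero_less_mult_iff)
  also have "\<dots> = (\<integral>\<^sup>+x. ennreal (1 / norm2) * indicator K x \<partial>\<nu>)" using K_M nu_sets by (simp add: nn_integral_cmult)
  also have "\<dots> \<le> (\<integral>\<^sup>+x. ennreal (\<phi>2 x) \<partial>\<nu>)"
  proof (intro nn_integral_mono)
    fix x assume "x \<in> space \<nu>"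
    then have "ennreal (1 / norm2 * indicator K x) \<le> ennreal (\<phi>2 x)" unfolding spn by (intro ennreal_leI phi2_ge_K)
    then show "ennreal (1 / norm2) * indicator K x \<le> ennreal (\<phi>2 x)"
      by (cases "x \<in> K") auto
  qed
  finally show ?thesis unfolding is_qsd_for_def using nu_qsd nu_phi1 by simp
qed

text \<open>
  The conditional laws of a quasi-stationary distribution are constant in time, so the rate of
  convergence forces its distance to \<open>\<nu>\<close> to vanish.
\<close>

lemma qsd_unique:
  assumes "is_qsd_for S cem P X \<phi>1 \<phi>2 \<nu>'"
  shows "\<nu>' = \<nu>"
proof -
  have qsd: "\<nu>' \<in> space (prob_algebra (live_space S cem))" "\<And>n. cond_law S cem P X \<nu>' n = \<nu>'"
    and fin: "(\<integral>\<^sup>+x. ennreal (\<phi>1 x) \<partial>\<nu>') < \<infinity>" "0 < (\<integral>\<^sup>+x. ennreal (\<phi>2 x) \<partial>\<nu>')"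
    using assms unfolding is_qsd_for_def is_qsd_def by auto
  have sets': "sets \<nu>' = sets M" using qsd(1) by (simp add: space_prob_algebra)
  have sp: "space \<nu>' = E" using sets_eq_imp_space_eq[OF sets'] space_M by simp
  interpret n': prob_space \<nu>' using qsd(1) by (simp add: space_prob_algebra)
  interpret n: prob_space \<nu> by (rule nu_prob)
  define q where "q = (\<integral>\<^sup>+x. ennreal (\<phi>1 x) \<partial>\<nu>') / (\<integral>\<^sup>+x. ennreal (\<phi>2 x) \<partial>\<nu>')"
  have "q < \<infinity>" unfolding q_def using fin by (auto simp: less_top[symmetric] ennreal_divide_eq_top_iff)
  then obtain r where r: "q = ennreal r" "0 \<le> r" by (cases q) auto
  have int: "integrable \<nu>' \<phi>1" "integrable \<nu> \<phi>1"
    using sets' fin nu_sets nu_phi1 by (auto intro!: H.V_bounded_integrable H.V_bounded_V)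
  show ?thesis
  proof (rule measure_eqI)
    show "sets \<nu>' = sets \<nu>" using sets' nu_sets by simp
    fix A assume A: "A \<in> sets \<nu>'"
    have AM: "A \<in> sets M" "A \<in> sets \<nu>" using A sets' nu_sets by auto
    have le: "\<bar>measure \<nu>' A - measure \<nu> A\<bar> \<le> rate_const * \<alpha> ^ n * r" for n
    proof -
      have mem: "indicator A \<in> {f \<in> borel_measurable \<nu>'. \<forall>x\<in>space \<nu>'. \<bar>f x\<bar> \<le> \<phi>1 x}"
        using A one_le_phi1 by (auto simp: sp indicator_def intro: order_trans[OF zero_le_one])
      have "ennreal \<bar>(\<integral>x. indicator A x \<partial>\<nu>') - (\<integral>x. indicator A x \<partial>\<nu>)\<bar> \<le> weighted_tv \<phi>1 \<nu>' \<nu>"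
        unfolding weighted_tv_def using int by (simp only: if_True simp_thms) (rule SUP_upper[OF mem])
      also have "\<dots> \<le> ennreal (rate_const * \<alpha> ^ n) * q"
        using convergence[OF qsd(1) fin, of n] unfolding qsd(2) q_def .
      also have "\<dots> = ennreal (rate_const * \<alpha> ^ n * r)"
        unfolding r(1) using rate_const alpha r(2) by (simp add: ennreal_mult)
      finally show ?thesis using A AM rate_const alpha r(2) by (subst (asm) ennreal_le_iff) auto
    qed
    have "(\<lambda>n. rate_const * \<alpha> ^ n * r) \<longlonglongrightarrow> rate_const * 0 * r"
      using alpha by (intro tendsto_intros LIMSEQ_power_zero) auto
    then have "\<bar>measure \<nu>' A - measure \<nu> A\<bar> \<le> rate_const * 0 * r" using le by (intro LIMSEQ_le_const) auto
    then have "measure \<nu>' A = measure \<nu> A" by simp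
    then show "emeasure \<nu>' A = emeasure \<nu> A" by (simp add: n'.emeasure_eq_measure n.emeasure_eq_measure)
  qed
qed

end

section \<open>Existence of the limiting data and the theorem\<close>

context reducible_weight
begin

text \<open>
  The measure from which the invariant one is built is \<open>\<nu>Y\<close>, extended by zero to \<open>E\<close>. It is subinvariant because
  the kernel of \<open>X\<close> dominates that of \<open>Y\<close>, under which \<open>\<nu>Y\<close> is invariant.
\<close>

lemma quasi_limit_exists:
  "\<exists>\<phi>1 \<rho> C a b n1 c1 v m \<nu> \<eta> \<alpha> Z a'.
    quasi_limit S cem \<Omega> P X D1 D2 D3 K SY Y \<phi>1Y \<phi>2Y \<theta>1Y \<theta>2Y \<theta>0 \<gamma> \<nu>Y g \<phi>1 \<rho> C a b n1 c1 v m \<nu> \<eta> \<alpha> Z a'"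
proof -
  let ?V = "\<lambda>x. enn2real (weight x)"
  obtain \<rho> C a b n1 c1 v m where harris: "harris_kernel M (killed_kernel S P X E s0) K ?V \<rho> C a b n1 c1 v m"
    and nuYK: "0 < emeasure \<nu>Y K"
    by (rule harris_X) blast
  interpret H: harris_kernel M "killed_kernel S P X E s0" K ?V \<rho> C a b n1 c1 v m by (rule harris)
  have V_eq: "ennreal (?V x) = weight x" if "x \<in> E" for x using weight_finite[OF that] by simp
  have sets_nuY: "sets \<nu>Y = sets (restrict_space S D2)" using nuY(1) by (simp add: space_prob_algebra)
  have sp: "space \<nu>Y = D2" using sets_eq_imp_space_eq[OF sets_nuY] D_space by (auto simp: space_restrict_space)
  have id: "(\<lambda>x. x) \<in> \<nu>Y \<rightarrow>\<^sub>M M"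
  proof -
    have "(\<lambda>x. x) \<in> restrict_space S D2 \<rightarrow>\<^sub>M M"
      using D_E by (intro measurable_restrict_space2 measurable_restrict_space1) (auto simp: space_restrict_space)
    then show ?thesis using sets_nuY by (simp cong: measurable_cong_sets)
  qed
  define \<mu> where "\<mu> = distr \<nu>Y M (\<lambda>x. x)"
  have int_mu: "(\<integral>\<^sup>+x. f x \<partial>\<mu>) = (\<integral>\<^sup>+x. f x \<partial>\<nu>Y)" if "f \<in> borel_measurable M" for f :: "'a \<Rightarrow> ennreal"
    unfolding \<mu>_def using that id by (intro nn_integral_distr) auto
  have mu_sets: "sets \<mu> = sets M" by (simp add: \<mu>_def)
  have mu_V: "(\<integral>\<^sup>+x. ennreal (?V x) \<partial>\<mu>) < \<infinity>"
  proof -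
    obtain A M0 where A: "0 < A" "\<And>x. x \<in> D2 \<Longrightarrow> weight x \<le> ennreal (A * \<phi>1Y x)"
      using weight_bounds by metis
    have "(\<integral>\<^sup>+x. ennreal (?V x) \<partial>\<mu>) = (\<integral>\<^sup>+x. ennreal (?V x) \<partial>\<nu>Y)" by (intro int_mu) measurable
    also have "\<dots> \<le> (\<integral>\<^sup>+x. ennreal A * ennreal (\<phi>1Y x) \<partial>\<nu>Y)"
      using A D_E by (intro nn_integral_mono) (simp add: sp V_eq ennreal_mult')
    also have "\<dots> = ennreal A * (\<integral>\<^sup>+x. ennreal (\<phi>1Y x) \<partial>\<nu>Y)"
      using measurable_phi1Y sets_nuY by (intro nn_integral_cmult) (simp cong: measurable_cong_sets)
    also have "\<dots> < \<infinity>" using nuY(2) by (simp add: ennreal_mult_less_top)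
    finally show ?thesis .
  qed
  have mu_K: "0 < emeasure \<mu> K"
  proof -
    have "emeasure \<mu> K = emeasure \<nu>Y K"
      unfolding \<mu>_def using id K_M K_D2 by (subst emeasure_distr) (auto simp: sp intro!: arg_cong[where f="emeasure \<nu>Y"])
    then show ?thesis using nuYK by simp
  qed
  have mu_sub: "(\<integral>\<^sup>+x. f x \<partial>\<mu>) \<le> (\<integral>\<^sup>+x. H.R f x \<partial>\<mu>)" if f: "f \<in> borel_measurable M" for f
  proof -
    have f2: "f \<in> borel_measurable (restrict_space S D2)" using D_E D_sets by (intro measurable_sub[OF _ _ f]) auto
    have "(\<integral>\<^sup>+x. f x \<partial>\<mu>) = (\<integral>\<^sup>+x. RK s0 D2 f x \<partial>\<nu>Y)" using int_mu[OF f] nuY(3)[OF f2] by simp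
    also have "\<dots> \<le> (\<integral>\<^sup>+x. H.R f x \<partial>\<nu>Y)"
      using RK_D2_le_E[OF f, where n=1 and s=s0] by (intro nn_integral_mono) (simp add: sp)
    also have "\<dots> = (\<integral>\<^sup>+x. H.R f x \<partial>\<mu>)" by (rule int_mu[OF H.measurable_kernel_op[OF f], symmetric])
    finally show ?thesis .
  qed
  obtain \<nu> where nu: "prob_space \<nu>" "sets \<nu> = sets M" "(\<integral>\<^sup>+x. ennreal (?V x) \<partial>\<nu>) < \<infinity>" "0 < emeasure \<nu> K"
    "\<And>f. f \<in> borel_measurable M \<Longrightarrow> (\<integral>\<^sup>+x. H.R f x \<partial>\<nu>) = (\<integral>\<^sup>+x. f x \<partial>\<nu>)"
    by (rule H.invariant_measure[OF mu_sets mu_V mu_K mu_sub]) auto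
  obtain \<eta> \<alpha> Z a' where eta: "H.V_bounded \<eta>" "\<And>x. 0 \<le> \<eta> x" "0 < a'" "\<And>x. x \<in> K \<Longrightarrow> a' \<le> \<eta> x"
    "0 < \<alpha>" "\<alpha> < 1" "0 < Z"
    "\<And>f n x. f \<in> borel_measurable M \<Longrightarrow> (\<And>y. y \<in> space M \<Longrightarrow> \<bar>f y\<bar> \<le> ?V y) \<Longrightarrow> x \<in> space M \<Longrightarrow>
      \<bar>(H.T ^^ n) f x - (\<integral>y. f y \<partial>\<nu>) * \<eta> x\<bar> \<le> Z * \<alpha> ^ n * ?V x"
    using H.spectral_gap[OF nu] by metis
  have "quasi_limit S cem \<Omega> P X D1 D2 D3 K SY Y \<phi>1Y \<phi>2Y \<theta>1Y \<theta>2Y \<theta>0 \<gamma> \<nu>Y g ?V \<rho> C a b n1 c1 v m \<nu> \<eta> \<alpha> Z a'"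
    by (intro quasi_limit.intro quasi_limit_axioms.intro reducible_weight_axioms harris V_eq nu eta)
  then show ?thesis by blast
qed

end

theorem theorem6p1:
  fixes S :: "'a measure" and cem :: 'a and \<Omega> :: "'w measure"
    and P :: "'a \<Rightarrow> 'w measure" and X Y :: "nat \<Rightarrow> 'w \<Rightarrow> 'a"
    and D1 D2 D3 K :: "'a set" and SY :: "'a measure"
    and \<phi>1Y \<phi>2Y :: "'a \<Rightarrow> real" and \<theta>1Y \<theta>2Y \<theta>0Y \<gamma> :: real and \<nu>Y :: "'a measure"
  assumes "absorbed_markov_process S cem \<Omega> P X"
    and "reducible_partition S cem P X D1 D2 D3"
    and SY_def: "SY = restrict_space S (D2 \<union> {cem})"
    and Y_def: "Y = killed_process X cem (D1 \<union> D3 \<union> {cem})"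
    and H1: "assumption_E SY cem P Y K \<phi>1Y \<phi>2Y \<theta>1Y \<theta>2Y"
    and "is_qsd_for SY cem P Y \<phi>1Y \<phi>2Y \<nu>Y"
    and "is_decay_parameter cem P Y \<nu>Y \<theta>0Y"
    and H2: "hypothesis_H2 S cem P X D1 D2 D3 \<phi>1Y \<theta>0Y \<gamma>"
  shows "\<forall>g. \<gamma> \<le> g \<and> \<theta>1Y < g \<and> g < \<theta>0Y \<longrightarrow>
    (\<exists>\<phi>1 \<phi>2 \<theta>1 \<theta>2 c.
       (\<forall>x\<in>space S - {cem}. ennreal (\<phi>1 x) =
          (\<integral>\<^sup>+\<omega>. inv_pow g (min (hitting_time X K \<omega>) (absorption_time X cem \<omega>)) \<partial>P x)) \<and>
       0 < c \<and> (\<forall>x\<in>space S - {cem}. c * indicator K x \<le> \<phi>2 x) \<and>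
       assumption_E S cem P X K \<phi>1 \<phi>2 \<theta>1 \<theta>2 \<and>
       (\<exists>\<nu>. is_qsd_for S cem P X \<phi>1 \<phi>2 \<nu> \<and>
          (\<forall>\<nu>'. is_qsd_for S cem P X \<phi>1 \<phi>2 \<nu>' \<longrightarrow> \<nu>' = \<nu>) \<and>
          (\<exists>C \<alpha>. 0 < C \<and> 0 < \<alpha> \<and> \<alpha> < 1 \<and>
             (\<forall>\<mu>\<in>space (prob_algebra (live_space S cem)).
                (\<integral>\<^sup>+x. ennreal (\<phi>1 x) \<partial>\<mu>) < \<infinity> \<longrightarrow> 0 < (\<integral>\<^sup>+x. ennreal (\<phi>2 x) \<partial>\<mu>) \<longrightarrow>
                (\<forall>n. weighted_tv \<phi>1 (cond_law S cem P X \<mu> n) \<nu>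
                       \<le> ennreal (C * \<alpha> ^ n) * ((\<integral>\<^sup>+x. ennreal (\<phi>1 x) \<partial>\<mu>) / (\<integral>\<^sup>+x. ennreal (\<phi>2 x) \<partial>\<mu>))))) \<and>
          (\<exists>\<theta>0. is_decay_parameter cem P X \<nu> \<theta>0 \<and> \<theta>0 = \<theta>0Y \<and>
             measure \<nu> D1 = 0 \<and>
             (\<exists>\<eta> :: 'a \<Rightarrow> real.
                (\<forall>x\<in>space S - {cem}.
                   (\<lambda>n. \<theta>0 powi (- int n) * \<P>(\<omega> in P x. enat n < absorption_time X cem \<omega>))
                     \<longlonglongrightarrow> \<eta> x) \<and>
                (\<forall>x\<in>D3. \<eta> x = 0)))))"
proof (intro allI impI, goal_cases)
  case g: (1 g)
  have "reducible_process S cem \<Omega> P X D1 D2 D3 K SY Y \<phi>1Y \<phi>2Y \<theta>1Y \<theta>2Y \<theta>0Y \<gamma> \<nu>Y"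
    by (intro reducible_process.intro reducible_process_axioms.intro assms)
  then have weight: "reducible_weight S cem \<Omega> P X D1 D2 D3 K SY Y \<phi>1Y \<phi>2Y \<theta>1Y \<theta>2Y \<theta>0Y \<gamma> \<nu>Y g"
    using g by (intro reducible_weight.intro reducible_weight_axioms.intro) auto
  obtain \<phi>1 \<rho> C a b n1 c1 v m \<nu> \<eta> \<alpha> Z a' where
    "quasi_limit S cem \<Omega> P X D1 D2 D3 K SY Y \<phi>1Y \<phi>2Y \<theta>1Y \<theta>2Y \<theta>0Y \<gamma> \<nu>Y g \<phi>1 \<rho> C a b n1 c1 v m \<nu> \<eta> \<alpha> Z a'"
    using reducible_weight.quasi_limit_exists[OF weight] by blast
  then interpret Q: quasi_limit S cem \<Omega> P X D1 D2 D3 K SY Y \<phi>1Y \<phi>2Y \<theta>1Y \<theta>2Y \<theta>0Y \<gamma> \<nu>Y g \<phi>1 \<rho> C a b n1 c1 v m \<nu> \<eta> \<alpha> Z a' .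
  show ?case
  proof (intro exI conjI ballI allI impI)
    fix x assume "x \<in> space S - {cem}"
    then show "ennreal (\<phi>1 x) = (\<integral>\<^sup>+\<omega>. inv_pow g (min (hitting_time X K \<omega>) (absorption_time X cem \<omega>)) \<partial>P x)"
      using Q.phi1 unfolding Q.weight_def by blast
  next
    show "0 < 1 / Q.norm2" using Q.norm2 by simp
  next
    fix x assume "x \<in> space S - {cem}"
    then show "1 / Q.norm2 * indicator K x \<le> Q.\<phi>2 x" by (rule Q.phi2_ge_K)
  next
    show "assumption_E S cem P X K \<phi>1 Q.\<phi>2 g Q.\<theta>2" by (rule Q.assumption_E_X)
  next
    show "is_qsd_for S cem P X \<phi>1 Q.\<phi>2 \<nu>" by (rule Q.nu_qsd_for)
  next
    fix \<nu>' assume "is_qsd_for S cem P X \<phi>1 Q.\<phi>2 \<nu>'"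
    then show "\<nu>' = \<nu>" by (rule Q.qsd_unique)
  next
    show "0 < Q.rate_const" "0 < \<alpha>" "\<alpha> < 1" by (rule Q.rate_const Q.alpha)+
  next
    fix \<mu> n assume "\<mu> \<in> space (prob_algebra (live_space S cem))" "(\<integral>\<^sup>+x. ennreal (\<phi>1 x) \<partial>\<mu>) < \<infinity>"
      "0 < (\<integral>\<^sup>+x. ennreal (Q.\<phi>2 x) \<partial>\<mu>)"
    then show "weighted_tv \<phi>1 (cond_law S cem P X \<mu> n) \<nu>
        \<le> ennreal (Q.rate_const * \<alpha> ^ n) * ((\<integral>\<^sup>+x. ennreal (\<phi>1 x) \<partial>\<mu>) / (\<integral>\<^sup>+x. ennreal (Q.\<phi>2 x) \<partial>\<mu>))"
      by (rule Q.convergence)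
  next
    show "is_decay_parameter cem P X \<nu> \<theta>0Y" by (rule Q.nu_decay)
  next
    show "\<theta>0Y = \<theta>0Y" ..
  next
    show "measure \<nu> D1 = 0" by (rule Q.nu_D1)
  next
    fix x assume "x \<in> space S - {cem}"
    then show "(\<lambda>n. \<theta>0Y powi (- int n) * \<P>(\<omega> in P x. enat n < absorption_time X cem \<omega>)) \<longlonglongrightarrow> \<eta> x"
      by (rule Q.eta_limit)
  next
    fix x assume "x \<in> D3"
    then show "\<eta> x = 0" by (rule Q.eta_D3)
  qed
qed

end
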